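(* Let $\alpha<\beta$ be real and $\mathscr{H}:=L^2([\alpha,\beta],L^2(\mathbb{R}))$. Let $P=P_U$ be the selfadjoint extension of $P_0$ (a realization of $\frac{1}{i2\pi}\frac{\partial}{\partial x}$) corresponding to a unitary operator $U:L^2(\mathbb{R})\to L^2(\mathbb{R})$. Let $Q:=\frac{1}{i2\pi}\frac{\partial}{\partial y}$ with domain consisting of all $f\in\mathscr{H}$ such that $\frac{\partial}{\partial y}f$ (in the sense of distributions) is in $\mathscr{H}$. Then $P$ and $Q$ commute if and only if $U$ is diagonalized via the Fourier transform as $$U=\int_{\mathbb{R}}e(\gamma(\lambda))\,|e_\lambda\rangle\langle e_\lambda|\,d\lambda$$ for some Borel function $\gamma:\mathbb{R}\to[0,1)$.
   Context: All Hilbert spaces are complex; $e(r):=e^{i2\pi r}$ and $e_\lambda(y):=e(\lambda y)$. Elements of $\mathscr{H}$ are regarded as functions $f(x,y)$ on $[\alpha,\beta]\times\mathbb{R}$. With $H=L^2(\mathbb{R})$: $P_0f=\frac{1}{i2\pi}f'$ (derivative in $x$) with domain $\{f\in\mathscr{H}\mid f'\in\mathscr{H},\ f(\alpha)=f(\beta)=0\}$, and $P_Uf=\frac{1}{i2\pi}f'$ with domain $\{f\in\mathscr{H}\mid f'\in\mathscr{H},\ f(\beta)=Uf(\alpha)\}$ (endpoint values in $H$ are those of the continuous representative). $P_U$ and $Q$ are selfadjoint. Two (unbounded) selfadjoint operators $A,B$ commute if their spectral measures commute, equivalently $e(aA)e(bB)=e(bB)e(aA)$ for all $a,b\in\mathbb{R}$.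 The formula for $U$ means: with $\widehat{\varphi}(\lambda)=\int_{\mathbb{R}}\varphi(y)e(-\lambda y)\,dy$ the $L^2$ Fourier transform, $\widehat{U\varphi}(\lambda)=e(\gamma(\lambda))\widehat{\varphi}(\lambda)$ for a.e. $\lambda$ and all $\varphi\in L^2(\mathbb{R})$; $d\lambda$ is Lebesgue measure. *)

theory Defs
  imports "HOL-Analysis.Analysis"
begin

text \<open>
  Elements of an \<open>L\<^sup>2\<close> space are represented by functions, and equality in \<open>L\<^sup>2\<close> is equality
  almost everywhere. Inner products are linear in the second argument.
\<close>

definition expi2pi :: "real \<Rightarrow> complex" where
  "expi2pi r = exp (\<i> * 2 * of_real pi * of_real r)"

definition L2 :: "'a measure \<Rightarrow> ('a \<Rightarrow> complex) set" where
  "L2 M = {f \<in> borel_measurable M. integrable M (\<lambda>x. (cmod (f x))\<^sup>2)}"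

definition l2_inner :: "'a measure \<Rightarrow> ('a \<Rightarrow> complex) \<Rightarrow> ('a \<Rightarrow> complex) \<Rightarrow> complex" where
  "l2_inner M f g = (LINT x|M. cnj (f x) * g x)"

definition l2_dist :: "'a measure \<Rightarrow> ('a \<Rightarrow> complex) \<Rightarrow> ('a \<Rightarrow> complex) \<Rightarrow> real" where
  "l2_dist M f g = sqrt (LINT x|M. (cmod (f x - g x))\<^sup>2)"

definition ae_eq :: "'a measure \<Rightarrow> ('a \<Rightarrow> complex) \<Rightarrow> ('a \<Rightarrow> complex) \<Rightarrow> bool" where
  "ae_eq M f g \<longleftrightarrow> (AE x in M. f x = g x)"

text \<open>Everywhere defined linear maps of the Hilbert space \<open>L2 M\<close>, acting on representatives.\<close>

definition l2_linear :: "'a measure \<Rightarrow> (('a \<Rightarrow> complex) \<Rightarrow> ('a \<Rightarrow> complex)) \<Rightarrow> bool" where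
  "l2_linear M T \<longleftrightarrow>
     (\<forall>f\<in>L2 M. T f \<in> L2 M) \<and>
     (\<forall>f\<in>L2 M. \<forall>g\<in>L2 M. ae_eq M f g \<longrightarrow> ae_eq M (T f) (T g)) \<and>
     (\<forall>f\<in>L2 M. \<forall>g\<in>L2 M. ae_eq M (T (\<lambda>x. f x + g x)) (\<lambda>x. T f x + T g x)) \<and>
     (\<forall>c. \<forall>f\<in>L2 M. ae_eq M (T (\<lambda>x. c * f x)) (\<lambda>x. c * T f x))"

definition l2_unitary :: "'a measure \<Rightarrow> (('a \<Rightarrow> complex) \<Rightarrow> ('a \<Rightarrow> complex)) \<Rightarrow> bool" where
  "l2_unitary M U \<longleftrightarrow>
     l2_linear M U \<and>
     (\<forall>f\<in>L2 M. \<forall>g\<in>L2 M. l2_inner M (U f) (U g) = l2_inner M f g) \<and>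
     (\<forall>g\<in>L2 M. \<exists>f\<in>L2 M. ae_eq M (U f) g)"

definition l2_projection :: "'a measure \<Rightarrow> (('a \<Rightarrow> complex) \<Rightarrow> ('a \<Rightarrow> complex)) \<Rightarrow> bool" where
  "l2_projection M T \<longleftrightarrow>
     l2_linear M T \<and>
     (\<forall>f\<in>L2 M. ae_eq M (T (T f)) (T f)) \<and>
     (\<forall>f\<in>L2 M. \<forall>g\<in>L2 M. l2_inner M (T f) g = l2_inner M f (T g))"

text \<open>
  Projection-valued Borel measures on the line; countable additivity is in the strong operator
  topology (orthogonality of \<open>E S\<close> and \<open>E T\<close> for disjoint \<open>S\<close>, \<open>T\<close> follows, because a sum of
  two projections is a projection only if they are orthogonal).
\<close>

definition projection_measure ::
    "'a measure \<Rightarrow> (real set \<Rightarrow> ('a \<Rightarrow> complex) \<Rightarrow> ('a \<Rightarrow> complex)) \<Rightarrow> bool" where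
  "projection_measure M E \<longleftrightarrow>
     (\<forall>S\<in>sets borel. l2_projection M (E S)) \<and>
     (\<forall>f\<in>L2 M. ae_eq M (E UNIV f) f) \<and>
     (\<forall>S. range S \<subseteq> sets borel \<and> disjoint_family S \<longrightarrow>
        (\<forall>f\<in>L2 M. (\<lambda>n. l2_dist M (\<lambda>x. \<Sum>i<n. E (S i) f x) (E (\<Union>i. S i) f)) \<longlonglongrightarrow> 0))"

text \<open>The measure \<open>S \<mapsto> \<langle>f, E(S) f\<rangle>\<close>.\<close>

definition spectral_distr ::
    "'a measure \<Rightarrow> (real set \<Rightarrow> ('a \<Rightarrow> complex) \<Rightarrow> ('a \<Rightarrow> complex)) \<Rightarrow> ('a \<Rightarrow> complex) \<Rightarrow> real measure" where
  "spectral_distr M E f =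
     measure_of UNIV (sets borel) (\<lambda>S. ennreal (Re (l2_inner M f (E S f))))"

text \<open>
  An unbounded operator \<open>A\<close> on \<open>L2 M\<close> is represented by its graph: \<open>A f g\<close> means that \<open>f\<close> is in
  the domain of \<open>A\<close> and \<open>A f = g\<close>.
\<close>

type_synonym 'a l2_operator = "('a \<Rightarrow> complex) \<Rightarrow> ('a \<Rightarrow> complex) \<Rightarrow> bool"

text \<open>
  \<open>A = \<integral> t dE(t)\<close>: the domain of \<open>A\<close> consists of the \<open>f\<close> with \<open>\<integral> t\<^sup>2 d\<langle>f, E(t) f\<rangle> < \<infinity>\<close>, and
  \<open>\<langle>f, A f\<rangle> = \<integral> t d\<langle>f, E(t) f\<rangle>\<close> on this (dense) domain, which by polarization determines the
  linear operator \<open>A\<close>.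
\<close>

definition is_spectral_measure ::
    "'a measure \<Rightarrow> (real set \<Rightarrow> ('a \<Rightarrow> complex) \<Rightarrow> ('a \<Rightarrow> complex)) \<Rightarrow> 'a l2_operator \<Rightarrow> bool" where
  "is_spectral_measure M E A \<longleftrightarrow>
     projection_measure M E \<and>
     (\<forall>f\<in>L2 M. (\<exists>g. A f g) \<longleftrightarrow> integrable (spectral_distr M E f) (\<lambda>t. t\<^sup>2)) \<and>
     (\<forall>f g. A f g \<longrightarrow> f \<in> L2 M \<and> g \<in> L2 M \<and>
        l2_inner M f g = of_real (LINT t|spectral_distr M E f. t))"

text \<open>
  Commutation of selfadjoint operators in terms of their spectral measures. By the spectral
  theorem \<open>E\<close> and \<open>F\<close> exist and are unique (up to equality a.e. of the values).
\<close>

definition spectrally_commute :: "'a measure \<Rightarrow> 'a l2_operator \<Rightarrow> 'a l2_operator \<Rightarrow> bool" where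
  "spectrally_commute M A B \<longleftrightarrow>
     (\<exists>E F. is_spectral_measure M E A \<and> is_spectral_measure M F B \<and>
        (\<forall>S\<in>sets borel. \<forall>T\<in>sets borel. \<forall>f\<in>L2 M. ae_eq M (E S (F T f)) (F T (E S f))))"

text \<open>
  \<open>C\<^sup>\<infinity>\<close> functions: all iterated directional derivatives exist and are Frechet differentiable.
\<close>

definition dir_deriv ::
    "'a \<Rightarrow> ('a::real_normed_vector \<Rightarrow> complex) \<Rightarrow> 'a \<Rightarrow> complex" where
  "dir_deriv v \<phi> p = frechet_derivative \<phi> (at p) v"

coinductive smooth :: "('a::real_normed_vector \<Rightarrow> complex) \<Rightarrow> bool" where
  "(\<forall>p. \<phi> differentiable (at p)) \<Longrightarrow> (\<forall>v. smooth (dir_deriv v \<phi>)) \<Longrightarrow> smooth \<phi>"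

definition test_function :: "'a::real_normed_vector set \<Rightarrow> ('a \<Rightarrow> complex) \<Rightarrow> bool" where
  "test_function \<Omega> \<phi> \<longleftrightarrow>
     smooth \<phi> \<and> compact (closure {p. \<phi> p \<noteq> 0}) \<and> closure {p. \<phi> p \<noteq> 0} \<subseteq> \<Omega>"

text \<open>
  \<open>L2 (strip_measure \<alpha> \<beta>)\<close> is the Hilbert space \<open>L\<^sup>2([\<alpha>,\<beta>], L\<^sup>2(\<real>))\<close>, with elements regarded as
  functions of \<open>(x, y) \<in> [\<alpha>,\<beta>] \<times> \<real>\<close>.
\<close>

definition strip_measure :: "real \<Rightarrow> real \<Rightarrow> (real \<times> real) measure" where
  "strip_measure \<alpha> \<beta> = restrict_space lborel {\<alpha>..\<beta>} \<Otimes>\<^sub>M lborel"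

text \<open>\<open>g\<close> is the distributional derivative of \<open>f\<close> in direction \<open>v\<close> on \<open>(\<alpha>,\<beta>) \<times> \<real>\<close>.\<close>

definition weak_deriv ::
    "real \<Rightarrow> real \<Rightarrow> real \<times> real \<Rightarrow> (real \<times> real \<Rightarrow> complex) \<Rightarrow> (real \<times> real \<Rightarrow> complex) \<Rightarrow> bool" where
  "weak_deriv \<alpha> \<beta> v f g \<longleftrightarrow>
     (\<forall>\<phi>. test_function ({\<alpha><..<\<beta>} \<times> UNIV) \<phi> \<longrightarrow>
        (LINT p|strip_measure \<alpha> \<beta>. f p * dir_deriv v \<phi> p) =
        - (LINT p|strip_measure \<alpha> \<beta>. g p * \<phi> p))"

text \<open>\<open>F\<close> is the representative of \<open>f\<close> that is continuous from \<open>[\<alpha>,\<beta>]\<close> to \<open>L\<^sup>2(\<real>)\<close>.\<close>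

definition continuous_representative ::
    "real \<Rightarrow> real \<Rightarrow> (real \<times> real \<Rightarrow> complex) \<Rightarrow> (real \<Rightarrow> real \<Rightarrow> complex) \<Rightarrow> bool" where
  "continuous_representative \<alpha> \<beta> f F \<longleftrightarrow>
     (\<forall>x\<in>{\<alpha>..\<beta>}. F x \<in> L2 lborel) \<and>
     (\<forall>x\<in>{\<alpha>..\<beta>}. ((\<lambda>t. l2_dist lborel (F t) (F x)) \<longlongrightarrow> 0) (at x within {\<alpha>..\<beta>})) \<and>
     (AE x in restrict_space lborel {\<alpha>..\<beta>}. ae_eq lborel (\<lambda>y. f (x, y)) (F x))"

definition P_op ::
    "real \<Rightarrow> real \<Rightarrow> ((real \<Rightarrow> complex) \<Rightarrow> (real \<Rightarrow> complex)) \<Rightarrow> (real \<times> real) l2_operator" where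
  "P_op \<alpha> \<beta> U f g \<longleftrightarrow>
     f \<in> L2 (strip_measure \<alpha> \<beta>) \<and> g \<in> L2 (strip_measure \<alpha> \<beta>) \<and>
     (\<exists>f'\<in>L2 (strip_measure \<alpha> \<beta>). weak_deriv \<alpha> \<beta> (1, 0) f f' \<and>
        ae_eq (strip_measure \<alpha> \<beta>) g (\<lambda>p. f' p / (\<i> * 2 * of_real pi))) \<and>
     (\<exists>F. continuous_representative \<alpha> \<beta> f F \<and> ae_eq lborel (F \<beta>) (U (F \<alpha>)))"

definition Q_op :: "real \<Rightarrow> real \<Rightarrow> (real \<times> real) l2_operator" where
  "Q_op \<alpha> \<beta> f g \<longleftrightarrow>
     f \<in> L2 (strip_measure \<alpha> \<beta>) \<and> g \<in> L2 (strip_measure \<alpha> \<beta>) \<and>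
     (\<exists>f'\<in>L2 (strip_measure \<alpha> \<beta>). weak_deriv \<alpha> \<beta> (0, 1) f f' \<and>
        ae_eq (strip_measure \<alpha> \<beta>) g (\<lambda>p. f' p / (\<i> * 2 * of_real pi)))"

text \<open>
  The \<open>L\<^sup>2\<close> Fourier transform, as limit in the mean of the truncated Fourier integrals; it exists
  and is unique a.e. by Plancherel's theorem.
\<close>

definition is_fourier_transform :: "(real \<Rightarrow> complex) \<Rightarrow> (real \<Rightarrow> complex) \<Rightarrow> bool" where
  "is_fourier_transform \<phi> \<psi> \<longleftrightarrow> \<psi> \<in> L2 lborel \<and>
     (\<lambda>n. l2_dist lborel
        (\<lambda>t. LINT y:{- real n..real n}|lborel. \<phi> y * expi2pi (- t * y)) \<psi>) \<longlonglongrightarrow> 0"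

definition fourier :: "(real \<Rightarrow> complex) \<Rightarrow> real \<Rightarrow> complex" where
  "fourier \<phi> = (SOME \<psi>. is_fourier_transform \<phi> \<psi>)"

text \<open>\<open>U = \<integral> e(\<gamma>(t)) |e\<^sub>t\<rangle>\<langle>e\<^sub>t| dt\<close>\<close>

definition fourier_diagonalized ::
    "((real \<Rightarrow> complex) \<Rightarrow> (real \<Rightarrow> complex)) \<Rightarrow> (real \<Rightarrow> real) \<Rightarrow> bool" where
  "fourier_diagonalized U \<gamma> \<longleftrightarrow>
     (\<forall>\<phi>\<in>L2 lborel. AE t in lborel. fourier (U \<phi>) t = expi2pi (\<gamma> t) * fourier \<phi> t)"

end

theory Submission
  imports Defs "HOL-Computational_Algebra.Polynomial"
begin

text \<open>
  The partial Fourier transform in \<open>y\<close> turns \<open>Q\<close> into multiplication by \<open>\<lambda>\<close>. If \<open>U\<close> is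
  multiplication by \<open>e(\<gamma>(\<lambda>))\<close> on the Fourier side, then on the fibre over \<open>\<lambda>\<close> the operator
  \<open>P\<close> is \<open>d/dx / (i2\<pi>)\<close> with boundary condition \<open>f(\<beta>) = e(\<gamma>(\<lambda>)) f(\<alpha>)\<close>, whose eigenvectors
  are the exponentials with frequencies \<open>(k + \<gamma>(\<lambda>)) / (\<beta> - \<alpha>)\<close>, \<open>k \<in> \<int>\<close>. So one unitary
  turns \<open>P\<close> and \<open>Q\<close> into multiplication operators, and these commute.

  Conversely, the spectral projection \<open>F(I)\<close> of \<open>Q\<close> is the multiplication by \<open>1\<^sub>I(\<lambda>)\<close> on the
  Fourier side. If it commutes with the spectral measure of \<open>P\<close>, it preserves the domain of \<open>P\<close>,
  and comparing the boundary values of \<open>f\<close> and \<open>F(I) f\<close> for \<open>f\<close> interpolating linearly between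
  \<open>\<phi>\<close> and \<open>U \<phi>\<close> shows that \<open>U\<close> commutes with \<open>1\<^sub>I(\<lambda>)\<close>. A unitary that commutes with
  the multiplications by indicator functions of intervals is itself a multiplication.
\<close>

subsection \<open>Square-integrable functions\<close>

text \<open>\<open>spectrally_commute\<close> only asserts that some \<open>E\<close> and
  \<open>F\<close> exist, and \<open>is_spectral_measure\<close> records no more than a domain and a
  quadratic form. For \<open>E\<close> this suffices: the domain of \<open>P\<close> consists of the
  vectors with finite second moment, and a commuting projection cannot increase that moment. For
  \<open>F\<close> it has to be shown that every spectral measure of a multiplication by
  \<open>m\<close> is given by indicators of \<open>m\<close>. The bound on \<open>m\<close> over
  the range of \<open>F I\<close> is won from quadratic forms alone, by iterating a norm bound and
  letting the power grow.

  The domains are described by test functions, whereas the Fourier side needs formulas. A function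
  with an \<open>x\<close>-derivative in \<open>L2\<close> is therefore written as
  \<open>K(y)\<close> plus the integral of the derivative from \<alpha> to \<open>x\<close>. That
  integration acts in \<open>x\<close> alone and commutes with the Fourier transform in
  \<open>y\<close>, so the boundary condition passes to the fibres. The \<open>y\<close>-derivative
  is reached through translations by 1: the symbol \<lambda> is unbounded, but
  \<open>1 - e(\<lambda>)\<close> and its quotient by \<lambda> are bounded.\<close>

definition l2sq :: "'a measure \<Rightarrow> ('a \<Rightarrow> complex) \<Rightarrow> real" where
  "l2sq M f = (LINT x|M. (cmod (f x))\<^sup>2)"

lemma L2_I: "f \<in> borel_measurable M \<Longrightarrow> integrable M (\<lambda>x. (cmod (f x))\<^sup>2) \<Longrightarrow> f \<in> L2 M"
  by (simp add: L2_def)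

lemma L2_measurable[measurable_dest, dest]: "f \<in> L2 M \<Longrightarrow> f \<in> borel_measurable M"
  by (simp add: L2_def)

lemma L2_integrable: "f \<in> L2 M \<Longrightarrow> integrable M (\<lambda>x. (cmod (f x))\<^sup>2)"
  by (simp add: L2_def)

lemma norm_add_sq_le: "(cmod (a + b))\<^sup>2 \<le> 2 * (cmod a)\<^sup>2 + 2 * (cmod b)\<^sup>2"
proof -
  have "(cmod (a + b))\<^sup>2 \<le> (cmod a + cmod b)\<^sup>2"
    by (intro power_mono norm_triangle_ineq) auto
  also have "\<dots> \<le> 2 * (cmod a)\<^sup>2 + 2 * (cmod b)\<^sup>2"
    using sum_squares_bound[of "cmod a" "cmod b"] by (simp add: power2_sum)
  finally show ?thesis .
qed

lemma L2_bound:
  assumes "f \<in> borel_measurable M" "g \<in> L2 M" "\<And>x. x \<in> space M \<Longrightarrow> cmod (f x) \<le> C * cmod (g x)"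
  shows "f \<in> L2 M"
proof (rule L2_I[OF assms(1)])
  show "integrable M (\<lambda>x. (cmod (f x))\<^sup>2)"
  proof (rule Bochner_Integration.integrable_bound[where f = "\<lambda>x. C\<^sup>2 * (cmod (g x))\<^sup>2"])
    show "integrable M (\<lambda>x. C\<^sup>2 * (cmod (g x))\<^sup>2)"
      using L2_integrable[OF assms(2)] by simp
    show "(\<lambda>x. (cmod (f x))\<^sup>2) \<in> borel_measurable M"
      using assms(1) by measurable
    show "AE x in M. norm ((cmod (f x))\<^sup>2) \<le> norm (C\<^sup>2 * (cmod (g x))\<^sup>2)"
    proof (rule AE_I2)
      fix x assume "x \<in> space M"
      then have "(cmod (f x))\<^sup>2 \<le> (C * cmod (g x))\<^sup>2"
        using assms(3) by (intro power_mono) auto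
      then show "norm ((cmod (f x))\<^sup>2) \<le> norm (C\<^sup>2 * (cmod (g x))\<^sup>2)"
        by (simp add: power_mult_distrib)
    qed
  qed
qed

lemma L2_add:
  assumes "f \<in> L2 M" "g \<in> L2 M" shows "(\<lambda>x. f x + g x) \<in> L2 M"
proof (rule L2_I)
  show "(\<lambda>x. f x + g x) \<in> borel_measurable M"
    using assms by measurable
  show "integrable M (\<lambda>x. (cmod (f x + g x))\<^sup>2)"
  proof (rule Bochner_Integration.integrable_bound)
    show "integrable M (\<lambda>x. 2 * (cmod (f x))\<^sup>2 + 2 * (cmod (g x))\<^sup>2)"
      using assms[THEN L2_integrable] by simp
    show "(\<lambda>x. (cmod (f x + g x))\<^sup>2) \<in> borel_measurable M"
      using assms by measurable
  qed (use norm_add_sq_le in auto)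
qed

lemma L2_mult_bounded:
  assumes "f \<in> L2 M" "m \<in> borel_measurable M" "\<And>x. x \<in> space M \<Longrightarrow> cmod (m x) \<le> C"
  shows "(\<lambda>x. m x * f x) \<in> L2 M"
proof (rule L2_bound[OF _ assms(1), where C = C])
  show "(\<lambda>x. m x * f x) \<in> borel_measurable M"
    using assms by measurable
  show "cmod (m x * f x) \<le> C * cmod (f x)" if "x \<in> space M" for x
    using assms(3)[OF that] by (simp add: norm_mult mult_right_mono)
qed

lemma L2_cmult: "f \<in> L2 M \<Longrightarrow> (\<lambda>x. c * f x) \<in> L2 M"
  by (rule L2_mult_bounded[where C = "cmod c"]) auto

lemma L2_uminus: "f \<in> L2 M \<Longrightarrow> (\<lambda>x. - f x) \<in> L2 M"
  using L2_cmult[of f M "-1"] by simp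

lemma L2_diff:
  assumes "f \<in> L2 M" "g \<in> L2 M" shows "(\<lambda>x. f x - g x) \<in> L2 M"
  using L2_add[OF assms(1) L2_uminus[OF assms(2)]] by simp

lemma borel_measurable_cnj [measurable]: "cnj \<in> borel_measurable borel"
  by (intro borel_measurable_continuous_onI continuous_intros)

lemma L2_cnj:
  assumes "f \<in> L2 M" shows "(\<lambda>x. cnj (f x)) \<in> L2 M"
proof (rule L2_bound[OF _ assms, where C = 1])
  show "(\<lambda>x. cnj (f x)) \<in> borel_measurable M"
    using assms by measurable
qed auto

lemma L2_zero: "(\<lambda>x. 0) \<in> L2 M"
  by (rule L2_I) auto

lemma L2_sum: "(\<And>i. i \<in> I \<Longrightarrow> f i \<in> L2 M) \<Longrightarrow> (\<lambda>x. \<Sum>i\<in>I. f i x) \<in> L2 M"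
  by (induction I rule: infinite_finite_induct) (auto intro!: L2_add L2_zero)

lemma L2_indicator_mult:
  assumes "f \<in> L2 M" "{x\<in>space M. P x} \<in> sets M"
  shows "(\<lambda>x. of_bool (P x) * f x) \<in> L2 M"
proof (rule L2_mult_bounded[OF assms(1), where C = 1])
  have [measurable]: "Measurable.pred M P"
    using assms(2) by (simp add: pred_def)
  have "(\<lambda>x. if P x then 1 else 0 :: complex) \<in> borel_measurable M"
    by measurable
  then show "(\<lambda>x. of_bool (P x) :: complex) \<in> borel_measurable M"
    by (simp add: of_bool_def)
qed auto

lemma L2_cong_AE:
  assumes "f \<in> L2 M" "g \<in> borel_measurable M" "AE x in M. f x = g x"
  shows "g \<in> L2 M"
proof (rule L2_I[OF assms(2)])
  show "integrable M (\<lambda>x. (cmod (g x))\<^sup>2)"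
    by (rule integrable_cong_AE_imp[OF L2_integrable[OF assms(1)]]) (use assms(2,3) in auto)
qed

lemma L2_prod_integrable:
  assumes "f \<in> L2 M" "g \<in> L2 M" shows "integrable M (\<lambda>x. f x * g x)"
proof (rule Bochner_Integration.integrable_bound)
  show "integrable M (\<lambda>x. (cmod (f x))\<^sup>2 + (cmod (g x))\<^sup>2)"
    using assms[THEN L2_integrable] by simp
  show "(\<lambda>x. f x * g x) \<in> borel_measurable M"
    using assms by measurable
  have "cmod a * cmod b \<le> (cmod a)\<^sup>2 + (cmod b)\<^sup>2" for a b
  proof -
    have "0 \<le> cmod a * cmod b" by simp
    then show ?thesis
      using sum_squares_bound[of "cmod a" "cmod b"] by linarith
  qed
  then show "AE x in M. norm (f x * g x) \<le> norm ((cmod (f x))\<^sup>2 + (cmod (g x))\<^sup>2)"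
    by (simp add: norm_mult)
qed

lemma L2_inner_integrable:
  "f \<in> L2 M \<Longrightarrow> g \<in> L2 M \<Longrightarrow> integrable M (\<lambda>x. cnj (f x) * g x)"
  by (rule L2_prod_integrable[OF L2_cnj])

lemma (in finite_measure) L2_imp_integrable:
  assumes "f \<in> L2 M" shows "integrable M f"
proof -
  have "(\<lambda>x. 1) \<in> L2 M"
    by (rule L2_I) auto
  from L2_prod_integrable[OF this assms] show ?thesis by simp
qed

lemma (in finite_measure) L2_bounded:
  assumes "f \<in> borel_measurable M" "\<And>x. x \<in> space M \<Longrightarrow> cmod (f x) \<le> C"
  shows "f \<in> L2 M"
proof -
  have "(\<lambda>x. 1) \<in> L2 M"
    by (rule L2_I) auto
  from L2_mult_bounded[OF this assms] show ?thesis by simp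
qed

lemma l2_inner_add_right:
  "f \<in> L2 M \<Longrightarrow> g \<in> L2 M \<Longrightarrow> h \<in> L2 M \<Longrightarrow>
    l2_inner M f (\<lambda>x. g x + h x) = l2_inner M f g + l2_inner M f h"
  unfolding l2_inner_def
  by (simp add: distrib_left Bochner_Integration.integral_add L2_inner_integrable)

lemma l2_inner_cmult_right: "l2_inner M f (\<lambda>x. c * g x) = c * l2_inner M f g"
  unfolding l2_inner_def by (simp add: mult.left_commute[of _ c])

lemma l2_inner_cnj: "cnj (l2_inner M f g) = l2_inner M g f"
  unfolding l2_inner_def by (subst Bochner_Integration.integral_cnj[symmetric]) (simp add: mult.commute)

lemma l2_inner_diff_right:
  "f \<in> L2 M \<Longrightarrow> g \<in> L2 M \<Longrightarrow> h \<in> L2 M \<Longrightarrow>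
    l2_inner M f (\<lambda>x. g x - h x) = l2_inner M f g - l2_inner M f h"
  unfolding l2_inner_def
  by (simp add: right_diff_distrib Bochner_Integration.integral_diff L2_inner_integrable)

lemma l2_inner_add_left:
  "f \<in> L2 M \<Longrightarrow> g \<in> L2 M \<Longrightarrow> h \<in> L2 M \<Longrightarrow>
    l2_inner M (\<lambda>x. g x + h x) f = l2_inner M g f + l2_inner M h f"
  using arg_cong[OF l2_inner_add_right[of f M g h], of cnj] by (simp add: l2_inner_cnj)

lemma l2_inner_diff_left:
  "f \<in> L2 M \<Longrightarrow> g \<in> L2 M \<Longrightarrow> h \<in> L2 M \<Longrightarrow>
    l2_inner M (\<lambda>x. g x - h x) f = l2_inner M g f - l2_inner M h f"
  using arg_cong[OF l2_inner_diff_right[of f M g h], of cnj] by (simp add: l2_inner_cnj)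

lemma l2_inner_cmult_left: "l2_inner M (\<lambda>x. c * g x) f = cnj c * l2_inner M g f"
  using arg_cong[OF l2_inner_cmult_right[of M f c g], of cnj] by (simp add: l2_inner_cnj)

lemma l2_inner_sum_right:
  "f \<in> L2 M \<Longrightarrow> (\<And>i. i \<in> I \<Longrightarrow> g i \<in> L2 M) \<Longrightarrow>
    l2_inner M f (\<lambda>x. \<Sum>i\<in>I. g i x) = (\<Sum>i\<in>I. l2_inner M f (g i))"
  by (induction I rule: infinite_finite_induct)
     (auto simp: l2_inner_add_right L2_sum, auto simp: l2_inner_def)

lemma l2_inner_cong_AE:
  assumes "f \<in> L2 M" "f' \<in> L2 M" "g \<in> L2 M" "g' \<in> L2 M" "ae_eq M f f'" "ae_eq M g g'"
  shows "l2_inner M f g = l2_inner M f' g'"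
  unfolding l2_inner_def
proof (rule integral_cong_AE)
  show "AE x in M. cnj (f x) * g x = cnj (f' x) * g' x"
    using assms(5,6) unfolding ae_eq_def by eventually_elim simp
  have [measurable]: "f \<in> borel_measurable M" "f' \<in> borel_measurable M"
    "g \<in> borel_measurable M" "g' \<in> borel_measurable M"
    using assms(1-4) by auto
  show "(\<lambda>x. cnj (f x) * g x) \<in> borel_measurable M" "(\<lambda>x. cnj (f' x) * g' x) \<in> borel_measurable M"
    by measurable
qed

lemma l2sq_nonneg [simp]: "0 \<le> l2sq M f"
  by (simp add: l2sq_def)

lemma l2_inner_self: "l2_inner M f f = of_real (l2sq M f)"
proof -
  have "cnj (f x) * f x = of_real ((cmod (f x))\<^sup>2)" for x
    using complex_norm_square[of "f x"] by (simp add: mult.commute)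
  then show ?thesis
    unfolding l2_inner_def l2sq_def by (simp del: of_real_power)
qed

lemma l2sq_eq_Re: "l2sq M f = Re (l2_inner M f f)"
  by (simp add: l2_inner_self)

lemma l2sq_cmult: "l2sq M (\<lambda>x. c * f x) = (cmod c)\<^sup>2 * l2sq M f"
  by (simp add: l2sq_def norm_mult power_mult_distrib)

lemma l2sq_add:
  assumes "f \<in> L2 M" "g \<in> L2 M"
  shows "l2sq M (\<lambda>x. f x + g x) = l2sq M f + l2sq M g + 2 * Re (l2_inner M f g)"
proof -
  have "Re (l2_inner M g f) = Re (l2_inner M f g)"
    using l2_inner_cnj[of M f g] by (metis cnj.sel(1))
  then show ?thesis
    using assms by (simp add: l2sq_eq_Re l2_inner_add_left l2_inner_add_right L2_add)
qed

lemma l2sq_diff: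
  assumes "f \<in> L2 M" "g \<in> L2 M"
  shows "l2sq M (\<lambda>x. f x - g x) = l2sq M f + l2sq M g - 2 * Re (l2_inner M f g)"
proof -
  have "Re (l2_inner M g f) = Re (l2_inner M f g)"
    using l2_inner_cnj[of M f g] by (metis cnj.sel(1))
  then show ?thesis
    using assms by (simp add: l2sq_eq_Re l2_inner_diff_left l2_inner_diff_right L2_diff)
qed

lemma l2sq_cong_AE:
  assumes "f \<in> borel_measurable M" "g \<in> borel_measurable M" "AE x in M. f x = g x"
  shows "l2sq M f = l2sq M g"
  unfolding l2sq_def
  by (rule integral_cong_AE) (use assms in auto)

lemma l2sq_eq_0_iff:
  assumes "f \<in> L2 M" shows "l2sq M f = 0 \<longleftrightarrow> (AE x in M. f x = 0)"
  unfolding l2sq_def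
  using integral_nonneg_eq_0_iff_AE[OF L2_integrable[OF assms]] by simp

lemma l2_cauchy_schwarz:
  assumes "f \<in> L2 M" "g \<in> L2 M"
  shows "cmod (l2_inner M f g) \<le> sqrt (l2sq M f) * sqrt (l2sq M g)"
proof -
  define z where "z = l2_inner M f g"
  \<comment> \<open>Expands the squared norm of \<open>t f - cnj z g\<close>. The factor
    \<open>cnj z\<close> makes the cross term the real number \<open>t |z|^2\<close>, so a real
    parameter is enough.\<close>
  have quad: "0 \<le> l2sq M f * t\<^sup>2 - 2 * t * (cmod z)\<^sup>2 + (cmod z)\<^sup>2 * l2sq M g" for t :: real
  proof -
    have "0 \<le> l2sq M (\<lambda>x. of_real t * f x - cnj z * g x)" by simp
    also have "\<dots> = t\<^sup>2 * l2sq M f + (cmod z)\<^sup>2 * l2sq M g - 2 * Re (t * (cnj z * z))"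
      using assms
      by (simp add: l2sq_diff L2_cmult l2sq_cmult l2_inner_cmult_left l2_inner_cmult_right z_def)
    also have "cnj z * z = of_real ((cmod z)\<^sup>2)"
      using complex_norm_square[of z] by (simp add: mult.commute)
    finally show ?thesis by (simp add: algebra_simps del: of_real_power)
  qed
  have "(cmod z)\<^sup>2 \<le> l2sq M f * l2sq M g"
  proof (cases "l2sq M f = 0")
    case True
    \<comment> \<open>With \<open>f\<close> of norm zero the form is affine in \<open>t\<close>;
      this \<open>t\<close> turns it into \<open>- |z|^2 (l2sq M g + 2)\<close>.\<close>
    have "0 \<le> l2sq M f * (l2sq M g + 1)\<^sup>2 - 2 * (l2sq M g + 1) * (cmod z)\<^sup>2 + (cmod z)\<^sup>2 * l2sq M g"
      by (rule quad)
    then have "(cmod z)\<^sup>2 * (l2sq M g + 2) \<le> 0"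
      using True by (simp add: algebra_simps)
    moreover have "l2sq M g + 2 > 0"
      using l2sq_nonneg[of M g] by linarith
    ultimately have "(cmod z)\<^sup>2 \<le> 0"
      by (smt (verit) mult_pos_pos)
    then show ?thesis using True by simp
  next
    case False
    then have pos: "l2sq M f > 0"
      using l2sq_nonneg[of M f] by linarith
    show ?thesis
    proof (cases "z = 0")
      case False
      \<comment> \<open>The value of \<open>t\<close> that minimizes the quadratic.\<close>
      have "0 \<le> l2sq M f * ((cmod z)\<^sup>2 / l2sq M f)\<^sup>2 - 2 * ((cmod z)\<^sup>2 / l2sq M f) * (cmod z)\<^sup>2
          + (cmod z)\<^sup>2 * l2sq M g"
        by (rule quad)
      also have "\<dots> = (cmod z)\<^sup>2 * (l2sq M g - (cmod z)\<^sup>2 / l2sq M f)"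
        using pos by (simp add: field_simps power2_eq_square)
      finally have "0 \<le> l2sq M g - (cmod z)\<^sup>2 / l2sq M f"
        using False by (simp add: zero_le_mult_iff)
      then show ?thesis using pos by (simp add: field_simps)
    qed simp
  qed
  then have "sqrt ((cmod z)\<^sup>2) \<le> sqrt (l2sq M f * l2sq M g)"
    by (rule real_sqrt_le_mono)
  then show ?thesis by (simp add: z_def real_sqrt_mult)
qed

lemma l2sq_triangle:
  assumes "f \<in> L2 M" "g \<in> L2 M"
  shows "sqrt (l2sq M (\<lambda>x. f x + g x)) \<le> sqrt (l2sq M f) + sqrt (l2sq M g)"
proof (rule real_le_lsqrt)
  have "Re (l2_inner M f g) \<le> sqrt (l2sq M f) * sqrt (l2sq M g)"
    using l2_cauchy_schwarz[OF assms] complex_Re_le_cmod order_trans by blast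
  then show "l2sq M (\<lambda>x. f x + g x) \<le> (sqrt (l2sq M f) + sqrt (l2sq M g))\<^sup>2"
    using l2sq_add[OF assms] by (simp add: power2_sum)
qed auto

lemma l2_dist_eq: "l2_dist M f g = sqrt (l2sq M (\<lambda>x. f x - g x))"
  by (simp add: l2_dist_def l2sq_def)

lemma l2_dist_nonneg [simp]: "0 \<le> l2_dist M f g"
  by (simp add: l2_dist_eq)

lemma l2_dist_sym: "l2_dist M f g = l2_dist M g f"
  by (simp add: l2_dist_def norm_minus_commute)

lemma l2_dist_triangle:
  assumes "f \<in> L2 M" "g \<in> L2 M" "h \<in> L2 M"
  shows "l2_dist M f h \<le> l2_dist M f g + l2_dist M g h"
  using l2sq_triangle[OF L2_diff[OF assms(1,2)] L2_diff[OF assms(2,3)]]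
  by (simp add: l2_dist_eq)

lemma l2_dist_0_imp_AE:
  assumes "f \<in> L2 M" "g \<in> L2 M" "l2_dist M f g = 0"
  shows "AE x in M. f x = g x"
  using assms l2sq_eq_0_iff[OF L2_diff[OF assms(1,2)]] by (simp add: l2_dist_eq)

lemma l2_dist_cong_AE:
  assumes "f \<in> borel_measurable M" "g \<in> borel_measurable M" "f' \<in> borel_measurable M"
    "g' \<in> borel_measurable M" "ae_eq M f f'" "ae_eq M g g'"
  shows "l2_dist M f g = l2_dist M f' g'"
proof -
  have "AE x in M. f x - g x = f' x - g' x"
    using assms(5,6) unfolding ae_eq_def by eventually_elim simp
  then show ?thesis
    unfolding l2_dist_eq using assms(1-4) by (subst l2sq_cong_AE) auto
qed

section \<open>Convergence in \<open>L2\<close> and completeness\<close>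

lemma LIMSEQ_0_squeeze:
  fixes f g :: "nat \<Rightarrow> real"
  assumes "\<And>n. norm (f n) \<le> g n" "g \<longlonglongrightarrow> 0" shows "f \<longlonglongrightarrow> 0"
  by (rule Lim_null_comparison[OF _ assms(2)]) (use assms(1) in simp)

text \<open>Membership in \<open>L2 M\<close> is bundled in because \<open>l2_dist\<close> is built
  on an integral whose default value is 0: for functions that are not square-integrable, a vanishing
  distance says nothing.\<close>

definition l2_lim :: "'a measure \<Rightarrow> (nat \<Rightarrow> 'a \<Rightarrow> complex) \<Rightarrow> ('a \<Rightarrow> complex) \<Rightarrow> bool" where
  "l2_lim M u f \<longleftrightarrow> f \<in> L2 M \<and> (\<forall>n. u n \<in> L2 M) \<and> (\<lambda>n. l2_dist M (u n) f) \<longlonglongrightarrow> 0"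

lemma l2_lim_L2: "l2_lim M u f \<Longrightarrow> f \<in> L2 M" "l2_lim M u f \<Longrightarrow> u n \<in> L2 M"
  by (auto simp: l2_lim_def)

lemma l2_lim_unique:
  assumes "l2_lim M u f" "l2_lim M u g" shows "AE x in M. f x = g x"
proof -
  have "l2_dist M f g \<le> l2_dist M (u n) f + l2_dist M (u n) g" for n
    using l2_dist_triangle[of f M "u n" g] assms by (auto simp: l2_lim_def l2_dist_sym[of M f])
  moreover have "(\<lambda>n. l2_dist M (u n) f + l2_dist M (u n) g) \<longlonglongrightarrow> 0 + 0"
    using assms by (intro tendsto_add) (auto simp: l2_lim_def)
  ultimately have "l2_dist M f g \<le> 0"
    by (intro LIMSEQ_le_const) auto
  then have "l2_dist M f g = 0"
    using l2_dist_nonneg[of M f g] by linarith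
  then show ?thesis using assms by (auto intro!: l2_dist_0_imp_AE simp: l2_lim_def)
qed

lemma l2_lim_cong_AE:
  assumes "l2_lim M u f" "\<And>n. v n \<in> borel_measurable M" "g \<in> borel_measurable M"
    "\<And>n. ae_eq M (u n) (v n)" "ae_eq M f g"
  shows "l2_lim M v g"
proof -
  have "l2_dist M (u n) f = l2_dist M (v n) g" for n
    by (rule l2_dist_cong_AE) (use assms in \<open>auto simp: l2_lim_def\<close>)
  moreover have "g \<in> L2 M"
    by (rule L2_cong_AE[of f]) (use assms in \<open>simp_all add: l2_lim_def ae_eq_def\<close>)
  moreover have "v n \<in> L2 M" for n
    by (rule L2_cong_AE[of "u n"]) (use assms in \<open>simp_all add: l2_lim_def ae_eq_def\<close>)
  ultimately show ?thesis using assms(1) by (simp add: l2_lim_def)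
qed

lemma l2_lim_const: "f \<in> L2 M \<Longrightarrow> l2_lim M (\<lambda>n. f) f"
  by (simp add: l2_lim_def l2_dist_eq l2sq_def)

lemma l2_lim_subseq: "l2_lim M u f \<Longrightarrow> strict_mono r \<Longrightarrow> l2_lim M (\<lambda>n. u (r n)) f"
  unfolding l2_lim_def using LIMSEQ_subseq_LIMSEQ[of "\<lambda>n. l2_dist M (u n) f" 0 r]
  by (auto simp: o_def)

lemma l2_lim_map:
  assumes "l2_lim M u f" "\<And>n. v n \<in> L2 N" "g \<in> L2 N"
    "\<And>n. l2_dist N (v n) g \<le> C * l2_dist M (u n) f"
  shows "l2_lim N v g"
proof -
  have "(\<lambda>n. C * l2_dist M (u n) f) \<longlonglongrightarrow> C * 0"
    using assms(1) by (intro tendsto_mult tendsto_const) (auto simp: l2_lim_def)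
  then have lim: "(\<lambda>n. C * l2_dist M (u n) f) \<longlonglongrightarrow> 0" by simp
  have "(\<lambda>n. l2_dist N (v n) g) \<longlonglongrightarrow> 0"
    by (rule LIMSEQ_0_squeeze[OF _ lim]) (simp add: assms(4))
  then show ?thesis using assms by (simp add: l2_lim_def)
qed

lemma l2_lim_add:
  assumes "l2_lim M u f" "l2_lim M v g"
  shows "l2_lim M (\<lambda>n x. u n x + v n x) (\<lambda>x. f x + g x)"
proof -
  have "l2_dist M (\<lambda>x. u n x + v n x) (\<lambda>x. f x + g x) \<le> l2_dist M (u n) f + l2_dist M (v n) g" for n
    using l2sq_triangle[of "\<lambda>x. u n x - f x" M "\<lambda>x. v n x - g x"] assms
    by (auto simp: l2_dist_eq l2_lim_def L2_diff algebra_simps)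
  moreover have "(\<lambda>n. l2_dist M (u n) f + l2_dist M (v n) g) \<longlonglongrightarrow> 0"
    using assms tendsto_add[of "\<lambda>n. l2_dist M (u n) f" 0 sequentially "\<lambda>n. l2_dist M (v n) g" 0]
    by (simp add: l2_lim_def)
  ultimately have "(\<lambda>n. l2_dist M (\<lambda>x. u n x + v n x) (\<lambda>x. f x + g x)) \<longlonglongrightarrow> 0"
    by - (rule LIMSEQ_0_squeeze[where g = "\<lambda>n. l2_dist M (u n) f + l2_dist M (v n) g"], simp_all)
  then show ?thesis using assms by (auto simp: l2_lim_def L2_add)
qed

lemma l2_lim_mult:
  assumes "l2_lim M u f" "m \<in> borel_measurable M" "\<And>x. x \<in> space M \<Longrightarrow> cmod (m x) \<le> C" "0 \<le> C"
  shows "l2_lim M (\<lambda>n x. m x * u n x) (\<lambda>x. m x * f x)"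
proof (rule l2_lim_map[OF assms(1), where C = C])
  show "l2_dist M (\<lambda>x. m x * u n x) (\<lambda>x. m x * f x) \<le> C * l2_dist M (u n) f" for n
  proof -
    have d: "(\<lambda>x. u n x - f x) \<in> L2 M"
      using assms(1) by (auto simp: l2_lim_def L2_diff)
    have "l2sq M (\<lambda>x. m x * (u n x - f x)) \<le> C\<^sup>2 * l2sq M (\<lambda>x. u n x - f x)"
      unfolding l2sq_def integral_mult_right_zero[symmetric]
    proof (rule integral_mono)
      show "integrable M (\<lambda>x. (cmod (m x * (u n x - f x)))\<^sup>2)"
        by (rule L2_integrable, rule L2_mult_bounded[OF d assms(2,3)])
      show "integrable M (\<lambda>x. C\<^sup>2 * (cmod (u n x - f x))\<^sup>2)"
        using L2_integrable[OF d] by simp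
      show "(cmod (m x * (u n x - f x)))\<^sup>2 \<le> C\<^sup>2 * (cmod (u n x - f x))\<^sup>2" if "x \<in> space M" for x
        using assms(3)[OF that]
        by (simp add: norm_mult power_mult_distrib mult_right_mono power_mono)
    qed
    then have "sqrt (l2sq M (\<lambda>x. m x * (u n x - f x))) \<le> sqrt (C\<^sup>2 * l2sq M (\<lambda>x. u n x - f x))"
      by (rule real_sqrt_le_mono)
    then show ?thesis
      using assms(4) by (simp add: l2_dist_eq real_sqrt_mult right_diff_distrib)
  qed
  show "(\<lambda>x. m x * u n x) \<in> L2 M" for n
    using assms by (auto simp: l2_lim_def intro!: L2_mult_bounded)
  show "(\<lambda>x. m x * f x) \<in> L2 M"
    using assms by (auto simp: l2_lim_def intro!: L2_mult_bounded)
qed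

lemma l2_lim_cmult: "l2_lim M u f \<Longrightarrow> l2_lim M (\<lambda>n x. c * u n x) (\<lambda>x. c * f x)"
  by (rule l2_lim_mult[where C = "cmod c"]) auto

lemma l2_lim_inner:
  assumes "l2_lim M u f" "g \<in> L2 M"
  shows "(\<lambda>n. l2_inner M g (u n)) \<longlonglongrightarrow> l2_inner M g f"
proof (rule Lim_null[THEN iffD2], rule Lim_null_comparison)
  have "norm (l2_inner M g (u n) - l2_inner M g f) \<le> sqrt (l2sq M g) * l2_dist M (u n) f" for n
    using assms l2_cauchy_schwarz[of g M "\<lambda>x. u n x - f x"]
    by (simp add: l2_lim_def l2_inner_diff_right[symmetric] L2_diff l2_dist_eq)
  then show "\<forall>\<^sub>F n in sequentially. norm (l2_inner M g (u n) - l2_inner M g f) \<le> sqrt (l2sq M g) * l2_dist M (u n) f"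
    by simp
  have "(\<lambda>n. sqrt (l2sq M g) * l2_dist M (u n) f) \<longlonglongrightarrow> sqrt (l2sq M g) * 0"
    using assms(1) by (intro tendsto_mult tendsto_const) (auto simp: l2_lim_def)
  then show "(\<lambda>n. sqrt (l2sq M g) * l2_dist M (u n) f) \<longlonglongrightarrow> 0" by simp
qed

lemma l2_lim_sqrt_l2sq:
  assumes "l2_lim M u f" shows "(\<lambda>n. sqrt (l2sq M (u n))) \<longlonglongrightarrow> sqrt (l2sq M f)"
proof (rule Lim_null[THEN iffD2], rule LIMSEQ_0_squeeze)
  show "norm (sqrt (l2sq M (u n)) - sqrt (l2sq M f)) \<le> l2_dist M (u n) f" for n
  proof -
    have L: "u n \<in> L2 M" "f \<in> L2 M"
      using assms by (auto simp: l2_lim_def)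
    have "sqrt (l2sq M (u n)) \<le> l2_dist M (u n) f + sqrt (l2sq M f)"
      using l2sq_triangle[OF L2_diff[OF L] L(2)] by (simp add: l2_dist_eq)
    moreover have "sqrt (l2sq M f) \<le> l2_dist M (u n) f + sqrt (l2sq M (u n))"
      using l2sq_triangle[OF L2_diff[OF L(2,1)] L(1)] l2_dist_sym[of M f "u n"]
      by (simp add: l2_dist_eq)
    ultimately show "norm (sqrt (l2sq M (u n)) - sqrt (l2sq M f)) \<le> l2_dist M (u n) f"
      by (simp add: abs_le_iff)
  qed
  show "(\<lambda>n. l2_dist M (u n) f) \<longlonglongrightarrow> 0"
    using assms by (simp add: l2_lim_def)
qed

lemma l2_lim_l2sq: "l2_lim M u f \<Longrightarrow> (\<lambda>n. l2sq M (u n)) \<longlonglongrightarrow> l2sq M f"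
  using tendsto_power[OF l2_lim_sqrt_l2sq, of M u f 2] by simp

text \<open>Riesz-Fischer. A subsequence whose consecutive distances decay like \<open>2^-k\<close>
  converges almost everywhere, and Fatou's lemma shows that its pointwise limit is also the
  \<open>L2\<close> limit of the whole sequence.\<close>

lemma l2_complete:
  assumes u: "\<And>n. u n \<in> L2 M"
    and cauchy: "\<And>e. e > 0 \<Longrightarrow> \<exists>N. \<forall>m\<ge>N. \<forall>n\<ge>N. l2_dist M (u m) (u n) < e"
  shows "\<exists>f. l2_lim M u f"
proof -
  have "\<exists>r. \<forall>k. (\<forall>m\<ge>r k. \<forall>n\<ge>r k. l2_dist M (u m) (u n) < (1/2)^k) \<and> r k < r (Suc k)"
  proof (rule dependent_nat_choice)
    show "\<exists>x. \<forall>m\<ge>x. \<forall>n\<ge>x. l2_dist M (u m) (u n) < (1/2)^0"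
      using cauchy[of 1] by simp
    fix x k
    obtain N where "\<forall>m\<ge>N. \<forall>n\<ge>N. l2_dist M (u m) (u n) < (1/2)^Suc k"
      using cauchy[of "(1/2)^Suc k"] by auto
    then show "\<exists>y. (\<forall>m\<ge>y. \<forall>n\<ge>y. l2_dist M (u m) (u n) < (1/2)^Suc k) \<and> x < y"
      by (intro exI[of _ "max N (Suc x)"]) auto
  qed
  then obtain r where r: "\<And>k m n. m \<ge> r k \<Longrightarrow> n \<ge> r k \<Longrightarrow> l2_dist M (u m) (u n) < (1/2)^k"
    and mono: "\<And>k. r k < r (Suc k)" by blast
  have rmono: "strict_mono r"
    using mono by (rule strict_mono_Suc_iff[THEN iffD2, rule_format])
  define d where "d k x = u (r (Suc k)) x - u (r k) x" for k x
  have dL2: "d k \<in> L2 M" for k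
    unfolding d_def using u by (intro L2_diff)
  have d_small: "l2sq M (d k) \<le> (1/4)^k" for k
  proof -
    have "sqrt (l2sq M (d k)) < (1/2)^k"
      using r[of k "r (Suc k)" "r k"] mono[of k] by (simp add: l2_dist_eq d_def[abs_def])
    then have "(sqrt (l2sq M (d k)))\<^sup>2 \<le> ((1/2)^k)\<^sup>2"
      by (intro power_mono) auto
    then show ?thesis
      by (simp add: power_even_eq[symmetric] power_mult[symmetric] mult.commute[of _ 2])
         (simp add: power_mult power2_eq_square)
  qed
  have nn: "(\<integral>\<^sup>+x. ennreal ((cmod (d k x))\<^sup>2) \<partial>M) = ennreal (l2sq M (d k))" for k
    unfolding l2sq_def by (rule nn_integral_eq_integral[OF L2_integrable[OF dL2]]) auto
  \<comment> \<open>The weights \<open>2^k\<close> make the \<open>L\<^sup>2\<close>-convergent subsequence converge geometrically a.e.\<close>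
  have "(\<integral>\<^sup>+x. (\<Sum>k. ennreal (2^k * (cmod (d k x))\<^sup>2)) \<partial>M) = (\<Sum>k. \<integral>\<^sup>+x. ennreal (2^k * (cmod (d k x))\<^sup>2) \<partial>M)"
    using dL2 by (intro nn_integral_suminf) (auto dest!: L2_measurable)
  also have "\<dots> = (\<Sum>k. ennreal (2^k * l2sq M (d k)))"
  proof (intro suminf_cong)
    fix k
    have [measurable]: "d k \<in> borel_measurable M" using dL2 by auto
    show "(\<integral>\<^sup>+x. ennreal (2^k * (cmod (d k x))\<^sup>2) \<partial>M) = ennreal (2^k * l2sq M (d k))"
      by (simp add: ennreal_mult nn_integral_cmult nn)
  qed
  also have "\<dots> \<le> (\<Sum>k. ennreal ((1/2)^k))"
  proof (intro suminf_le allI summableI ennreal_leI)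
    fix k
    have "2^k * l2sq M (d k) \<le> 2^k * (1/4)^k"
      using d_small by (intro mult_left_mono) auto
    also have "\<dots> = (1/2 :: real)^k"
      by (simp flip: power_mult_distrib)
    finally show "2^k * l2sq M (d k) \<le> (1/2)^k" .
  qed
  also have "\<dots> = ennreal (\<Sum>k. (1/2)^k)"
    by (intro suminf_ennreal2 summable_geometric) auto
  also have "\<dots> < \<infinity>" by simp
  finally have "(\<integral>\<^sup>+x. (\<Sum>k. ennreal (2^k * (cmod (d k x))\<^sup>2)) \<partial>M) \<noteq> \<infinity>" by auto
  then have "AE x in M. (\<Sum>k. ennreal (2^k * (cmod (d k x))\<^sup>2)) \<noteq> \<infinity>"
    using dL2 by (intro nn_integral_noteq_infinite) (auto dest!: L2_measurable)
  then have AEconv: "AE x in M. convergent (\<lambda>k. u (r k) x)"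
  proof eventually_elim
    case (elim x)
    have "summable (\<lambda>k. 2^k * (cmod (d k x))\<^sup>2)"
      using elim by (intro summable_suminf_not_top) auto
    then have "(\<lambda>k. 2^k * (cmod (d k x))\<^sup>2) \<longlonglongrightarrow> 0"
      by (rule summable_LIMSEQ_zero)
    then obtain K where K: "\<And>k. k \<ge> K \<Longrightarrow> 2^k * (cmod (d k x))\<^sup>2 \<le> 1"
      using order_tendstoD(2)[of _ 0 _ 1] by (force simp: eventually_sequentially)
    have bd: "norm (d k x) \<le> sqrt (1/2) ^ k" if "k \<ge> K" for k
    proof -
      have "(cmod (d k x))\<^sup>2 \<le> (1/2)^k"
        using K[OF that] by (simp add: field_simps)
      then have "cmod (d k x) \<le> sqrt ((1/2)^k)"
        by (rule real_le_rsqrt)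
      then show ?thesis by (simp add: real_sqrt_power)
    qed
    have "summable (\<lambda>k. d k x)"
      by (rule summable_comparison_test'[where g = "\<lambda>k. sqrt (1/2) ^ k" and N = K])
         (use bd in \<open>auto intro!: summable_geometric simp: real_sqrt_divide\<close>)
    then have "convergent (\<lambda>n. \<Sum>k<n. d k x)"
      by (simp add: summable_iff_convergent)
    moreover have "(\<Sum>k<n. d k x) = u (r n) x - u (r 0) x" for n
      unfolding d_def by (rule sum_lessThan_telescope)
    ultimately have "convergent (\<lambda>n. (u (r n) x - u (r 0) x) + u (r 0) x)"
      by (intro convergent_add convergent_const) simp
    then show ?case by simp
  qed
  define f where "f x = lim (\<lambda>k. u (r k) x)" for x
  have [measurable]: "u n \<in> borel_measurable M" for n
    using u by auto
  have fm [measurable]: "f \<in> borel_measurable M"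
    unfolding f_def by (rule borel_measurable_lim_metric) measurable
  have lim: "AE x in M. (\<lambda>k. u (r k) x) \<longlonglongrightarrow> f x"
    using AEconv by eventually_elim (simp add: f_def convergent_LIMSEQ_iff)
  \<comment> \<open>Along the subsequence \<open>r\<close> the bound on the distance from
    \<open>u n\<close> to all later terms survives in the limit.\<close>
  have fatou: "(\<integral>\<^sup>+x. ennreal ((cmod (u n x - f x))\<^sup>2) \<partial>M) \<le> ennreal (e\<^sup>2)"
    if e: "e > 0" "\<And>m. m \<ge> n \<Longrightarrow> l2_dist M (u n) (u m) < e" for n e
  proof -
    have "(\<integral>\<^sup>+x. ennreal ((cmod (u n x - f x))\<^sup>2) \<partial>M)
        = (\<integral>\<^sup>+x. liminf (\<lambda>k. ennreal ((cmod (u n x - u (r k) x))\<^sup>2)) \<partial>M)"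
    proof (rule nn_integral_cong_AE, use lim in eventually_elim)
      fix x assume "(\<lambda>k. u (r k) x) \<longlonglongrightarrow> f x"
      then have "(\<lambda>k. ennreal ((cmod (u n x - u (r k) x))\<^sup>2)) \<longlonglongrightarrow> ennreal ((cmod (u n x - f x))\<^sup>2)"
        by (intro tendsto_ennrealI tendsto_intros)
      then show "ennreal ((cmod (u n x - f x))\<^sup>2) = liminf (\<lambda>k. ennreal ((cmod (u n x - u (r k) x))\<^sup>2))"
        by (intro lim_imp_Liminf[symmetric]) auto
    qed
    also have "\<dots> \<le> liminf (\<lambda>k. \<integral>\<^sup>+x. ennreal ((cmod (u n x - u (r k) x))\<^sup>2) \<partial>M)"
      by (rule nn_integral_liminf) measurable
    also have "\<dots> \<le> ennreal (e\<^sup>2)"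
    proof (rule Liminf_le)
      show "\<forall>\<^sub>F k in sequentially. (\<integral>\<^sup>+x. ennreal ((cmod (u n x - u (r k) x))\<^sup>2) \<partial>M) \<le> ennreal (e\<^sup>2)"
        unfolding eventually_sequentially
      proof (intro exI[of _ n] allI impI)
        fix k assume "n \<le> k"
        then have "n \<le> r k"
          using seq_suble[OF rmono, of k] by linarith
        then have "sqrt (l2sq M (\<lambda>x. u n x - u (r k) x)) < e"
          using e(2) by (simp add: l2_dist_eq)
        then have "(sqrt (l2sq M (\<lambda>x. u n x - u (r k) x)))\<^sup>2 \<le> e\<^sup>2"
          by (intro power_mono) auto
        moreover have "(\<integral>\<^sup>+x. ennreal ((cmod (u n x - u (r k) x))\<^sup>2) \<partial>M) = ennreal (l2sq M (\<lambda>x. u n x - u (r k) x))"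
          unfolding l2sq_def by (rule nn_integral_eq_integral[OF L2_integrable[OF L2_diff]]) (use u in auto)
        ultimately show "(\<integral>\<^sup>+x. ennreal ((cmod (u n x - u (r k) x))\<^sup>2) \<partial>M) \<le> ennreal (e\<^sup>2)"
          by (simp add: ennreal_leI)
      qed
    qed simp
    finally show ?thesis .
  qed
  have close: "(\<lambda>x. u n x - f x) \<in> L2 M \<and> l2_dist M (u n) f \<le> e"
    if e: "e > 0" "\<And>m. m \<ge> n \<Longrightarrow> l2_dist M (u n) (u m) < e" for n e
  proof
    note F = fatou[OF e]
    show L: "(\<lambda>x. u n x - f x) \<in> L2 M"
    proof (rule L2_I)
      show "integrable M (\<lambda>x. (cmod (u n x - f x))\<^sup>2)"
        using F by (intro integrableI_bounded) (auto simp: top_unique less_top[symmetric])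
    qed measurable
    have "ennreal (l2sq M (\<lambda>x. u n x - f x)) \<le> ennreal (e\<^sup>2)"
      using F nn_integral_eq_integral[OF L2_integrable[OF L]] by (simp add: l2sq_def)
    then have "l2sq M (\<lambda>x. u n x - f x) \<le> e\<^sup>2"
      by (simp add: ennreal_le_iff)
    then show "l2_dist M (u n) f \<le> e"
      using e(1) unfolding l2_dist_eq by (intro real_le_lsqrt) auto
  qed
  obtain N where N: "\<forall>m\<ge>N. \<forall>n\<ge>N. l2_dist M (u m) (u n) < 1"
    using cauchy[of 1] by auto
  have "(\<lambda>x. u N x - f x) \<in> L2 M"
    using close[of 1 N] N by auto
  then have "(\<lambda>x. u N x - (u N x - f x)) \<in> L2 M"
    by (rule L2_diff[OF u])
  then have fL: "f \<in> L2 M" by simp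
  have "(\<lambda>n. l2_dist M (u n) f) \<longlonglongrightarrow> 0"
  proof (rule LIMSEQ_I)
    fix e :: real assume "e > 0"
    then obtain N where N: "\<forall>m\<ge>N. \<forall>n\<ge>N. l2_dist M (u m) (u n) < e/2"
      using cauchy[of "e/2"] by auto
    have "norm (l2_dist M (u n) f - 0) < e" if "n \<ge> N" for n
      using close[of "e/2" n] N that \<open>e > 0\<close> by auto
    then show "\<exists>no. \<forall>n\<ge>no. norm (l2_dist M (u n) f - 0) < e" by blast
  qed
  then show ?thesis using fL u by (auto simp: l2_lim_def)
qed

text \<open>Distances of preimages equal distances of images, so preimages of a convergent sequence
  are Cauchy and completeness supplies a preimage of the limit. This yields surjectivity in
  \<open>fs_surj\<close>.\<close>

lemma l2_isometry_range_closed: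
  assumes V: "\<And>f. f \<in> L2 M \<Longrightarrow> V f \<in> L2 N"
    and iso: "\<And>f g. f \<in> L2 M \<Longrightarrow> g \<in> L2 M \<Longrightarrow> l2_dist N (V f) (V g) = l2_dist M f g"
    and lim: "l2_lim N c d" and s: "\<And>n. s n \<in> L2 M" "\<And>n. AE x in N. V (s n) x = c n x"
  shows "\<exists>f. l2_lim M s f \<and> (AE x in N. V f x = d x)"
proof -
  have "ae_eq N (c n) (V (s n))" for n
    using s(2)[of n] unfolding ae_eq_def by eventually_elim simp
  then have lim': "l2_lim N (\<lambda>n. V (s n)) d"
    by (intro l2_lim_cong_AE[OF lim])
       (use V s lim in \<open>auto simp: ae_eq_def l2_lim_def\<close>)
  have "\<exists>f. l2_lim M s f"
  proof (rule l2_complete[OF s(1)])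
    fix e :: real assume "e > 0"
    have "(\<lambda>n. l2_dist N (V (s n)) d) \<longlonglongrightarrow> 0"
      using lim' by (simp add: l2_lim_def)
    then obtain n0 where n0: "\<And>n. n \<ge> n0 \<Longrightarrow> l2_dist N (V (s n)) d < e/2"
      using order_tendstoD(2)[of _ 0 _ "e/2"] \<open>e > 0\<close> by (force simp: eventually_sequentially)
    have "l2_dist M (s m) (s n) < e" if "m \<ge> n0" "n \<ge> n0" for m n
    proof -
      have "l2_dist N (V (s m)) (V (s n)) \<le> l2_dist N (V (s m)) d + l2_dist N d (V (s n))"
        using V s lim' by (intro l2_dist_triangle) (auto simp: l2_lim_def)
      then show ?thesis
        using iso[OF s(1) s(1)] n0[OF that(1)] n0[OF that(2)] by (simp add: l2_dist_sym[of N d])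
    qed
    then show "\<exists>N. \<forall>m\<ge>N. \<forall>n\<ge>N. l2_dist M (s m) (s n) < e" by blast
  qed
  then obtain f where f: "l2_lim M s f" by blast
  have "l2_lim N (\<lambda>n. V (s n)) (V f)"
    by (rule l2_lim_map[OF f, where C = 1]) (use V iso s f in \<open>auto simp: l2_lim_def\<close>)
  from l2_lim_unique[OF this lim'] f show ?thesis by blast
qed

section \<open>Functions determined by their integrals over sets, boxes and intervals\<close>

lemma AE_zero_of_set_integrals:
  fixes r :: "'a \<Rightarrow> real"
  assumes r: "integrable M r" and z: "\<And>A. A \<in> sets M \<Longrightarrow> (LINT x:A|M. r x) = 0"
  shows "AE x in M. r x = 0"
proof -
  have [measurable]: "r \<in> borel_measurable M" using r by auto
  \<comment> \<open>On the set where \<open>s * r\<close> is positive the vanishing integral has a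
    nonnegative integrand; the two signs treat the positive and the negative part.\<close>
  have pos: "AE x in M. \<not> s * r x > 0" if s: "s = 1 \<or> s = -1" for s :: real
  proof -
    define A where "A = {x\<in>space M. s * r x > 0}"
    have A: "A \<in> sets M" unfolding A_def by measurable
    have i: "integrable M (\<lambda>x. indicator A x * (s * r x))"
      using integrable_mult_right[OF integrable_real_mult_indicator[OF A r], of s]
      by (simp add: ac_simps)
    have "(LINT x|M. indicator A x * (s * r x)) = s * (LINT x:A|M. r x)"
      by (simp add: set_lebesgue_integral_def mult.left_commute)
    also have "\<dots> = 0" using z[OF A] by simp
    finally have "AE x in M. indicator A x * (s * r x) = 0"
      using integral_nonneg_eq_0_iff_AE[OF i] by (auto simp: A_def indicator_def)
    with AE_space show ?thesis
      by eventually_elim (auto simp: A_def indicator_def split: if_splits)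
  qed
  have "AE x in M. \<not> r x > 0" "AE x in M. \<not> r x < 0"
    using pos[of 1] pos[of "-1"] by auto
  then show ?thesis by eventually_elim linarith
qed

text \<open>Open boxes form an intersection-stable generator of the Borel sets, and the sets over
  which \<open>f\<close> integrates to zero form a Dynkin system. Closure under complements needs
  the total integral to vanish, which comes from exhausting the space by boxes.\<close>

lemma AE_zero_of_box_integrals:
  fixes f :: "'a::euclidean_space \<Rightarrow> complex"
  assumes f: "integrable lborel f" and z: "\<And>a b. (LINT x:box a b|lborel. f x) = 0"
  shows "AE x in lborel. f x = 0"
proof -
  have [measurable]: "f \<in> borel_measurable borel" using f by auto
  have si: "set_integrable lborel A f" if "A \<in> sets borel" for A
    using f that by (auto simp: set_integrable_def intro!: integrable_mult_indicator)
  let ?G = "range (\<lambda>(a, b). box a b :: 'a set)"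
  have sets: "sets borel = sigma_sets UNIV ?G"
    by (subst borel_eq_box) (simp add: sets_measure_of)
  have int_f: "(LINT x|lborel. f x) = 0"
  proof (rule LIMSEQ_unique)
    show "(\<lambda>n. LINT x:box (-(real n *\<^sub>R One)) (real n *\<^sub>R One)|lborel. f x) \<longlonglongrightarrow> (LINT x|lborel. f x)"
      unfolding set_lebesgue_integral_def
    proof (rule integral_dominated_convergence[where w = "\<lambda>x. norm (f x)"])
      show "AE x in lborel. (\<lambda>n. indicator (box (- (real n *\<^sub>R One)) (real n *\<^sub>R One)) x *\<^sub>R f x) \<longlonglongrightarrow> f x"
      proof (rule AE_I2, rule tendsto_eventually)
        fix x :: 'a
        obtain n0 :: nat where n0: "Max ((\<lambda>i. \<bar>x \<bullet> i\<bar>) ` Basis) < real n0"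
          using reals_Archimedean2 by blast
        have "\<bar>x \<bullet> i\<bar> < real n" if "n \<ge> n0" "i \<in> Basis" for i n
        proof -
          have "\<bar>x \<bullet> i\<bar> \<le> Max ((\<lambda>i. \<bar>x \<bullet> i\<bar>) ` Basis)"
            using that by (intro Max_ge) auto
          then show ?thesis using n0 that by linarith
        qed
        then have "x \<in> box (- (real n *\<^sub>R One)) (real n *\<^sub>R One)" if "n \<ge> n0" for n
          using that by (fastforce simp: mem_box)
        then show "\<forall>\<^sub>F n in sequentially. indicator (box (- (real n *\<^sub>R One)) (real n *\<^sub>R One)) x *\<^sub>R f x = f x"
          unfolding eventually_sequentially by (intro exI[of _ n0]) simp
      qed
    qed (use f in \<open>auto simp: indicator_def\<close>)
    show "(\<lambda>n. LINT x:box (-(real n *\<^sub>R One)) (real n *\<^sub>R One)|lborel. f x) \<longlonglongrightarrow> 0"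
      using z by simp
  qed
  have all: "(LINT x:A|lborel. f x) = 0" if "A \<in> sets borel" for A
  proof -
    have "Int_stable ?G"
      by (auto simp: Int_stable_def box_Int_box)
    moreover have "?G \<subseteq> Pow UNIV" by auto
    moreover have "A \<in> sigma_sets UNIV ?G" using that sets by simp
    ultimately show ?thesis
    proof (induction rule: sigma_sets_induct_disjoint)
      case (basic A) then show ?case using z by auto
    next
      case empty then show ?case by (simp add: set_lebesgue_integral_def)
    next
      case (compl A)
      then have A: "A \<in> sets borel" using sets by simp
      have "(LINT x:(UNIV - A) \<union> A|lborel. f x) = (LINT x:UNIV - A|lborel. f x) + (LINT x:A|lborel. f x)"
        using A by (intro set_integral_Un si) auto
      then show ?case using compl int_f by (simp add: set_lebesgue_integral_def)
    next
      case (union A)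
      then have A: "range A \<subseteq> sets borel" using sets by simp
      have "(LINT x:(\<Union>i. A i)|lborel. f x) = (\<Sum>i. (LINT x:A i|lborel. f x))"
        using A union(1) by (intro lebesgue_integral_countable_add si) (auto simp: disjoint_family_on_def)
      then show ?case using union by simp
    qed
  qed
  have "AE x in lborel. Re (f x) = 0"
  proof (rule AE_zero_of_set_integrals)
    show "integrable lborel (\<lambda>x. Re (f x))" using f by simp
    fix A :: "'a set" assume A: "A \<in> sets lborel"
    have "(LINT x:A|lborel. Re (f x)) = Re (LINT x:A|lborel. f x)"
      using si A unfolding set_lebesgue_integral_def set_integrable_def by (subst integral_Re[symmetric]) auto
    then show "(LINT x:A|lborel. Re (f x)) = 0" using all A by simp
  qed
  moreover have "AE x in lborel. Im (f x) = 0"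
  proof (rule AE_zero_of_set_integrals)
    show "integrable lborel (\<lambda>x. Im (f x))" using f by simp
    fix A :: "'a set" assume A: "A \<in> sets lborel"
    have "(LINT x:A|lborel. Im (f x)) = Im (LINT x:A|lborel. f x)"
      using si A unfolding set_lebesgue_integral_def set_integrable_def by (subst integral_Im[symmetric]) auto
    then show "(LINT x:A|lborel. Im (f x)) = 0" using all A by simp
  qed
  ultimately show ?thesis
    by eventually_elim (simp add: complex_eq_iff)
qed

lemma finite_measure_restrict_interval: "finite_measure (restrict_space lborel {\<alpha>..\<beta>::real})"
proof
  show "emeasure (restrict_space lborel {\<alpha>..\<beta>}) (space (restrict_space lborel {\<alpha>..\<beta>})) \<noteq> \<infinity>"
    by (subst emeasure_restrict_space) (auto simp: space_restrict_space emeasure_lborel_Icc_eq)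
qed

lemma LINT_restrict_interval:
  fixes f :: "real \<Rightarrow> 'b::{banach, second_countable_topology}"
  shows "(LINT x|restrict_space lborel {\<alpha>..\<beta>}. f x) = (LINT x:{\<alpha>..\<beta>}|lborel. f x)"
  unfolding set_lebesgue_integral_def by (rule integral_restrict_space) simp

lemma integrable_restrict_interval:
  fixes f :: "real \<Rightarrow> 'b::{banach, second_countable_topology}"
  shows "integrable (restrict_space lborel {\<alpha>..\<beta>}) f \<longleftrightarrow> set_integrable lborel {\<alpha>..\<beta>} f"
  unfolding set_integrable_def by (rule integrable_restrict_space) simp

lemma borel_measurable_restrict_lborel [measurable (raw)]:
  "f \<in> borel_measurable borel \<Longrightarrow> f \<in> borel_measurable (restrict_space lborel S)"
  by (rule measurable_restrict_space1) simp

text \<open>Extend \<open>f\<close> by zero to the line. A box meets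
  \<open>[\<alpha>,\<beta>]\<close> in an open subinterval up to the two endpoints, which are
  null.\<close>

lemma AE_zero_of_subinterval_integrals:
  fixes f :: "real \<Rightarrow> complex"
  assumes f: "integrable (restrict_space lborel {\<alpha>..\<beta>}) f"
    and z: "\<And>a b. \<alpha> \<le> a \<Longrightarrow> a < b \<Longrightarrow> b \<le> \<beta> \<Longrightarrow>
      (LINT x|restrict_space lborel {\<alpha>..\<beta>}. indicator {a<..<b} x * f x) = 0"
  shows "AE x in restrict_space lborel {\<alpha>..\<beta>}. f x = 0"
proof -
  have "AE x in lborel. indicator {\<alpha>..\<beta>} x *\<^sub>R f x = 0"
  proof (rule AE_zero_of_box_integrals)
    show "integrable lborel (\<lambda>x. indicator {\<alpha>..\<beta>} x *\<^sub>R f x)"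
      using f by (simp add: integrable_restrict_interval set_integrable_def)
    fix a b :: real
    define a' b' where "a' = max \<alpha> a" and "b' = min \<beta> b"
    have "(LINT x:box a b|lborel. indicator {\<alpha>..\<beta>} x *\<^sub>R f x)
        = (LINT x:{\<alpha>..\<beta>}|lborel. indicator {a'<..<b'} x * f x)"
      unfolding set_lebesgue_integral_def
    proof (rule integral_cong_AE)
      show "AE x in lborel. indicator (box a b) x *\<^sub>R indicator {\<alpha>..\<beta>} x *\<^sub>R f x
          = indicator {\<alpha>..\<beta>} x *\<^sub>R (indicator {a'<..<b'} x * f x)"
        using AE_lborel_singleton[of \<alpha>] AE_lborel_singleton[of \<beta>]
        by eventually_elim (auto simp: indicator_def a'_def b'_def)
      have [measurable]: "(\<lambda>x. indicator {\<alpha>..\<beta>} x *\<^sub>R f x) \<in> borel_measurable lborel"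
        using f by (auto simp: integrable_restrict_interval set_integrable_def)
      have [measurable]: "box a b \<in> sets lborel" by simp
      show "(\<lambda>x. indicator (box a b) x *\<^sub>R indicator {\<alpha>..\<beta>} x *\<^sub>R f x) \<in> borel_measurable lborel"
        by measurable
      have "(\<lambda>x. indicator {a'<..<b'} x *\<^sub>R (indicator {\<alpha>..\<beta>} x *\<^sub>R f x)) \<in> borel_measurable lborel"
        by measurable
      then show "(\<lambda>x. indicator {\<alpha>..\<beta>} x *\<^sub>R (indicator {a'<..<b'} x * f x)) \<in> borel_measurable lborel"
        by (rule measurable_cong[THEN iffD1, rotated]) (auto simp: indicator_def)
    qed
    also have "\<dots> = 0"
      using z[of a' b'] by (cases "a' < b'") (auto simp: LINT_restrict_interval a'_def b'_def)
    finally show "(LINT x:box a b|lborel. indicator {\<alpha>..\<beta>} x *\<^sub>R f x) = 0" .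
  qed
  then show ?thesis
    by (subst AE_restrict_space_iff) (simp_all add: indicator_def imp_conjL)
qed

subsection \<open>Fourier series\<close>

lemma expi2pi_cis: "expi2pi r = cis (2 * pi * r)"
  by (simp add: expi2pi_def cis_conv_exp algebra_simps)

lemma norm_expi2pi [simp]: "cmod (expi2pi r) = 1"
  by (simp add: expi2pi_cis)

lemma expi2pi_add: "expi2pi (a + b) = expi2pi a * expi2pi b"
  by (simp add: expi2pi_cis cis_mult algebra_simps)

lemma expi2pi_0 [simp]: "expi2pi 0 = 1"
  by (simp add: expi2pi_cis)

lemma expi2pi_of_int [simp]: "expi2pi (of_int n) = 1"
  by (simp add: expi2pi_cis)

lemma cnj_expi2pi: "cnj (expi2pi r) = expi2pi (- r)"
  by (simp add: expi2pi_cis cis_cnj)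

lemma expi2pi_minus_mult [simp]: "expi2pi (- r) * expi2pi r = 1" "expi2pi r * expi2pi (- r) = 1"
  using expi2pi_add[of "-r" r] expi2pi_add[of r "-r"] by auto

lemma expi2pi_nonzero [simp]: "expi2pi r \<noteq> 0"
  using norm_expi2pi[of r] by (metis norm_zero zero_neq_one)

lemma expi2pi_eq_1_iff: "expi2pi r = 1 \<longleftrightarrow> r \<in> \<int>"
proof
  assume "expi2pi r = 1"
  then have "cos (2 * pi * r) = 1"
    by (metis expi2pi_cis cis.sel(1) one_complex.sel(1))
  then obtain n :: int where "2 * pi * r = of_int n * 2 * pi"
    using cos_one_2pi_int by blast
  then have "r = of_int n" by simp
  then show "r \<in> \<int>" by simp
next
  assume "r \<in> \<int>" then show "expi2pi r = 1" by (elim Ints_cases) simp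
qed

lemma continuous_on_expi2pi [continuous_intros]:
  "continuous_on S f \<Longrightarrow> continuous_on S (\<lambda>x. expi2pi (f x))"
  unfolding expi2pi_def by (intro continuous_intros)

lemma borel_measurable_expi2pi [measurable]: "expi2pi \<in> borel_measurable borel"
  by (intro borel_measurable_continuous_onI continuous_on_expi2pi continuous_on_id)

lemma has_vector_derivative_expi2pi:
  "((\<lambda>x. expi2pi (c * x + d)) has_vector_derivative (\<i> * 2 * of_real pi * of_real c) * expi2pi (c * x + d)) (at x within S)"
proof -
  have "((\<lambda>z. exp (\<i> * 2 * of_real pi * (of_real c * z + of_real d))) has_field_derivative
      \<i> * 2 * of_real pi * of_real c * exp (\<i> * 2 * of_real pi * (of_real c * of_real x + of_real d))) (at (of_real x))"
    by (auto intro!: derivative_eq_intros)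
  then have "((\<lambda>z. exp (\<i> * 2 * of_real pi * (of_real c * of_real z + of_real d))) has_vector_derivative
      \<i> * 2 * of_real pi * of_real c * exp (\<i> * 2 * of_real pi * (of_real c * of_real x + of_real d))) (at x within S)"
    by (rule has_vector_derivative_real_field)
  then show ?thesis by (simp add: expi2pi_def)
qed

text \<open>The functions orthogonal to all trigonometric monomials form a module over the
  polynomial functions on the circle, hence over its continuous functions.\<close>

lemma trig_orthogonal_imp_zero:
  fixes f :: "real \<Rightarrow> complex"
  assumes "\<alpha> < \<beta>" and f: "integrable (restrict_space lborel {\<alpha>..\<beta>}) f"
    and z: "\<And>k::int. (LINT x|restrict_space lborel {\<alpha>..\<beta>}. f x * expi2pi (of_int k * ((x - \<alpha>) / (\<beta> - \<alpha>)))) = 0"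
  shows "AE x in restrict_space lborel {\<alpha>..\<beta>}. f x = 0"
proof -
  let ?X = "restrict_space lborel {\<alpha>..\<beta>}"
  define w where "w x = expi2pi ((x - \<alpha>) / (\<beta> - \<alpha>))" for x
  define e where "e k x = expi2pi (of_int k * ((x - \<alpha>) / (\<beta> - \<alpha>)))" for k :: int and x
  have [measurable]: "e k \<in> borel_measurable borel" "w \<in> borel_measurable borel" for k
    unfolding e_def w_def by measurable
  have e_w: "w x * e k x = e (k + 1) x" "cnj (w x) * e k x = e (k - 1) x" for k x
  proof -
    define s where "s = (x - \<alpha>) / (\<beta> - \<alpha>)"
    show "w x * e k x = e (k + 1) x" "cnj (w x) * e k x = e (k - 1) x"
      unfolding e_def w_def cnj_expi2pi s_def[symmetric] expi2pi_add[symmetric]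
      by (simp_all add: algebra_simps)
  qed
  \<comment> \<open>Multiplication by \<open>w\<close> or \<open>cnj w\<close> only shifts the index
    \<open>k\<close>, so this property is stable under it.\<close>
  define Z where "Z f \<longleftrightarrow> integrable ?X f \<and> (\<forall>k. (LINT x|?X. f x * e k x) = 0)" for f
  have ie: "integrable ?X (\<lambda>x. f x * m x)"
    if "integrable ?X f" "m \<in> borel_measurable borel" "\<And>x. cmod (m x) \<le> C" for f m C
  proof (rule Bochner_Integration.integrable_bound)
    show "integrable ?X (\<lambda>x. C * norm (f x))" using that by simp
    have [measurable]: "f \<in> borel_measurable ?X" "m \<in> borel_measurable borel" using that by auto
    show "(\<lambda>x. f x * m x) \<in> borel_measurable ?X" by measurable
    have "0 \<le> C" using that(3)[of 0] norm_ge_zero order_trans by blast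
    then show "AE x in ?X. norm (f x * m x) \<le> norm (C * norm (f x))"
      using that(3) by (auto simp: norm_mult mult.commute[of C] intro!: AE_I2 mult_left_mono)
  qed
  have Zw: "Z (\<lambda>x. f x * (A * w x + B * cnj (w x)))" if "Z f" for f A B
  proof -
    have fi: "integrable ?X f" using that by (simp add: Z_def)
    have ek: "integrable ?X (\<lambda>x. f x * e k x)" for k
      by (rule ie[OF fi, where C = 1]) (auto simp: e_def)
    have "integrable ?X (\<lambda>x. f x * (A * w x + B * cnj (w x)))"
    proof (rule ie[OF fi, where C = "cmod A + cmod B"])
      show "cmod (A * w x + B * cnj (w x)) \<le> cmod A + cmod B" for x
        using norm_triangle_ineq[of "A * w x" "B * cnj (w x)"] by (simp add: norm_mult w_def)
    qed measurable
    moreover have "(LINT x|?X. (f x * (A * w x + B * cnj (w x))) * e k x) = 0" for k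
    proof -
      have "(f x * (A * w x + B * cnj (w x))) * e k x = A * (f x * e (k+1) x) + B * (f x * e (k-1) x)" for x
        unfolding e_w[symmetric] by (simp add: algebra_simps)
      then show ?thesis using that ek by (simp add: Z_def)
    qed
    ultimately show ?thesis by (simp add: Z_def)
  qed
  have poly: "\<forall>f. Z f \<longrightarrow> Z (\<lambda>x. f x * of_real (g (w x)))" if "real_polynomial_function g" for g
    using that
  proof (induction rule: real_polynomial_function.induct)
    case (linear g)
    have g: "g z = g 1 * Re z + g \<i> * Im z" for z
    proof -
      have "g (Re z *\<^sub>R 1 + Im z *\<^sub>R \<i>) = Re z *\<^sub>R g 1 + Im z *\<^sub>R g \<i>"
        using linear by (simp add: bounded_linear.linear linear_add linear_scale)
      moreover have "Re z *\<^sub>R 1 + Im z *\<^sub>R \<i> = z" by (simp add: complex_eq_iff)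
      ultimately show ?thesis by (simp add: mult.commute)
    qed
    \<comment> \<open>A real linear form on the plane, rewritten through \<open>z\<close> and
      \<open>cnj z\<close>.\<close>
    have "of_real (g z) = (g 1 - \<i> * g \<i>) / 2 * z + (g 1 + \<i> * g \<i>) / 2 * cnj z" for z
      by (subst g) (simp add: complex_eq_iff field_simps)
    then obtain A B where "\<And>z. of_real (g z) = A * z + B * cnj z" by blast
    then show ?case using Zw by simp
  next
    case (const c)
    then show ?case by (auto simp: Z_def mult.commute[of _ "of_real c"] mult.assoc)
  next
    case (add g h)
    have "Z (\<lambda>x. f x * of_real (g (w x)) + f x * of_real (h (w x)))" if "Z f" for f
    proof -
      note G = add.IH[rule_format, OF that]
      have "integrable ?X (\<lambda>x. (f x * of_real (g (w x))) * e k x)" "integrable ?X (\<lambda>x. (f x * of_real (h (w x))) * e k x)" for k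
        using G by (auto intro!: ie[where C = 1] simp: Z_def e_def[of k])
      then show ?thesis using G by (simp add: Z_def distrib_right)
    qed
    then show ?case by (simp add: distrib_left)
  next
    case (mult g h)
    have "Z (\<lambda>x. (f x * of_real (g (w x))) * of_real (h (w x)))" if "Z f" for f
      using mult.IH that by blast
    then show ?case by (simp add: mult.assoc)
  qed
  have Zf: "Z f" using f z by (simp add: Z_def e_def)
  have cont: "(LINT x|?X. f x * of_real (h (w x))) = 0" if h: "continuous_on UNIV h" for h :: "complex \<Rightarrow> real"
  proof -
    have E: "cmod (LINT x|?X. f x * of_real (h (w x))) \<le> eps * (LINT x|?X. cmod (f x))" if "eps > 0" for eps
    proof -
      obtain g where g: "real_polynomial_function g" "\<And>x. x \<in> sphere 0 1 \<Longrightarrow> \<bar>h x - g x\<bar> < eps"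
        using Stone_Weierstrass_real_polynomial_function[of "sphere 0 1" h eps] continuous_on_subset[OF h] \<open>eps > 0\<close>
        by (metis compact_sphere subset_UNIV)
      have gc: "continuous_on UNIV g"
        using g(1) continuous_on_polymonial_function real_polynomial_function_eq by blast
      have [measurable]: "g \<in> borel_measurable borel" "h \<in> borel_measurable borel"
        using gc h by (auto intro: borel_measurable_continuous_onI)
      have bd: "\<bar>h (w x) - g (w x)\<bar> \<le> eps" for x
        using g(2)[of "w x"] by (simp add: w_def less_imp_le)
      have i1: "integrable ?X (\<lambda>x. f x * of_real (g (w x)))"
        using poly[OF g(1)] Zf by (simp add: Z_def)
      have i2: "integrable ?X (\<lambda>x. f x * of_real (h (w x) - g (w x)))"
        by (rule ie[OF f, where C = eps]) (use bd in \<open>auto simp del: of_real_diff simp: norm_of_real\<close>)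
      have e0: "e 0 x = 1" for x by (simp add: e_def)
      have "(LINT x|?X. f x * of_real (g (w x))) = (LINT x|?X. f x * of_real (g (w x)) * e 0 x)"
        by (simp add: e0)
      also have "\<dots> = 0"
        using poly[OF g(1)] Zf unfolding Z_def by blast
      finally have "(LINT x|?X. f x * of_real (h (w x)))
          = (LINT x|?X. f x * of_real (h (w x) - g (w x))) + 0"
      proof -
        assume 0: "(LINT x|?X. f x * of_real (g (w x))) = 0"
        have "(LINT x|?X. f x * of_real (h (w x) - g (w x)) + f x * of_real (g (w x)))
            = (LINT x|?X. f x * of_real (h (w x) - g (w x))) + (LINT x|?X. f x * of_real (g (w x)))"
          by (rule Bochner_Integration.integral_add[OF i2 i1])
        then show ?thesis using 0 by (simp add: distrib_left[symmetric])
      qed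
      then have "cmod (LINT x|?X. f x * of_real (h (w x))) \<le> (LINT x|?X. cmod (f x * of_real (h (w x) - g (w x))))"
        by (simp only: add_0_right) (rule integral_norm_bound)
      also have "\<dots> \<le> (LINT x|?X. eps * cmod (f x))"
      proof (rule integral_mono)
        show "integrable ?X (\<lambda>x. cmod (f x * of_real (h (w x) - g (w x))))" using i2 by (rule integrable_norm)
        show "integrable ?X (\<lambda>x. eps * cmod (f x))" using f by simp
        show "cmod (f x * of_real (h (w x) - g (w x))) \<le> eps * cmod (f x)" for x
          using mult_left_mono[OF bd[of x], of "cmod (f x)"]
          by (simp add: norm_mult mult.commute[of eps] norm_of_real del: of_real_diff)
      qed
      also have "\<dots> = eps * (LINT x|?X. cmod (f x))" by simp
      finally show ?thesis .
    qed
    have "cmod (LINT x|?X. f x * of_real (h (w x))) \<le> 0"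
    proof (rule field_le_epsilon)
      fix d :: real assume d: "d > 0"
      define I where "I = (LINT x|?X. cmod (f x))"
      have I: "I \<ge> 0" by (simp add: I_def)
      have "cmod (LINT x|?X. f x * of_real (h (w x))) \<le> d / (I + 1) * I"
        using E[OF divide_pos_pos[of d "I + 1"]] d I unfolding I_def[symmetric] by linarith
      also have "\<dots> \<le> d" using d I by (simp add: field_simps)
      finally show "cmod (LINT x|?X. f x * of_real (h (w x))) \<le> 0 + d" by simp
    qed
    then show ?thesis by simp
  qed
  show ?thesis
  proof (rule AE_zero_of_subinterval_integrals[OF f])
    fix a b assume ab: "\<alpha> \<le> a" "a < b" "b \<le> \<beta>"
    \<comment> \<open>\<open>w\<close> wraps the interval once around the circle and identifies only
      \<alpha> with \<beta>. Both lie outside \<open>{a<..<b}\<close>, so membership of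
      \<open>w x\<close> in the closed set \<open>C\<close> decides whether \<open>x\<close> is in
      the open subinterval.\<close>
    define C where "C = w ` ({\<alpha>..a} \<union> {b..\<beta>})"
    have "compact C"
      unfolding C_def w_def by (intro compact_continuous_image compact_Un compact_Icc continuous_intros)
        (use assms(1) in auto)
    then have C: "closed C" "C \<noteq> {}"
      using ab by (auto simp: compact_imp_closed C_def)
    have w_in: "w x \<in> C \<longleftrightarrow> x \<notin> {a<..<b}" if "x \<in> {\<alpha>..\<beta>}" for x
    proof
      assume "w x \<in> C"
      then obtain y where y: "w x = w y" "y \<in> {\<alpha>..a} \<union> {b..\<beta>}"
        unfolding C_def by (rule imageE)
      have "expi2pi ((x - \<alpha>) / (\<beta> - \<alpha>) + - ((y - \<alpha>) / (\<beta> - \<alpha>))) = 1"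
        using y(1) by (simp only: expi2pi_add w_def expi2pi_minus_mult)
      then have "(x - y) / (\<beta> - \<alpha>) \<in> \<int>"
        by (simp only: expi2pi_eq_1_iff) (simp add: diff_divide_distrib)
      then obtain n where n: "x - y = of_int n * (\<beta> - \<alpha>)"
        using assms(1) by (auto elim!: Ints_cases simp: field_simps)
      show "x \<notin> {a<..<b}"
      proof
        assume x: "x \<in> {a<..<b}"
        then have "\<bar>x - y\<bar> < 1 * (\<beta> - \<alpha>)" using y(2) ab by auto
        then have "\<bar>real_of_int n\<bar> * (\<beta> - \<alpha>) < 1 * (\<beta> - \<alpha>)"
          using n assms(1) by (simp add: abs_mult)
        then have "\<bar>real_of_int n\<bar> < 1"
          using assms(1) mult_less_cancel_right_pos[of "\<beta> - \<alpha>"] by auto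
        then have "n = 0" by linarith
        then show False using n x y(2) by auto
      qed
    next
      assume "x \<notin> {a<..<b}"
      then have "x \<in> {\<alpha>..a} \<union> {b..\<beta>}" using that by auto
      then show "w x \<in> C" by (simp add: C_def)
    qed
    \<comment> \<open>Continuous functions of the plane that tend to the indicator of the complement
      of \<open>C\<close>, hence along \<open>w\<close> to the indicator of
      \<open>{a<..<b}\<close>.\<close>
    define h where "h n z = min 1 (real n * infdist z C)" for n z
    have hc: "continuous_on UNIV (h n)" for n
      unfolding h_def by (intro continuous_intros continuous_on_infdist)
    have [measurable]: "h n \<in> borel_measurable borel" for n
      using hc by (rule borel_measurable_continuous_onI)
    have [measurable]: "f \<in> borel_measurable ?X" using f by auto
    have "(\<lambda>n. LINT x|?X. f x * of_real (h n (w x))) \<longlonglongrightarrow> (LINT x|?X. indicator {a<..<b} x * f x)"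
    proof (rule integral_dominated_convergence[where w = "\<lambda>x. norm (f x)"])
      show "(\<lambda>x. indicator {a<..<b} x * f x) \<in> borel_measurable ?X" by measurable
      show "(\<lambda>x. f x * of_real (h n (w x))) \<in> borel_measurable ?X" for n by measurable
      show "integrable ?X (\<lambda>x. norm (f x))" using f by simp
      show "AE x in ?X. norm (f x * of_real (h n (w x))) \<le> norm (f x)" for n
      proof (rule AE_I2)
        fix x
        have "\<bar>h n (w x)\<bar> \<le> 1" by (simp add: h_def infdist_nonneg abs_le_iff)
        then have "norm (f x) * \<bar>h n (w x)\<bar> \<le> norm (f x) * 1" by (intro mult_left_mono) auto
        then show "norm (f x * of_real (h n (w x))) \<le> norm (f x)" by (simp add: norm_mult)
      qed
      show "AE x in ?X. (\<lambda>n. f x * of_real (h n (w x))) \<longlonglongrightarrow> indicator {a<..<b} x * f x"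
      proof (rule AE_I2)
        fix x assume "x \<in> space ?X"
        then have x: "x \<in> {\<alpha>..\<beta>}" by (simp add: space_restrict_space)
        have "(\<lambda>n. h n (w x)) \<longlonglongrightarrow> indicator {a<..<b} x"
        proof (cases "x \<in> {a<..<b}")
          case False
          then have "infdist (w x) C = 0" using w_in[OF x] C in_closed_iff_infdist_zero by blast
          then show ?thesis using False by (simp add: h_def)
        next
          case True
          then have "infdist (w x) C \<noteq> 0" using w_in[OF x] C in_closed_iff_infdist_zero by blast
          then have p: "infdist (w x) C > 0" using infdist_nonneg[of "w x" C] by linarith
          obtain n0 :: nat where n0: "1 / infdist (w x) C \<le> n0" using real_arch_simple by blast
          have "h n (w x) = 1" if "n \<ge> n0" for n
          proof -
            have "1 / infdist (w x) C \<le> n" using n0 that by linarith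
            then show ?thesis using p by (simp add: h_def field_simps)
          qed
          then have "\<forall>\<^sub>F n in sequentially. h n (w x) = indicator {a<..<b} x"
            using True unfolding eventually_sequentially by (intro exI[of _ n0]) simp
          then show ?thesis by (rule tendsto_eventually)
        qed
        then have "(\<lambda>n. f x * of_real (h n (w x))) \<longlonglongrightarrow> f x * of_real (indicator {a<..<b} x)"
          by (intro tendsto_intros)
        then show "(\<lambda>n. f x * of_real (h n (w x))) \<longlonglongrightarrow> indicator {a<..<b} x * f x"
          by (cases "x \<in> {a<..<b}") simp_all
      qed
    qed
    moreover have "(LINT x|?X. f x * of_real (h n (w x))) = 0" for n
      by (rule cont[OF hc])
    ultimately show "(LINT x|?X. indicator {a<..<b} x * f x) = 0"
      by (simp add: LIMSEQ_const_iff)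
  qed
qed

section \<open>Orthonormal expansions\<close>

locale l2_orthonormal_basis =
  fixes M :: "'a measure" and u :: "int \<Rightarrow> 'a \<Rightarrow> complex"
  assumes u_L2: "u k \<in> L2 M"
    and orthonormal: "l2_inner M (u j) (u k) = of_bool (j = k)"
    and complete: "f \<in> L2 M \<Longrightarrow> (\<And>k. l2_inner M (u k) f = 0) \<Longrightarrow> AE x in M. f x = 0"
begin

definition partial_sum :: "(int \<Rightarrow> complex) \<Rightarrow> nat \<Rightarrow> 'a \<Rightarrow> complex" where
  "partial_sum c n x = (\<Sum>k\<in>{- int n..int n}. c k * u k x)"

lemma partial_sum_L2: "partial_sum c n \<in> L2 M"
  unfolding partial_sum_def by (intro L2_sum L2_cmult u_L2)

lemma inner_partial_sum: "l2_inner M (u j) (partial_sum c n) = (if \<bar>j\<bar> \<le> int n then c j else 0)"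
proof -
  have "l2_inner M (u j) (partial_sum c n) = (\<Sum>k\<in>{- int n..int n}. c k * of_bool (j = k))"
    unfolding partial_sum_def
    by (subst l2_inner_sum_right) (auto simp: u_L2 L2_cmult l2_inner_cmult_right orthonormal)
  also have "\<dots> = (if \<bar>j\<bar> \<le> int n then c j else 0)"
    by (simp add: of_bool_def if_distrib sum.delta abs_le_iff cong: if_cong)
  finally show ?thesis .
qed

lemma inner_partial_sum_left:
  "g \<in> L2 M \<Longrightarrow> l2_inner M (partial_sum c n) g = (\<Sum>k\<in>{- int n..int n}. cnj (c k) * l2_inner M (u k) g)"
proof -
  assume g: "g \<in> L2 M"
  have "l2_inner M g (partial_sum c n) = (\<Sum>k\<in>{- int n..int n}. c k * l2_inner M g (u k))"
    unfolding partial_sum_def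
    by (subst l2_inner_sum_right) (auto simp: u_L2 L2_cmult l2_inner_cmult_right g)
  from arg_cong[OF this, of cnj] show ?thesis by (simp add: l2_inner_cnj cnj_sum)
qed

text \<open>Bessel's inequality makes the partial sums Cauchy. Their limit has the same coefficients
  as \<open>f\<close>, and \<open>complete\<close> leaves no room for a difference.\<close>

lemma partial_sum_tendsto:
  assumes f: "f \<in> L2 M"
  shows "l2_lim M (partial_sum (\<lambda>k. l2_inner M (u k) f)) f"
    and "(\<lambda>n. \<Sum>k\<in>{- int n..int n}. (cmod (l2_inner M (u k) f))\<^sup>2) \<longlonglongrightarrow> l2sq M f"
proof -
  define c where "c k = l2_inner M (u k) f" for k
  define a where "a n = (\<Sum>k\<in>{- int n..int n}. (cmod (c k))\<^sup>2)" for n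
  note S = partial_sum_L2[of c]
  have cc: "cnj z * z = of_real ((cmod z)\<^sup>2)" for z
    using complex_norm_square[of z] by (simp add: mult.commute)
  have inner: "l2_inner M (partial_sum c m) (partial_sum c n) = of_real (a m)" if "m \<le> n" for m n
  proof -
    have "l2_inner M (partial_sum c m) (partial_sum c n) = (\<Sum>k\<in>{- int m..int m}. of_real ((cmod (c k))\<^sup>2))"
      unfolding inner_partial_sum_left[OF S] inner_partial_sum cc[symmetric]
      by (rule sum.cong) (use that in auto)
    then show ?thesis by (simp add: a_def del: of_real_power)
  qed
  have a: "l2sq M (partial_sum c n) = a n" for n
    using inner[of n n] by (simp add: l2sq_eq_Re)
  have "l2_inner M (partial_sum c n) f = of_real (a n)" for n
    by (simp add: inner_partial_sum_left[OF f] c_def[symmetric] cc a_def del: of_real_power)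
  then have "l2sq M (\<lambda>x. partial_sum c n x - f x) = l2sq M f - a n" for n
    by (simp add: l2sq_diff[OF S f] a)
  then have bessel: "a n \<le> l2sq M f" for n
    using l2sq_nonneg[of M "\<lambda>x. partial_sum c n x - f x"] by simp
  have "incseq a"
    unfolding a_def by (intro incseq_SucI sum_mono2) auto
  then have "convergent a"
    using incseq_convergent[of a "l2sq M f"] bessel unfolding convergent_def by blast
  then have cauchy: "Cauchy a" by (rule convergent_Cauchy)
  have dist: "l2_dist M (partial_sum c m) (partial_sum c n) = sqrt (a n - a m)" if "m \<le> n" for m n
    by (simp add: l2_dist_eq l2sq_diff[OF S S] a inner[OF that])
  have "\<exists>h. l2_lim M (partial_sum c) h"
  proof (rule l2_complete[OF S])
    fix e :: real assume e: "e > 0"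
    then obtain N where N: "\<And>m n. m \<ge> N \<Longrightarrow> n \<ge> N \<Longrightarrow> norm (a m - a n) < e\<^sup>2"
      using CauchyD[OF cauchy, of "e\<^sup>2"] by auto
    have "l2_dist M (partial_sum c m) (partial_sum c n) < e" if "m \<ge> N" "n \<ge> N" "m \<le> n" for m n
    proof -
      have "sqrt (a n - a m) < sqrt (e\<^sup>2)"
        using N[OF that(1,2)] by (intro real_sqrt_less_mono) auto
      then show ?thesis using e dist[OF that(3)] by simp
    qed
    then show "\<exists>N. \<forall>m\<ge>N. \<forall>n\<ge>N. l2_dist M (partial_sum c m) (partial_sum c n) < e"
      by (metis l2_dist_sym nat_le_linear)
  qed
  then obtain h where h: "l2_lim M (partial_sum c) h" by blast
  have hL: "h \<in> L2 M" using h by (simp add: l2_lim_def)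
  have "AE x in M. h x - f x = 0"
  proof (rule complete[OF L2_diff[OF hL f]])
    fix k
    have "(\<lambda>n. l2_inner M (u k) (partial_sum c n)) \<longlonglongrightarrow> l2_inner M (u k) h"
      by (rule l2_lim_inner[OF h u_L2])
    moreover have "(\<lambda>n. l2_inner M (u k) (partial_sum c n)) \<longlonglongrightarrow> c k"
    proof (rule tendsto_eventually)
      show "\<forall>\<^sub>F n in sequentially. l2_inner M (u k) (partial_sum c n) = c k"
        unfolding eventually_sequentially inner_partial_sum by (intro exI[of _ "nat \<bar>k\<bar>"]) auto
    qed
    ultimately have "l2_inner M (u k) h = c k" by (rule LIMSEQ_unique)
    then show "l2_inner M (u k) (\<lambda>x. h x - f x) = 0"
      by (simp add: l2_inner_diff_right[OF u_L2 hL f] c_def)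
  qed
  then have "ae_eq M h f" unfolding ae_eq_def by eventually_elim simp
  then have lim: "l2_lim M (partial_sum c) f"
    using f S by (intro l2_lim_cong_AE[OF h]) (auto simp: ae_eq_def)
  then show "l2_lim M (partial_sum (\<lambda>k. l2_inner M (u k) f)) f"
    by (simp add: c_def[abs_def])
  show "(\<lambda>n. \<Sum>k\<in>{- int n..int n}. (cmod (l2_inner M (u k) f))\<^sup>2) \<longlonglongrightarrow> l2sq M f"
    using l2_lim_l2sq[OF lim] unfolding a a_def c_def .
qed

text \<open>Stated with \<open>nn_integral\<close> over a counting measure, so that it can be
  integrated over further parameters by Tonelli without integrability questions.\<close>

lemma parseval_nn:
  assumes f: "f \<in> L2 M"
  shows "(\<integral>\<^sup>+k. ennreal ((cmod (l2_inner M (u k) f))\<^sup>2) \<partial>count_space UNIV) = ennreal (l2sq M f)"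
proof (rule LIMSEQ_unique)
  let ?c = "\<lambda>k. (cmod (l2_inner M (u k) f))\<^sup>2"
  show "(\<lambda>n. \<integral>\<^sup>+k. ennreal (?c k) * indicator {- int n..int n} k \<partial>count_space UNIV)
      \<longlonglongrightarrow> (\<integral>\<^sup>+k. ennreal (?c k) \<partial>count_space UNIV)"
  proof (rule nn_integral_LIMSEQ)
    show "incseq (\<lambda>n k. ennreal (?c k) * indicator {- int n..int n} k)"
      by (auto simp: incseq_def le_fun_def indicator_def)
    fix k :: int
    show "(\<lambda>n. ennreal (?c k) * indicator {- int n..int n} k) \<longlonglongrightarrow> ennreal (?c k)"
    proof (rule tendsto_eventually)
      show "\<forall>\<^sub>F n in sequentially. ennreal (?c k) * indicator {- int n..int n} k = ennreal (?c k)"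
        unfolding eventually_sequentially by (intro exI[of _ "nat \<bar>k\<bar>"]) (auto simp: indicator_def)
    qed
  qed auto
  have "(\<integral>\<^sup>+k. ennreal (?c k) * indicator {- int n..int n} k \<partial>count_space UNIV) = ennreal (\<Sum>k\<in>{- int n..int n}. ?c k)" for n
    by (simp add: nn_integral_count_space_indicator[symmetric] nn_integral_count_space_finite sum_ennreal)
  then show "(\<lambda>n. \<integral>\<^sup>+k. ennreal (?c k) * indicator {- int n..int n} k \<partial>count_space UNIV) \<longlonglongrightarrow> ennreal (l2sq M f)"
    using partial_sum_tendsto(2)[OF f] by (simp add: tendsto_ennrealI)
qed

end

text \<open>The normalized eigenfunctions of \<open>d/dx / (i 2 pi)\<close> under the boundary
  condition \<open>f(\<beta>) = e(\<theta>) f(\<alpha>)\<close>, with eigenvalue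
  \<open>(k + \<theta>) / (\<beta> - \<alpha>)\<close>.\<close>

definition fourier_basis :: "real \<Rightarrow> real \<Rightarrow> real \<Rightarrow> int \<Rightarrow> real \<Rightarrow> complex" where
  "fourier_basis \<alpha> \<beta> \<theta> k x =
     expi2pi ((of_int k + \<theta>) / (\<beta> - \<alpha>) * (x - \<alpha>)) / of_real (sqrt (\<beta> - \<alpha>))"

lemma LBINT_has_vector_derivative:
  fixes F :: "real \<Rightarrow> complex"
  assumes "a \<le> b" "\<And>x. (F has_vector_derivative f x) (at x within {a..b})" "continuous_on {a..b} f"
  shows "(LINT x|restrict_space lborel {a..b}. f x) = F b - F a"
    "integrable (restrict_space lborel {a..b}) f"
proof -
  have "has_bochner_integral lborel (\<lambda>x. indicator {a..b} x *\<^sub>R f x) (F b - F a)"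
    by (rule has_bochner_integral_FTC_Icc[OF assms(1,2,3)])
  then show "(LINT x|restrict_space lborel {a..b}. f x) = F b - F a"
    "integrable (restrict_space lborel {a..b}) f"
    by (auto simp: LINT_restrict_interval integrable_restrict_interval set_lebesgue_integral_def
        set_integrable_def has_bochner_integral_iff)
qed

lemma LINT_expi2pi_int:
  assumes "\<alpha> < \<beta>" "n \<noteq> 0"
  shows "(LINT x|restrict_space lborel {\<alpha>..\<beta>}. expi2pi (of_int n / (\<beta> - \<alpha>) * (x - \<alpha>))) = 0"
proof -
  define c where "c = of_int n / (\<beta> - \<alpha>)"
  have c: "c \<noteq> 0" using assms by (simp add: c_def)
  have eq: "c * (x - \<alpha>) = c * x + (- (c * \<alpha>))" for x by (simp add: algebra_simps)
  have "(LINT x|restrict_space lborel {\<alpha>..\<beta>}. expi2pi (c * (x - \<alpha>)))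
      = expi2pi (c * (\<beta> - \<alpha>)) / (\<i> * 2 * of_real pi * of_real c) - expi2pi (c * (\<alpha> - \<alpha>)) / (\<i> * 2 * of_real pi * of_real c)"
  proof (rule LBINT_has_vector_derivative)
    show "((\<lambda>x. expi2pi (c * (x - \<alpha>)) / (\<i> * 2 * of_real pi * of_real c)) has_vector_derivative expi2pi (c * (x - \<alpha>)))
        (at x within {\<alpha>..\<beta>})" for x
      using has_vector_derivative_mult_right[OF has_vector_derivative_expi2pi[of c "- (c * \<alpha>)" x "{\<alpha>..\<beta>}"],
          of "1 / (\<i> * 2 * of_real pi * of_real c)"] c
      unfolding eq by simp
    show "continuous_on {\<alpha>..\<beta>} (\<lambda>x. expi2pi (c * (x - \<alpha>)))"
      by (intro continuous_intros)
  qed (use assms in simp)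
  also have "c * (\<beta> - \<alpha>) = of_int n"
    using assms by (simp add: c_def)
  finally show ?thesis by (simp add: c_def)
qed

lemma borel_measurable_fourier_basis [measurable]: "fourier_basis \<alpha> \<beta> \<theta> k \<in> borel_measurable borel"
  unfolding fourier_basis_def[abs_def] by measurable

lemma fourier_basis_orthonormal_basis:
  assumes "\<alpha> < \<beta>"
  shows "l2_orthonormal_basis (restrict_space lborel {\<alpha>..\<beta>}) (fourier_basis \<alpha> \<beta> \<theta>)"
proof
  let ?X = "restrict_space lborel {\<alpha>..\<beta>}" and ?u = "fourier_basis \<alpha> \<beta> \<theta>"
  interpret finite_measure ?X by (rule finite_measure_restrict_interval)
  have sq: "of_real (sqrt (\<beta> - \<alpha>)) * of_real (sqrt (\<beta> - \<alpha>)) = (of_real (\<beta> - \<alpha>) :: complex)"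
    using assms by (simp flip: of_real_mult)
  show L2: "?u k \<in> L2 ?X" for k
    by (rule L2_bounded[where C = "1 / sqrt (\<beta> - \<alpha>)"])
       (use assms in \<open>auto simp: fourier_basis_def norm_divide\<close>)
  have prod: "cnj (?u j x) * ?u k x = expi2pi (of_int (k - j) / (\<beta> - \<alpha>) * (x - \<alpha>)) / of_real (\<beta> - \<alpha>)" for j k x
    unfolding fourier_basis_def complex_cnj_divide cnj_expi2pi complex_cnj_complex_of_real times_divide_times_eq sq
      expi2pi_add[symmetric]
    by (simp add: algebra_simps diff_divide_distrib add_divide_distrib)
  show "l2_inner ?X (?u j) (?u k) = of_bool (j = k)" for j k
  proof (cases "j = k")
    case True
    have "measure ?X {\<alpha>..\<beta>} = \<beta> - \<alpha>"
      using assms by (simp add: measure_restrict_space)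
    then show ?thesis
      using True assms by (simp add: l2_inner_def prod space_restrict_space scaleR_conv_of_real)
  next
    case False
    then show ?thesis using LINT_expi2pi_int[OF assms, of "k - j"] by (simp add: l2_inner_def prod)
  qed
  fix f assume f: "f \<in> L2 ?X" and 0: "\<And>k. l2_inner ?X (?u k) f = 0"
  \<comment> \<open>The twist by \<theta> is a common factor of modulus 1 in all basis functions.
    Moved onto \<open>f\<close>, it reduces completeness to the untwisted trigonometric
    system.\<close>
  have "AE x in ?X. f x * expi2pi (- \<theta> / (\<beta> - \<alpha>) * (x - \<alpha>)) = 0"
  proof (rule trig_orthogonal_imp_zero[OF assms])
    have "(\<lambda>x. expi2pi (- \<theta> / (\<beta> - \<alpha>) * (x - \<alpha>)) * f x) \<in> L2 ?X"
      by (rule L2_mult_bounded[OF f, where C = 1]) auto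
    then show "integrable ?X (\<lambda>x. f x * expi2pi (- \<theta> / (\<beta> - \<alpha>) * (x - \<alpha>)))"
      by (simp add: L2_imp_integrable mult.commute)
    fix k :: int
    have "f x * expi2pi (- \<theta> / (\<beta> - \<alpha>) * (x - \<alpha>)) * expi2pi (of_int k * ((x - \<alpha>) / (\<beta> - \<alpha>)))
        = of_real (sqrt (\<beta> - \<alpha>)) * (cnj (?u (- k) x) * f x)" for x
    proof -
      have "- \<theta> / (\<beta> - \<alpha>) * (x - \<alpha>) + of_int k * ((x - \<alpha>) / (\<beta> - \<alpha>)) = - ((of_int (- k) + \<theta>) / (\<beta> - \<alpha>) * (x - \<alpha>))"
        by (simp add: algebra_simps diff_divide_distrib add_divide_distrib)
      then show ?thesis
        unfolding mult.assoc expi2pi_add[symmetric] fourier_basis_def complex_cnj_divide cnj_expi2pi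
        using assms by simp
    qed
    then show "(LINT x|?X. f x * expi2pi (- \<theta> / (\<beta> - \<alpha>) * (x - \<alpha>)) * expi2pi (of_int k * ((x - \<alpha>) / (\<beta> - \<alpha>)))) = 0"
      using 0[of "-k"] by (simp only: l2_inner_def integral_mult_right_zero mult_zero_right)
  qed
  then show "AE x in ?X. f x = 0" by simp
qed

text \<open>Dominated convergence with majorant \<open>|f|^2\<close>. The predicate form serves
  truncation in \<open>y\<close>, truncation of the index \<open>k\<close>, and the countable
  additivity of \<open>mult_spectral\<close>.\<close>

lemma l2_lim_cutoff:
  assumes f: "f \<in> L2 M" and P: "\<And>n. {x\<in>space M. P n x} \<in> sets M"
    and ev: "\<And>x. x \<in> space M \<Longrightarrow> \<forall>\<^sub>F n in sequentially. P n x"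
  shows "l2_lim M (\<lambda>n x. of_bool (P n x) * f x) f"
proof -
  have L: "(\<lambda>x. of_bool (P n x) * f x) \<in> L2 M" for n
    by (rule L2_indicator_mult[OF f P])
  have "(\<lambda>n. l2sq M (\<lambda>x. of_bool (P n x) * f x - f x)) \<longlonglongrightarrow> (LINT x|M. 0)"
    unfolding l2sq_def
  proof (rule integral_dominated_convergence[where w = "\<lambda>x. (cmod (f x))\<^sup>2"])
    show "(\<lambda>x. (cmod (of_bool (P n x) * f x - f x))\<^sup>2) \<in> borel_measurable M" for n
      using L2_integrable[OF L2_diff[OF L f]] by auto
    show "integrable M (\<lambda>x. (cmod (f x))\<^sup>2)" by (rule L2_integrable[OF f])
    show "AE x in M. norm ((cmod (of_bool (P n x) * f x - f x))\<^sup>2) \<le> (cmod (f x))\<^sup>2" for n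
      by (rule AE_I2) auto
    show "AE x in M. (\<lambda>n. (cmod (of_bool (P n x) * f x - f x))\<^sup>2) \<longlonglongrightarrow> 0"
    proof (rule AE_I2, rule tendsto_eventually)
      fix x assume "x \<in> space M"
      from ev[OF this] show "\<forall>\<^sub>F n in sequentially. (cmod (of_bool (P n x) * f x - f x))\<^sup>2 = 0"
        by eventually_elim simp
    qed
  qed simp
  then have "(\<lambda>n. l2_dist M (\<lambda>x. of_bool (P n x) * f x) f) \<longlonglongrightarrow> sqrt 0"
    unfolding l2_dist_eq by (intro tendsto_real_sqrt) simp
  then show ?thesis using L f by (simp add: l2_lim_def)
qed

section \<open>Isometries and unitaries between \<open>L2\<close> spaces\<close>

locale l2_isometry =
  fixes M :: "'a measure" and N :: "'b measure" and V :: "('a \<Rightarrow> complex) \<Rightarrow> ('b \<Rightarrow> complex)"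
  assumes L2: "f \<in> L2 M \<Longrightarrow> V f \<in> L2 N"
    and add: "f \<in> L2 M \<Longrightarrow> g \<in> L2 M \<Longrightarrow> AE x in N. V (\<lambda>x. f x + g x) x = V f x + V g x"
    and cmult: "f \<in> L2 M \<Longrightarrow> AE x in N. V (\<lambda>x. c * f x) x = c * V f x"
    and l2sq: "f \<in> L2 M \<Longrightarrow> l2sq N (V f) = l2sq M f"
begin

lemma diff:
  assumes "f \<in> L2 M" "g \<in> L2 M"
  shows "AE x in N. V (\<lambda>x. f x - g x) x = V f x - V g x"
proof -
  have "AE x in N. V (\<lambda>x. f x + (-1) * g x) x = V f x + V (\<lambda>x. (-1) * g x) x"
    by (rule add[OF assms(1) L2_cmult[OF assms(2)]])
  moreover have "AE x in N. V (\<lambda>x. (-1) * g x) x = (-1) * V g x"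
    by (rule cmult[OF assms(2)])
  ultimately show ?thesis by eventually_elim simp
qed

lemma dist:
  assumes "f \<in> L2 M" "g \<in> L2 M" shows "l2_dist N (V f) (V g) = l2_dist M f g"
proof -
  have "l2sq N (\<lambda>x. V f x - V g x) = l2sq N (V (\<lambda>x. f x - g x))"
    by (rule l2sq_cong_AE) (use assms L2 L2_diff diff[OF assms] in \<open>auto\<close>)
  then show ?thesis using assms by (simp add: l2_dist_eq l2sq L2_diff)
qed

text \<open>Functions at distance zero have images at distance zero, so a map given on
  representatives descends to classes.\<close>

lemma cong:
  assumes "f \<in> L2 M" "g \<in> L2 M" "AE x in M. f x = g x"
  shows "AE x in N. V f x = V g x"
proof (rule l2_dist_0_imp_AE[OF L2[OF assms(1)] L2[OF assms(2)]])
  have "AE x in M. f x - g x = 0" using assms(3) by eventually_elim simp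
  then show "l2_dist N (V f) (V g) = 0"
    using dist[OF assms(1,2)] l2sq_eq_0_iff[OF L2_diff[OF assms(1,2)]] by (simp add: l2_dist_eq)
qed

text \<open>Polarization: the norm of a sum determines the real part, and replacing \<open>g\<close>
  by \<open>i g\<close> determines the imaginary part.\<close>

lemma inner:
  assumes "f \<in> L2 M" "g \<in> L2 M" shows "l2_inner N (V f) (V g) = l2_inner M f g"
proof -
  have Re: "Re (l2_inner N (V f) (V g)) = Re (l2_inner M f g)" if "f \<in> L2 M" "g \<in> L2 M" for f g
  proof -
    have "l2sq N (\<lambda>x. V f x + V g x) = l2sq N (V (\<lambda>x. f x + g x))"
      by (rule l2sq_cong_AE) (use that L2 L2_add add[OF that] in \<open>auto\<close>)
    also have "\<dots> = l2sq M (\<lambda>x. f x + g x)"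
      by (rule l2sq[OF L2_add[OF that]])
    finally show ?thesis using that L2 by (simp add: l2sq_add l2sq)
  qed
  have "l2_inner N (V f) (V (\<lambda>x. \<i> * g x)) = l2_inner N (V f) (\<lambda>x. \<i> * V g x)"
    by (rule l2_inner_cong_AE) (use assms cmult[of g \<i>] in \<open>auto simp: ae_eq_def L2 L2_cmult\<close>)
  then have "Im (l2_inner N (V f) (V g)) = Im (l2_inner M f g)"
    using Re[OF assms(1) L2_cmult[OF assms(2), of \<i>]] by (simp add: l2_inner_cmult_right)
  with Re[OF assms] show ?thesis by (simp add: complex_eq_iff)
qed

lemma lim: "l2_lim M u f \<Longrightarrow> l2_lim N (\<lambda>n. V (u n)) (V f)"
  by (simp add: l2_lim_def dist L2)

lemma sum:
  assumes "finite I" "\<And>i. i \<in> I \<Longrightarrow> f i \<in> L2 M"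
  shows "AE x in N. V (\<lambda>x. \<Sum>i\<in>I. f i x) x = (\<Sum>i\<in>I. V (f i) x)"
  using assms
proof (induction I)
  case empty
  have "AE x in N. V (\<lambda>x. 0 * 0) x = 0 * V (\<lambda>x. 0) x" by (rule cmult[OF L2_zero])
  then show ?case by simp
next
  case (insert i I)
  have "AE x in N. V (\<lambda>x. f i x + (\<Sum>i\<in>I. f i x)) x = V (f i) x + V (\<lambda>x. \<Sum>i\<in>I. f i x) x"
    using insert by (intro add L2_sum) auto
  moreover have "AE x in N. V (\<lambda>x. \<Sum>i\<in>I. f i x) x = (\<Sum>i\<in>I. V (f i) x)"
    using insert by auto
  ultimately show ?case by eventually_elim (use insert in simp)
qed

end

text \<open>A right inverse is named, rather than surjectivity asserted, so that constructions such
  as \<open>mult_spectral\<close> are explicit maps on representatives. That \<open>W\<close> is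
  also a left inverse and an isometry follows from \<open>V\<close> being isometric.\<close>

locale l2_unitary_pair = l2_isometry +
  fixes W :: "('b \<Rightarrow> complex) \<Rightarrow> ('a \<Rightarrow> complex)"
  assumes W_L2: "h \<in> L2 N \<Longrightarrow> W h \<in> L2 M"
    and V_W: "h \<in> L2 N \<Longrightarrow> AE x in N. V (W h) x = h x"
begin

lemma eq_iff:
  assumes "f \<in> L2 M" "g \<in> L2 M"
  shows "(AE x in M. f x = g x) \<longleftrightarrow> (AE x in N. V f x = V g x)"
proof
  assume "AE x in N. V f x = V g x"
  then have "AE x in N. V f x - V g x = 0" by eventually_elim simp
  then have "l2_dist M f g = 0"
    using dist[OF assms] l2sq_eq_0_iff[OF L2_diff[OF L2[OF assms(1)] L2[OF assms(2)]]]
    by (simp add: l2_dist_eq)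
  then show "AE x in M. f x = g x" by (rule l2_dist_0_imp_AE[OF assms])
qed (rule cong[OF assms])

lemma W_V: "f \<in> L2 M \<Longrightarrow> AE x in M. W (V f) x = f x"
  by (subst eq_iff) (auto intro: W_L2 L2 V_W)

lemma eqI:
  assumes "f \<in> L2 M" "h \<in> L2 N" "AE x in N. V f x = h x"
  shows "AE x in M. W h x = f x"
proof (subst eq_iff)
  show "AE x in N. V (W h) x = V f x"
    using V_W[OF assms(2)] assms(3) by eventually_elim simp
qed (use assms W_L2 in auto)

lemma inner_left: "h \<in> L2 N \<Longrightarrow> f \<in> L2 M \<Longrightarrow> l2_inner M (W h) f = l2_inner N h (V f)"
proof -
  assume h: "h \<in> L2 N" and f: "f \<in> L2 M"
  have "l2_inner M (W h) f = l2_inner N (V (W h)) (V f)"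
    by (rule inner[symmetric, OF W_L2[OF h] f])
  also have "\<dots> = l2_inner N h (V f)"
    by (rule l2_inner_cong_AE) (use V_W h f W_L2 L2 in \<open>auto simp: ae_eq_def\<close>)
  finally show ?thesis .
qed

lemma inner_right: "h \<in> L2 N \<Longrightarrow> f \<in> L2 M \<Longrightarrow> l2_inner M f (W h) = l2_inner N (V f) h"
  using arg_cong[OF inner_left, of h f cnj] by (simp add: l2_inner_cnj)

sublocale inverse: l2_unitary_pair N M W V
proof
  show "AE x in M. W (\<lambda>x. f x + g x) x = W f x + W g x" if "f \<in> L2 N" "g \<in> L2 N" for f g
  proof (rule eqI)
    show "AE x in N. V (\<lambda>x. W f x + W g x) x = f x + g x"
      using add[OF W_L2[OF that(1)] W_L2[OF that(2)]] V_W[OF that(1)] V_W[OF that(2)]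
      by eventually_elim simp
  qed (use that W_L2 in \<open>auto intro: L2_add\<close>)
  show "AE x in M. W (\<lambda>x. c * f x) x = c * W f x" if "f \<in> L2 N" for f c
  proof (rule eqI)
    show "AE x in N. V (\<lambda>x. c * W f x) x = c * f x"
      using cmult[OF W_L2[OF that], of c] V_W[OF that] by eventually_elim simp
  qed (use that W_L2 in \<open>auto intro: L2_cmult\<close>)
  show "l2sq M (W f) = l2sq N f" if "f \<in> L2 N" for f
  proof -
    have "l2sq M (W f) = l2sq N (V (W f))" by (simp add: l2sq W_L2 that)
    also have "\<dots> = l2sq N f"
      by (rule l2sq_cong_AE) (use V_W[OF that] that W_L2 L2 in auto)
    finally show ?thesis .
  qed
qed (use W_L2 L2 W_V in auto)

end

text \<open>The approximations \<open>T n f\<close> have the same mutual distances as the cutoffs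
  \<open>C n f\<close>, which converge. This gives existence of the Fourier transform and of its
  partial version.\<close>

lemma l2_isometry_limit_exists:
  assumes "\<And>n. T n f \<in> L2 N" "l2_lim M (\<lambda>n. C n f) f"
    and "\<And>m n. l2_dist N (T m f) (T n f) = l2_dist M (C m f) (C n f)"
  shows "\<exists>g. l2_lim N (\<lambda>n. T n f) g"
proof (rule l2_complete[OF assms(1)])
  fix e :: real assume "e > 0"
  have "(\<lambda>n. l2_dist M (C n f) f) \<longlonglongrightarrow> 0" using assms(2) by (simp add: l2_lim_def)
  then obtain n0 where n0: "\<And>n. n \<ge> n0 \<Longrightarrow> l2_dist M (C n f) f < e/2"
    using order_tendstoD(2)[of _ 0 _ "e/2"] \<open>e > 0\<close> by (force simp: eventually_sequentially)
  have "l2_dist N (T m f) (T n f) < e" if "m \<ge> n0" "n \<ge> n0" for m n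
  proof -
    have "l2_dist M (C m f) (C n f) \<le> l2_dist M (C m f) f + l2_dist M f (C n f)"
      using assms(2) by (intro l2_dist_triangle) (auto simp: l2_lim_def)
    then show ?thesis
      using n0[OF that(1)] n0[OF that(2)] assms(3) by (simp add: l2_dist_sym[of M f])
  qed
  then show "\<exists>n0. \<forall>m\<ge>n0. \<forall>n\<ge>n0. l2_dist N (T m f) (T n f) < e" by blast
qed

lemma l2_isometry_limit:
  assumes V: "\<And>f. f \<in> L2 M \<Longrightarrow> l2_lim N (\<lambda>n. T n f) (V f)"
    and C: "\<And>f. f \<in> L2 M \<Longrightarrow> l2_lim M (\<lambda>n. C n f) f"
    and sq: "\<And>f n. f \<in> L2 M \<Longrightarrow> l2sq N (T n f) = l2sq M (C n f)"
    and add: "\<And>f g n. f \<in> L2 M \<Longrightarrow> g \<in> L2 M \<Longrightarrow> AE x in N. T n (\<lambda>x. f x + g x) x = T n f x + T n g x"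
    and cmult: "\<And>f c n. f \<in> L2 M \<Longrightarrow> AE x in N. T n (\<lambda>x. c * f x) x = c * T n f x"
  shows "l2_isometry M N V"
proof
  show L2: "V f \<in> L2 N" if "f \<in> L2 M" for f
    using V[OF that] by (simp add: l2_lim_def)
  have T: "T n f \<in> L2 N" if "f \<in> L2 M" for f n
    using V[OF that] by (simp add: l2_lim_def)
  show "AE x in N. V (\<lambda>x. f x + g x) x = V f x + V g x" if "f \<in> L2 M" "g \<in> L2 M" for f g
  proof (rule l2_lim_unique)
    show "l2_lim N (\<lambda>n x. T n f x + T n g x) (\<lambda>x. V f x + V g x)"
      by (rule l2_lim_add[OF V[OF that(1)] V[OF that(2)]])
    show "l2_lim N (\<lambda>n x. T n f x + T n g x) (V (\<lambda>x. f x + g x))"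
      by (rule l2_lim_cong_AE[OF V[OF L2_add[OF that]]])
         (use add that T L2_measurable[OF L2[OF L2_add[OF that]]] in \<open>auto simp: ae_eq_def\<close>)
  qed
  show "AE x in N. V (\<lambda>x. c * f x) x = c * V f x" if "f \<in> L2 M" for f c
  proof (rule l2_lim_unique)
    show "l2_lim N (\<lambda>n x. c * T n f x) (\<lambda>x. c * V f x)"
      by (rule l2_lim_cmult[OF V[OF that]])
    show "l2_lim N (\<lambda>n x. c * T n f x) (V (\<lambda>x. c * f x))"
      by (rule l2_lim_cong_AE[OF V[OF L2_cmult[OF that]]])
         (use cmult that T L2_measurable[OF L2[OF L2_cmult[OF that]]] in \<open>auto simp: ae_eq_def\<close>)
  qed
  show "l2sq N (V f) = l2sq M f" if "f \<in> L2 M" for f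
    using l2_lim_l2sq[OF V[OF that]] l2_lim_l2sq[OF C[OF that]] sq[OF that]
    by (simp add: LIMSEQ_unique)
qed

subsection \<open>Plancherel's theorem\<close>

text \<open>Every real lies in exactly one \<open>[k, k + 1)\<close>. Tonelli exchanges the sum over
  \<open>k\<close> with the integral, and each piece is shifted to the unit interval.\<close>

lemma nn_integral_unfold_unit_interval:
  fixes h :: "real \<Rightarrow> ennreal"
  assumes [measurable]: "h \<in> borel_measurable borel"
  shows "(\<integral>\<^sup>+t. h t \<partial>lborel) = (\<integral>\<^sup>+\<theta>. (\<integral>\<^sup>+k. h (of_int k + \<theta>) \<partial>count_space UNIV) * indicator {0..<1} \<theta> \<partial>lborel)"
proof -
  interpret pair_sigma_finite "count_space (UNIV :: int set)" "lborel :: real measure"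
    by (intro pair_sigma_finite.intro sigma_finite_measure_count_space sigma_finite_lborel)
  have m: "(\<lambda>(k, t). g k t) \<in> borel_measurable (count_space (UNIV :: int set) \<Otimes>\<^sub>M lborel)"
    if "\<And>k. g k \<in> borel_measurable borel" for g :: "int \<Rightarrow> real \<Rightarrow> ennreal"
    using that by (intro measurable_pair_measure_countable1) auto
  have "(\<integral>\<^sup>+t. h t \<partial>lborel) = (\<integral>\<^sup>+t. (\<integral>\<^sup>+k. h t * indicator {of_int k..<of_int k + 1} t \<partial>count_space UNIV) \<partial>lborel)"
  proof (rule nn_integral_cong)
    fix t :: real
    have "(\<integral>\<^sup>+k. h t * indicator {of_int k..<of_int k + 1} t \<partial>count_space UNIV)
        = (\<integral>\<^sup>+k. h t * indicator {\<lfloor>t\<rfloor>} k \<partial>count_space UNIV)"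
      by (intro nn_integral_cong arg_cong2[where f = "(*)"] refl) (auto simp: indicator_def dest: floor_unique)
    also have "\<dots> = h t" by (subst nn_integral_cmult_indicator) auto
    finally show "h t = (\<integral>\<^sup>+k. h t * indicator {of_int k..<of_int k + 1} t \<partial>count_space UNIV)" ..
  qed
  also have "\<dots> = (\<integral>\<^sup>+k. (\<integral>\<^sup>+t. h t * indicator {of_int k..<of_int k + 1} t \<partial>lborel) \<partial>count_space UNIV)"
    by (subst Fubini'[symmetric]) (auto intro!: m)
  also have "\<dots> = (\<integral>\<^sup>+k. (\<integral>\<^sup>+\<theta>. h (of_int k + \<theta>) * indicator {0..<1} \<theta> \<partial>lborel) \<partial>count_space UNIV)"
  proof (rule nn_integral_cong)
    fix k :: int
    show "(\<integral>\<^sup>+t. h t * indicator {of_int k..<of_int k + 1} t \<partial>lborel) = (\<integral>\<^sup>+\<theta>. h (of_int k + \<theta>) * indicator {0..<1} \<theta> \<partial>lborel)"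
      by (subst nn_integral_real_affine[where c = 1 and t = "of_int k"])
         (auto intro!: nn_integral_cong simp: indicator_def)
  qed
  also have "\<dots> = (\<integral>\<^sup>+\<theta>. (\<integral>\<^sup>+k. h (of_int k + \<theta>) * indicator {0..<1} \<theta> \<partial>count_space UNIV) \<partial>lborel)"
    by (subst Fubini') (auto intro!: m)
  also have "\<dots> = (\<integral>\<^sup>+\<theta>. (\<integral>\<^sup>+k. h (of_int k + \<theta>) \<partial>count_space UNIV) * indicator {0..<1} \<theta> \<partial>lborel)"
    by (intro nn_integral_cong nn_integral_multc) auto
  finally show ?thesis .
qed

lemma borel_measurable_interval_fourier [measurable]:
  assumes [measurable]: "\<phi> \<in> borel_measurable (restrict_space lborel {a..b})"
  shows "(\<lambda>t. LINT y|restrict_space lborel {a..b}. \<phi> y * expi2pi (- t * y)) \<in> borel_measurable borel"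
proof -
  interpret finite_measure "restrict_space lborel {a..b}" by (rule finite_measure_restrict_interval)
  have "(\<lambda>x. x) \<in> restrict_space lborel {a..b} \<rightarrow>\<^sub>M borel" by simp
  note [measurable] = measurable_compose[OF measurable_snd this]
  show ?thesis by (rule borel_measurable_lebesgue_integral) measurable
qed

text \<open>Parseval's identity for the basis twisted by \<open>\<theta>\<close>, integrated over \<open>\<theta>\<close>.\<close>

lemma plancherel_interval:
  assumes "a < b" and \<phi>: "\<phi> \<in> L2 (restrict_space lborel {a..b})"
  shows "(\<integral>\<^sup>+t. ennreal ((cmod (LINT y|restrict_space lborel {a..b}. \<phi> y * expi2pi (- t * y)))\<^sup>2) \<partial>lborel)
    = ennreal (l2sq (restrict_space lborel {a..b}) \<phi>)"
proof -
  let ?X = "restrict_space lborel {a..b}"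
  define L where "L = b - a"
  define G where "G t = (LINT y|?X. \<phi> y * expi2pi (- t * y))" for t
  have L: "L > 0" using assms by (simp add: L_def)
  have [measurable]: "G \<in> borel_measurable borel"
    unfolding G_def using \<phi> by measurable
  have "(\<integral>\<^sup>+k. ennreal ((cmod (G ((of_int k + \<theta>) / L)))\<^sup>2) \<partial>count_space UNIV) = ennreal (L * l2sq ?X \<phi>)" for \<theta>
  proof -
    interpret l2_orthonormal_basis ?X "fourier_basis a b \<theta>"
      by (rule fourier_basis_orthonormal_basis[OF assms(1)])
    \<comment> \<open>The sample of the transform at \<open>(k + \<theta>) / L\<close> is, up to a
      factor of modulus \<open>sqrt L\<close>, the \<open>k\<close>-th coefficient in the basis
      twisted by \<theta>.\<close>
    have c: "(cmod (G ((of_int k + \<theta>) / L)))\<^sup>2 = L * (cmod (l2_inner ?X (fourier_basis a b \<theta> k) \<phi>))\<^sup>2" for k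
    proof -
      define t where "t = (of_int k + \<theta>) / L"
      have "cnj (fourier_basis a b \<theta> k y) * \<phi> y = (expi2pi (t * a) / of_real (sqrt L)) * (\<phi> y * expi2pi (- t * y))" for y
      proof -
        have "- (t * (y - a)) = t * a + - t * y" by (simp add: algebra_simps)
        then have "cnj (fourier_basis a b \<theta> k y) = expi2pi (t * a + - t * y) / of_real (sqrt L)"
          by (simp add: fourier_basis_def cnj_expi2pi L_def[symmetric] t_def[symmetric])
        then show ?thesis unfolding expi2pi_add by simp
      qed
      then have "l2_inner ?X (fourier_basis a b \<theta> k) \<phi> = expi2pi (t * a) / of_real (sqrt L) * G t"
        by (simp only: l2_inner_def G_def integral_mult_right_zero)
      then show ?thesis
        using L by (simp add: norm_mult norm_divide power_mult_distrib power_divide t_def)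
    qed
    have "(\<integral>\<^sup>+k. ennreal ((cmod (G ((of_int k + \<theta>) / L)))\<^sup>2) \<partial>count_space UNIV)
      = ennreal L * (\<integral>\<^sup>+k. ennreal ((cmod (l2_inner ?X (fourier_basis a b \<theta> k) \<phi>))\<^sup>2) \<partial>count_space UNIV)"
      unfolding c using L by (subst nn_integral_cmult[symmetric]) (auto simp: ennreal_mult)
    then show ?thesis using L by (simp add: parseval_nn[OF \<phi>] ennreal_mult)
  qed
  note eq = this
  have "(\<integral>\<^sup>+t. ennreal ((cmod (G t))\<^sup>2) \<partial>lborel) = ennreal (1/L) * (\<integral>\<^sup>+t. ennreal ((cmod (G (t / L)))\<^sup>2) \<partial>lborel)"
    using L by (subst nn_integral_real_affine[where c = "1/L" and t = 0]) auto
  also have "(\<integral>\<^sup>+t. ennreal ((cmod (G (t / L)))\<^sup>2) \<partial>lborel) = (\<integral>\<^sup>+\<theta>. ennreal (L * l2sq ?X \<phi>) * indicator {0..<1::real} \<theta> \<partial>lborel)"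
    by (subst nn_integral_unfold_unit_interval) (simp_all add: eq)
  also have "\<dots> = ennreal (L * l2sq ?X \<phi>)"
    by (subst nn_integral_cmult_indicator) auto
  also have "ennreal (1/L) * \<dots> = ennreal (l2sq ?X \<phi>)"
    using L by (simp flip: ennreal_mult)
  finally show ?thesis by (simp add: G_def)
qed

definition trunc_fourier :: "nat \<Rightarrow> (real \<Rightarrow> complex) \<Rightarrow> real \<Rightarrow> complex" where
  "trunc_fourier n \<phi> t = (LINT y:{- real n..real n}|lborel. \<phi> y * expi2pi (- t * y))"

definition cutoff :: "nat \<Rightarrow> (real \<Rightarrow> complex) \<Rightarrow> real \<Rightarrow> complex" where
  "cutoff n \<phi> y = of_bool (\<bar>y\<bar> \<le> real n) * \<phi> y"

lemma L2_restrict_interval: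
  assumes "\<phi> \<in> L2 lborel" shows "\<phi> \<in> L2 (restrict_space lborel {a..b::real})"
proof (rule L2_I)
  show "\<phi> \<in> borel_measurable (restrict_space lborel {a..b})"
    using assms by (auto intro!: measurable_restrict_space1)
  show "integrable (restrict_space lborel {a..b}) (\<lambda>x. (cmod (\<phi> x))\<^sup>2)"
    unfolding integrable_restrict_interval set_integrable_def
    by (rule integrable_mult_indicator) (use L2_integrable[OF assms] in auto)
qed

lemma trunc_fourier_eq: "trunc_fourier n \<phi> t = (LINT y|restrict_space lborel {- real n..real n}. \<phi> y * expi2pi (- t * y))"
  by (simp add: trunc_fourier_def LINT_restrict_interval)

lemma cutoff_L2: "\<phi> \<in> L2 lborel \<Longrightarrow> cutoff n \<phi> \<in> L2 lborel"
  unfolding cutoff_def[abs_def] by (rule L2_indicator_mult) auto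

lemma l2sq_cutoff: "l2sq lborel (cutoff n \<phi>) = l2sq (restrict_space lborel {- real n..real n}) \<phi>"
  unfolding l2sq_def LINT_restrict_interval set_lebesgue_integral_def cutoff_def
  by (rule Bochner_Integration.integral_cong) (auto simp: indicator_def abs_le_iff)

lemma trunc_fourier_plancherel:
  assumes \<phi>: "\<phi> \<in> L2 lborel"
  shows "trunc_fourier n \<phi> \<in> L2 lborel" "l2sq lborel (trunc_fourier n \<phi>) = l2sq lborel (cutoff n \<phi>)"
    "(\<integral>\<^sup>+t. ennreal ((cmod (trunc_fourier n \<phi> t))\<^sup>2) \<partial>lborel) = ennreal (l2sq lborel (cutoff n \<phi>))"
proof -
  let ?X = "restrict_space lborel {- real n..real n}"
  note X = L2_restrict_interval[OF \<phi>, of "- real n" "real n"]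
  show nn: "(\<integral>\<^sup>+t. ennreal ((cmod (trunc_fourier n \<phi> t))\<^sup>2) \<partial>lborel) = ennreal (l2sq lborel (cutoff n \<phi>))"
  \<comment> \<open>\<open>plancherel_interval\<close> needs a nondegenerate interval; for
    \<open>n = 0\<close> both sides vanish because a point is null.\<close>
  proof (cases "n = 0")
    case True
    have "trunc_fourier 0 \<phi> t = 0" for t
      unfolding trunc_fourier_def set_lebesgue_integral_def
      by (rule integral_eq_zero_AE, use AE_lborel_singleton[of 0] in eventually_elim) auto
    moreover have "l2sq lborel (cutoff 0 \<phi>) = 0"
      unfolding l2sq_def cutoff_def
      by (rule integral_eq_zero_AE, use AE_lborel_singleton[of 0] in eventually_elim) auto
    ultimately show ?thesis using True by simp
  next
    case False
    then show ?thesis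
      using plancherel_interval[OF _ X] by (simp add: trunc_fourier_eq l2sq_cutoff)
  qed
  have [measurable]: "trunc_fourier n \<phi> \<in> borel_measurable borel"
    unfolding trunc_fourier_eq[abs_def] using X by measurable
  show L: "trunc_fourier n \<phi> \<in> L2 lborel"
    by (rule L2_I) (auto intro!: integrableI_bounded simp: nn)
  show "l2sq lborel (trunc_fourier n \<phi>) = l2sq lborel (cutoff n \<phi>)"
    using nn nn_integral_eq_integral[OF L2_integrable[OF L]] by (simp add: l2sq_def[of _ "trunc_fourier n \<phi>"])
qed

lemma trunc_fourier_add:
  assumes "\<phi> \<in> L2 lborel" "\<psi> \<in> L2 lborel"
  shows "trunc_fourier n (\<lambda>x. \<phi> x + \<psi> x) t = trunc_fourier n \<phi> t + trunc_fourier n \<psi> t"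
proof -
  let ?X = "restrict_space lborel {- real n..real n}"
  interpret finite_measure ?X by (rule finite_measure_restrict_interval)
  have "integrable ?X (\<lambda>y. \<phi> y * expi2pi (- t * y))" if "\<phi> \<in> L2 lborel" for \<phi>
  proof -
    have "(\<lambda>y. expi2pi (- t * y) * \<phi> y) \<in> L2 ?X"
      by (rule L2_mult_bounded[OF L2_restrict_interval[OF that], where C = 1]) auto
    then show ?thesis by (simp add: L2_imp_integrable mult.commute)
  qed
  from this[OF assms(1)] this[OF assms(2)] show ?thesis
    by (simp add: trunc_fourier_eq distrib_right)
qed

lemma trunc_fourier_cmult: "trunc_fourier n (\<lambda>x. c * \<phi> x) t = c * trunc_fourier n \<phi> t"
  unfolding trunc_fourier_eq by (simp add: mult.assoc)

lemma trunc_fourier_diff: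
  assumes "\<phi> \<in> L2 lborel" "\<psi> \<in> L2 lborel"
  shows "trunc_fourier n (\<lambda>x. \<phi> x - \<psi> x) t = trunc_fourier n \<phi> t - trunc_fourier n \<psi> t"
  using trunc_fourier_add[OF assms(1) L2_uminus[OF assms(2)], of n t] trunc_fourier_cmult[of n "-1" \<psi> t]
  by simp

lemma trunc_fourier_cutoff: "m \<le> n \<Longrightarrow> trunc_fourier n (cutoff m \<phi>) t = trunc_fourier m \<phi> t"
  unfolding trunc_fourier_def cutoff_def set_lebesgue_integral_def
  by (rule Bochner_Integration.integral_cong) (auto simp: indicator_def abs_le_iff)

text \<open>For \<open>m \<le> n\<close> both terms are \<open>n\<close>-th truncated transforms, of
  \<open>cutoff m \<phi>\<close> and of \<phi>, so Plancherel applies to the difference. The other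
  order follows by symmetry.\<close>

lemma l2sq_trunc_fourier_diff:
  assumes \<phi>: "\<phi> \<in> L2 lborel"
  shows "l2sq lborel (\<lambda>t. trunc_fourier m \<phi> t - trunc_fourier n \<phi> t) = l2sq lborel (\<lambda>y. cutoff m \<phi> y - cutoff n \<phi> y)"
proof -
  have "l2sq lborel (\<lambda>t. trunc_fourier m \<phi> t - trunc_fourier n \<phi> t) = l2sq lborel (\<lambda>y. cutoff m \<phi> y - cutoff n \<phi> y)"
    if "m \<le> n" for m n
  proof -
    have "l2sq lborel (\<lambda>t. trunc_fourier m \<phi> t - trunc_fourier n \<phi> t) = l2sq lborel (trunc_fourier n (\<lambda>y. cutoff m \<phi> y - \<phi> y))"
      by (simp add: trunc_fourier_diff[OF cutoff_L2[OF \<phi>] \<phi>] trunc_fourier_cutoff[OF that] l2sq_def)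
    also have "\<dots> = l2sq lborel (cutoff n (\<lambda>y. cutoff m \<phi> y - \<phi> y))"
      by (rule trunc_fourier_plancherel(2)[OF L2_diff[OF cutoff_L2[OF \<phi>] \<phi>]])
    also have "cutoff n (\<lambda>y. cutoff m \<phi> y - \<phi> y) = (\<lambda>y. cutoff m \<phi> y - cutoff n \<phi> y)"
      using that by (auto simp: cutoff_def fun_eq_iff)
    finally show ?thesis .
  qed
  note * = this
  have sym: "l2sq M (\<lambda>x. f x - g x) = l2sq M (\<lambda>x. g x - f x)" for M and f g :: "real \<Rightarrow> complex"
    by (simp add: l2sq_def norm_minus_commute)
  show ?thesis
  proof (cases "m \<le> n")
    case False
    then have "n \<le> m" by simp
    from *[OF this] show ?thesis unfolding sym[of _ "trunc_fourier m \<phi>"] sym[of _ "cutoff m \<phi>"] .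
  qed (rule *)
qed

lemma l2_lim_cutoff_real: "\<phi> \<in> L2 lborel \<Longrightarrow> l2_lim lborel (\<lambda>n. cutoff n \<phi>) \<phi>"
  unfolding cutoff_def[abs_def]
proof (rule l2_lim_cutoff)
  fix y :: real
  obtain n0 :: nat where "\<bar>y\<bar> \<le> real n0" using real_arch_simple by blast
  then show "\<forall>\<^sub>F n in sequentially. \<bar>y\<bar> \<le> real n"
    unfolding eventually_sequentially by (intro exI[of _ n0]) auto
qed auto

lemma is_fourier_transform_iff:
  "\<phi> \<in> L2 lborel \<Longrightarrow> is_fourier_transform \<phi> \<psi> \<longleftrightarrow> l2_lim lborel (\<lambda>n. trunc_fourier n \<phi>) \<psi>"
  unfolding is_fourier_transform_def l2_lim_def
  by (simp add: trunc_fourier_plancherel(1)) (simp add: trunc_fourier_def[abs_def])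

lemma fourier_lim:
  assumes "\<phi> \<in> L2 lborel" shows "l2_lim lborel (\<lambda>n. trunc_fourier n \<phi>) (fourier \<phi>)"
proof -
  have "\<exists>\<psi>. l2_lim lborel (\<lambda>n. trunc_fourier n \<phi>) \<psi>"
    by (rule l2_isometry_limit_exists[where C = cutoff, OF _ l2_lim_cutoff_real[OF assms]])
       (use assms in \<open>simp_all add: trunc_fourier_plancherel l2_dist_eq l2sq_trunc_fourier_diff\<close>)
  then have "\<exists>\<psi>. is_fourier_transform \<phi> \<psi>" using is_fourier_transform_iff[OF assms] by blast
  then show ?thesis
    unfolding fourier_def is_fourier_transform_iff[OF assms, symmetric] by (rule someI_ex)
qed

interpretation fourier: l2_isometry lborel lborel fourier
  by (rule l2_isometry_limit[where T = trunc_fourier and C = cutoff])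
     (simp_all add: fourier_lim l2_lim_cutoff_real trunc_fourier_plancherel trunc_fourier_add trunc_fourier_cmult)

lemma fourier_eqI:
  "\<phi> \<in> L2 lborel \<Longrightarrow> is_fourier_transform \<phi> \<psi> \<Longrightarrow> AE t in lborel. fourier \<phi> t = \<psi> t"
  using l2_lim_unique[OF fourier_lim] is_fourier_transform_iff by blast

section \<open>The Fourier transform in the second variable, and its inverse\<close>

lemma (in pair_sigma_finite) AE_L2_fibre:
  assumes "f \<in> L2 (M1 \<Otimes>\<^sub>M M2)" shows "AE x in M1. (\<lambda>y. f (x, y)) \<in> L2 M2"
  using AE_integrable_fst'[OF L2_integrable[OF assms]] AE_space
proof eventually_elim
  case (elim x)
  have "f \<in> borel_measurable (M1 \<Otimes>\<^sub>M M2)" using assms by auto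
  from measurable_compose_Pair1[OF elim(2) this] elim(1) show ?case by (intro L2_I) auto
qed

lemma (in pair_sigma_finite) l2sq_fibre:
  assumes "f \<in> L2 (M1 \<Otimes>\<^sub>M M2)"
  shows "l2sq (M1 \<Otimes>\<^sub>M M2) f = (LINT x|M1. l2sq M2 (\<lambda>y. f (x, y)))"
  using integral_fst'[OF L2_integrable[OF assms]] by (simp add: l2sq_def)

lemma (in pair_sigma_finite) l2_inner_fibre:
  assumes "f \<in> L2 (M1 \<Otimes>\<^sub>M M2)" "g \<in> L2 (M1 \<Otimes>\<^sub>M M2)"
  shows "l2_inner (M1 \<Otimes>\<^sub>M M2) f g = (LINT x|M1. l2_inner M2 (\<lambda>y. f (x, y)) (\<lambda>y. g (x, y)))"
  using integral_fst'[OF L2_inner_integrable[OF assms]] by (simp add: l2_inner_def)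

lemma (in pair_sigma_finite) AE_L2_fibre_snd:
  assumes "f \<in> L2 (M1 \<Otimes>\<^sub>M M2)" shows "AE y in M2. (\<lambda>x. f (x, y)) \<in> L2 M1"
proof -
  have [measurable]: "f \<in> borel_measurable (M1 \<Otimes>\<^sub>M M2)" using assms by auto
  have "AE y in M2. integrable M1 (\<lambda>x. (cmod (f (x, y)))\<^sup>2)"
    using AE_integrable_snd[of "\<lambda>x y. (cmod (f (x, y)))\<^sup>2"] L2_integrable[OF assms]
    by (simp add: case_prod_unfold)
  with AE_space show ?thesis
  proof eventually_elim
    case (elim y)
    then show ?case by (intro L2_I) (auto intro: measurable_compose[OF measurable_Pair2'])
  qed
qed

lemma pair_sigma_finite_lborel:
  "sigma_finite_measure N \<Longrightarrow> pair_sigma_finite N (lborel :: real measure)"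
  by (intro pair_sigma_finite.intro sigma_finite_lborel)

definition trunc_pft :: "nat \<Rightarrow> ('a \<times> real \<Rightarrow> complex) \<Rightarrow> 'a \<times> real \<Rightarrow> complex" where
  "trunc_pft n f p = trunc_fourier n (\<lambda>y. f (fst p, y)) (snd p)"

definition pcutoff :: "nat \<Rightarrow> ('a \<times> real \<Rightarrow> complex) \<Rightarrow> 'a \<times> real \<Rightarrow> complex" where
  "pcutoff n f p = of_bool (\<bar>snd p\<bar> \<le> real n) * f p"

text \<open>Chosen as a limit in \<open>L2\<close> of the product. Applying \<open>fourier\<close>
  on each fibre would select representatives fibre by fibre, and the result need not be jointly
  measurable.\<close>

definition pft :: "'a measure \<Rightarrow> ('a \<times> real \<Rightarrow> complex) \<Rightarrow> 'a \<times> real \<Rightarrow> complex" where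
  "pft N f = (SOME g. l2_lim (N \<Otimes>\<^sub>M lborel) (\<lambda>n. trunc_pft n f) g)"

text \<open>The inverse transform has the conjugate kernel, so it is the transform conjugated before
  and after.\<close>

definition ipft :: "'a measure \<Rightarrow> ('a \<times> real \<Rightarrow> complex) \<Rightarrow> 'a \<times> real \<Rightarrow> complex" where
  "ipft N h p = cnj (pft N (\<lambda>q. cnj (h q)) p)"

lemma pcutoff_L2: "f \<in> L2 (N \<Otimes>\<^sub>M lborel) \<Longrightarrow> pcutoff n f \<in> L2 (N \<Otimes>\<^sub>M lborel)"
  unfolding pcutoff_def[abs_def] by (rule L2_indicator_mult) measurable

lemma pcutoff_lim: "f \<in> L2 (N \<Otimes>\<^sub>M lborel) \<Longrightarrow> l2_lim (N \<Otimes>\<^sub>M lborel) (\<lambda>n. pcutoff n f) f"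
  unfolding pcutoff_def[abs_def]
proof (rule l2_lim_cutoff)
  fix p :: "'a \<times> real"
  obtain n0 :: nat where "\<bar>snd p\<bar> \<le> real n0" using real_arch_simple by blast
  then show "\<forall>\<^sub>F n in sequentially. \<bar>snd p\<bar> \<le> real n"
    unfolding eventually_sequentially by (intro exI[of _ n0]) auto
qed measurable

lemma pcutoff_fibre: "(\<lambda>y. pcutoff n f (x, y)) = cutoff n (\<lambda>y. f (x, y))"
  by (simp add: pcutoff_def cutoff_def[abs_def])

lemma borel_measurable_trunc_pft:
  assumes [measurable]: "f \<in> borel_measurable (N \<Otimes>\<^sub>M lborel)"
  shows "trunc_pft n f \<in> borel_measurable (N \<Otimes>\<^sub>M lborel)"
proof -
  have "f \<in> borel_measurable (N \<Otimes>\<^sub>M borel)"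
    using assms by (simp cong: measurable_cong_sets sets_pair_measure_cong)
  then have [measurable]: "(\<lambda>p. indicator {- real n..real n} (snd p) *\<^sub>R (f (fst (fst p), snd p) * expi2pi (- snd (fst p) * snd p)))
      \<in> borel_measurable ((N \<Otimes>\<^sub>M lborel) \<Otimes>\<^sub>M lborel)"
    by measurable
  show ?thesis
    unfolding trunc_pft_def[abs_def] trunc_fourier_def set_lebesgue_integral_def
    by (rule lborel.borel_measurable_lebesgue_integral) (simp add: case_prod_unfold)
qed

context
  fixes N :: "'a measure"
  assumes N: "sigma_finite_measure N"
begin

interpretation pair_sigma_finite N "lborel :: real measure"
  by (rule pair_sigma_finite_lborel[OF N])

text \<open>Plancherel on almost every fibre, then Tonelli. Nonnegative integrals are used because
  integrability of the transform is part of the claim.\<close>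

lemma trunc_pft_plancherel:
  assumes f: "f \<in> L2 (N \<Otimes>\<^sub>M lborel)"
  shows "trunc_pft n f \<in> L2 (N \<Otimes>\<^sub>M lborel)"
    "l2sq (N \<Otimes>\<^sub>M lborel) (trunc_pft n f) = l2sq (N \<Otimes>\<^sub>M lborel) (pcutoff n f)"
proof -
  have [measurable]: "trunc_pft n f \<in> borel_measurable (N \<Otimes>\<^sub>M lborel)"
    using f by (intro borel_measurable_trunc_pft) auto
  have [measurable]: "pcutoff n f \<in> borel_measurable (N \<Otimes>\<^sub>M lborel)"
    using pcutoff_L2[OF f] by auto
  have "(\<integral>\<^sup>+p. ennreal ((cmod (trunc_pft n f p))\<^sup>2) \<partial>(N \<Otimes>\<^sub>M lborel))
      = (\<integral>\<^sup>+x. \<integral>\<^sup>+t. ennreal ((cmod (trunc_pft n f (x, t)))\<^sup>2) \<partial>lborel \<partial>N)"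
    by (rule lborel.nn_integral_fst[symmetric]) measurable
  also have "\<dots> = (\<integral>\<^sup>+x. \<integral>\<^sup>+y. ennreal ((cmod (pcutoff n f (x, y)))\<^sup>2) \<partial>lborel \<partial>N)"
  proof (rule nn_integral_cong_AE, use AE_L2_fibre[OF f] in eventually_elim)
    case (elim x)
    have "(\<integral>\<^sup>+y. ennreal ((cmod (cutoff n (\<lambda>y. f (x, y)) y))\<^sup>2) \<partial>lborel) = ennreal (l2sq lborel (cutoff n (\<lambda>y. f (x, y))))"
      unfolding l2sq_def by (rule nn_integral_eq_integral[OF L2_integrable[OF cutoff_L2[OF elim]]]) auto
    then show ?case
      using trunc_fourier_plancherel(3)[OF elim, of n] by (simp add: trunc_pft_def pcutoff_def cutoff_def)
  qed
  also have "\<dots> = (\<integral>\<^sup>+p. ennreal ((cmod (pcutoff n f p))\<^sup>2) \<partial>(N \<Otimes>\<^sub>M lborel))"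
    by (rule lborel.nn_integral_fst) measurable
  also have "\<dots> = ennreal (l2sq (N \<Otimes>\<^sub>M lborel) (pcutoff n f))"
    unfolding l2sq_def by (rule nn_integral_eq_integral[OF L2_integrable[OF pcutoff_L2[OF f]]]) auto
  finally have nn: "(\<integral>\<^sup>+p. ennreal ((cmod (trunc_pft n f p))\<^sup>2) \<partial>(N \<Otimes>\<^sub>M lborel)) = ennreal (l2sq (N \<Otimes>\<^sub>M lborel) (pcutoff n f))" .
  show L: "trunc_pft n f \<in> L2 (N \<Otimes>\<^sub>M lborel)"
    by (rule L2_I) (auto intro!: integrableI_bounded simp: nn)
  show "l2sq (N \<Otimes>\<^sub>M lborel) (trunc_pft n f) = l2sq (N \<Otimes>\<^sub>M lborel) (pcutoff n f)"
    using nn nn_integral_eq_integral[OF L2_integrable[OF L]] by (simp add: l2sq_def[of _ "trunc_pft n f"])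
qed

lemma l2sq_trunc_pft_diff:
  assumes f: "f \<in> L2 (N \<Otimes>\<^sub>M lborel)"
  shows "l2sq (N \<Otimes>\<^sub>M lborel) (\<lambda>p. trunc_pft m f p - trunc_pft n f p) = l2sq (N \<Otimes>\<^sub>M lborel) (\<lambda>p. pcutoff m f p - pcutoff n f p)"
proof -
  have "(LINT x|N. l2sq lborel (\<lambda>t. trunc_pft m f (x, t) - trunc_pft n f (x, t)))
      = (LINT x|N. l2sq lborel (\<lambda>y. pcutoff m f (x, y) - pcutoff n f (x, y)))"
  proof (rule integral_cong_AE)
    have 1: "(\<lambda>p. trunc_pft m f p - trunc_pft n f p) \<in> L2 (N \<Otimes>\<^sub>M lborel)"
      "(\<lambda>p. pcutoff m f p - pcutoff n f p) \<in> L2 (N \<Otimes>\<^sub>M lborel)"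
      using f trunc_pft_plancherel pcutoff_L2 by (auto intro!: L2_diff)
    show "(\<lambda>x. l2sq lborel (\<lambda>t. trunc_pft m f (x, t) - trunc_pft n f (x, t))) \<in> borel_measurable N"
      "(\<lambda>x. l2sq lborel (\<lambda>y. pcutoff m f (x, y) - pcutoff n f (x, y))) \<in> borel_measurable N"
      using integrable_fst'[OF L2_integrable[OF 1(1)]] integrable_fst'[OF L2_integrable[OF 1(2)]]
      by (auto simp: l2sq_def)
    show "AE x in N. l2sq lborel (\<lambda>t. trunc_pft m f (x, t) - trunc_pft n f (x, t))
        = l2sq lborel (\<lambda>y. pcutoff m f (x, y) - pcutoff n f (x, y))"
      using AE_L2_fibre[OF f] by eventually_elim
        (simp add: trunc_pft_def pcutoff_def l2sq_trunc_fourier_diff, simp add: cutoff_def)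
  qed
  then show ?thesis
    unfolding l2sq_fibre[OF L2_diff[OF trunc_pft_plancherel(1)[OF f] trunc_pft_plancherel(1)[OF f]]]
      l2sq_fibre[OF L2_diff[OF pcutoff_L2[OF f] pcutoff_L2[OF f]]] .
qed

lemma pft_lim:
  assumes "f \<in> L2 (N \<Otimes>\<^sub>M lborel)" shows "l2_lim (N \<Otimes>\<^sub>M lborel) (\<lambda>n. trunc_pft n f) (pft N f)"
proof -
  have "\<exists>g. l2_lim (N \<Otimes>\<^sub>M lborel) (\<lambda>n. trunc_pft n f) g"
    by (rule l2_isometry_limit_exists[where C = pcutoff, OF _ pcutoff_lim[OF assms]])
       (use assms in \<open>simp_all add: trunc_pft_plancherel l2_dist_eq l2sq_trunc_pft_diff\<close>)
  then show ?thesis unfolding pft_def by (rule someI_ex)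
qed

lemma trunc_pft_add:
  assumes "f \<in> L2 (N \<Otimes>\<^sub>M lborel)" "g \<in> L2 (N \<Otimes>\<^sub>M lborel)"
  shows "AE p in N \<Otimes>\<^sub>M lborel. trunc_pft n (\<lambda>p. f p + g p) p = trunc_pft n f p + trunc_pft n g p"
proof (rule AE_pair_measure)
  have [measurable]: "trunc_pft n (\<lambda>p. f p + g p) \<in> borel_measurable (N \<Otimes>\<^sub>M lborel)"
    "trunc_pft n f \<in> borel_measurable (N \<Otimes>\<^sub>M lborel)" "trunc_pft n g \<in> borel_measurable (N \<Otimes>\<^sub>M lborel)"
    using assms L2_add[OF assms] by (auto intro!: L2_measurable trunc_pft_plancherel)
  show "{p \<in> space (N \<Otimes>\<^sub>M lborel). trunc_pft n (\<lambda>p. f p + g p) p = trunc_pft n f p + trunc_pft n g p} \<in> sets (N \<Otimes>\<^sub>M lborel)"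
    by measurable
  show "AE x in N. AE t in lborel. trunc_pft n (\<lambda>p. f p + g p) (x, t) = trunc_pft n f (x, t) + trunc_pft n g (x, t)"
    using AE_L2_fibre[OF assms(1)] AE_L2_fibre[OF assms(2)]
    by eventually_elim (simp add: trunc_pft_def trunc_fourier_add)
qed

lemma pft_isometry: "l2_isometry (N \<Otimes>\<^sub>M lborel) (N \<Otimes>\<^sub>M lborel) (pft N)"
  by (rule l2_isometry_limit[where T = trunc_pft and C = pcutoff])
     (simp_all add: pft_lim pcutoff_lim trunc_pft_plancherel trunc_pft_add, simp add: trunc_pft_def trunc_fourier_cmult)

end

text \<open>Cutoffs in both variables make the kernel
  \<open>cnj (\<phi> y) * \<psi> t * e(t y)\<close> absolutely integrable, so Fubini may exchange
  the two integrations.\<close>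

lemma trunc_fourier_adjoint:
  assumes "\<phi> \<in> L2 lborel" "\<psi> \<in> L2 lborel"
  shows "l2_inner lborel (trunc_fourier m \<phi>) (cutoff n \<psi>)
    = l2_inner lborel (cutoff m \<phi>) (\<lambda>y. cnj (trunc_fourier n (\<lambda>t. cnj (\<psi> t)) y))"
proof -
  let ?X = "restrict_space lborel {- real m..real m}" and ?Y = "restrict_space lborel {- real n..real n}"
  interpret X: finite_measure ?X by (rule finite_measure_restrict_interval)
  interpret Y: finite_measure ?Y by (rule finite_measure_restrict_interval)
  interpret pair_sigma_finite ?X ?Y ..
  have [measurable]: "\<phi> \<in> borel_measurable ?X" "\<psi> \<in> borel_measurable ?Y"
    using assms L2_restrict_interval by (auto intro!: L2_measurable)
  have i: "integrable ?X \<phi>" "integrable ?Y \<psi>"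
    using assms by (auto intro!: X.L2_imp_integrable Y.L2_imp_integrable L2_restrict_interval)
  define k where "k y t = cnj (\<phi> y) * \<psi> t * expi2pi (t * y)" for y t
  have id: "(\<lambda>x. x) \<in> ?X \<rightarrow>\<^sub>M borel" "(\<lambda>x. x) \<in> ?Y \<rightarrow>\<^sub>M borel" by simp_all
  note [measurable] = measurable_compose[OF measurable_fst id(1)] measurable_compose[OF measurable_snd id(2)]
  have km: "(\<lambda>(y, t). k y t) \<in> borel_measurable (?X \<Otimes>\<^sub>M ?Y)"
    unfolding k_def by measurable
  have int: "integrable (?X \<Otimes>\<^sub>M ?Y) (\<lambda>(y, t). k y t)"
  proof (rule Fubini_integrable[OF km])
    show "integrable ?X (\<lambda>y. LINT t|?Y. norm (case (y, t) of (y, t) \<Rightarrow> k y t))"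
      using i by (simp add: k_def norm_mult)
    show "AE y in ?X. integrable ?Y (\<lambda>t. case (y, t) of (y, t) \<Rightarrow> k y t)"
    proof (rule AE_I2)
      fix y
      have "integrable ?Y (\<lambda>t. \<psi> t * expi2pi (t * y))"
        by (rule Bochner_Integration.integrable_bound[OF i(2)]) (auto simp: norm_mult)
      then show "integrable ?Y (\<lambda>t. case (y, t) of (y, t) \<Rightarrow> k y t)"
        by (simp add: k_def mult.assoc)
    qed
  qed
  have "l2_inner lborel (trunc_fourier m \<phi>) (cutoff n \<psi>) = (LINT t|?Y. cnj (trunc_fourier m \<phi> t) * \<psi> t)"
    unfolding l2_inner_def LINT_restrict_interval set_lebesgue_integral_def cutoff_def
    by (rule Bochner_Integration.integral_cong) (auto simp: indicator_def abs_le_iff)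
  also have "\<dots> = (LINT t|?Y. LINT y|?X. k y t)"
  proof (rule Bochner_Integration.integral_cong[OF refl])
    fix t
    have "cnj (trunc_fourier m \<phi> t) * \<psi> t = (LINT y|?X. cnj (\<phi> y * expi2pi (- t * y))) * \<psi> t"
      by (simp add: trunc_fourier_eq del: complex_cnj_mult)
    also have "\<dots> = (LINT y|?X. cnj (\<phi> y * expi2pi (- t * y)) * \<psi> t)"
      by simp
    also have "(\<lambda>y. cnj (\<phi> y * expi2pi (- t * y)) * \<psi> t) = (\<lambda>y. k y t)"
      by (simp add: k_def cnj_expi2pi fun_eq_iff)
    finally show "cnj (trunc_fourier m \<phi> t) * \<psi> t = (LINT y|?X. k y t)" .
  qed
  also have "\<dots> = (LINT y|?X. LINT t|?Y. k y t)"
    by (rule Fubini_integral[OF int])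
  also have "\<dots> = (LINT y|?X. cnj (\<phi> y) * cnj (trunc_fourier n (\<lambda>t. cnj (\<psi> t)) y))"
  proof (rule Bochner_Integration.integral_cong[OF refl])
    fix y
    have "cnj (trunc_fourier n (\<lambda>t. cnj (\<psi> t)) y) = (LINT t|?Y. cnj (cnj (\<psi> t) * expi2pi (- y * t)))"
      by (simp add: trunc_fourier_eq del: complex_cnj_mult)
    also have "\<dots> = (LINT t|?Y. \<psi> t * expi2pi (t * y))"
      by (simp add: cnj_expi2pi mult.commute)
    finally show "(LINT t|?Y. k y t) = cnj (\<phi> y) * cnj (trunc_fourier n (\<lambda>t. cnj (\<psi> t)) y)"
      by (simp add: k_def mult.assoc)
  qed
  also have "\<dots> = l2_inner lborel (cutoff m \<phi>) (\<lambda>y. cnj (trunc_fourier n (\<lambda>t. cnj (\<psi> t)) y))"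
    unfolding l2_inner_def LINT_restrict_interval set_lebesgue_integral_def cutoff_def
    by (rule Bochner_Integration.integral_cong) (auto simp: indicator_def abs_le_iff)
  finally show ?thesis .
qed

lemma l2_dist_cnj: "l2_dist M (\<lambda>x. cnj (f x)) (\<lambda>x. cnj (g x)) = l2_dist M f g"
  unfolding l2_dist_def by (simp flip: complex_cnj_diff)

lemma l2_lim_cnj: "l2_lim M u f \<Longrightarrow> l2_lim M (\<lambda>n x. cnj (u n x)) (\<lambda>x. cnj (f x))"
  by (simp add: l2_lim_def L2_cnj l2_dist_cnj)

text \<open>Fibrewise \<open>trunc_fourier_adjoint\<close>, followed by the limit in the cutoff
  \<open>m\<close> of \<open>k\<close> and then in the cutoff \<open>n\<close> of
  \<open>h\<close>.\<close>

lemma pft_adjoint: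
  assumes N: "sigma_finite_measure N" and k: "k \<in> L2 (N \<Otimes>\<^sub>M lborel)" and h: "h \<in> L2 (N \<Otimes>\<^sub>M lborel)"
  shows "l2_inner (N \<Otimes>\<^sub>M lborel) (pft N k) h = l2_inner (N \<Otimes>\<^sub>M lborel) k (ipft N h)"
proof -
  let ?M = "N \<Otimes>\<^sub>M (lborel :: real measure)"
  interpret pair_sigma_finite N "lborel :: real measure"
    by (rule pair_sigma_finite_lborel[OF N])
  define S where "S n p = cnj (trunc_pft n (\<lambda>q. cnj (h q)) p)" for n p
  have S_L2: "S n \<in> L2 ?M" for n
    unfolding S_def by (rule L2_cnj[OF trunc_pft_plancherel(1)[OF N L2_cnj[OF h]]])
  have S_lim: "l2_lim ?M S (ipft N h)"
    unfolding S_def[abs_def] ipft_def[abs_def] by (rule l2_lim_cnj[OF pft_lim[OF N L2_cnj[OF h]]])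
  have *: "l2_inner ?M (trunc_pft m k) (pcutoff n h) = l2_inner ?M (pcutoff m k) (S n)" for m n
    unfolding l2_inner_fibre[OF trunc_pft_plancherel(1)[OF N k] pcutoff_L2[OF h]] l2_inner_fibre[OF pcutoff_L2[OF k] S_L2]
  proof (rule integral_cong_AE)
    show "AE x in N. l2_inner lborel (\<lambda>y. trunc_pft m k (x, y)) (\<lambda>y. pcutoff n h (x, y))
        = l2_inner lborel (\<lambda>y. pcutoff m k (x, y)) (\<lambda>y. S n (x, y))"
      using AE_L2_fibre[OF k] AE_L2_fibre[OF h]
    proof eventually_elim
      case (elim x)
      from trunc_fourier_adjoint[OF elim, of m n] show ?case
        by (simp add: pcutoff_fibre S_def trunc_pft_def)
    qed
  qed (use integrable_fst'[OF L2_inner_integrable[OF trunc_pft_plancherel(1)[OF N k] pcutoff_L2[OF h]]]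
        integrable_fst'[OF L2_inner_integrable[OF pcutoff_L2[OF k] S_L2]] in \<open>auto simp: l2_inner_def\<close>)
  have lim_left: "(\<lambda>n. l2_inner ?M (u n) g) \<longlonglongrightarrow> l2_inner ?M f g" if "l2_lim ?M u f" "g \<in> L2 ?M" for u f g
    using tendsto_cnj[OF l2_lim_inner[OF that]] by (simp add: l2_inner_cnj)
  have "l2_inner ?M (pft N k) (pcutoff n h) = l2_inner ?M k (S n)" for n
  proof (rule LIMSEQ_unique)
    show "(\<lambda>m. l2_inner ?M (trunc_pft m k) (pcutoff n h)) \<longlonglongrightarrow> l2_inner ?M (pft N k) (pcutoff n h)"
      by (rule lim_left[OF pft_lim[OF N k] pcutoff_L2[OF h]])
    show "(\<lambda>m. l2_inner ?M (trunc_pft m k) (pcutoff n h)) \<longlonglongrightarrow> l2_inner ?M k (S n)"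
      unfolding * by (rule lim_left[OF pcutoff_lim[OF k] S_L2])
  qed
  then have "(\<lambda>n. l2_inner ?M (pft N k) (pcutoff n h)) \<longlonglongrightarrow> l2_inner ?M k (ipft N h)"
    using l2_lim_inner[OF S_lim k] by simp
  moreover have "(\<lambda>n. l2_inner ?M (pft N k) (pcutoff n h)) \<longlonglongrightarrow> l2_inner ?M (pft N k) h"
    by (rule l2_lim_inner[OF pcutoff_lim[OF h]]) (use pft_lim[OF N k] in \<open>simp add: l2_lim_def\<close>)
  ultimately show ?thesis using LIMSEQ_unique by blast
qed

text \<open>By \<open>pft_adjoint\<close> the inner product of \<open>pft N (ipft N h)\<close> with
  \<open>h\<close> is the squared norm of \<open>h\<close>. Both vectors have that norm, so this is
  the equality case of Cauchy-Schwarz and they coincide.\<close>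

lemma pft_unitary:
  assumes N: "sigma_finite_measure N"
  shows "l2_unitary_pair (N \<Otimes>\<^sub>M lborel) (N \<Otimes>\<^sub>M lborel) (pft N) (ipft N)"
proof -
  let ?M = "N \<Otimes>\<^sub>M (lborel :: real measure)"
  interpret l2_isometry ?M ?M "pft N" by (rule pft_isometry[OF N])
  have iL2: "ipft N h \<in> L2 ?M" if "h \<in> L2 ?M" for h
    unfolding ipft_def[abs_def] by (intro L2_cnj L2 that)
  show ?thesis
  proof
    fix h assume h: "h \<in> L2 ?M"
    show "ipft N h \<in> L2 ?M" by (rule iL2[OF h])
    have isq: "l2sq ?M (ipft N h) = l2sq ?M h"
    proof -
      have "l2sq ?M (ipft N h) = l2sq ?M (pft N (\<lambda>q. cnj (h q)))"
        by (simp add: l2sq_def ipft_def)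
      also have "\<dots> = l2sq ?M (\<lambda>q. cnj (h q))" by (rule l2sq[OF L2_cnj[OF h]])
      finally show ?thesis by (simp add: l2sq_def)
    qed
    have "l2_inner ?M (pft N (ipft N h)) h = of_real (l2sq ?M h)"
      unfolding pft_adjoint[OF N iL2[OF h] h] l2_inner_self isq ..
    then have "l2_dist ?M (pft N (ipft N h)) h = 0"
      by (simp add: l2_dist_eq l2sq_diff L2 iL2 h l2sq isq)
    then show "AE x in ?M. pft N (ipft N h) x = h x"
      by (rule l2_dist_0_imp_AE[OF L2[OF iL2[OF h]] h])
  qed
qed

text \<open>Convergence on the product gives convergence on almost every fibre along one
  subsequence. There the full sequence of truncated transforms is already known to converge to
  \<open>fourier\<close>, so the limits agree.\<close>

lemma pft_fibre:
  assumes N: "sigma_finite_measure N" and f: "f \<in> L2 (N \<Otimes>\<^sub>M lborel)"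
  shows "AE x in N. (\<lambda>y. f (x, y)) \<in> L2 lborel \<and> is_fourier_transform (\<lambda>y. f (x, y)) (\<lambda>t. pft N f (x, t))"
proof -
  let ?M = "N \<Otimes>\<^sub>M (lborel :: real measure)"
  interpret pair_sigma_finite N "lborel :: real measure"
    by (rule pair_sigma_finite_lborel[OF N])
  define D where "D n p = trunc_pft n f p - pft N f p" for n p
  have lim: "l2_lim ?M (\<lambda>n. trunc_pft n f) (pft N f)" by (rule pft_lim[OF N f])
  have D: "D n \<in> L2 ?M" for n
    unfolding D_def using lim by (intro L2_diff) (auto simp: l2_lim_def)
  have "(\<lambda>n. (l2_dist ?M (trunc_pft n f) (pft N f))\<^sup>2) \<longlonglongrightarrow> 0\<^sup>2"
    using lim by (intro tendsto_power) (auto simp: l2_lim_def)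
  then have "(\<lambda>n. l2sq ?M (D n)) \<longlonglongrightarrow> 0" by (simp add: l2_dist_eq D_def[abs_def])
  then have "(\<lambda>n. LINT x|N. norm (l2sq lborel (\<lambda>t. D n (x, t)))) \<longlonglongrightarrow> 0"
    by (simp add: l2sq_fibre[OF D])
  moreover have "integrable N (\<lambda>x. l2sq lborel (\<lambda>t. D n (x, t)))" for n
    using integrable_fst'[OF L2_integrable[OF D]] by (simp add: l2sq_def)
  ultimately obtain r :: "nat \<Rightarrow> nat" where r: "strict_mono r"
    and rlim: "AE x in N. (\<lambda>n. l2sq lborel (\<lambda>t. D (r n) (x, t))) \<longlonglongrightarrow> 0"
    using tendsto_L1_AE_subseq[of N "\<lambda>n x. l2sq lborel (\<lambda>t. D n (x, t))"] by blast
  have pL: "pft N f \<in> L2 ?M" using lim by (simp add: l2_lim_def)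
  show ?thesis
    using rlim AE_L2_fibre[OF f] AE_L2_fibre[OF pL]
  proof eventually_elim
    case (elim x)
    let ?\<phi> = "\<lambda>y. f (x, y)" and ?\<psi> = "\<lambda>t. pft N f (x, t)"
    have "(\<lambda>n. sqrt (l2sq lborel (\<lambda>t. D (r n) (x, t)))) \<longlonglongrightarrow> sqrt 0"
      using elim(1) by (rule tendsto_real_sqrt)
    then have "l2_lim lborel (\<lambda>n. trunc_fourier (r n) ?\<phi>) ?\<psi>"
      using elim(2,3) by (simp add: l2_lim_def l2_dist_eq D_def trunc_pft_def trunc_fourier_plancherel(1))
    then have "AE t in lborel. fourier ?\<phi> t = ?\<psi> t"
      using l2_lim_unique l2_lim_subseq[OF fourier_lim[OF elim(2)] r] by blast
    then have "l2_lim lborel (\<lambda>n. trunc_fourier n ?\<phi>) ?\<psi>"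
      using elim(2,3) by (intro l2_lim_cong_AE[OF fourier_lim[OF elim(2)]])
        (auto simp: ae_eq_def dest: trunc_fourier_plancherel(1)[THEN L2_measurable])
    then show ?case using elim(2) is_fourier_transform_iff by blast
  qed
qed

lemma (in pair_sigma_finite) L2_snd:
  assumes "finite_measure M1" "h \<in> L2 M2"
  shows "(\<lambda>p. h (snd p)) \<in> L2 (M1 \<Otimes>\<^sub>M M2)"
proof (rule L2_I)
  interpret finite_measure M1 by fact
  have [measurable]: "h \<in> borel_measurable M2" using assms by auto
  show "(\<lambda>p. h (snd p)) \<in> borel_measurable (M1 \<Otimes>\<^sub>M M2)" by measurable
  show "integrable (M1 \<Otimes>\<^sub>M M2) (\<lambda>p. (cmod (h (snd p)))\<^sup>2)"
    by (rule Fubini_integrable) (use L2_integrable[OF assms(2)] in auto)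
qed

text \<open>Extend \<open>h\<close> constantly over an auxiliary unit interval and invert the
  partial transform there. Almost every fibre of the preimage has Fourier transform
  \<open>h\<close>, and one such fibre is enough.\<close>

lemma fourier_surj:
  assumes h: "h \<in> L2 lborel" shows "\<exists>\<phi>\<in>L2 lborel. AE t in lborel. fourier \<phi> t = h t"
proof -
  let ?X = "restrict_space lborel {0..1::real}"
  interpret finite_measure ?X by (rule finite_measure_restrict_interval)
  have N: "sigma_finite_measure ?X" by unfold_locales
  interpret pair_sigma_finite ?X "lborel :: real measure" by (rule pair_sigma_finite_lborel[OF N])
  interpret U: l2_unitary_pair "?X \<Otimes>\<^sub>M lborel" "?X \<Otimes>\<^sub>M lborel" "pft ?X" "ipft ?X"
    by (rule pft_unitary[OF N])
  define H :: "real \<times> real \<Rightarrow> complex" where "H p = h (snd p)" for p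
  have H: "H \<in> L2 (?X \<Otimes>\<^sub>M lborel)"
    unfolding H_def[abs_def] by (rule L2_snd[OF finite_measure_restrict_interval h])
  let ?G = "ipft ?X H"
  have "AE x in ?X. \<exists>\<phi>\<in>L2 lborel. AE t in lborel. fourier \<phi> t = h t"
    using pft_fibre[OF N U.W_L2[OF H]] AE_pair[OF U.V_W[OF H]]
  proof eventually_elim
    case (elim x)
    then have "AE t in lborel. fourier (\<lambda>y. ?G (x, y)) t = pft ?X ?G (x, t)"
      using fourier_eqI by blast
    with elim(2) have "AE t in lborel. fourier (\<lambda>y. ?G (x, y)) t = h t"
      by eventually_elim (simp add: H_def)
    then show ?case using elim(1) by blast
  qed
  \<comment> \<open>The interval has positive measure, so a property that holds almost everywhere
    holds somewhere.\<close>
  moreover have "ae_filter ?X \<noteq> bot"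
    by (simp add: ae_filter_eq_bot_iff emeasure_restrict_space space_restrict_space)
  ultimately show ?thesis
    using eventually_happens by blast
qed

definition inv_fourier :: "(real \<Rightarrow> complex) \<Rightarrow> real \<Rightarrow> complex" where
  "inv_fourier h = (SOME \<phi>. \<phi> \<in> L2 lborel \<and> (AE t in lborel. fourier \<phi> t = h t))"

interpretation fourier: l2_unitary_pair lborel lborel fourier inv_fourier
proof
  fix h :: "real \<Rightarrow> complex" assume "h \<in> L2 lborel"
  then have "\<exists>\<phi>. \<phi> \<in> L2 lborel \<and> (AE t in lborel. fourier \<phi> t = h t)" using fourier_surj by blast
  from someI_ex[OF this] show "inv_fourier h \<in> L2 lborel" "AE t in lborel. fourier (inv_fourier h) t = h t"
    by (auto simp: inv_fourier_def)
qed

subsection \<open>Spectral measures of multiplication operators\<close>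

lemma Re_cnj_mult: "Re (cnj z * (of_real r * z)) = r * (cmod z)\<^sup>2"
  unfolding cmod_power2 by (simp add: power2_eq_square algebra_simps)

text \<open>\<open>V\<close> carries \<open>A\<close> to multiplication by \<open>m\<close> on its
  maximal domain: a suitable \<open>g\<close> in \<open>L2 M\<close> exists precisely when
  \<open>m\<close> times \<open>V f\<close> is square-integrable, see
  \<open>mult_L2_iff\<close>.\<close>

locale mult_representation = l2_unitary_pair M N V W
  for M :: "'a measure" and N :: "'b measure" and V W +
  fixes m :: "'b \<Rightarrow> real" and A :: "'a l2_operator"
  assumes m_measurable [measurable]: "m \<in> borel_measurable N"
    and A_iff: "A f g \<longleftrightarrow> f \<in> L2 M \<and> g \<in> L2 M \<and> (AE p in N. V g p = of_real (m p) * V f p)"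
begin

definition mult_spectral :: "real set \<Rightarrow> ('a \<Rightarrow> complex) \<Rightarrow> 'a \<Rightarrow> complex" where
  "mult_spectral S f = W (\<lambda>p. of_bool (m p \<in> S) * V f p)"

lemma restrict_L2:
  assumes [measurable]: "S \<in> sets borel" and h: "h \<in> L2 N"
  shows "(\<lambda>p. of_bool (m p \<in> S) * h p) \<in> L2 N"
  by (rule L2_indicator_mult[OF h]) measurable

lemma mult_spectral_L2: "S \<in> sets borel \<Longrightarrow> f \<in> L2 M \<Longrightarrow> mult_spectral S f \<in> L2 M"
  unfolding mult_spectral_def by (intro W_L2 restrict_L2 L2)

lemma V_mult_spectral:
  "S \<in> sets borel \<Longrightarrow> f \<in> L2 M \<Longrightarrow> AE p in N. V (mult_spectral S f) p = of_bool (m p \<in> S) * V f p"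
  unfolding mult_spectral_def by (intro V_W restrict_L2 L2)

lemma l2_projection_mult_spectral:
  assumes S: "S \<in> sets borel" shows "l2_projection M (mult_spectral S)"
proof -
  note E = mult_spectral_L2[OF S] and VE = V_mult_spectral[OF S]
  have cnj_b: "cnj (of_bool b) = of_bool b" for b by (cases b) auto
  have "AE x in M. mult_spectral S f x = mult_spectral S g x"
    if "f \<in> L2 M" "g \<in> L2 M" "AE x in M. f x = g x" for f g
    using cong[OF that] VE[OF that(1)] VE[OF that(2)] by (subst eq_iff) (auto intro: E that)
  moreover have "AE x in M. mult_spectral S (\<lambda>x. f x + g x) x = mult_spectral S f x + mult_spectral S g x"
    if "f \<in> L2 M" "g \<in> L2 M" for f g
  proof (subst eq_iff)
    show "AE p in N. V (mult_spectral S (\<lambda>x. f x + g x)) p = V (\<lambda>x. mult_spectral S f x + mult_spectral S g x) p"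
      using add[OF that] add[OF E[OF that(1)] E[OF that(2)]] VE[OF that(1)] VE[OF that(2)] VE[OF L2_add[OF that]]
      by eventually_elim (simp add: distrib_left)
  qed (auto intro: E L2_add that)
  moreover have "AE x in M. mult_spectral S (\<lambda>x. c * f x) x = c * mult_spectral S f x"
    if "f \<in> L2 M" for f c
  proof (subst eq_iff)
    show "AE p in N. V (mult_spectral S (\<lambda>x. c * f x)) p = V (\<lambda>x. c * mult_spectral S f x) p"
      using cmult[OF that, of c] cmult[OF E[OF that], of c] VE[OF that] VE[OF L2_cmult[OF that, of c]]
      by eventually_elim simp
  qed (auto intro: E L2_cmult that)
  moreover have "AE x in M. mult_spectral S (mult_spectral S f) x = mult_spectral S f x" if "f \<in> L2 M" for f
  proof (subst eq_iff)
    show "AE p in N. V (mult_spectral S (mult_spectral S f)) p = V (mult_spectral S f) p"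
      using VE[OF that] VE[OF E[OF that]] by eventually_elim simp
  qed (auto intro: E that)
  moreover have "l2_inner M (mult_spectral S f) g = l2_inner M f (mult_spectral S g)" if "f \<in> L2 M" "g \<in> L2 M" for f g
    unfolding mult_spectral_def
    by (subst inner_left inner_right; (intro restrict_L2 L2 S that)?)+
       (simp add: l2_inner_def mult.assoc mult.left_commute cnj_b)
  ultimately show ?thesis
    using E by (simp add: l2_projection_def l2_linear_def ae_eq_def)
qed

lemma projection_measure_mult_spectral: "projection_measure M mult_spectral"
proof -
  have "AE x in M. mult_spectral UNIV f x = f x" if "f \<in> L2 M" for f
    using W_V[OF that] by (simp add: mult_spectral_def)
  moreover have "(\<lambda>n. l2_dist M (\<lambda>x. \<Sum>i<n. mult_spectral (S i) f x) (mult_spectral (\<Union>i. S i) f)) \<longlonglongrightarrow> 0"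
    if S: "range S \<subseteq> sets borel" "disjoint_family S" and f: "f \<in> L2 M" for S f
  proof -
    have Si: "S i \<in> sets borel" for i using S by auto
    have U: "(\<Union>i. S i) \<in> sets borel" using Si by auto
    define h where "h p = of_bool (m p \<in> (\<Union>i. S i)) * V f p" for p
    have h: "h \<in> L2 N" unfolding h_def[abs_def] by (intro restrict_L2 U L2 f)
    define P where "P n p \<longleftrightarrow> m p \<notin> (\<Union>i. S i) \<or> m p \<in> (\<Union>i<n. S i)" for n :: nat and p
    have lim: "l2_lim N (\<lambda>n p. of_bool (P n p) * h p) h"
    proof (rule l2_lim_cutoff[OF h])
      fix n
      have "(\<Union>i<n. S i) \<in> sets borel" using Si by auto
      note [measurable] = this U
      show "{p \<in> space N. P n p} \<in> sets N" unfolding P_def by measurable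
    next
      fix p
      show "\<forall>\<^sub>F n in sequentially. P n p"
      proof (cases "m p \<in> (\<Union>i. S i)")
        case True
        then obtain i where "m p \<in> S i" by auto
        then show ?thesis unfolding eventually_sequentially P_def by (intro exI[of _ "Suc i"]) auto
      qed (simp add: P_def)
    qed
    have "of_bool (P n p) * h p = (\<Sum>i<n. of_bool (m p \<in> S i) * V f p)" for n p
    proof (cases "m p \<in> (\<Union>i<n. S i)")
      case True
      then obtain i where i: "i < n" "m p \<in> S i" by auto
      have "(\<Sum>j<n. of_bool (m p \<in> S j) * V f p) = (\<Sum>j<n. if j = i then V f p else 0)"
        by (rule sum.cong) (use i S(2) in \<open>auto simp: disjoint_family_on_def\<close>)
      then show ?thesis using True i by (auto simp: P_def h_def)
    next
      case False
      then have "(\<Sum>j<n. of_bool (m p \<in> S j) * V f p) = 0" by (intro sum.neutral) auto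
      then show ?thesis using False by (auto simp: P_def h_def)
    qed
    note eq = this
    have "l2_dist M (\<lambda>x. \<Sum>i<n. mult_spectral (S i) f x) (mult_spectral (\<Union>i. S i) f) = l2_dist N (\<lambda>p. of_bool (P n p) * h p) h" for n
    proof -
      note EL = mult_spectral_L2[OF Si f]
      have sL: "(\<lambda>x. \<Sum>i<n. mult_spectral (S i) f x) \<in> L2 M" by (intro L2_sum EL)
      have uL: "mult_spectral (\<Union>i. S i) f \<in> L2 M" by (rule mult_spectral_L2[OF U f])
      have all: "AE p in N. \<forall>i. V (mult_spectral (S i) f) p = of_bool (m p \<in> S i) * V f p"
        unfolding AE_all_countable using V_mult_spectral[OF Si f] by blast
      have "AE p in N. V (\<lambda>x. \<Sum>i<n. mult_spectral (S i) f x) p = (\<Sum>i<n. V (mult_spectral (S i) f) p)"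
        by (rule sum) (auto intro: EL)
      with all have 1: "AE p in N. V (\<lambda>x. \<Sum>i<n. mult_spectral (S i) f x) p = of_bool (P n p) * h p"
        by eventually_elim (simp add: eq)
      have "l2_dist N (V (\<lambda>x. \<Sum>i<n. mult_spectral (S i) f x)) (V (mult_spectral (\<Union>i. S i) f))
          = l2_dist N (\<lambda>p. of_bool (P n p) * h p) h"
      proof (rule l2_dist_cong_AE)
        show "ae_eq N (V (mult_spectral (\<Union>i. S i) f)) h"
          using V_mult_spectral[OF U f] by (simp add: ae_eq_def h_def)
        show "(\<lambda>p. of_bool (P n p) * h p) \<in> borel_measurable N"
          using lim by (auto simp: l2_lim_def)
      qed (use 1 L2[OF sL] L2[OF uL] h in \<open>auto simp: ae_eq_def\<close>)
      then show ?thesis by (simp add: dist[OF sL uL])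
    qed
    then show ?thesis using lim by (simp add: l2_lim_def)
  qed
  ultimately show ?thesis
    using l2_projection_mult_spectral by (simp add: projection_measure_def ae_eq_def)
qed

lemma mult_L2_iff: "f \<in> L2 M \<Longrightarrow> (\<exists>g. A f g) \<longleftrightarrow> (\<lambda>p. of_real (m p) * V f p) \<in> L2 N"
proof
  assume f: "f \<in> L2 M" and "\<exists>g. A f g"
  then obtain g where g: "g \<in> L2 M" "AE p in N. V g p = of_real (m p) * V f p"
    by (auto simp: A_iff)
  have [measurable]: "V f \<in> borel_measurable N" using L2[OF f] by auto
  show "(\<lambda>p. of_real (m p) * V f p) \<in> L2 N"
    by (rule L2_cong_AE[OF L2[OF g(1)] _ g(2)]) measurable
next
  assume "f \<in> L2 M" "(\<lambda>p. of_real (m p) * V f p) \<in> L2 N"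
  then have "A f (W (\<lambda>p. of_real (m p) * V f p))"
    unfolding A_iff using V_W W_L2 by auto
  then show "\<exists>g. A f g" by blast
qed

lemma inner_A:
  assumes "A f g" shows "l2_inner M f g = of_real (LINT p|N. m p * (cmod (V f p))\<^sup>2)"
proof -
  have f: "f \<in> L2 M" and g: "g \<in> L2 M" and e: "AE p in N. V g p = of_real (m p) * V f p"
    using assms by (auto simp: A_iff)
  have mL: "(\<lambda>p. of_real (m p) * V f p) \<in> L2 N" using assms mult_L2_iff[OF f] by blast
  have "l2_inner M f g = l2_inner N (V f) (\<lambda>p. of_real (m p) * V f p)"
    unfolding inner[OF f g, symmetric]
    by (rule l2_inner_cong_AE) (use L2 f g mL e in \<open>auto simp: ae_eq_def\<close>)
  also have "\<dots> = (LINT p|N. of_real (m p * (cmod (V f p))\<^sup>2))"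
    unfolding l2_inner_def
  proof (rule Bochner_Integration.integral_cong[OF refl])
    fix p
    show "cnj (V f p) * (of_real (m p) * V f p) = of_real (m p * (cmod (V f p))\<^sup>2)"
      using complex_norm_square[of "V f p"] by (simp add: ac_simps del: of_real_power)
  qed
  finally show ?thesis by (simp only: integral_complex_of_real)
qed

lemma spectral_distr_mult_spectral:
  assumes f: "f \<in> L2 M"
  shows "spectral_distr M mult_spectral f = distr (density N (\<lambda>p. ennreal ((cmod (V f p))\<^sup>2))) borel m"
    (is "_ = ?D")
proof -
  have [measurable]: "V f \<in> borel_measurable N" using L2[OF f] by auto
  have "emeasure ?D S = ennreal (Re (l2_inner M f (mult_spectral S f)))" if S: "S \<in> sets borel" for S
  proof -
    have R: "(\<lambda>p. of_bool (m p \<in> S) * V f p) \<in> L2 N" by (rule restrict_L2[OF S L2[OF f]])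
    have "l2_inner M f (mult_spectral S f) = l2_inner N (V f) (\<lambda>p. of_bool (m p \<in> S) * V f p)"
      unfolding mult_spectral_def by (rule inner_right[OF R f])
    also have "\<dots> = l2_inner N (\<lambda>p. of_bool (m p \<in> S) * V f p) (\<lambda>p. of_bool (m p \<in> S) * V f p)"
      unfolding l2_inner_def by (rule Bochner_Integration.integral_cong) auto
    finally have 1: "Re (l2_inner M f (mult_spectral S f)) = l2sq N (\<lambda>p. of_bool (m p \<in> S) * V f p)"
      by (simp add: l2_inner_self)
    have "emeasure ?D S = (\<integral>\<^sup>+p. ennreal ((cmod (V f p))\<^sup>2) * indicator (m -` S \<inter> space N) p \<partial>N)"
      using S by (simp add: emeasure_distr emeasure_density)
    also have "\<dots> = (\<integral>\<^sup>+p. ennreal ((cmod (of_bool (m p \<in> S) * V f p))\<^sup>2) \<partial>N)"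
      by (rule nn_integral_cong) (auto simp: indicator_def)
    also have "\<dots> = ennreal (l2sq N (\<lambda>p. of_bool (m p \<in> S) * V f p))"
      unfolding l2sq_def by (rule nn_integral_eq_integral[OF L2_integrable[OF R]]) auto
    finally show ?thesis using 1 by simp
  qed
  then have "spectral_distr M mult_spectral f = measure_of UNIV (sets borel) (emeasure ?D)"
    unfolding spectral_distr_def
    by (intro measure_of_eq) (simp_all add: sets.sigma_sets_eq[of borel, simplified])
  also have "\<dots> = ?D"
    using measure_of_of_measure[of ?D] by simp
  finally show ?thesis .
qed

lemma is_spectral_measure_mult_spectral: "is_spectral_measure M mult_spectral A"
proof -
  have "(\<exists>g. A f g) \<longleftrightarrow> integrable (spectral_distr M mult_spectral f) (\<lambda>t. t\<^sup>2)" if f: "f \<in> L2 M" for f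
  proof -
    have [measurable]: "V f \<in> borel_measurable N" using L2[OF f] by auto
    have "integrable (spectral_distr M mult_spectral f) (\<lambda>t. t\<^sup>2) \<longleftrightarrow> integrable N (\<lambda>p. (cmod (V f p))\<^sup>2 * (m p)\<^sup>2)"
      unfolding spectral_distr_mult_spectral[OF f]
      by (subst integrable_distr_eq) (simp_all add: integrable_density)
    also have "\<dots> \<longleftrightarrow> (\<lambda>p. of_real (m p) * V f p) \<in> L2 N"
      by (simp add: L2_def norm_mult power_mult_distrib mult.commute)
    finally show ?thesis using mult_L2_iff[OF f] by blast
  qed
  moreover have "l2_inner M f g = of_real (LINT t|spectral_distr M mult_spectral f. t)" if "A f g" for f g
  proof -
    have f: "f \<in> L2 M" using that by (simp add: A_iff)
    have [measurable]: "V f \<in> borel_measurable N" using L2[OF f] by auto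
    show ?thesis
      unfolding inner_A[OF that] spectral_distr_mult_spectral[OF f]
      by (subst integral_distr) (simp_all add: integral_density mult.commute)
  qed
  moreover have "f \<in> L2 M \<and> g \<in> L2 M" if "A f g" for f g using that by (simp add: A_iff)
  ultimately show ?thesis
    using projection_measure_mult_spectral unfolding is_spectral_measure_def by blast
qed

end

section \<open>Algebra of projection-valued measures and their scalar distributions\<close>

locale l2_projection_measure =
  fixes M :: "'a measure" and E :: "real set \<Rightarrow> ('a \<Rightarrow> complex) \<Rightarrow> 'a \<Rightarrow> complex"
  assumes pm: "projection_measure M E"
begin

lemma
  assumes S: "S \<in> sets borel"
  shows E_L2: "f \<in> L2 M \<Longrightarrow> E S f \<in> L2 M"
    and E_cong: "f \<in> L2 M \<Longrightarrow> g \<in> L2 M \<Longrightarrow> AE x in M. f x = g x \<Longrightarrow> AE x in M. E S f x = E S g x"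
    and E_add: "f \<in> L2 M \<Longrightarrow> g \<in> L2 M \<Longrightarrow> AE x in M. E S (\<lambda>x. f x + g x) x = E S f x + E S g x"
    and E_cmult: "f \<in> L2 M \<Longrightarrow> AE x in M. E S (\<lambda>x. c * f x) x = c * E S f x"
    and E_idem: "f \<in> L2 M \<Longrightarrow> AE x in M. E S (E S f) x = E S f x"
    and E_sym: "f \<in> L2 M \<Longrightarrow> g \<in> L2 M \<Longrightarrow> l2_inner M (E S f) g = l2_inner M f (E S g)"
proof -
  have "l2_projection M (E S)" using pm S by (simp add: projection_measure_def)
  then show "f \<in> L2 M \<Longrightarrow> E S f \<in> L2 M"
    "f \<in> L2 M \<Longrightarrow> g \<in> L2 M \<Longrightarrow> AE x in M. f x = g x \<Longrightarrow> AE x in M. E S f x = E S g x"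
    "f \<in> L2 M \<Longrightarrow> g \<in> L2 M \<Longrightarrow> AE x in M. E S (\<lambda>x. f x + g x) x = E S f x + E S g x"
    "f \<in> L2 M \<Longrightarrow> AE x in M. E S (\<lambda>x. c * f x) x = c * E S f x"
    "f \<in> L2 M \<Longrightarrow> AE x in M. E S (E S f) x = E S f x"
    "f \<in> L2 M \<Longrightarrow> g \<in> L2 M \<Longrightarrow> l2_inner M (E S f) g = l2_inner M f (E S g)"
    by (simp_all add: l2_projection_def l2_linear_def ae_eq_def)
qed

lemma E_UNIV: "f \<in> L2 M \<Longrightarrow> AE x in M. E UNIV f x = f x"
  using pm by (simp add: projection_measure_def ae_eq_def)

lemma E_lim:
  assumes "\<And>i. S i \<in> sets borel" "disjoint_family S" "f \<in> L2 M"
  shows "l2_lim M (\<lambda>n x. \<Sum>i<n. E (S i) f x) (E (\<Union>i. S i) f)"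
proof -
  have "(\<lambda>n. l2_dist M (\<lambda>x. \<Sum>i<n. E (S i) f x) (E (\<Union>i. S i) f)) \<longlonglongrightarrow> 0"
    using pm assms by (simp add: projection_measure_def image_subset_iff)
  moreover have "(\<Union>i. S i) \<in> sets borel" using assms(1) by auto
  ultimately show ?thesis unfolding l2_lim_def using assms by (auto intro!: L2_sum E_L2)
qed

lemma l2sq_E:
  assumes "S \<in> sets borel" "f \<in> L2 M"
  shows "l2_inner M f (E S f) = of_real (l2sq M (E S f))"
proof -
  have "l2_inner M (E S f) (E S f) = l2_inner M f (E S (E S f))"
    by (rule E_sym) (use assms E_L2 in auto)
  also have "\<dots> = l2_inner M f (E S f)"
    by (rule l2_inner_cong_AE) (use assms E_L2 E_idem in \<open>auto simp: ae_eq_def\<close>)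
  finally show ?thesis by (simp add: l2_inner_self)
qed

lemma E_contract:
  assumes "S \<in> sets borel" "f \<in> L2 M" shows "l2sq M (E S f) \<le> l2sq M f"
  using l2sq_nonneg[of M "\<lambda>x. f x - E S f x"] l2sq_diff[OF assms(2) E_L2[OF assms]] l2sq_E[OF assms]
  by simp

text \<open>Countable additivity for the sequence of empty sets: the sums of \<open>n + 2\<close>
  copies of \<open>E {} f\<close> converge to \<open>E {} f\<close>, at distance
  \<open>n + 1\<close> times its norm, which forces the norm to be zero.\<close>

lemma E_empty: assumes f: "f \<in> L2 M" shows "AE x in M. E {} f x = 0"
proof -
  have "l2_lim M (\<lambda>n x. \<Sum>i<n. E {} f x) (E {} f)"
    using E_lim[of "\<lambda>i. {}" f] f by (simp add: disjoint_family_on_def)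
  then have "(\<lambda>n. l2_lim M (\<lambda>n x. \<Sum>i<n. E {} f x) (E {} f)) = (\<lambda>n. True)" by simp
  have lim: "(\<lambda>n. l2_dist M (\<lambda>x. \<Sum>i<n. E {} f x) (E {} f)) \<longlonglongrightarrow> 0"
    using \<open>l2_lim M _ _\<close> by (simp add: l2_lim_def)
  have "l2_dist M (\<lambda>x. \<Sum>i<n + 2. E {} f x) (E {} f) = real (n + 1) * sqrt (l2sq M (E {} f))" for n
  proof -
    have "(\<Sum>i<n + 2. E {} f x) - E {} f x = of_real (real (n + 1)) * E {} f x" for x
      by (simp add: algebra_simps)
    then have "l2_dist M (\<lambda>x. \<Sum>i<n + 2. E {} f x) (E {} f) = sqrt ((cmod (of_real (real (n + 1))))\<^sup>2 * l2sq M (E {} f))"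
      unfolding l2_dist_eq l2sq_cmult[symmetric] by presburger
    then show ?thesis by (simp add: real_sqrt_mult del: of_real_add of_real_of_nat_eq)
  qed
  then have "(\<lambda>n. real (n + 1) * sqrt (l2sq M (E {} f))) \<longlonglongrightarrow> 0"
    using LIMSEQ_ignore_initial_segment[OF lim, of 2] by simp
  moreover have "sqrt (l2sq M (E {} f)) \<le> real (n + 1) * sqrt (l2sq M (E {} f))" for n
    using mult_right_mono[of 1 "real (n + 1)" "sqrt (l2sq M (E {} f))"] by simp
  ultimately have "sqrt (l2sq M (E {} f)) \<le> 0"
    by (intro LIMSEQ_le_const[where X = "\<lambda>n. real (n + 1) * sqrt (l2sq M (E {} f))"]) auto
  then have "l2sq M (E {} f) = 0" using l2sq_nonneg[of M "E {} f"] by simp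
  then show ?thesis using l2sq_eq_0_iff[OF E_L2[OF _ f]] by simp
qed

text \<open>Countable additivity for the pair padded with empty sets, which contribute nothing by
  \<open>E_empty\<close>.\<close>

lemma E_union:
  assumes S: "S \<in> sets borel" and T: "T \<in> sets borel" and "S \<inter> T = {}" and f: "f \<in> L2 M"
  shows "AE x in M. E (S \<union> T) f x = E S f x + E T f x"
proof -
  define X where "X i = (if i = 0 then S else if i = 1 then T else {})" for i :: nat
  have X: "X i \<in> sets borel" for i using S T by (simp add: X_def)
  have dX: "disjoint_family X"
    using assms(3) by (auto simp: disjoint_family_on_def X_def)
  have U: "(\<Union>i. X i) = S \<union> T"
    by (auto simp: X_def split: if_splits intro: exI[of _ 0] exI[of _ 1])
  have lim: "l2_lim M (\<lambda>n x. \<Sum>i<n + 2. E (X i) f x) (E (S \<union> T) f)"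
    using l2_lim_subseq[OF E_lim[OF X dX f], of "\<lambda>n. n + 2"] by (simp add: U strict_mono_def)
  have "AE x in M. (\<Sum>i<n + 2. E (X i) f x) = E S f x + E T f x" for n
    using E_empty[OF f]
  proof eventually_elim
    case (elim x)
    have "(\<Sum>i<n + 2. E (X i) f x) = E (X 0) f x + E (X 1) f x"
    proof (induction n)
      case 0 then show ?case by (simp add: numeral_2_eq_2)
    next
      case (Suc n)
      have "X (n + 2) = {}" by (simp add: X_def)
      then show ?case using Suc elim by simp
    qed
    then show ?case by (simp add: X_def)
  qed
  then have "l2_lim M (\<lambda>n x. E S f x + E T f x) (E (S \<union> T) f)"
    by (intro l2_lim_cong_AE[OF lim])
       (use S T in \<open>auto simp: ae_eq_def intro!: L2_measurable[OF L2_add] L2_measurable[OF E_L2] E_L2 f\<close>)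
  moreover have "l2_lim M (\<lambda>n x. E S f x + E T f x) (\<lambda>x. E S f x + E T f x)"
    by (intro l2_lim_const L2_add E_L2 S T f)
  ultimately show ?thesis by (rule l2_lim_unique)
qed

text \<open>For \<open>g = E T f\<close> additivity gives
  \<open>|E (S \<union> T) g|^2 = |E S g|^2 + |g|^2\<close>, and a projection is a contraction, so
  \<open>E S g\<close> vanishes.\<close>

lemma E_orth:
  assumes S: "S \<in> sets borel" and T: "T \<in> sets borel" and d: "S \<inter> T = {}" and f: "f \<in> L2 M"
  shows "AE x in M. E S (E T f) x = 0"
proof -
  have U: "S \<union> T \<in> sets borel" using S T by auto
  define g where "g = E T f"
  have g: "g \<in> L2 M" using E_L2[OF T f] by (simp add: g_def)
  have "l2_inner M g (E (S \<union> T) g) = l2_inner M g (\<lambda>x. E S g x + E T g x)"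
    by (rule l2_inner_cong_AE) (use E_union[OF S T d g] in \<open>auto simp: ae_eq_def intro!: L2_add E_L2 S T U g\<close>)
  also have "\<dots> = of_real (l2sq M (E S g) + l2sq M (E T g))"
    using g S T by (simp add: l2_inner_add_right E_L2 l2sq_E)
  finally have "l2sq M (E (S \<union> T) g) = l2sq M (E S g) + l2sq M (E T g)"
    unfolding l2sq_E[OF U g] by (simp only: of_real_eq_iff)
  moreover have "l2sq M (E T g) = l2sq M g"
    by (rule l2sq_cong_AE) (use E_idem[OF T f] E_L2 T f in \<open>auto simp: g_def\<close>)
  ultimately have "l2sq M (E S g) = 0"
    using E_contract[OF U g] l2sq_nonneg[of M "E S g"] by linarith
  then show ?thesis using l2sq_eq_0_iff[OF E_L2[OF S g]] by (simp add: g_def)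
qed

text \<open>Split \<open>T\<close> into \<open>S \<inter> T\<close> and \<open>T - S\<close>. The
  second part is killed by \<open>E S\<close>, and on the range of \<open>E (S \<inter> T)\<close>
  the projection \<open>E S\<close> acts as the identity.\<close>

lemma E_inter:
  assumes S: "S \<in> sets borel" and T: "T \<in> sets borel" and f: "f \<in> L2 M"
  shows "AE x in M. E S (E T f) x = E (S \<inter> T) f x"
proof -
  have ST: "S \<inter> T \<in> sets borel" "T - S \<in> sets borel" "S - T \<in> sets borel" using S T by auto
  define g where "g = E (S \<inter> T) f"
  have g: "g \<in> L2 M" using E_L2[OF ST(1) f] by (simp add: g_def)
  have "AE x in M. E T f x = g x + E (T - S) f x"
  proof -
    have "(S \<inter> T) \<union> (T - S) = T" "(S \<inter> T) \<inter> (T - S) = {}" by auto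
    then show ?thesis using E_union[OF ST(1,2) _ f] by (simp add: g_def)
  qed
  then have "AE x in M. E S (E T f) x = E S (\<lambda>x. g x + E (T - S) f x) x"
    by (intro E_cong[OF S] L2_add E_L2 ST T f g)
  moreover have "AE x in M. E S (\<lambda>x. g x + E (T - S) f x) x = E S g x + E S (E (T - S) f) x"
    by (intro E_add[OF S] E_L2 ST f g)
  moreover have "AE x in M. E S (E (T - S) f) x = 0"
    by (intro E_orth S ST f) auto
  moreover have "AE x in M. E ((S \<inter> T) \<union> (S - T)) g x = E (S \<inter> T) g x + E (S - T) g x"
    by (intro E_union ST g) auto
  moreover have "AE x in M. E (S - T) g x = 0"
    unfolding g_def by (intro E_orth ST f) auto
  moreover have "AE x in M. E (S \<inter> T) g x = g x"
    unfolding g_def by (intro E_idem ST f)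
  moreover have "(S \<inter> T) \<union> (S - T) = S" by auto
  ultimately show ?thesis by (auto simp: g_def)
qed

lemma sets_spectral_distr [simp, measurable_cong]: "sets (spectral_distr M E f) = sets borel"
  unfolding spectral_distr_def by (simp add: sets.sigma_sets_eq[of borel, simplified])

lemma space_spectral_distr [simp]: "space (spectral_distr M E f) = UNIV"
  unfolding spectral_distr_def by simp

lemma emeasure_spectral_distr:
  assumes f: "f \<in> L2 M" and S: "S \<in> sets borel"
  shows "emeasure (spectral_distr M E f) S = ennreal (l2sq M (E S f))"
proof -
  have "emeasure (spectral_distr M E f) S = ennreal (Re (l2_inner M f (E S f)))"
  proof (rule emeasure_measure_of[OF spectral_distr_def])
    show "positive (sets (spectral_distr M E f)) (\<lambda>S. ennreal (Re (l2_inner M f (E S f))))"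
      using E_empty[OF f] f by (simp add: positive_def l2sq_E l2sq_eq_0_iff E_L2)
    show "countably_additive (sets (spectral_distr M E f)) (\<lambda>S. ennreal (Re (l2_inner M f (E S f))))"
    proof (rule countably_additiveI)
      fix X :: "nat \<Rightarrow> real set"
      assume X: "range X \<subseteq> sets (spectral_distr M E f)" "disjoint_family X"
      then have Xi: "X i \<in> sets borel" for i by auto
      have "(\<lambda>n. l2_inner M f (\<lambda>x. \<Sum>i<n. E (X i) f x)) \<longlonglongrightarrow> l2_inner M f (E (\<Union>i. X i) f)"
        by (rule l2_lim_inner[OF E_lim[OF Xi X(2) f] f])
      then have "(\<lambda>n. Re (l2_inner M f (\<lambda>x. \<Sum>i<n. E (X i) f x))) \<longlonglongrightarrow> Re (l2_inner M f (E (\<Union>i. X i) f))"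
        by (rule tendsto_Re)
      moreover have "Re (l2_inner M f (\<lambda>x. \<Sum>i<n. E (X i) f x)) = (\<Sum>i<n. Re (l2_inner M f (E (X i) f)))" for n
        using f Xi by (simp add: l2_inner_sum_right E_L2)
      ultimately have "(\<lambda>i. Re (l2_inner M f (E (X i) f))) sums Re (l2_inner M f (E (\<Union>i. X i) f))"
        by (simp add: sums_def)
      moreover have "0 \<le> Re (l2_inner M f (E (X i) f))" for i
        using l2sq_E[OF Xi f] by simp
      ultimately show "(\<Sum>i. ennreal (Re (l2_inner M f (E (X i) f)))) = ennreal (Re (l2_inner M f (E (\<Union>i. X i) f)))"
        by (intro suminf_ennreal_eq)
    qed
  qed (use S in auto)
  then show ?thesis by (simp add: l2sq_E[OF S f])
qed

lemma finite_measure_spectral_distr: "f \<in> L2 M \<Longrightarrow> finite_measure (spectral_distr M E f)"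
  by standard (simp add: emeasure_spectral_distr)

end

text \<open>Uniqueness of the spectral measure of a multiplication operator, up to points.\<close>

locale mult_spectral_measure = mult_representation M N V W m A + l2_projection_measure M E
  for M :: "'a measure" and N :: "'b measure" and V W m A E +
  assumes sm: "is_spectral_measure M E A"
begin

text \<open>The closed subspace onto which \<open>E I\<close> projects: the vectors whose spectral
  distribution is carried by \<open>I\<close>.\<close>

definition ran :: "real set \<Rightarrow> ('a \<Rightarrow> complex) \<Rightarrow> bool" where
  "ran I v \<longleftrightarrow> v \<in> L2 M \<and> (AE x in M. E I v x = v x)"

lemma ran_L2: "ran I v \<Longrightarrow> v \<in> L2 M" by (simp add: ran_def)

lemma ran_E: "I \<in> sets borel \<Longrightarrow> f \<in> L2 M \<Longrightarrow> ran I (E I f)"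
  by (simp add: ran_def E_L2 E_idem)

lemma ran_add: "I \<in> sets borel \<Longrightarrow> ran I u \<Longrightarrow> ran I v \<Longrightarrow> ran I (\<lambda>x. u x + v x)"
  unfolding ran_def using E_add[of I u v] by (auto simp: L2_add)

lemma ran_cmult: "I \<in> sets borel \<Longrightarrow> ran I v \<Longrightarrow> ran I (\<lambda>x. c * v x)"
  unfolding ran_def using E_cmult[of I v c] by (auto simp: L2_cmult)

lemma ran_disjoint:
  assumes "I \<in> sets borel" "S \<in> sets borel" "ran I v" "S \<inter> I = {}"
  shows "AE x in M. E S v x = 0"
proof -
  have v: "v \<in> L2 M" "AE x in M. E I v x = v x" using assms(3) by (auto simp: ran_def)
  have "AE x in M. E S (E I v) x = E S v x"
    by (rule E_cong[OF assms(2) E_L2[OF assms(1) v(1)] v])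
  moreover have "AE x in M. E S (E I v) x = 0"
    by (rule E_orth) (use assms v in auto)
  ultimately show ?thesis by eventually_elim simp
qed

text \<open>The distribution of \<open>v\<close> is carried by the bounded set \<open>I\<close>. A
  finite second moment puts \<open>v\<close> into the domain of \<open>A\<close>, and the first
  moment differs from \<open>c\<close> times the mass by at most \<open>R\<close> times the mass;
  \<open>inner_A\<close> reads this moment on the side of \<open>N\<close>.\<close>

lemma form_bound:
  assumes I: "I \<in> sets borel" "I \<subseteq> {c - R..c + R}" and v: "ran I v"
  shows "(\<lambda>p. of_real (m p) * V v p) \<in> L2 N"
    and "\<bar>LINT p|N. (m p - c) * (cmod (V v p))\<^sup>2\<bar> \<le> R * l2sq M v"
proof -
  let ?\<mu> = "spectral_distr M E v"
  have vL: "v \<in> L2 M" using v by (rule ran_L2)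
  interpret \<mu>: finite_measure ?\<mu> by (rule finite_measure_spectral_distr[OF vL])
  have "emeasure ?\<mu> (- I) = 0"
    using ran_disjoint[OF I(1) _ v, of "- I"] I(1) vL
    by (simp add: emeasure_spectral_distr l2sq_eq_0_iff E_L2)
  then have "AE t in ?\<mu>. t \<in> I"
    using I(1) by (intro AE_I[where N = "- I"]) auto
  then have R: "AE t in ?\<mu>. \<bar>t - c\<bar> \<le> R"
    by eventually_elim (auto simp: abs_le_iff dest!: subsetD[OF I(2)])
  have "integrable ?\<mu> (\<lambda>t. t\<^sup>2)"
  proof (rule \<mu>.integrable_const_bound)
    show "AE t in ?\<mu>. norm (t\<^sup>2) \<le> (\<bar>c\<bar> + R)\<^sup>2"
      using R
    proof eventually_elim
      case (elim t)
      then have "\<bar>t\<bar> \<le> \<bar>c\<bar> + R" by linarith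
      then have "\<bar>t\<bar>\<^sup>2 \<le> (\<bar>c\<bar> + R)\<^sup>2" by (intro power_mono) auto
      then show ?case by simp
    qed
  qed simp
  then obtain g where g: "A v g"
    using sm vL unfolding is_spectral_measure_def by blast
  then show mL: "(\<lambda>p. of_real (m p) * V v p) \<in> L2 N"
    using mult_L2_iff[OF vL] by blast
  have "complex_of_real (LINT p|N. m p * (cmod (V v p))\<^sup>2) = of_real (LINT t|?\<mu>. t)"
    using inner_A[OF g] sm g unfolding is_spectral_measure_def by metis
  then have eq: "(LINT p|N. m p * (cmod (V v p))\<^sup>2) = (LINT t|?\<mu>. t)"
    by (simp only: of_real_eq_iff)
  have it: "integrable ?\<mu> (\<lambda>t. t)"
  proof (rule \<mu>.integrable_const_bound)
    show "AE t in ?\<mu>. norm t \<le> \<bar>c\<bar> + R" using R by eventually_elim auto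
  qed simp
  have "integrable N (\<lambda>p. cnj (V v p) * (of_real (m p) * V v p))"
    by (rule L2_inner_integrable[OF L2[OF vL] mL])
  then have "integrable N (\<lambda>p. Re (cnj (V v p) * (of_real (m p) * V v p)))" by (rule integrable_Re)
  then have im: "integrable N (\<lambda>p. m p * (cmod (V v p))\<^sup>2)" by (simp only: Re_cnj_mult)
  have mass: "measure ?\<mu> UNIV = l2sq M v"
  proof -
    have "l2sq M (E UNIV v) = l2sq M v"
      by (rule l2sq_cong_AE) (use E_UNIV[OF vL] vL E_L2[of UNIV v] in auto)
    then show ?thesis by (simp add: measure_def emeasure_spectral_distr[OF vL])
  qed
  have "(LINT p|N. (m p - c) * (cmod (V v p))\<^sup>2) = (LINT p|N. m p * (cmod (V v p))\<^sup>2) - c * l2sq N (V v)"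
    using im L2_integrable[OF L2[OF vL]] by (simp add: left_diff_distrib l2sq_def)
  also have "\<dots> = (LINT t|?\<mu>. t - c)"
    using it by (simp add: eq l2sq[OF vL] mass)
  finally have "\<bar>LINT p|N. (m p - c) * (cmod (V v p))\<^sup>2\<bar> \<le> (LINT t|?\<mu>. \<bar>t - c\<bar>)"
    using integral_abs_bound[of ?\<mu> "\<lambda>t. t - c"] by simp
  also have "\<dots> \<le> (LINT t|?\<mu>. R)"
    by (rule integral_mono_AE) (use it R in auto)
  also have "\<dots> = R * l2sq M v" by (simp add: mass)
  finally show "\<bar>LINT p|N. (m p - c) * (cmod (V v p))\<^sup>2\<bar> \<le> R * l2sq M v" .
qed

text \<open>If \<open>v\<close> and \<open>u\<close> have disjoint spectral supports, then \<open>v + u\<close> and \<open>v - u\<close> have the same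
  spectral distribution.\<close>

lemma cross_term:
  assumes I: "I \<in> sets borel" "I \<subseteq> {c - R..c + R}" and v: "ran I v"
    and J: "J \<in> sets borel" "J \<subseteq> {d - Q..d + Q}" and u: "ran J u" and d: "I \<inter> J = {}"
  shows "l2_inner N (V v) (\<lambda>p. of_real (m p) * V u p) = 0"
proof -
  note vL = ran_L2[OF v] and uL = ran_L2[OF u]
  note mv = form_bound(1)[OF I v] and mu = form_bound(1)[OF J u]
  define b where "b = l2_inner N (V v) (\<lambda>p. of_real (m p) * V u p)"
  \<comment> \<open>\<open>E S v\<close> stays in the range of \<open>E I\<close>, while
    \<open>E I\<close> annihilates \<open>E S u\<close> because \<open>u\<close> lives on the
    disjoint set \<open>J\<close>.\<close>
  have orth: "l2_inner M (E S v) (E S u) = 0" if S: "S \<in> sets borel" for S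
  proof -
    have 1: "AE x in M. E I (E S v) x = E S v x"
    proof -
      have "AE x in M. E I (E S v) x = E (I \<inter> S) v x" "AE x in M. E S (E I v) x = E (S \<inter> I) v x"
        by (intro E_inter I S vL)+
      moreover have "AE x in M. E S (E I v) x = E S v x"
        using v I(1) by (intro E_cong[OF S]) (auto simp: ran_def E_L2)
      ultimately show ?thesis by (auto simp: Int_commute)
    qed
    have "l2_inner M (E S v) (E S u) = l2_inner M (E I (E S v)) (E S u)"
      by (rule l2_inner_cong_AE) (use 1 in \<open>auto simp: ae_eq_def intro!: E_L2 I S vL uL\<close>)
    also have "\<dots> = l2_inner M (E S v) (E I (E S u))"
      by (intro E_sym E_L2 I S vL uL)
    also have "\<dots> = l2_inner M (E S v) (\<lambda>x. 0)"
    proof (rule l2_inner_cong_AE)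
      have "AE x in M. E I (E S u) x = E (I \<inter> S) u x" by (intro E_inter I S uL)
      moreover have "AE x in M. E (I \<inter> S) u x = 0"
        by (rule ran_disjoint[OF J(1) _ u]) (use I S d in auto)
      ultimately show "ae_eq M (E I (E S u)) (\<lambda>x. 0)" unfolding ae_eq_def by eventually_elim simp
    qed (auto simp: ae_eq_def intro!: E_L2 I S vL uL L2_zero)
    finally show ?thesis by (simp add: l2_inner_def)
  qed
  have sq: "l2sq M (E S (\<lambda>x. v x + z * u x)) = l2sq M (E S v) + l2sq M (\<lambda>x. z * E S u x)"
    if S: "S \<in> sets borel" for S z
  proof -
    have "AE x in M. E S (\<lambda>x. v x + z * u x) x = E S v x + z * E S u x"
      using E_add[OF S vL L2_cmult[OF uL, of z]] E_cmult[OF S uL, of z] by eventually_elim simp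
    then have "l2sq M (E S (\<lambda>x. v x + z * u x)) = l2sq M (\<lambda>x. E S v x + z * E S u x)"
      by (intro l2sq_cong_AE L2_measurable L2_add L2_cmult E_L2 S vL uL)
    also have "\<dots> = l2sq M (E S v) + l2sq M (\<lambda>x. z * E S u x)"
      using orth[OF S] by (simp add: l2sq_add E_L2 S vL uL L2_cmult l2_inner_cmult_right)
    finally show ?thesis .
  qed
  have distr_eq: "spectral_distr M E (\<lambda>x. v x + z * u x) = spectral_distr M E (\<lambda>x. v x + z' * u x)"
    if "cmod z = cmod z'" for z z'
    unfolding spectral_distr_def
    by (rule measure_of_eq)
       (simp_all add: sets.sigma_sets_eq[of borel, simplified] l2sq_E L2_add L2_cmult vL uL sq l2sq_cmult that)
  have form: "(LINT t|spectral_distr M E (\<lambda>x. v x + z * u x). t)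
      = (LINT p|N. m p * (cmod (V v p))\<^sup>2) + (cmod z)\<^sup>2 * (LINT p|N. m p * (cmod (V u p))\<^sup>2) + 2 * Re (z * b)" for z
  proof -
    define h where "h x = v x + z * u x" for x
    have hL: "h \<in> L2 M" unfolding h_def[abs_def] by (intro L2_add L2_cmult vL uL)
    have Vh: "AE p in N. V h p = V v p + z * V u p"
      unfolding h_def[abs_def] using add[OF vL L2_cmult[OF uL, of z]] cmult[OF uL, of z]
      by eventually_elim simp
    define k where "k p = of_real (m p) * V v p + z * (of_real (m p) * V u p)" for p
    have kL: "k \<in> L2 N" unfolding k_def[abs_def] by (intro L2_add L2_cmult mv mu)
    have "AE p in N. V (W k) p = of_real (m p) * V h p"
      using V_W[OF kL] Vh by eventually_elim (simp add: k_def algebra_simps)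
    then have Ah: "A h (W k)" using hL W_L2[OF kL] by (simp add: A_iff)
    have "complex_of_real (LINT t|spectral_distr M E h. t) = l2_inner M h (W k)"
      using sm Ah unfolding is_spectral_measure_def by metis
    also have "\<dots> = l2_inner N (V h) k" by (rule inner_right[OF kL hL])
    also have "\<dots> = l2_inner N (\<lambda>p. V v p + z * V u p) k"
      by (rule l2_inner_cong_AE) (use Vh kL hL L2 vL uL in \<open>auto simp: ae_eq_def intro!: L2_add L2_cmult\<close>)
    also have "\<dots> = l2_inner N (V v) (\<lambda>p. of_real (m p) * V v p) + z * b
        + cnj z * (l2_inner N (V u) (\<lambda>p. of_real (m p) * V v p) + z * l2_inner N (V u) (\<lambda>p. of_real (m p) * V u p))"
      using mv mu L2[OF vL] L2[OF uL] kL unfolding k_def[abs_def]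
      by (simp add: l2_inner_add_left l2_inner_add_right L2_add L2_cmult l2_inner_cmult_left l2_inner_cmult_right b_def)
    also have "l2_inner N (V u) (\<lambda>p. of_real (m p) * V v p) = cnj b"
      unfolding b_def l2_inner_cnj by (simp add: l2_inner_def ac_simps)
    finally have e: "complex_of_real (LINT t|spectral_distr M E h. t)
      = l2_inner N (V v) (\<lambda>p. of_real (m p) * V v p) + z * b
        + cnj z * (cnj b + z * l2_inner N (V u) (\<lambda>p. of_real (m p) * V u p))" .
    have diag: "l2_inner N (V w) (\<lambda>p. of_real (m p) * V w p) = of_real (LINT p|N. m p * (cmod (V w p))\<^sup>2)" for w
      unfolding l2_inner_def integral_complex_of_real[symmetric]
    proof (rule Bochner_Integration.integral_cong[OF refl])
      fix p
      show "cnj (V w p) * (of_real (m p) * V w p) = of_real (m p * (cmod (V w p))\<^sup>2)"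
        using complex_norm_square[of "V w p"] by (simp add: ac_simps del: of_real_power)
    qed
    have zz: "cnj z * (z * of_real r) = of_real ((cmod z)\<^sup>2 * r)" for r
      using complex_norm_square[of z] by (simp add: ac_simps del: of_real_power)
    show ?thesis
      using arg_cong[OF e, of Re] unfolding diag h_def[abs_def, symmetric] by (simp add: distrib_left zz)
  qed
  \<comment> \<open>\<open>z\<close> and \<open>- z\<close> have equal modulus, so both vectors have
    the same first moment and the mixed term must vanish. The values \<open>1\<close> and
    \<open>\<i>\<close> then kill both parts of \<open>b\<close>.\<close>
  have "Re (z * b) = 0" for z
    proof -
    have "2 * Re (z * b) = 2 * Re (- z * b)"
      using form[of z] form[of "- z"] distr_eq[of z "- z"] by (simp only: norm_minus_cancel)
    then show ?thesis unfolding mult_minus_left by (simp only: uminus_complex.sel)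
  qed

  from this[of 1] this[of \<i>] have "b = 0" by (simp add: complex_eq_iff)
  then show ?thesis by (simp add: b_def)
qed

text \<open>Since \<open>m\<close> is real it can be moved onto a vector of the range of
  \<open>E (S i)\<close>, where \<open>cross_term\<close> gives zero. That lemma needs bounded
  supports, so the complement of \<open>I\<close> is cut into the sets \<open>S i\<close> on which
  \<open>|t|\<close> stays in a unit interval; countable additivity reassembles them into
  \<open>E (- I) g = 0\<close>.\<close>

lemma ran_invariant:
  assumes I: "I \<in> sets borel" "I \<subseteq> {c - R..c + R}" and v: "ran I v"
  shows "ran I (W (\<lambda>p. of_real (m p) * V v p))"
proof -
  note vL = ran_L2[OF v] and mv = form_bound(1)[OF I v]
  define g where "g = W (\<lambda>p. of_real (m p) * V v p)"
  have gL: "g \<in> L2 M" unfolding g_def by (rule W_L2[OF mv])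
  have mI: "- I \<in> sets borel" using I by auto
  define S where "S i = {t. real i \<le> \<bar>t\<bar> \<and> \<bar>t\<bar> < real i + 1} - I" for i :: nat
  have S: "S i \<in> sets borel" for i
    unfolding S_def using I(1) by measurable
  have dS: "disjoint_family S"
  proof (unfold disjoint_family_on_def, intro ballI impI)
    fix i j :: nat assume "i \<noteq> j"
    then show "S i \<inter> S j = {}" unfolding S_def by (cases "i < j") auto
  qed
  have US: "(\<Union>i. S i) = - I"
  proof -
    have "t \<in> (\<Union>i. S i)" if "t \<notin> I" for t
    proof (rule UN_I[of "nat \<lfloor>\<bar>t\<bar>\<rfloor>"])
      show "t \<in> S (nat \<lfloor>\<bar>t\<bar>\<rfloor>)" using that unfolding S_def by auto
    qed simp
    then show ?thesis by (auto simp: S_def)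
  qed
  have "l2_inner M g (E (S i) w) = 0" if w: "w \<in> L2 M" for w i
  proof -
    have "l2_inner M g (E (S i) w) = l2_inner N (\<lambda>p. of_real (m p) * V v p) (V (E (S i) w))"
      unfolding g_def by (rule inner_left[OF mv E_L2[OF S w]])
    also have "\<dots> = l2_inner N (V v) (\<lambda>p. of_real (m p) * V (E (S i) w) p)"
      by (simp add: l2_inner_def ac_simps)
    also have "\<dots> = 0"
    proof (rule cross_term[OF I v S _ ran_E[OF S w]])
      show "S i \<subseteq> {0 - (real i + 1)..0 + (real i + 1)}" by (auto simp: S_def)
      show "I \<inter> S i = {}" by (auto simp: S_def)
    qed
    finally show ?thesis .
  qed
  then have "l2_inner M g (\<lambda>x. \<Sum>i<n. E (S i) g x) = 0" for n
    using gL S by (simp add: l2_inner_sum_right E_L2)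
  then have "l2_inner M g (E (- I) g) = 0"
    using l2_lim_inner[OF E_lim[OF S dS gL] gL] by (simp add: US LIMSEQ_const_iff)
  then have "l2sq M (E (- I) g) = 0" using l2sq_E[OF mI gL] by simp
  then have "AE x in M. E (- I) g x = 0" using l2sq_eq_0_iff[OF E_L2[OF mI gL]] by simp
  moreover have "AE x in M. E (I \<union> - I) g x = E I g x + E (- I) g x"
    by (rule E_union[OF I(1) mI _ gL]) auto
  ultimately have "AE x in M. E I g x = g x"
    using E_UNIV[OF gL] by (auto simp: Compl_partition)
  then show ?thesis using gL by (simp add: ran_def g_def)
qed

text \<open>\<open>(R - u)(R + u)\<^sup>2 + (R + u)(R - u)\<^sup>2 = 2 R (R\<^sup>2 - u\<^sup>2)\<close> turns bounds on the quadratic form of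
  \<open>u = m - c\<close> into a bound on its norm.\<close>

lemma ran_norm_bound:
  assumes I: "I \<in> sets borel" "I \<subseteq> {c - R..c + R}" and v: "ran I v" and R: "R > 0"
  shows "\<exists>w. ran I w \<and> (AE p in N. V w p = of_real (m p - c) * V v p) \<and> l2sq M w \<le> R\<^sup>2 * l2sq M v"
proof -
  note vL = ran_L2[OF v] and mv = form_bound(1)[OF I v]
  define g where "g = W (\<lambda>p. of_real (m p) * V v p)"
  have g: "ran I g" unfolding g_def by (rule ran_invariant[OF I v])
  note gL = ran_L2[OF g]
  have Vg: "AE p in N. V g p = of_real (m p) * V v p" unfolding g_def by (rule V_W[OF mv])
  define lin where "lin a b x = a * v x + b * g x" for a b :: complex and x
  have lin: "ran I (lin a b)" for a b
    unfolding lin_def[abs_def] by (intro ran_add ran_cmult I v g)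
  have Vlin: "AE p in N. V (lin a b) p = (a + b * of_real (m p)) * V v p" for a b
    unfolding lin_def[abs_def]
    using add[OF L2_cmult[OF vL, of a] L2_cmult[OF gL, of b]] cmult[OF vL, of a] cmult[OF gL, of b] Vg
    by eventually_elim (simp add: algebra_simps)
  define w where "w = lin (of_real (- c)) 1"
  have Vw: "AE p in N. V w p = of_real (m p - c) * V v p"
    using Vlin[of "of_real (- c)" 1] unfolding w_def by eventually_elim (simp add: algebra_simps)
  have wL: "w \<in> L2 M" unfolding w_def by (rule ran_L2[OF lin])
  define u where "u p = m p - c" for p
  define q where "q p = (cmod (V v p))\<^sup>2" for p
  \<comment> \<open>\<open>form_bound\<close> for the vectors \<open>(R + u) v\<close> and
    \<open>(R - u) v\<close>, with \<open>s\<close> as the sign; both lie in \<open>ran I\<close>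
    because they are combinations of \<open>v\<close> and \<open>g\<close>.\<close>
  have key: "integrable N (\<lambda>p. (R + s * u p)\<^sup>2 * q p) \<and> integrable N (\<lambda>p. u p * ((R + s * u p)\<^sup>2 * q p))
      \<and> \<bar>LINT p|N. u p * ((R + s * u p)\<^sup>2 * q p)\<bar> \<le> R * (LINT p|N. (R + s * u p)\<^sup>2 * q p)"
    if s: "s = 1 \<or> s = -1" for s
  proof -
    define f where "f = lin (of_real (R - s * c)) (of_real s)"
    have f: "ran I f" unfolding f_def by (rule lin)
    note fL = ran_L2[OF f]
    have Vf: "AE p in N. (cmod (V f p))\<^sup>2 = (R + s * u p)\<^sup>2 * q p"
      using Vlin[of "of_real (R - s * c)" "of_real s"] unfolding f_def[symmetric]
    proof eventually_elim
      case (elim p)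
      have "V f p = of_real (R + s * u p) * V v p"
        unfolding elim by (simp add: u_def algebra_simps)
      then show ?case by (simp add: norm_mult power_mult_distrib q_def del: of_real_add of_real_mult)
    qed
    have [measurable]: "V f \<in> borel_measurable N" "V v \<in> borel_measurable N" "m \<in> borel_measurable N"
      using L2 fL vL by auto
    have [measurable]: "u \<in> borel_measurable N" "q \<in> borel_measurable N"
      unfolding u_def[abs_def] q_def[abs_def] by measurable
    have i1: "integrable N (\<lambda>p. (R + s * u p)\<^sup>2 * q p)"
      by (rule integrable_cong_AE_imp[OF L2_integrable[OF L2[OF fL]]]) (use Vf in \<open>auto elim: AE_mp\<close>)
    have ui: "integrable N (\<lambda>p. u p * (cmod (V f p))\<^sup>2)"
    proof -
      have "integrable N (\<lambda>p. Re (cnj (V f p) * (of_real (m p) * V f p)))"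
        by (intro integrable_Re L2_inner_integrable L2 fL form_bound(1)[OF I f])
      then show ?thesis unfolding Re_cnj_mult using L2_integrable[OF L2[OF fL]] by (simp add: u_def left_diff_distrib)
    qed
    have e2: "AE p in N. u p * (cmod (V f p))\<^sup>2 = u p * ((R + s * u p)\<^sup>2 * q p)"
      using Vf by eventually_elim simp
    have i2: "integrable N (\<lambda>p. u p * ((R + s * u p)\<^sup>2 * q p))"
      by (rule integrable_cong_AE_imp[OF ui]) (use e2 in \<open>auto elim: AE_mp\<close>)
    have "(LINT p|N. (m p - c) * (cmod (V f p))\<^sup>2) = (LINT p|N. u p * ((R + s * u p)\<^sup>2 * q p))"
      by (rule integral_cong_AE) (use e2 in \<open>auto simp: u_def\<close>)
    moreover have "l2sq M f = (LINT p|N. (R + s * u p)\<^sup>2 * q p)"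
      unfolding l2sq[OF fL, symmetric] unfolding l2sq_def by (rule integral_cong_AE) (use Vf in auto)
    ultimately show ?thesis using form_bound(2)[OF I f] i1 i2 by simp
  qed
  have iq: "integrable N q" using L2_integrable[OF L2[OF vL]] by (simp add: q_def[abs_def])
  have sw: "l2sq M w = (LINT p|N. (u p)\<^sup>2 * q p)" "integrable N (\<lambda>p. (u p)\<^sup>2 * q p)"
  proof -
    have [measurable]: "V w \<in> borel_measurable N" "V v \<in> borel_measurable N"
      using L2 wL vL by auto
    have [measurable]: "u \<in> borel_measurable N" "q \<in> borel_measurable N"
      unfolding u_def[abs_def] q_def[abs_def] by measurable
    have e: "AE p in N. (cmod (V w p))\<^sup>2 = (u p)\<^sup>2 * q p"
      using Vw by eventually_elim (simp add: norm_mult power_mult_distrib u_def q_def del: of_real_diff)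
    show "l2sq M w = (LINT p|N. (u p)\<^sup>2 * q p)"
      unfolding l2sq[OF wL, symmetric] unfolding l2sq_def by (rule integral_cong_AE) (use e in auto)
    show "integrable N (\<lambda>p. (u p)\<^sup>2 * q p)"
      by (rule integrable_cong_AE_imp[OF L2_integrable[OF L2[OF wL]]]) (use e in \<open>auto elim: AE_mp\<close>)
  qed
  note k1 = key[of 1, simplified] and k2 = key[of "-1", simplified]
  have "0 \<le> (R * (LINT p|N. (R + u p)\<^sup>2 * q p) - (LINT p|N. u p * ((R + u p)\<^sup>2 * q p)))
      + (R * (LINT p|N. (R - u p)\<^sup>2 * q p) + (LINT p|N. u p * ((R - u p)\<^sup>2 * q p)))"
    using k1 k2 by linarith
  also have "\<dots> = (LINT p|N. (R * ((R + u p)\<^sup>2 * q p) - u p * ((R + u p)\<^sup>2 * q p))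
      + (R * ((R - u p)\<^sup>2 * q p) + u p * ((R - u p)\<^sup>2 * q p)))"
    using k1 k2 by simp
  also have "\<dots> = (LINT p|N. 2 * R * (R\<^sup>2 * q p - (u p)\<^sup>2 * q p))"
    by (rule Bochner_Integration.integral_cong) (auto simp: power2_eq_square algebra_simps)
  also have "\<dots> = 2 * R * (R\<^sup>2 * l2sq M v - l2sq M w)"
    using iq sw by (simp add: q_def[abs_def] l2sq_def[symmetric] l2sq[OF vL])
  finally have "l2sq M w \<le> R\<^sup>2 * l2sq M v"
    using R by (simp add: zero_le_mult_iff)
  then show ?thesis using Vw lin unfolding w_def by blast
qed

text \<open>\<open>ran_norm_bound\<close> returns a vector of the same range, so it can be iterated.
  The constant is exactly \<open>R^2\<close> at each stage, which is what the growth argument of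
  \<open>ran_support\<close> exploits.\<close>

lemma ran_power_bound:
  assumes I: "I \<in> sets borel" "I \<subseteq> {c - R..c + R}" and v: "ran I v" and R: "R > 0"
  shows "\<exists>w. ran I w \<and> (AE p in N. V w p = of_real (m p - c) ^ k * V v p) \<and> l2sq M w \<le> (R\<^sup>2) ^ k * l2sq M v"
proof (induction k)
  case 0 then show ?case using v by (intro exI[of _ v]) auto
next
  case (Suc k)
  then obtain w where w: "ran I w" "AE p in N. V w p = of_real (m p - c) ^ k * V v p" "l2sq M w \<le> (R\<^sup>2) ^ k * l2sq M v"
    by blast
  obtain x where x: "ran I x" "AE p in N. V x p = of_real (m p - c) * V w p" "l2sq M x \<le> R\<^sup>2 * l2sq M w"
    using ran_norm_bound[OF I w(1) R] by blast
  have "AE p in N. V x p = of_real (m p - c) ^ Suc k * V v p"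
    using x(2) w(2) by eventually_elim simp
  moreover have "l2sq M x \<le> (R\<^sup>2) ^ Suc k * l2sq M v"
    using x(3) mult_left_mono[OF w(3), of "R\<^sup>2"] by (simp add: mult.assoc)
  ultimately show ?case using x(1) by blast
qed

text \<open>If \<open>V v\<close> had mass \<open>J > 0\<close> where
  \<open>|m - c| \<ge> R Q\<close> with \<open>Q > 1\<close>, then \<open>(m - c)^k V v\<close>
  would have squared norm at least \<open>(R Q)^(2k) J\<close>, whereas
  \<open>ran_power_bound\<close> allows only \<open>R^(2k)\<close> times the squared norm of
  \<open>v\<close>. Large \<open>k\<close> is contradictory.\<close>

lemma ran_support:
  assumes I: "I \<in> sets borel" "I \<subseteq> {c - R..c + R}" and v: "ran I v" and R: "R > 0"
  shows "AE p in N. \<bar>m p - c\<bar> > R \<longrightarrow> V v p = 0"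
proof -
  note vL = ran_L2[OF v]
  have [measurable]: "V v \<in> borel_measurable N" using L2[OF vL] by auto
  have "AE p in N. \<bar>m p - c\<bar> \<ge> R * (1 + 1 / real (Suc n)) \<longrightarrow> V v p = 0" for n
  proof -
    \<comment> \<open>The growth argument needs a factor strictly above 1; these countably many
      thresholds together exhaust \<open>|m - c| > R\<close>.\<close>
    define Q where "Q = 1 + 1 / real (Suc n)"
    define Z where "Z p \<longleftrightarrow> \<bar>m p - c\<bar> \<ge> R * Q" for p
    have Q: "Q > 1" by (simp add: Q_def)
    have ZL: "(\<lambda>p. of_bool (Z p) * V v p) \<in> L2 N"
      unfolding Z_def by (rule L2_indicator_mult[OF L2[OF vL]]) measurable
    define J where "J = l2sq N (\<lambda>p. of_bool (Z p) * V v p)"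
    have bd: "(Q\<^sup>2) ^ k * J \<le> l2sq M v" for k
    proof -
      obtain w where w: "ran I w" "AE p in N. V w p = of_real (m p - c) ^ k * V v p" "l2sq M w \<le> (R\<^sup>2) ^ k * l2sq M v"
        using ran_power_bound[OF I v R] by blast
      have wL: "w \<in> L2 M" by (rule ran_L2[OF w(1)])
      have "(R\<^sup>2) ^ k * ((Q\<^sup>2) ^ k * J) = (LINT p|N. ((R * Q)\<^sup>2) ^ k * (cmod (of_bool (Z p) * V v p))\<^sup>2)"
        by (simp add: J_def l2sq_def power_mult_distrib mult.assoc)
      also have "\<dots> \<le> (LINT p|N. (cmod (V w p))\<^sup>2)"
      proof (rule integral_mono_AE)
        show "integrable N (\<lambda>p. ((R * Q)\<^sup>2) ^ k * (cmod (of_bool (Z p) * V v p))\<^sup>2)"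
          using L2_integrable[OF ZL] by simp
        show "integrable N (\<lambda>p. (cmod (V w p))\<^sup>2)" by (rule L2_integrable[OF L2[OF wL]])
        show "AE p in N. ((R * Q)\<^sup>2) ^ k * (cmod (of_bool (Z p) * V v p))\<^sup>2 \<le> (cmod (V w p))\<^sup>2"
          using w(2)
        proof eventually_elim
          case (elim p)
          have e: "(cmod (V w p))\<^sup>2 = ((m p - c)\<^sup>2) ^ k * (cmod (V v p))\<^sup>2"
            unfolding elim by (simp add: norm_mult norm_power power_mult_distrib power_mult[symmetric] mult.commute[of k] power_even_abs del: of_real_diff)
          show ?case
          proof (cases "Z p")
            case True
            then have "(R * Q)\<^sup>2 \<le> \<bar>m p - c\<bar>\<^sup>2"
              using R Q unfolding Z_def by (intro power_mono) auto
            then have "((R * Q)\<^sup>2) ^ k \<le> ((m p - c)\<^sup>2) ^ k" by (simp add: power_mono)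
            then show ?thesis unfolding e using True by (simp add: mult_right_mono)
          qed simp
        qed
      qed
      also have "\<dots> \<le> (R\<^sup>2) ^ k * l2sq M v"
        using w(3) by (simp add: l2sq_def[symmetric] l2sq[OF wL])
      finally show ?thesis using R by simp
    qed
    have "J = 0"
    proof (rule ccontr)
      assume "J \<noteq> 0"
      then have J: "J > 0" using J_def l2sq_nonneg[of N "\<lambda>p. of_bool (Z p) * V v p"] by linarith
      have "1 < Q\<^sup>2" using Q by (simp add: one_less_power)
      then obtain k where "l2sq M v / J < (Q\<^sup>2) ^ k" using real_arch_pow by blast
      then show False using bd[of k] J by (simp add: field_simps)
    qed
    then have "AE p in N. of_bool (Z p) * V v p = 0"
      using l2sq_eq_0_iff[OF ZL] by (simp add: J_def)
    then show ?thesis by eventually_elim (auto simp: Z_def Q_def)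
  qed
  then have "AE p in N. \<forall>n. \<bar>m p - c\<bar> \<ge> R * (1 + 1 / real (Suc n)) \<longrightarrow> V v p = 0"
    unfolding AE_all_countable by blast
  then show ?thesis
  proof eventually_elim
    case (elim p)
    show ?case
    proof
      assume "\<bar>m p - c\<bar> > R"
      then have "\<bar>m p - c\<bar> / R - 1 > 0" using R by (simp add: field_simps)
      then obtain n where "1 / real (Suc n) < \<bar>m p - c\<bar> / R - 1"
        using nat_approx_posE by blast
      then have "\<bar>m p - c\<bar> \<ge> R * (1 + 1 / real (Suc n))" using R by (simp add: field_simps)
      then show "V v p = 0" using elim by blast
    qed
  qed
qed

text \<open>The line is tiled by translates of \<open>{a<..b}\<close>, and \<open>f\<close> is the
  sum of its projections to the tiles. Each projection is supported in its closed tile by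
  \<open>ran_support\<close>, so over the open interval only one of them survives and must equal
  \<open>V f\<close>. Closed tiles overlap at endpoints, which \<open>null\<close> removes.\<close>

lemma V_E_interval:
  assumes ab: "a < b" and f: "f \<in> L2 M" and null: "\<And>c. AE p in N. m p \<noteq> c"
  shows "AE p in N. V (E {a<..b} f) p = of_bool (m p \<in> {a<..b}) * V f p"
proof -
  define l where "l = b - a"
  have l: "l > 0" using ab by (simp add: l_def)
  \<comment> \<open>\<open>int_decode\<close> enumerates the integers, as countable additivity is
    stated for sequences indexed by \<open>nat\<close>.\<close>
  define S where "S i = {a + of_int (int_decode i) * l<..a + (of_int (int_decode i) + 1) * l}" for i
  have S: "S i \<in> sets borel" for i by (simp add: S_def)
  have "t \<in> S i \<longleftrightarrow> int_decode i = \<lceil>(t - a) / l\<rceil> - 1" for t i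
  proof -
    have "t \<in> S i \<longleftrightarrow> of_int (int_decode i) < (t - a) / l \<and> (t - a) / l \<le> of_int (int_decode i) + 1"
      unfolding S_def using l by (auto simp: field_simps)
    also have "\<dots> \<longleftrightarrow> \<lceil>(t - a) / l\<rceil> = int_decode i + 1"
      by (subst ceiling_eq_iff) auto
    finally show ?thesis by auto
  qed
  note in_S = this
  have dS: "disjoint_family S"
    by (auto simp: disjoint_family_on_def in_S) (metis int_decode_eq)
  have US: "(\<Union>i. S i) = UNIV"
  proof -
    have "t \<in> S (int_encode (\<lceil>(t - a) / l\<rceil> - 1))" for t by (simp add: in_S)
    then show ?thesis by blast
  qed
  define i0 where "i0 = int_encode 0"
  have S0: "S i0 = {a<..b}" by (simp add: S_def i0_def l_def)
  define F where "F i = E (S i) f" for i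
  have FL: "F i \<in> L2 M" for i unfolding F_def by (rule E_L2[OF S f])
  have supp: "AE p in N. m p \<notin> {a + of_int (int_decode i) * l..a + (of_int (int_decode i) + 1) * l} \<longrightarrow> V (F i) p = 0" for i
  proof -
    define c where "c = a + (of_int (int_decode i) + 1/2) * l"
    have "AE p in N. \<bar>m p - c\<bar> > l / 2 \<longrightarrow> V (F i) p = 0"
      unfolding F_def
      by (rule ran_support[OF S _ ran_E[OF S f]]) (use l in \<open>auto simp: S_def c_def algebra_simps\<close>)
    then show ?thesis
    proof eventually_elim
      case (elim p)
      then show ?case unfolding c_def by (auto simp: algebra_simps abs_if split: if_splits)
    qed
  qed
  then have supp_all: "AE p in N. \<forall>i. m p \<notin> {a + of_int (int_decode i) * l..a + (of_int (int_decode i) + 1) * l} \<longrightarrow> V (F i) p = 0"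
    by (simp only: AE_all_countable) blast
  define P where "P p \<longleftrightarrow> m p \<in> {a<..<b}" for p
  have vanish: "V (F i) p = 0" if "P p" "i \<noteq> i0"
    "\<forall>i. m p \<notin> {a + of_int (int_decode i) * l..a + (of_int (int_decode i) + 1) * l} \<longrightarrow> V (F i) p = 0" for p i
  proof -
    define k where "k = int_decode i"
    have "k \<noteq> 0" using that(2) unfolding k_def i0_def by (metis int_decode_inverse)
    then consider "k \<ge> 1" | "k + 1 \<le> 0" by linarith
    then have "m p \<notin> {a + of_int k * l..a + (of_int k + 1) * l}"
    proof cases
      case 1
      then have "1 * l \<le> of_int k * l" using l by (intro mult_right_mono) auto
      moreover have "m p < a + l" using that(1) by (simp add: P_def l_def)
      ultimately have "m p < a + of_int k * l" by linarith
      then show ?thesis by simp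
    next
      case 2
      then have "(of_int k + 1) * l \<le> 0 * l" using l by (intro mult_right_mono) linarith+
      then show ?thesis using that(1) by (auto simp: P_def)
    qed
    then show ?thesis using that(3) by (simp add: k_def)
  qed
  have Flim: "l2_lim M (\<lambda>n x. \<Sum>i<n. F i x) f"
  proof (rule l2_lim_cong_AE[OF E_lim[OF S dS f]])
    show "ae_eq M (E (\<Union>i. S i) f) f" using E_UNIV[OF f] by (simp add: US ae_eq_def)
  qed (use FL f in \<open>auto simp: F_def ae_eq_def intro!: L2_measurable L2_sum\<close>)
  have "l2_lim N (\<lambda>n p. of_bool (P p) * V (\<lambda>x. \<Sum>i<n. F i x) p) (\<lambda>p. of_bool (P p) * V f p)"
  proof (rule l2_lim_mult[OF lim[OF Flim], where C = 1])
    have "(\<lambda>p. if P p then 1 else 0 :: complex) \<in> borel_measurable N" unfolding P_def by measurable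
    then show "(\<lambda>p. of_bool (P p) :: complex) \<in> borel_measurable N" by (simp add: of_bool_def)
  qed auto
  \<comment> \<open>Shifted so that every partial sum contains the index \<open>i0\<close> of the
    tile \<open>{a<..b}\<close>.\<close>
  then have lim2: "l2_lim N (\<lambda>n p. of_bool (P p) * V (\<lambda>x. \<Sum>i<n + Suc i0. F i x) p) (\<lambda>p. of_bool (P p) * V f p)"
    by (rule l2_lim_subseq[where r = "\<lambda>n. n + Suc i0"]) (simp add: strict_mono_def)
  have PL: "(\<lambda>p. of_bool (P p) * V (F i0) p) \<in> L2 N"
    unfolding P_def by (rule L2_indicator_mult[OF L2[OF FL]]) measurable
  have "AE p in N. of_bool (P p) * V (\<lambda>x. \<Sum>i<n + Suc i0. F i x) p = of_bool (P p) * V (F i0) p" for n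
  proof -
    have "AE p in N. V (\<lambda>x. \<Sum>i<n + Suc i0. F i x) p = (\<Sum>i<n + Suc i0. V (F i) p)"
      by (rule sum) (auto intro: FL)
    then show ?thesis using supp_all
    proof eventually_elim
      case (elim p)
      show ?case
      proof (cases "P p")
        case True
        have "(\<Sum>i<n + Suc i0. V (F i) p) = (\<Sum>i<n + Suc i0. if i = i0 then V (F i0) p else 0)"
          by (rule sum.cong) (use vanish[OF True _ elim(2)] in auto)
        then show ?thesis using elim(1) by simp
      qed simp
    qed
  qed
  then have "l2_lim N (\<lambda>n p. of_bool (P p) * V (F i0) p) (\<lambda>p. of_bool (P p) * V f p)"
    using PL by (intro l2_lim_cong_AE[OF lim2]) (use l2_lim_L2(1)[OF lim2] in \<open>auto simp: ae_eq_def\<close>)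
  then have "AE p in N. of_bool (P p) * V f p = of_bool (P p) * V (F i0) p"
    using l2_lim_const[OF PL] by (rule l2_lim_unique)
  moreover have "AE p in N. m p \<notin> {a..b} \<longrightarrow> V (F i0) p = 0"
    using supp[of i0] by (simp add: i0_def l_def)
  ultimately show ?thesis
    using null[of a] null[of b]
  proof eventually_elim
    case (elim p)
    have F0: "F i0 = E {a<..b} f" by (simp add: F_def S0)
    show ?case
    proof (cases "P p")
      case True
      then have "m p \<in> {a<..b}" by (simp add: P_def)
      then show ?thesis using elim(1) True F0 by simp
    next
      case False
      then have "m p \<notin> {a..b}" "m p \<notin> {a<..b}" using elim(3,4) by (auto simp: P_def)
      then show ?thesis using elim(2) F0 by simp
    qed
  qed
qed

end

subsection \<open>Smooth functions\<close>

lemma dir_deriv_eq: "(f has_derivative f') (at p) \<Longrightarrow> dir_deriv v f p = f' v"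
  using frechet_derivative_at[of f f' p] by (simp add: dir_deriv_def)

lemma smooth_differentiable: "smooth \<phi> \<Longrightarrow> \<phi> differentiable (at p)"
  by (erule smooth.cases) auto

lemma smooth_dir_deriv: "smooth \<phi> \<Longrightarrow> smooth (dir_deriv v \<phi>)"
  by (erule smooth.cases) auto

lemma smooth_const: "smooth (\<lambda>p. c)"
proof (coinduction arbitrary: c)
  case smooth
  have "dir_deriv v (\<lambda>p. c) = (\<lambda>p. 0)" for v :: 'a
    by (rule ext, rule dir_deriv_eq[where f' = "\<lambda>v. 0", THEN trans]) auto
  then show ?case by auto
qed

text \<open>The derivative of a product is a sum of products, so products alone are no invariant for
  the coinduction behind \<open>smooth\<close>. The closure under both operations is one, by
  \<open>smooth_alg_step\<close>.\<close>

inductive smooth_alg :: "('a::real_normed_vector \<Rightarrow> complex) \<Rightarrow> bool" where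
  base: "smooth f \<Longrightarrow> smooth_alg f"
| add: "smooth_alg f \<Longrightarrow> smooth_alg g \<Longrightarrow> smooth_alg (\<lambda>p. f p + g p)"
| mult: "smooth_alg f \<Longrightarrow> smooth_alg g \<Longrightarrow> smooth_alg (\<lambda>p. f p * g p)"

lemma smooth_alg_step: "smooth_alg f \<Longrightarrow> (\<forall>p. f differentiable (at p)) \<and> (\<forall>v. smooth_alg (dir_deriv v f))"
proof (induction rule: smooth_alg.induct)
  case (base f)
  then show ?case by (auto intro: smooth_alg.base smooth_differentiable smooth_dir_deriv)
next
  case (add f g)
  then have d: "(f has_derivative frechet_derivative f (at p)) (at p)" "(g has_derivative frechet_derivative g (at p)) (at p)" for p
    by (auto simp: frechet_derivative_works)
  have "dir_deriv v (\<lambda>p. f p + g p) = (\<lambda>p. dir_deriv v f p + dir_deriv v g p)" for v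
    using dir_deriv_eq[OF has_derivative_add[OF d]] by (auto simp: dir_deriv_def)
  then show ?case using add by (auto intro: smooth_alg.add)
next
  case (mult f g)
  then have d: "(f has_derivative frechet_derivative f (at p)) (at p)" "(g has_derivative frechet_derivative g (at p)) (at p)" for p
    by (auto simp: frechet_derivative_works)
  have "dir_deriv v (\<lambda>p. f p * g p) = (\<lambda>p. f p * dir_deriv v g p + dir_deriv v f p * g p)" for v
    using dir_deriv_eq[OF has_derivative_mult[OF d]] by (auto simp: dir_deriv_def)
  moreover have "smooth_alg (\<lambda>p. f p * dir_deriv v g p + dir_deriv v f p * g p)" for v
    using mult by (intro smooth_alg.add[OF smooth_alg.mult smooth_alg.mult]) auto
  moreover have "(\<lambda>p. f p * g p) differentiable (at p)" for p
    using has_derivative_mult[OF d] unfolding differentiable_def by blast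
  ultimately show ?case by simp
qed

lemma smooth_alg_smooth: "smooth_alg f \<Longrightarrow> smooth f"
proof (coinduction arbitrary: f)
  case smooth
  then show ?case using smooth_alg_step by blast
qed

lemma smooth_add: "smooth f \<Longrightarrow> smooth g \<Longrightarrow> smooth (\<lambda>p. f p + g p)"
  by (rule smooth_alg_smooth, rule smooth_alg.add) (auto intro: smooth_alg.base)

lemma smooth_mult: "smooth f \<Longrightarrow> smooth g \<Longrightarrow> smooth (\<lambda>p. f p * g p)"
  by (rule smooth_alg_smooth, rule smooth_alg.mult) (auto intro: smooth_alg.base)

lemma smooth_cmult: "smooth f \<Longrightarrow> smooth (\<lambda>p. c * f p)"
  by (rule smooth_mult[OF smooth_const])

lemma smooth_diff: "smooth f \<Longrightarrow> smooth g \<Longrightarrow> smooth (\<lambda>p. f p - g p)"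
  using smooth_add[OF _ smooth_cmult[of g "-1"]] by simp

text \<open>A directional derivative of the composite is again a composite, of the derivative of
  \<open>f\<close> along \<open>L v\<close>, so the coinduction closes.\<close>

lemma smooth_compose_affine:
  assumes "smooth f" "bounded_linear L" shows "smooth (\<lambda>p. f (L p + c))"
  using assms(1)
proof (coinduction arbitrary: f)
  case smooth
  have "((\<lambda>p. L p + c) has_derivative L) (at p)" for p
    using assms(2) by (auto intro!: derivative_eq_intros bounded_linear.has_derivative[of L "\<lambda>x. x" "\<lambda>x. x"])
  then have "((\<lambda>p. f (L p + c)) has_derivative (\<lambda>v. frechet_derivative f (at (L p + c)) (L v))) (at p)" for p
    using has_derivative_compose[of "\<lambda>p. L p + c" L p UNIV f "frechet_derivative f (at (L p + c))"]
      smooth_differentiable[OF smooth(1), of "L p + c"] by (simp add: frechet_derivative_works)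
  note d = this
  have "dir_deriv v (\<lambda>p. f (L p + c)) = (\<lambda>p. dir_deriv (L v) f (L p + c))" for v
    using dir_deriv_eq[OF d] by (auto simp: dir_deriv_def)
  moreover have "(\<lambda>p. f (L p + c)) differentiable (at p)" for p
    using d differentiable_def by blast
  ultimately show ?case using smooth_dir_deriv[OF smooth(1)] by blast
qed

lemma dir_deriv_vector: 
  fixes F :: "real \<Rightarrow> complex"
  assumes "(F has_vector_derivative f) (at x)" shows "dir_deriv v F x = of_real v * f"
  using dir_deriv_eq[OF assms[unfolded has_vector_derivative_def]] by (simp add: scaleR_conv_of_real)

lemma smooth_antiderivative:
  fixes F :: "real \<Rightarrow> complex"
  assumes "\<And>x. (F has_vector_derivative f x) (at x)" "smooth f" shows "smooth F"
proof (rule smooth.intros)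
  show "\<forall>p. F differentiable (at p)"
    using assms(1) by (auto simp: has_vector_derivative_def differentiable_def)
  have "dir_deriv v F = (\<lambda>x. of_real v * f x)" for v
    using dir_deriv_vector[OF assms(1)] by auto
  then show "\<forall>v. smooth (dir_deriv v F)" using smooth_cmult[OF assms(2)] by simp
qed

lemma smooth_of_derivative_sequence:
  fixes D :: "nat \<Rightarrow> real \<Rightarrow> complex"
  assumes D: "\<And>n x. (D n has_vector_derivative D (Suc n) x) (at x)"
  shows "smooth (D n)"
proof -
  \<comment> \<open>The constant is carried along because the derivative in direction
    \<open>v\<close> contributes a factor \<open>v\<close>.\<close>
  have "smooth (\<lambda>x. c * D n x)" for c n
  proof (coinduction arbitrary: c n)
    case smooth
    have d: "((\<lambda>x. c * D n x) has_vector_derivative c * D (Suc n) x) (at x)" for x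
      by (intro has_vector_derivative_mult_right D)
    have "dir_deriv v (\<lambda>x. c * D n x) = (\<lambda>x. (of_real v * c) * D (Suc n) x)" for v
      using dir_deriv_vector[OF d] by auto
    moreover have "(\<lambda>x. c * D n x) differentiable (at p)" for p
      using d by (auto simp: has_vector_derivative_def differentiable_def)
    ultimately show ?case by blast
  qed
  from this[of 1] show ?thesis by simp
qed

section \<open>The function \<open>exp(-1/x)\<close> and smooth steps\<close>

lemma poly_times_exp_minus_tendsto: "((\<lambda>u::real. poly p u * exp (- u)) \<longlongrightarrow> 0) at_top"
proof -
  have "((\<lambda>u. \<Sum>i\<le>degree p. coeff p i * (u ^ i / exp u)) \<longlongrightarrow> (\<Sum>i\<le>degree p. coeff p i * 0)) at_top"
    by (intro tendsto_sum tendsto_mult tendsto_const tendsto_power_div_exp_0)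
  then show ?thesis
    by (simp add: poly_altdef sum_distrib_right exp_minus field_simps sum_divide_distrib)
qed

text \<open>The derivative of \<open>p(1/x) exp(-1/x)\<close> is
  \<open>(1/x)^2 (p - p')(1/x) exp(-1/x)\<close>, whence the recursion.\<close>

fun flat_poly :: "nat \<Rightarrow> real poly" where
  "flat_poly 0 = 1"
| "flat_poly (Suc n) = [:0, 0, 1:] * (flat_poly n - pderiv (flat_poly n))"

definition flat :: "nat \<Rightarrow> real \<Rightarrow> real" where
  "flat n x = (if x > 0 then poly (flat_poly n) (1 / x) * exp (- (1 / x)) else 0)"

lemma flat_derivative: "(flat n has_real_derivative flat (Suc n) x) (at x)"
proof (cases "x = 0")
  case False
  show ?thesis
  proof (cases "x > 0")
    case True
    have "((\<lambda>x. poly (flat_poly n) (1 / x) * exp (- (1 / x))) has_real_derivative flat (Suc n) x) (at x)"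
      using True by (auto intro!: derivative_eq_intros simp: flat_def field_simps power2_eq_square)
    then show ?thesis
      by (rule has_field_derivative_transform_within[where d = x]) (use True in \<open>auto simp: flat_def dist_real_def\<close>)
  next
    case neg: False
    have "((\<lambda>x. 0) has_real_derivative flat (Suc n) x) (at x)" using neg by (simp add: flat_def)
    then show ?thesis
      by (rule has_field_derivative_transform_within[where d = "- x"]) (use False neg in \<open>auto simp: flat_def dist_real_def\<close>)
  qed
next
  case True
  \<comment> \<open>From the left the quotient is zero. From the right \<open>u = 1 / h\<close>
    turns it into a polynomial in \<open>u\<close> times \<open>exp (- u)\<close>, with
    \<open>u\<close> tending to infinity.\<close>
  have "((\<lambda>h. (flat n (0 + h) - flat n 0) / h) \<longlongrightarrow> 0) (at 0)"
  proof (rule filterlim_split_at)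
    show "((\<lambda>h. (flat n (0 + h) - flat n 0) / h) \<longlongrightarrow> 0) (at_left 0)"
      by (rule tendsto_eventually) (auto simp: eventually_at_filter flat_def)
    have "((\<lambda>h. poly ([:0, 1:] * flat_poly n) (inverse h) * exp (- inverse h)) \<longlongrightarrow> 0) (at_right (0::real))"
      by (rule filterlim_compose[OF poly_times_exp_minus_tendsto filterlim_inverse_at_top_right])
    then show "((\<lambda>h. (flat n (0 + h) - flat n 0) / h) \<longlongrightarrow> 0) (at_right 0)"
    proof (rule Lim_transform_eventually)
      show "\<forall>\<^sub>F h in at_right 0. poly ([:0, 1:] * flat_poly n) (inverse h) * exp (- inverse h) = (flat n (0 + h) - flat n 0) / h"
        unfolding eventually_at_filter by (auto simp: flat_def field_simps)
    qed
  qed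
  then show ?thesis using True by (simp add: has_field_derivative_iff flat_def)
qed

lemma has_vector_derivative_of_real':
  "(f has_real_derivative f') (at x) \<Longrightarrow> ((\<lambda>x. complex_of_real (f x)) has_vector_derivative of_real f') (at x)"
  using has_vector_derivative_of_real[of f f' "at x"]
  by (simp add: has_real_derivative_iff_has_vector_derivative)

lemma smooth_flat: "smooth (\<lambda>x. of_real (flat n x))"
  by (rule smooth_of_derivative_sequence[where D = "\<lambda>n x. of_real (flat n x)"])
     (rule has_vector_derivative_of_real'[OF flat_derivative])

lemma antiderivative_on_reals:
  fixes f :: "real \<Rightarrow> real"
  assumes "continuous_on UNIV f"
  obtains F where "\<And>x. (F has_real_derivative f x) (at x)" "F 0 = 0"
proof
  define F where "F u = (LBINT y=0..u. f y)" for u :: real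
  show "(F has_real_derivative f x) (at x)" for x
  proof -
    let ?b = "\<bar>x\<bar> + 1"
    have "((\<lambda>u. LBINT y=ereal 0..u. f y) has_vector_derivative f x) (at x within {-?b..?b})"
      by (rule interval_integral_FTC2) (use assms in \<open>auto intro: continuous_on_subset\<close>)
    then have "(F has_vector_derivative f x) (at x within {-?b..?b})"
      by (simp add: F_def[abs_def] zero_ereal_def)
    then have "(F has_vector_derivative f x) (at x)"
      by (subst (asm) at_within_interior) auto
    then show ?thesis by (simp add: has_real_derivative_iff_has_vector_derivative)
  qed
  show "F 0 = 0" by (simp add: F_def zero_ereal_def)
qed

text \<open>\<open>C\<close> is a smoothing of the ramp \<open>max 0 x\<close> and \<open>B\<close> is its derivative, a smooth step.\<close>

lemma smooth_step_exists:
  obtains B C :: "real \<Rightarrow> real" where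
    "smooth (\<lambda>x. of_real (B x))" "smooth (\<lambda>x. of_real (C x))"
    "\<And>x. (C has_real_derivative B x) (at x)"
    "\<And>x. 0 \<le> B x" "\<And>x. B x \<le> 1" "\<And>x. x \<le> 0 \<Longrightarrow> B x = 0" "\<And>x. x \<ge> 1 \<Longrightarrow> B x = 1"
    "\<And>x. x \<le> 0 \<Longrightarrow> C x = 0" "\<And>x. x \<ge> 1 \<Longrightarrow> C x = x - 1 + C 1"
proof -
  \<comment> \<open>A bump, positive exactly on the open unit interval; its normalized primitive
    \<open>B\<close> climbs from 0 to 1 there.\<close>
  define \<rho> where "\<rho> x = flat 0 x * flat 0 (1 - x)" for x
  have sm: "smooth (\<lambda>x. of_real (\<rho> x))"
  proof -
    have "smooth (\<lambda>x. complex_of_real (flat 0 ((- x) + 1)))"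
      by (rule smooth_compose_affine[OF smooth_flat[of 0]]) (intro bounded_linear_minus bounded_linear_ident)
    from smooth_mult[OF smooth_flat[of 0] this] show ?thesis by (simp add: \<rho>_def)
  qed
  have flat_c: "continuous_on UNIV (flat 0)"
    using flat_derivative[of 0] by (intro continuous_at_imp_continuous_on) (auto intro: DERIV_isCont)
  have "continuous_on UNIV \<rho>"
    unfolding \<rho>_def by (intro continuous_intros continuous_on_compose2[OF flat_c]) auto
  then obtain F where F: "\<And>x. (F has_real_derivative \<rho> x) (at x)" "F 0 = 0"
    using antiderivative_on_reals by blast
  have nonneg: "0 \<le> \<rho> x" for x by (simp add: \<rho>_def flat_def)
  have mono: "F x \<le> F y" if "x \<le> y" for x y
    by (rule DERIV_nonneg_imp_nondecreasing[OF that]) (use F(1) nonneg in blast)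
  have const: "F x = F y" if "x < y" "\<And>z. x < z \<Longrightarrow> z < y \<Longrightarrow> \<rho> z = 0" for x y
  proof -
    have "\<exists>z>x. z < y \<and> F y - F x = (y - x) * \<rho> z" by (rule MVT2[OF that(1)]) (rule F(1))
    then obtain z where z: "x < z" "z < y" "F y - F x = (y - x) * \<rho> z" by blast
    then show ?thesis using that(2)[OF z(1,2)] by simp
  qed
  have F0: "F x = 0" if "x \<le> 0" for x
    using const[of x 0] F(2) that by (cases "x = 0") (auto simp: \<rho>_def flat_def)
  have F1: "F x = F 1" if "x \<ge> 1" for x
    using const[of 1 x] that by (cases "x = 1") (auto simp: \<rho>_def flat_def)
  have "\<exists>z>0. z < 1 \<and> F 1 - F 0 = (1 - 0) * \<rho> z" by (rule MVT2) (simp_all add: F(1))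
  then obtain z where z: "0 < z" "z < 1" "F 1 - F 0 = (1 - 0) * \<rho> z" by blast
  then have pos: "F 1 > 0" using F(2) by (simp add: \<rho>_def flat_def)
  define B where "B x = F x / F 1" for x
  have F_sm: "smooth (\<lambda>x. of_real (F x))"
    by (rule smooth_antiderivative[OF has_vector_derivative_of_real'[OF F(1)] sm])
  have B_sm: "smooth (\<lambda>x. of_real (B x))"
    using smooth_cmult[OF F_sm, of "of_real (1 / F 1)"] by (simp add: B_def)
  have "continuous_on UNIV F"
    using F(1) by (intro continuous_at_imp_continuous_on) (auto intro: DERIV_isCont)
  then have "continuous_on UNIV B"
    unfolding B_def by (intro continuous_intros) (use pos in auto)
  then obtain C where C: "\<And>x. (C has_real_derivative B x) (at x)" "C 0 = 0"
    using antiderivative_on_reals by blast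
  have C_sm: "smooth (\<lambda>x. of_real (C x))"
    by (rule smooth_antiderivative[OF has_vector_derivative_of_real'[OF C(1)] B_sm])
  have C_eq: "C y - C x = (y - x) * c" if "x < y" "\<And>z. x < z \<Longrightarrow> z < y \<Longrightarrow> B z = c" for x y c
  proof -
    have "\<exists>z>x. z < y \<and> C y - C x = (y - x) * B z" by (rule MVT2[OF that(1)]) (rule C(1))
    then obtain z where z: "x < z" "z < y" "C y - C x = (y - x) * B z" by blast
    then show ?thesis using that(2)[OF z(1,2)] by simp
  qed
  show ?thesis
  proof
    show "0 \<le> B x" for x using F0[of x] mono[of 0 x] pos F(2) by (cases "x \<le> 0") (auto simp: B_def)
    show "B x \<le> 1" for x using F1[of x] mono[of x 1] pos by (cases "x \<ge> 1") (auto simp: B_def)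
    show "B x = 0" if "x \<le> 0" for x using F0[OF that] by (simp add: B_def)
    show "B x = 1" if "x \<ge> 1" for x using F1[OF that] pos by (simp add: B_def)
    show "C x = 0" if "x \<le> 0" for x
      using C_eq[of x 0 0] F0 C(2) that by (cases "x = 0") (auto simp: B_def)
    have B1: "B z = 1" if "z > 1" for z using F1[of z] pos that by (simp add: B_def)
    show "C x = x - 1 + C 1" if "x \<ge> 1" for x
      using C_eq[of 1 x 1] B1 that by (cases "x = 1") simp_all
  qed (use B_sm C_sm C in auto)
qed

subsection \<open>Limits of test functions\<close>

text \<open>For \<open>p1 < q1\<close> and \<open>p2 < q2\<close>, taking \<open>H = step\<close>
  gives \<open>w1\<close> times the indicator of \<open>{p1<..q1}\<close> plus \<open>w2\<close>
  times that of \<open>{p2<..q2}\<close>. With \<open>H = ramp\<close> one gets its primitive, equal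
  to \<open>w1 (q1 - p1) + w2 (q2 - p2)\<close> on the far right and so compactly supported when
  this number is zero. Smoothed versions use the same template.\<close>

definition comb :: "real \<Rightarrow> real \<Rightarrow> real \<Rightarrow> real \<Rightarrow> real \<Rightarrow> real \<Rightarrow> (real \<Rightarrow> real) \<Rightarrow> real \<Rightarrow> real" where
  "comb w1 p1 q1 w2 p2 q2 H s = w1 * (H (s - p1) - H (s - q1)) + w2 * (H (s - p2) - H (s - q2))"

definition step :: "real \<Rightarrow> real" where "step s = of_bool (s > 0)"
definition ramp :: "real \<Rightarrow> real" where "ramp s = max 0 s"

lemma strip_sigma_finite: "pair_sigma_finite (restrict_space lborel {\<alpha>..\<beta>::real}) (lborel :: real measure)"
proof (rule pair_sigma_finite_lborel)
  interpret finite_measure "restrict_space lborel {\<alpha>..\<beta>}" by (rule finite_measure_restrict_interval)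
  show "sigma_finite_measure (restrict_space lborel {\<alpha>..\<beta>})" by unfold_locales
qed

lemma space_strip: "space (strip_measure \<alpha> \<beta>) = {\<alpha>..\<beta>} \<times> UNIV"
  by (simp add: strip_measure_def space_pair_measure space_restrict_space)

lemma sets_strip_borel: "f \<in> borel_measurable borel \<Longrightarrow> f \<in> borel_measurable (strip_measure \<alpha> \<beta>)"
proof -
  assume f: "f \<in> borel_measurable borel"
  have "(\<lambda>x. x) \<in> restrict_space lborel {\<alpha>..\<beta>} \<rightarrow>\<^sub>M (borel :: real measure)"
    by (rule borel_measurable_restrict_lborel) simp
  note [measurable] = measurable_compose[OF measurable_fst this]
  have "(\<lambda>p. (fst p, snd p)) \<in> strip_measure \<alpha> \<beta> \<rightarrow>\<^sub>M borel \<Otimes>\<^sub>M borel"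
    unfolding strip_measure_def by measurable
  then have "(\<lambda>p. p) \<in> strip_measure \<alpha> \<beta> \<rightarrow>\<^sub>M borel"
    by (simp add: borel_prod)
  from measurable_compose[OF this f] show ?thesis by simp
qed

lemma L2_strip_bounded:
  assumes "h \<in> borel_measurable (strip_measure \<alpha> \<beta>)" and "\<And>p. cmod (h p) \<le> K" "\<And>p. \<bar>snd p\<bar> > R \<Longrightarrow> h p = 0"
  shows "h \<in> L2 (strip_measure \<alpha> \<beta>)"
proof (rule L2_I[OF assms(1)])
  interpret pair_sigma_finite "restrict_space lborel {\<alpha>..\<beta>}" "lborel :: real measure" by (rule strip_sigma_finite)
  have "integrable lborel (indicat_real {-R..R})"
    by (rule integrable_real_indicator) (auto simp: emeasure_lborel_Icc_eq)
  then have "integrable (restrict_space lborel {\<alpha>..\<beta>} \<Otimes>\<^sub>M lborel) (\<lambda>p. K\<^sup>2 * indicator {-R..R} (snd p))"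
    by (intro Fubini_integrable) (auto simp: finite_measure.integrable_const[OF finite_measure_restrict_interval])
  then show "integrable (strip_measure \<alpha> \<beta>) (\<lambda>p. (cmod (h p))\<^sup>2)"
    unfolding strip_measure_def
  proof (rule Bochner_Integration.integrable_bound)
    show "(\<lambda>p. (cmod (h p))\<^sup>2) \<in> borel_measurable (restrict_space lborel {\<alpha>..\<beta>} \<Otimes>\<^sub>M lborel)"
      using assms(1) unfolding strip_measure_def by measurable
    show "AE p in restrict_space lborel {\<alpha>..\<beta>} \<Otimes>\<^sub>M lborel. norm ((cmod (h p))\<^sup>2) \<le> norm (K\<^sup>2 * indicator {-R..R} (snd p))"
    proof (rule AE_I2)
      fix p :: "real \<times> real"
      show "norm ((cmod (h p))\<^sup>2) \<le> norm (K\<^sup>2 * indicator {-R..R} (snd p))"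
      proof (cases "\<bar>snd p\<bar> > R")
        case False
        have "(cmod (h p))\<^sup>2 \<le> K\<^sup>2" using assms(2)[of p] by (intro power_mono) auto
        moreover have "snd p \<in> {-R..R}" using False by auto
        ultimately show ?thesis by simp
      qed (use assms(3) in simp)
    qed
  qed
qed

text \<open>A constant times the indicator of \<open>|y| \<le> R\<close> is in \<open>L2\<close>
  because the strip has finite width; its product with \<open>f\<close> is the integrable
  majorant.\<close>

lemma strip_integral_tendsto:
  fixes h :: "nat \<Rightarrow> real \<times> real \<Rightarrow> complex"
  assumes f: "f \<in> L2 (strip_measure \<alpha> \<beta>)"
    and h: "\<And>n. h n \<in> borel_measurable (strip_measure \<alpha> \<beta>)" "\<And>n p. cmod (h n p) \<le> K" "\<And>n p. \<bar>snd p\<bar> > R \<Longrightarrow> h n p = 0"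
    and lim: "\<And>p. (\<lambda>n. h n p) \<longlonglongrightarrow> h0 p" "h0 \<in> borel_measurable (strip_measure \<alpha> \<beta>)"
  shows "(\<lambda>n. LINT p|strip_measure \<alpha> \<beta>. f p * h n p) \<longlonglongrightarrow> (LINT p|strip_measure \<alpha> \<beta>. f p * h0 p)"
proof (rule integral_dominated_convergence)
  have [measurable]: "f \<in> borel_measurable (strip_measure \<alpha> \<beta>)" using f by auto
  note [measurable] = h(1) lim(2)
  show "(\<lambda>p. f p * h0 p) \<in> borel_measurable (strip_measure \<alpha> \<beta>)" "(\<lambda>p. f p * h n p) \<in> borel_measurable (strip_measure \<alpha> \<beta>)" for n
    by measurable
  define D where "D p = complex_of_real (K * indicator {-R..R} (snd p))" for p :: "real \<times> real"
  have "D \<in> L2 (strip_measure \<alpha> \<beta>)"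
  proof (rule L2_strip_bounded[where K = "\<bar>K\<bar>" and R = R])
    show "D \<in> borel_measurable (strip_measure \<alpha> \<beta>)"
      unfolding D_def[abs_def] strip_measure_def by measurable
  qed (auto simp: D_def indicator_def)
  from integrable_norm[OF L2_prod_integrable[OF f this]]
  show "integrable (strip_measure \<alpha> \<beta>) (\<lambda>p. norm (f p * D p))" .
  show "AE p in strip_measure \<alpha> \<beta>. (\<lambda>n. f p * h n p) \<longlonglongrightarrow> f p * h0 p"
    by (intro AE_I2 tendsto_mult tendsto_const lim)
  have "cmod (h n p) \<le> cmod (D p)" for n p
  proof (cases "\<bar>snd p\<bar> > R")
    case False
    then have "snd p \<in> {-R..R}" by auto
    then have "cmod (D p) = \<bar>K\<bar>" by (simp add: D_def)
    then show ?thesis using h(2)[of n p] by simp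
  qed (simp add: h(3))
  then show "AE p in strip_measure \<alpha> \<beta>. norm (f p * h n p) \<le> norm (f p * D p)" for n
    by (intro AE_I2) (simp add: norm_mult mult_left_mono)
qed

text \<open>\<open>B\<close> and \<open>C\<close> of \<open>smooth_step_exists\<close> compressed by
  the factor \<open>Suc n\<close>. Past \<open>1 / Suc n\<close> only differences of
  \<open>Cn\<close> are specified, which is enough because \<open>comb\<close> uses \<open>H\<close>
  through differences.\<close>

lemma smooth_steps_exist:
  obtains Bn Cn :: "nat \<Rightarrow> real \<Rightarrow> real" where
    "\<And>n. smooth (\<lambda>x. of_real (Bn n x))" "\<And>n. smooth (\<lambda>x. of_real (Cn n x))"
    "\<And>n x. (Cn n has_real_derivative Bn n x) (at x)"
    "\<And>n x. 0 \<le> Bn n x" "\<And>n x. Bn n x \<le> 1"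
    "\<And>n x. x \<le> 0 \<Longrightarrow> Bn n x = 0" "\<And>n x. x \<ge> 1 / Suc n \<Longrightarrow> Bn n x = 1"
    "\<And>n x. x \<le> 0 \<Longrightarrow> Cn n x = 0"
    "\<And>n x y. x \<ge> 1 / Suc n \<Longrightarrow> y \<ge> 1 / Suc n \<Longrightarrow> Cn n x - Cn n y = x - y"
proof -
  obtain B C :: "real \<Rightarrow> real" where
    sm: "smooth (\<lambda>x. of_real (B x))" "smooth (\<lambda>x. of_real (C x))"
    and der: "\<And>x. (C has_real_derivative B x) (at x)"
    and B: "\<And>x. 0 \<le> B x" "\<And>x. B x \<le> 1" "\<And>x. x \<le> 0 \<Longrightarrow> B x = 0" "\<And>x. x \<ge> 1 \<Longrightarrow> B x = 1"
    and C: "\<And>x. x \<le> 0 \<Longrightarrow> C x = 0" "\<And>x. x \<ge> 1 \<Longrightarrow> C x = x - 1 + C 1"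
    by (rule smooth_step_exists) (rule that)
  have scale: "smooth (\<lambda>x. of_real (H (real (Suc n) * x)))" if "smooth (\<lambda>x. of_real (H x))" for H n
    using smooth_compose_affine[OF that bounded_linear_mult_right[of "real (Suc n)"], of 0] by simp
  show ?thesis
  proof (rule that[of "\<lambda>n x. B (real (Suc n) * x)" "\<lambda>n x. C (real (Suc n) * x) / real (Suc n)"])
    show "smooth (\<lambda>x. of_real (B (real (Suc n) * x)))" for n by (rule scale[OF sm(1)])
    show "smooth (\<lambda>x. of_real (C (real (Suc n) * x) / real (Suc n)))" for n
      using smooth_cmult[OF scale[OF sm(2), of n], of "of_real (1 / real (Suc n))"]
      by (simp add: field_simps del: of_nat_Suc)
    show "((\<lambda>x. C (real (Suc n) * x) / real (Suc n)) has_real_derivative B (real (Suc n) * x)) (at x)" for n x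
    proof -
      have "((\<lambda>x. C (real (Suc n) * x)) has_real_derivative B (real (Suc n) * x) * real (Suc n)) (at x)"
        by (rule DERIV_chain2[OF der]) (auto intro!: derivative_eq_intros)
      from DERIV_cdivide[OF this, of "real (Suc n)"] show ?thesis by simp
    qed
    show "x \<le> 0 \<Longrightarrow> B (real (Suc n) * x) = 0" "x \<le> 0 \<Longrightarrow> C (real (Suc n) * x) / real (Suc n) = 0" for n x
      using B(3) C(1) by (simp_all add: mult_nonneg_nonpos)
    have ge: "1 / real (Suc n) \<le> x \<Longrightarrow> 1 \<le> real (Suc n) * x" for n x
      by (simp add: field_simps del: of_nat_Suc)
    show "1 / real (Suc n) \<le> x \<Longrightarrow> B (real (Suc n) * x) = 1" for n x
      using B(4)[OF ge] .
    fix n x y assume x: "1 / real (Suc n) \<le> x" and y: "1 / real (Suc n) \<le> y"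
    have "C (real (Suc n) * x) - C (real (Suc n) * y) = real (Suc n) * (x - y)"
      unfolding C(2)[OF ge[OF x]] C(2)[OF ge[OF y]] by (simp add: algebra_simps)
    then show "C (real (Suc n) * x) / real (Suc n) - C (real (Suc n) * y) / real (Suc n) = x - y"
      by (simp add: diff_divide_distrib[symmetric] del: of_nat_Suc)
  qed (use B in auto)
qed

lemma test_function_product:
  assumes a: "smooth (\<lambda>x. of_real (a x))" "\<And>s. s \<notin> {A1..A2} \<Longrightarrow> a s = 0" and A: "{A1..A2} \<subseteq> {\<alpha><..<\<beta>}"
    and b: "smooth (\<lambda>x. of_real (b x))" "\<And>s. s \<notin> {B1..B2} \<Longrightarrow> b s = 0"
  shows "test_function ({\<alpha><..<\<beta>} \<times> UNIV) (\<lambda>z::real \<times> real. of_real (a (fst z) * b (snd z)))"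
  unfolding test_function_def
proof (intro conjI)
  let ?S = "{z::real \<times> real. complex_of_real (a (fst z) * b (snd z)) \<noteq> 0}"
  show "smooth (\<lambda>z::real \<times> real. of_real (a (fst z) * b (snd z)))"
    using smooth_mult[OF smooth_compose_affine[OF a(1) bounded_linear_fst, of 0] smooth_compose_affine[OF b(1) bounded_linear_snd, of 0]]
    by simp
  have "?S \<subseteq> {A1..A2} \<times> {B1..B2}"
  proof
    fix z assume "z \<in> ?S"
    then have "a (fst z) \<noteq> 0" "b (snd z) \<noteq> 0" by auto
    then have "fst z \<in> {A1..A2}" "snd z \<in> {B1..B2}" using a(2) b(2) by blast+
    then show "z \<in> {A1..A2} \<times> {B1..B2}" by (simp only: mem_Times_iff)
  qed
  then have *: "closure ?S \<subseteq> {A1..A2} \<times> {B1..B2}"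
    by (rule closure_minimal) (intro closed_Times closed_atLeastAtMost)
  then show "closure ?S \<subseteq> {\<alpha><..<\<beta>} \<times> UNIV"
    using A by blast
  have "compact (({A1..A2} \<times> {B1..B2}) \<inter> closure ?S)" by (intro compact_Int_closed compact_Times compact_Icc closed_closure)
  then show "compact (closure ?S)"
    using * by (simp add: Int_absorb1)
qed

lemma dir_deriv_product:
  assumes a: "\<And>s. (a has_real_derivative a' s) (at s)" and b: "\<And>s. (b has_real_derivative b' s) (at s)"
  shows "dir_deriv (v1, v2) (\<lambda>z::real \<times> real. complex_of_real (a (fst z) * b (snd z))) z
    = of_real (v1 * (a' (fst z) * b (snd z)) + v2 * (a (fst z) * b' (snd z)))"
proof -
  have 1: "((\<lambda>z. a (fst z)) has_derivative (\<lambda>v. a' (fst z) * fst v)) (at z)"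
    using has_derivative_compose[OF has_derivative_fst[OF has_derivative_ident] a[of "fst z", unfolded has_field_derivative_def]]
    by simp
  have 2: "((\<lambda>z. b (snd z)) has_derivative (\<lambda>v. b' (snd z) * snd v)) (at z)"
    using has_derivative_compose[OF has_derivative_snd[OF has_derivative_ident] b[of "snd z", unfolded has_field_derivative_def]]
    by simp
  show ?thesis
    using dir_deriv_eq[OF has_derivative_of_real[OF has_derivative_mult[OF 1 2]], of "(v1, v2)"]
    by (simp add: algebra_simps)
qed

lemma smooth_comb:
  assumes "smooth (\<lambda>x. of_real (H x))" shows "smooth (\<lambda>x. of_real (comb w1 p1 q1 w2 p2 q2 H x))"
proof -
  have s: "smooth (\<lambda>x. of_real (H (x - c)))" for c
    using smooth_compose_affine[OF assms bounded_linear_ident, of "- c"] by simp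
  have "smooth (\<lambda>x. of_real w1 * (of_real (H (x - p1)) - of_real (H (x - q1))) + of_real w2 * (of_real (H (x - p2)) - of_real (H (x - q2))))"
    by (rule smooth_add; rule smooth_cmult; rule smooth_diff; rule s)
  then show ?thesis by (simp add: comb_def)
qed

lemma comb_derivative:
  assumes "\<And>x. (H has_real_derivative H' x) (at x)"
  shows "(comb w1 p1 q1 w2 p2 q2 H has_real_derivative comb w1 p1 q1 w2 p2 q2 H' x) (at x)"
proof -
  have "((\<lambda>x. H (x - c)) has_real_derivative H' (x - c)) (at x)" for c
    using DERIV_chain2[OF assms, of "\<lambda>x. x - c" 1 x UNIV] DERIV_ident[THEN DERIV_diff[OF _ DERIV_const[of c]], of x UNIV]
    by simp
  note [derivative_intros] = this
  show ?thesis unfolding comb_def[abs_def]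
    by (auto intro!: derivative_eq_intros)
qed

lemma comb_step_single: "p < q \<Longrightarrow> comb 1 p q 0 p q step s = of_bool (p < s \<and> s \<le> q)"
  by (auto simp: comb_def step_def)

lemma borel_measurable_comb [measurable]:
  assumes [measurable]: "H \<in> borel_measurable borel" shows "comb w1 p1 q1 w2 p2 q2 H \<in> borel_measurable borel"
  unfolding comb_def[abs_def] by measurable

lemma borel_measurable_step [measurable]: "step \<in> borel_measurable borel"
proof -
  have "(\<lambda>s. if s > 0 then 1 else 0 :: real) \<in> borel_measurable (borel :: real measure)" by measurable
  then show ?thesis by (simp add: step_def[abs_def] of_bool_def)
qed

lemma borel_measurable_ramp [measurable]: "ramp \<in> borel_measurable borel"
  unfolding ramp_def[abs_def] by measurable

lemma comb_abs_le:
  assumes "\<And>s t. \<bar>H s - H t\<bar> \<le> K"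
  shows "\<bar>comb w1 p1 q1 w2 p2 q2 H s\<bar> \<le> (\<bar>w1\<bar> + \<bar>w2\<bar>) * K"
proof -
  have "\<bar>comb w1 p1 q1 w2 p2 q2 H s\<bar> \<le> \<bar>w1\<bar> * \<bar>H (s - p1) - H (s - q1)\<bar> + \<bar>w2\<bar> * \<bar>H (s - p2) - H (s - q2)\<bar>"
    unfolding comb_def by (metis abs_mult abs_triangle_ineq)
  also have "\<dots> \<le> \<bar>w1\<bar> * K + \<bar>w2\<bar> * K" by (intro add_mono mult_left_mono assms) auto
  finally show ?thesis by (simp add: distrib_right)
qed

lemma comb_abs_le_lipschitz:
  assumes "\<And>s t. \<bar>H s - H t\<bar> \<le> \<bar>s - t\<bar>"
  shows "\<bar>comb w1 p1 q1 w2 p2 q2 H s\<bar> \<le> \<bar>w1\<bar> * \<bar>q1 - p1\<bar> + \<bar>w2\<bar> * \<bar>q2 - p2\<bar>"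
proof -
  have "\<bar>comb w1 p1 q1 w2 p2 q2 H s\<bar> \<le> \<bar>w1\<bar> * \<bar>H (s - p1) - H (s - q1)\<bar> + \<bar>w2\<bar> * \<bar>H (s - p2) - H (s - q2)\<bar>"
    unfolding comb_def by (metis abs_mult abs_triangle_ineq)
  also have "\<dots> \<le> \<bar>w1\<bar> * \<bar>(s - p1) - (s - q1)\<bar> + \<bar>w2\<bar> * \<bar>(s - p2) - (s - q2)\<bar>"
    by (intro add_mono mult_left_mono assms) auto
  finally show ?thesis by simp
qed

lemma comb_tendsto:
  "(\<And>s. (\<lambda>n. Hn n s) \<longlonglongrightarrow> H s) \<Longrightarrow> (\<lambda>n. comb w1 p1 q1 w2 p2 q2 (Hn n) s) \<longlonglongrightarrow> comb w1 p1 q1 w2 p2 q2 H s"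
  unfolding comb_def by (intro tendsto_intros) auto

text \<open>Testing against products of a smoothed piecewise linear function of one variable and
  a smoothed indicator function of the other, and removing the smoothing.\<close>

lemma weak_deriv_comb:
  assumes f: "f \<in> L2 (strip_measure \<alpha> \<beta>)" and f': "f' \<in> L2 (strip_measure \<alpha> \<beta>)"
    and pq: "p1 < q1" "p2 < q2" and w: "w1 * (q1 - p1) + w2 * (q2 - p2) = 0" and cd: "c < d"
  shows "weak_deriv \<alpha> \<beta> (1, 0) f f' \<Longrightarrow> \<alpha> < p1 \<Longrightarrow> \<alpha> < p2 \<Longrightarrow> q1 < \<beta> \<Longrightarrow> q2 < \<beta> \<Longrightarrow>
      (LINT z|strip_measure \<alpha> \<beta>. f z * of_real (comb w1 p1 q1 w2 p2 q2 step (fst z) * comb 1 c d 0 c d step (snd z)))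
      = - (LINT z|strip_measure \<alpha> \<beta>. f' z * of_real (comb w1 p1 q1 w2 p2 q2 ramp (fst z) * comb 1 c d 0 c d step (snd z)))"
    and "weak_deriv \<alpha> \<beta> (0, 1) f f' \<Longrightarrow> \<alpha> < c \<Longrightarrow> d < \<beta> \<Longrightarrow>
      (LINT z|strip_measure \<alpha> \<beta>. f z * of_real (comb 1 c d 0 c d step (fst z) * comb w1 p1 q1 w2 p2 q2 step (snd z)))
      = - (LINT z|strip_measure \<alpha> \<beta>. f' z * of_real (comb 1 c d 0 c d step (fst z) * comb w1 p1 q1 w2 p2 q2 ramp (snd z)))"
proof -
  obtain Bn Cn :: "nat \<Rightarrow> real \<Rightarrow> real" where
    sm: "\<And>n. smooth (\<lambda>x. of_real (Bn n x))" "\<And>n. smooth (\<lambda>x. of_real (Cn n x))"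
    and der: "\<And>n x. (Cn n has_real_derivative Bn n x) (at x)"
    and B: "\<And>n x. 0 \<le> Bn n x" "\<And>n x. Bn n x \<le> 1" "\<And>n x. x \<le> 0 \<Longrightarrow> Bn n x = 0" "\<And>n x. x \<ge> 1 / Suc n \<Longrightarrow> Bn n x = 1"
    and C: "\<And>n x. x \<le> 0 \<Longrightarrow> Cn n x = 0" "\<And>n x y. x \<ge> 1 / Suc n \<Longrightarrow> y \<ge> 1 / Suc n \<Longrightarrow> Cn n x - Cn n y = x - y"
    by (rule smooth_steps_exist) (rule that)
  have Clip: "\<bar>Cn n s - Cn n t\<bar> \<le> \<bar>s - t\<bar>" for n s t
  proof -
    have "norm (Cn n s - Cn n t) \<le> 1 * norm (s - t)"
      by (rule field_differentiable_bound[of UNIV "Cn n" "Bn n"]) (use der B in auto)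
    then show ?thesis by simp
  qed
  have Bbd: "\<bar>Bn n s - Bn n t\<bar> \<le> 1" for n s t
    using B(1,2)[of n s] B(1,2)[of n t] by linarith
  have small: "\<exists>n0. \<forall>n\<ge>n0. 1 / Suc n < e" if "e > 0" for e :: real
    using LIMSEQ_inverse_real_of_nat[THEN order_tendstoD(2), OF that] by (simp add: eventually_sequentially inverse_eq_divide)
  have Blim: "(\<lambda>n. Bn n s) \<longlonglongrightarrow> step s" for s
  proof (cases "s \<le> 0")
    case True then show ?thesis by (simp add: B(3) step_def)
  next
    case False
    then obtain n0 where "\<forall>n\<ge>n0. 1 / Suc n < s" using small[of s] by auto
    then have "\<forall>\<^sub>F n in sequentially. Bn n s = step s"
      unfolding eventually_sequentially using False B(4) by (intro exI[of _ n0]) (auto simp: step_def less_imp_le)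
    then show ?thesis by (rule tendsto_eventually)
  qed
  have Clim: "(\<lambda>n. Cn n s) \<longlonglongrightarrow> ramp s" for s
  proof (cases "s \<le> 0")
    case True then show ?thesis by (simp add: C(1) ramp_def)
  next
    case False
    have "(\<lambda>n. Cn n (1 / Suc n)) \<longlonglongrightarrow> 0"
    proof (rule LIMSEQ_0_squeeze)
      show "norm (Cn n (1 / Suc n)) \<le> 1 / Suc n" for n
        using Clip[of n "1 / Suc n" 0] C(1)[of 0 n] by simp
      show "(\<lambda>n. 1 / real (Suc n)) \<longlonglongrightarrow> 0"
        using LIMSEQ_inverse_real_of_nat by (simp add: inverse_eq_divide)
    qed
    then have "(\<lambda>n. Cn n (1 / Suc n) + s - 1 / real (Suc n)) \<longlonglongrightarrow> 0 + s - 0"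
      using LIMSEQ_inverse_real_of_nat by (intro tendsto_intros) (auto simp: inverse_eq_divide)
    moreover obtain n0 where n0: "\<forall>n\<ge>n0. 1 / Suc n < s" using small[of s] False by auto
    have "\<forall>\<^sub>F n in sequentially. Cn n (1 / Suc n) + s - 1 / real (Suc n) = Cn n s"
      unfolding eventually_sequentially
    proof (intro exI[of _ n0] allI impI)
      fix n assume "n \<ge> n0"
      then have "1 / Suc n \<le> s" using n0 by (simp add: less_imp_le)
      from C(2)[OF this order_refl] show "Cn n (1 / Suc n) + s - 1 / real (Suc n) = Cn n s" by linarith
    qed
    ultimately have "(\<lambda>n. Cn n s) \<longlonglongrightarrow> 0 + s - 0" by (rule Lim_transform_eventually)
    then show ?thesis using False by (simp add: ramp_def)
  qed
  let ?u = "comb w1 p1 q1 w2 p2 q2" and ?i = "comb 1 c d 0 c d"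
  have inv1: "1 / real (Suc n) \<le> 1" for n by simp
  \<comment> \<open>Right of the supports the smoothed primitive has the constant value
    \<open>w1 (q1 - p1) + w2 (q2 - p2)\<close>, which hypothesis \<open>w\<close> makes zero. The
    extra \<open>1 / Suc n\<close> is the width of the smoothing.\<close>
  have u0: "?u (Bn n) s = 0" "?u (Cn n) s = 0" if "s \<notin> {min p1 p2..max q1 q2 + 1 / Suc n}" for n s
  proof -
    have "?u (Bn n) s = 0 \<and> ?u (Cn n) s = 0"
    proof (cases "s < min p1 p2")
      case True
      then show ?thesis using pq by (simp add: comb_def B(3) C(1))
    next
      case False
      then have s: "s > max q1 q2 + 1 / Suc n" using that by auto
      then have ge: "1 / Suc n \<le> s - q1" "1 / Suc n \<le> s - q2" "1 / Suc n \<le> s - p1" "1 / Suc n \<le> s - p2"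
        using pq by auto
      have "?u (Cn n) s = w1 * (q1 - p1) + w2 * (q2 - p2)"
        unfolding comb_def C(2)[OF ge(3,1)] C(2)[OF ge(4,2)] by simp
      then show ?thesis using w ge by (simp add: comb_def B(4))
    qed
    then show "?u (Bn n) s = 0" "?u (Cn n) s = 0" by auto
  qed
  have i0: "?i (Bn n) s = 0" if "s \<notin> {c..d + 1 / Suc n}" for n s
  proof (cases "s < c")
    case True
    then show ?thesis using cd by (simp add: comb_def B(3))
  next
    case False
    then have "1 / Suc n \<le> s - c" "1 / Suc n \<le> s - d" using that cd by auto
    then show ?thesis by (simp add: comb_def B(4))
  qed
  define K where "K = (\<bar>w1\<bar> + \<bar>w2\<bar>) * 1 + (\<bar>w1\<bar> * \<bar>q1 - p1\<bar> + \<bar>w2\<bar> * \<bar>q2 - p2\<bar>)"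
  define R where "R = \<bar>c\<bar> + \<bar>d\<bar> + \<bar>p1\<bar> + \<bar>p2\<bar> + \<bar>q1\<bar> + \<bar>q2\<bar> + 1"
  have uB: "\<bar>?u (Bn n) s\<bar> \<le> K" for n s
    using comb_abs_le[of "Bn n" 1, OF Bbd, of w1 p1 q1 w2 p2 q2 s] unfolding K_def by (smt (verit) mult_nonneg_nonneg abs_ge_zero)
  have uC: "\<bar>?u (Cn n) s\<bar> \<le> K" for n s
    using comb_abs_le_lipschitz[of "Cn n", OF Clip, of w1 p1 q1 w2 p2 q2 s] unfolding K_def by (smt (verit) mult_nonneg_nonneg abs_ge_zero)
  have iB: "\<bar>?i (Bn n) s\<bar> \<le> 1" for n s
    using comb_abs_le[of "Bn n" 1, OF Bbd, of 1 c d 0 c d s] by simp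
  have K0: "K \<ge> 0" by (simp add: K_def)
  have bd: "\<bar>x * y\<bar> \<le> K" if "\<bar>x\<bar> \<le> K" "\<bar>y\<bar> \<le> 1" for x y
    using mult_mono[OF that K0] by (simp add: abs_mult)
  have far: "\<bar>s\<bar> > R \<Longrightarrow> s \<notin> {min p1 p2..max q1 q2 + 1 / Suc n} \<and> s \<notin> {c..d + 1 / Suc n}" for s n
  proof -
    assume s: "\<bar>s\<bar> > R"
    define e where "e = 1 / real (Suc n)"
    have "e \<le> 1" using inv1[of n] by (simp add: e_def)
    then show ?thesis using s unfolding R_def e_def[symmetric] by auto
  qed
  have cont: "continuous_on UNIV (Bn n)" "continuous_on UNIV (Cn n)" for n
  proof -
    have "continuous_on UNIV (\<lambda>x. Re (complex_of_real (Bn n x)))"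
      using smooth_differentiable[OF sm(1)[of n]]
      by (intro continuous_on_Re continuous_at_imp_continuous_on) (auto intro: differentiable_imp_continuous_within)
    then show "continuous_on UNIV (Bn n)" by simp
    show "continuous_on UNIV (Cn n)"
      using der by (intro continuous_at_imp_continuous_on) (auto intro: DERIV_isCont)
  qed
  have [measurable]: "Bn n \<in> borel_measurable borel" "Cn n \<in> borel_measurable borel" for n
    using cont by (auto intro: borel_measurable_continuous_onI)
  have meas: "(\<lambda>z. complex_of_real (F (fst z) * G (snd z))) \<in> borel_measurable (strip_measure \<alpha> \<beta>)"
    if [measurable]: "F \<in> borel_measurable borel" "G \<in> borel_measurable borel" for F G
  proof -
    have "(\<lambda>z :: real \<times> real. complex_of_real (F (fst z) * G (snd z))) \<in> borel_measurable (borel \<Otimes>\<^sub>M borel)" by measurable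
    then show ?thesis unfolding borel_prod by (rule sets_strip_borel)
  qed
  have ud: "(?u (Cn n) has_real_derivative ?u (Bn n) s) (at s)" for n s
    by (rule comb_derivative[OF der])
  \<comment> \<open>The factor of the other variable enters with direction component 0, but
    \<open>dir_deriv_product\<close> still asks for some derivative of it.\<close>
  have bdiff: "\<exists>H'. \<forall>s. (?i (Bn n) has_real_derivative H' s) (at s)" for n
  proof -
    have "\<exists>H'. \<forall>s. (Bn n has_real_derivative H' s) (at s)"
    proof -
      have "Bn n differentiable (at s)" for s
      proof -
        obtain D where "((\<lambda>x. complex_of_real (Bn n x)) has_derivative D) (at s)"
          using smooth_differentiable[OF sm(1)[of n], of s] unfolding differentiable_def by blast
        from bounded_linear.has_derivative[OF bounded_linear_Re this] show ?thesis
          by (auto simp: differentiable_def)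
      qed
      then show ?thesis unfolding real_differentiable_def by metis
    qed
    then show ?thesis using comb_derivative by blast
  qed
  have lim_prod: "(\<lambda>n. complex_of_real (x n * y n)) \<longlonglongrightarrow> of_real (x0 * y0)" if "x \<longlonglongrightarrow> x0" "y \<longlonglongrightarrow> y0" for x y x0 y0
    using that by (intro tendsto_intros)
  have concl: "l = - l'" if "(\<lambda>n. x n) \<longlonglongrightarrow> l" "(\<lambda>n. y n) \<longlonglongrightarrow> l'" "\<exists>n0. \<forall>n\<ge>n0. x n = - y n"
    for x y :: "nat \<Rightarrow> complex" and l l'
  proof (rule LIMSEQ_unique[OF that(1)])
    have "(\<lambda>n. - y n) \<longlonglongrightarrow> - l'" using that(2) by (rule tendsto_minus)
    then show "x \<longlonglongrightarrow> - l'"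
      by (rule Lim_transform_eventually) (use that(3) in \<open>unfold eventually_sequentially, metis\<close>)
  qed
  {
    assume wd: "weak_deriv \<alpha> \<beta> (1, 0) f f'" and ab: "\<alpha> < p1" "\<alpha> < p2" "q1 < \<beta>" "q2 < \<beta>"
    show "(LINT z|strip_measure \<alpha> \<beta>. f z * of_real (?u step (fst z) * ?i step (snd z)))
      = - (LINT z|strip_measure \<alpha> \<beta>. f' z * of_real (?u ramp (fst z) * ?i step (snd z)))"
    proof (rule concl)
      show "(\<lambda>n. LINT z|strip_measure \<alpha> \<beta>. f z * of_real (?u (Bn n) (fst z) * ?i (Bn n) (snd z)))
        \<longlonglongrightarrow> (LINT z|strip_measure \<alpha> \<beta>. f z * of_real (?u step (fst z) * ?i step (snd z)))"
        by (rule strip_integral_tendsto[OF f, where K = K and R = R])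
           (use far i0 in \<open>auto simp del: of_real_mult simp: bd[OF uB iB] intro!: meas lim_prod comb_tendsto Blim\<close>)
      show "(\<lambda>n. LINT z|strip_measure \<alpha> \<beta>. f' z * of_real (?u (Cn n) (fst z) * ?i (Bn n) (snd z)))
        \<longlonglongrightarrow> (LINT z|strip_measure \<alpha> \<beta>. f' z * of_real (?u ramp (fst z) * ?i step (snd z)))"
        by (rule strip_integral_tendsto[OF f', where K = K and R = R])
           (use far i0 in \<open>auto simp del: of_real_mult simp: bd[OF uC iB] intro!: meas lim_prod comb_tendsto Blim Clim\<close>)
      \<comment> \<open>Smoothing enlarges the support to the right by \<open>1 / Suc n\<close>, so
        the products are test functions on the open strip only for large \<open>n\<close>.\<close>
      obtain n0 where n0: "\<forall>n\<ge>n0. 1 / Suc n < \<beta> - max q1 q2" using small[of "\<beta> - max q1 q2"] ab by auto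
      have "(LINT z|strip_measure \<alpha> \<beta>. f z * of_real (?u (Bn n) (fst z) * ?i (Bn n) (snd z)))
        = - (LINT z|strip_measure \<alpha> \<beta>. f' z * of_real (?u (Cn n) (fst z) * ?i (Bn n) (snd z)))" if "n \<ge> n0" for n
      proof -
        have t: "test_function ({\<alpha><..<\<beta>} \<times> UNIV) (\<lambda>z. of_real (?u (Cn n) (fst z) * ?i (Bn n) (snd z)))"
        proof (rule test_function_product[OF smooth_comb[OF sm(2)] u0(2) _ smooth_comb[OF sm(1)] i0])
          show "{min p1 p2..max q1 q2 + 1 / Suc n} \<subseteq> {\<alpha><..<\<beta>}"
            using n0[rule_format, OF that] ab by auto
        qed
        obtain H' where "\<And>s. (?i (Bn n) has_real_derivative H' s) (at s)" using bdiff by blast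
        from dir_deriv_product[OF ud this, of 1 0 n]
        have "dir_deriv (1, 0) (\<lambda>z. complex_of_real (?u (Cn n) (fst z) * ?i (Bn n) (snd z)))
          = (\<lambda>z. of_real (?u (Bn n) (fst z) * ?i (Bn n) (snd z)))" by (auto simp: fun_eq_iff)
        note dd = this
        show ?thesis using wd[unfolded weak_deriv_def, rule_format, OF t] unfolding dd .
      qed
      then show "\<exists>n0. \<forall>n\<ge>n0. (LINT z|strip_measure \<alpha> \<beta>. f z * of_real (?u (Bn n) (fst z) * ?i (Bn n) (snd z)))
        = - (LINT z|strip_measure \<alpha> \<beta>. f' z * of_real (?u (Cn n) (fst z) * ?i (Bn n) (snd z)))" by blast
    qed
  next
    assume wd: "weak_deriv \<alpha> \<beta> (0, 1) f f'" and ab: "\<alpha> < c" "d < \<beta>"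
    have bd': "\<bar>y * x\<bar> \<le> K" if "\<bar>x\<bar> \<le> K" "\<bar>y\<bar> \<le> 1" for x y
      using bd[OF that] by (simp add: mult.commute)
    show "(LINT z|strip_measure \<alpha> \<beta>. f z * of_real (?i step (fst z) * ?u step (snd z)))
      = - (LINT z|strip_measure \<alpha> \<beta>. f' z * of_real (?i step (fst z) * ?u ramp (snd z)))"
    proof (rule concl)
      show "(\<lambda>n. LINT z|strip_measure \<alpha> \<beta>. f z * of_real (?i (Bn n) (fst z) * ?u (Bn n) (snd z)))
        \<longlonglongrightarrow> (LINT z|strip_measure \<alpha> \<beta>. f z * of_real (?i step (fst z) * ?u step (snd z)))"
        by (rule strip_integral_tendsto[OF f, where K = K and R = R])
           (use far u0 in \<open>auto simp del: of_real_mult simp: bd'[OF uB iB] intro!: meas lim_prod comb_tendsto Blim\<close>)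
      show "(\<lambda>n. LINT z|strip_measure \<alpha> \<beta>. f' z * of_real (?i (Bn n) (fst z) * ?u (Cn n) (snd z)))
        \<longlonglongrightarrow> (LINT z|strip_measure \<alpha> \<beta>. f' z * of_real (?i step (fst z) * ?u ramp (snd z)))"
        by (rule strip_integral_tendsto[OF f', where K = K and R = R])
           (use far u0 in \<open>auto simp del: of_real_mult simp: bd'[OF uC iB] intro!: meas lim_prod comb_tendsto Blim Clim\<close>)
      obtain n0 where n0: "\<forall>n\<ge>n0. 1 / Suc n < \<beta> - d" using small[of "\<beta> - d"] ab by auto
      have "(LINT z|strip_measure \<alpha> \<beta>. f z * of_real (?i (Bn n) (fst z) * ?u (Bn n) (snd z)))
        = - (LINT z|strip_measure \<alpha> \<beta>. f' z * of_real (?i (Bn n) (fst z) * ?u (Cn n) (snd z)))" if "n \<ge> n0" for n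
      proof -
        have t: "test_function ({\<alpha><..<\<beta>} \<times> UNIV) (\<lambda>z. of_real (?i (Bn n) (fst z) * ?u (Cn n) (snd z)))"
        proof (rule test_function_product[OF smooth_comb[OF sm(1)] i0 _ smooth_comb[OF sm(2)] u0(2)])
          show "{c..d + 1 / Suc n} \<subseteq> {\<alpha><..<\<beta>}"
            using n0[rule_format, OF that] ab by auto
        qed
        obtain H' where "\<And>s. (?i (Bn n) has_real_derivative H' s) (at s)" using bdiff by blast
        from dir_deriv_product[OF this ud, of 0 1 n]
        have "dir_deriv (0, 1) (\<lambda>z. complex_of_real (?i (Bn n) (fst z) * ?u (Cn n) (snd z)))
          = (\<lambda>z. of_real (?i (Bn n) (fst z) * ?u (Bn n) (snd z)))" by (auto simp: fun_eq_iff)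
        note dd = this
        show ?thesis using wd[unfolded weak_deriv_def, rule_format, OF t] unfolding dd .
      qed
      then show "\<exists>n0. \<forall>n\<ge>n0. (LINT z|strip_measure \<alpha> \<beta>. f z * of_real (?i (Bn n) (fst z) * ?u (Bn n) (snd z)))
        = - (LINT z|strip_measure \<alpha> \<beta>. f' z * of_real (?i (Bn n) (fst z) * ?u (Cn n) (snd z)))" by blast
    qed
  }
qed

text \<open>Identifies the product with a restriction of planar Lebesgue measure, to which
  \<open>AE_zero_of_box_integrals\<close> can be applied.\<close>

lemma strip_measure_eq: "strip_measure \<alpha> \<beta> = restrict_space lborel ({\<alpha>..\<beta>} \<times> UNIV)"
  unfolding strip_measure_def
proof (rule pair_measure_eqI)
  let ?X = "restrict_space lborel {\<alpha>..\<beta>::real}" and ?Y = "restrict_space lborel ({\<alpha>..\<beta>} \<times> UNIV) :: (real \<times> real) measure"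
  let ?P = "?X \<Otimes>\<^sub>M (lborel :: real measure)"
  interpret finite_measure ?X by (rule finite_measure_restrict_interval)
  show "sigma_finite_measure ?X" by unfold_locales
  show "sigma_finite_measure (lborel :: real measure)" by (rule sigma_finite_lborel)
  have S: "{\<alpha>..\<beta>} \<times> UNIV \<in> sets (lborel :: (real \<times> real) measure)"
    by (simp add: borel_closed closed_Times)
  have 1: "(\<lambda>p. p) \<in> ?P \<rightarrow>\<^sub>M ?Y"
  proof (rule measurable_restrict_space2)
    show "(\<lambda>p. p) \<in> space ?P \<rightarrow> {\<alpha>..\<beta>} \<times> UNIV"
      by (auto simp: space_pair_measure space_restrict_space)
    have "(\<lambda>p. p) \<in> borel_measurable (strip_measure \<alpha> \<beta>)" by (rule sets_strip_borel) simp
    then show "(\<lambda>p. p) \<in> ?P \<rightarrow>\<^sub>M lborel" by (simp add: strip_measure_def)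
  qed
  have 2: "(\<lambda>p. (fst p, snd p)) \<in> ?Y \<rightarrow>\<^sub>M ?P"
  proof (rule measurable_Pair)
    have f: "fst \<in> borel_measurable (borel :: (real \<times> real) measure)" "snd \<in> borel_measurable (borel :: (real \<times> real) measure)"
      by (intro borel_measurable_continuous_onI continuous_intros)+
    show "fst \<in> ?Y \<rightarrow>\<^sub>M ?X"
      by (intro measurable_restrict_space2 measurable_restrict_space1) (use f in \<open>auto simp: space_restrict_space\<close>)
    show "snd \<in> ?Y \<rightarrow>\<^sub>M lborel"
      by (intro measurable_restrict_space1) (use f in auto)
  qed
  have sp: "space ?P = space ?Y" by (simp add: space_pair_measure space_restrict_space)
  show "sets ?P = sets ?Y"
  proof
    show "sets ?P \<subseteq> sets ?Y"
    proof
      fix A assume A: "A \<in> sets ?P"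
      have "(\<lambda>p. (fst p, snd p)) -` A \<inter> space ?Y \<in> sets ?Y" by (rule measurable_sets[OF 2 A])
      then show "A \<in> sets ?Y" using sets.sets_into_space[OF A] sp by (simp add: Int_absorb2)
    qed
    show "sets ?Y \<subseteq> sets ?P"
    proof
      fix A assume A: "A \<in> sets ?Y"
      have "(\<lambda>p. p) -` A \<inter> space ?P \<in> sets ?P" by (rule measurable_sets[OF 1 A])
      then show "A \<in> sets ?P" using sets.sets_into_space[OF A] sp by (simp add: Int_absorb2)
    qed
  qed
  fix A :: "real set" and B :: "real set" assume A: "A \<in> sets ?X" and B: "B \<in> sets lborel"
  have A': "A \<subseteq> {\<alpha>..\<beta>}" "A \<in> sets borel"
    using A by (auto simp: sets_restrict_space_iff)
  have "emeasure ?Y (A \<times> B) = emeasure (lborel :: (real \<times> real) measure) (A \<times> B)"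
    using A' S by (intro emeasure_restrict_space) auto
  also have "\<dots> = emeasure lborel A * emeasure lborel B"
    unfolding lborel_prod[symmetric] using A' B by (intro lborel.emeasure_pair_measure_Times) auto
  also have "emeasure lborel A = emeasure ?X A"
    using A' by (intro emeasure_restrict_space[symmetric]) auto
  finally show "emeasure ?X A * emeasure lborel B = emeasure ?Y (A \<times> B)" by simp
qed

text \<open>The rectangles in hypothesis \<open>z\<close> are half open and keep away from the
  vertical sides. Shrinking by \<open>e n\<close> reaches open rectangles that touch the sides.
  Truncation to \<open>|y| < N\<close> makes \<open>k\<close> integrable on the plane, and countably
  many \<open>N\<close> suffice.\<close>

lemma strip_zero:
  assumes k: "k \<in> L2 (strip_measure \<alpha> \<beta>)"
    and z: "\<And>p q c d. \<alpha> < p \<Longrightarrow> p < q \<Longrightarrow> q < \<beta> \<Longrightarrow> c < d \<Longrightarrow>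
      (LINT z|strip_measure \<alpha> \<beta>. k z * of_real (comb 1 p q 0 p q step (fst z) * comb 1 c d 0 c d step (snd z))) = 0"
  shows "AE z in strip_measure \<alpha> \<beta>. k z = 0"
proof -
  let ?M = "strip_measure \<alpha> \<beta>"
  have S: "{\<alpha>..\<beta>} \<times> UNIV \<in> sets (lborel :: (real \<times> real) measure)"
    by (simp add: borel_closed closed_Times)
  have meas: "(\<lambda>z. complex_of_real (F (fst z) * G (snd z))) \<in> borel_measurable ?M"
    if [measurable]: "F \<in> borel_measurable borel" "G \<in> borel_measurable borel" for F G
  proof -
    have "(\<lambda>z :: real \<times> real. complex_of_real (F (fst z) * G (snd z))) \<in> borel_measurable (borel \<Otimes>\<^sub>M borel)" by measurable
    then show ?thesis unfolding borel_prod by (rule sets_strip_borel)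
  qed
  have open_rect: "(LINT z|?M. k z * of_real (indicator {p<..<q} (fst z) * indicator {c<..<d} (snd z))) = 0"
    if pq: "\<alpha> \<le> p" "q \<le> \<beta>" for p q c d :: real
  proof -
    define e where "e n = 1 / real (Suc n)" for n
    have e: "e n > 0" for n by (simp add: e_def)
    define h where "h n z = complex_of_real (indicator {p + e n<..q - e n} (fst z) * indicator {c + e n<..d - e n} (snd z))" for n and z :: "real \<times> real"
    have ind: "(\<lambda>n. indicator {p + e n<..q - e n} s) \<longlonglongrightarrow> (indicator {p<..<q} s :: real)" for p q s
    proof (cases "p < s \<and> s < q")
      case True
      then obtain n0 where n0: "inverse (real (Suc n0)) < min (s - p) (q - s)"
        using reals_Archimedean[of "min (s - p) (q - s)"] by auto
      have "e n \<le> e n0" if "n \<ge> n0" for n using that by (simp add: e_def frac_le)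
      then have "\<forall>n\<ge>n0. indicator {p + e n<..q - e n} s = (indicator {p<..<q} s :: real)"
        using True n0 by (fastforce simp: indicator_def e_def[of n0] inverse_eq_divide)
      then show ?thesis
        by (intro tendsto_eventually) (auto simp: eventually_sequentially)
    next
      case False
      then have "indicator {p + e n<..q - e n} s = (indicator {p<..<q} s :: real)" for n
        using e[of n] by (auto simp: indicator_def)
      then show ?thesis by simp
    qed
    have "(\<lambda>n. LINT z|?M. k z * h n z) \<longlonglongrightarrow> (LINT z|?M. k z * of_real (indicator {p<..<q} (fst z) * indicator {c<..<d} (snd z)))"
    proof (rule strip_integral_tendsto[OF k, where K = 1 and R = "\<bar>c\<bar> + \<bar>d\<bar>"])
      show "h n \<in> borel_measurable ?M" for n unfolding h_def by (rule meas) auto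
      show "cmod (h n z) \<le> 1" for n z by (auto simp: h_def indicator_def)
      show "\<bar>snd z\<bar> > \<bar>c\<bar> + \<bar>d\<bar> \<Longrightarrow> h n z = 0" for n z using e[of n] by (auto simp: h_def indicator_def)
      show "(\<lambda>n. h n z) \<longlonglongrightarrow> of_real (indicator {p<..<q} (fst z) * indicator {c<..<d} (snd z))" for z
        unfolding h_def by (intro tendsto_of_real tendsto_mult ind)
    qed (rule meas, auto)
    moreover have "(LINT z|?M. k z * h n z) = 0" for n
    proof (cases "p + e n < q - e n \<and> c + e n < d - e n")
      case True
      have "h n z = of_real (comb 1 (p + e n) (q - e n) 0 (p + e n) (q - e n) step (fst z) * comb 1 (c + e n) (d - e n) 0 (c + e n) (d - e n) step (snd z))" for z
        using True by (simp add: h_def comb_step_single indicator_def)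
      then show ?thesis using z[of "p + e n" "q - e n" "c + e n" "d - e n"] True pq e[of n] by simp
    next
      case False
      then have "h n z = 0" for z by (auto simp: h_def indicator_def)
      then show ?thesis by simp
    qed
    ultimately show ?thesis by (simp add: LIMSEQ_const_iff)
  qed
  have "AE z in lborel. indicator ({\<alpha>..\<beta>} \<times> UNIV) z *\<^sub>R (k z * of_real (indicator {\<alpha><..<\<beta>} (fst z) * indicator {- real N<..<real N} (snd z))) = 0" for N
  proof (rule AE_zero_of_box_integrals)
    let ?i = "\<lambda>z. complex_of_real (indicator {\<alpha><..<\<beta>} (fst z) * indicator {- real N<..<real N} (snd z))"
    have "?i \<in> L2 ?M"
      by (rule L2_strip_bounded[where K = 1 and R = "real N"]) (auto intro!: meas simp: indicator_def simp del: of_real_mult)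
    from L2_prod_integrable[OF k this]
    show int: "integrable lborel (\<lambda>z. indicator ({\<alpha>..\<beta>} \<times> UNIV) z *\<^sub>R (k z * ?i z))"
      unfolding strip_measure_eq using S by (subst (asm) integrable_restrict_space) auto
    fix a b :: "real \<times> real"
    define p q c d where "p = max (fst a) \<alpha>" and "q = min (fst b) \<beta>" and "c = max (snd a) (- real N)" and "d = min (snd b) (real N)"
    have "(LINT z:box a b|lborel. indicator ({\<alpha>..\<beta>} \<times> UNIV) z *\<^sub>R (k z * ?i z))
        = (LINT z|lborel. indicator ({\<alpha>..\<beta>} \<times> UNIV) z *\<^sub>R (k z * of_real (indicator {p<..<q} (fst z) * indicator {c<..<d} (snd z))))"
      unfolding set_lebesgue_integral_def
    proof (rule Bochner_Integration.integral_cong[OF refl])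
      fix z :: "real \<times> real"
      have "z \<in> box a b \<longleftrightarrow> fst a < fst z \<and> fst z < fst b \<and> snd a < snd z \<and> snd z < snd b"
        by (cases a; cases b; cases z) (auto simp: mem_box Basis_prod_def ball_Un inner_Pair)
      then show "indicator (box a b) z *\<^sub>R indicator ({\<alpha>..\<beta>} \<times> UNIV) z *\<^sub>R (k z * ?i z)
        = indicator ({\<alpha>..\<beta>} \<times> UNIV) z *\<^sub>R (k z * of_real (indicator {p<..<q} (fst z) * indicator {c<..<d} (snd z)))"
        by (auto simp: indicator_def p_def q_def c_def d_def)
    qed
    also have "\<dots> = (LINT z|?M. k z * of_real (indicator {p<..<q} (fst z) * indicator {c<..<d} (snd z)))"
      unfolding strip_measure_eq by (rule integral_restrict_space[symmetric]) (use S in simp)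
    also have "\<dots> = 0" by (rule open_rect) (auto simp: p_def q_def)
    finally show "(LINT z:box a b|lborel. indicator ({\<alpha>..\<beta>} \<times> UNIV) z *\<^sub>R (k z * ?i z)) = 0" .
  qed
  then have "AE z in lborel. \<forall>N. indicator ({\<alpha>..\<beta>} \<times> UNIV) z *\<^sub>R (k z * of_real (indicator {\<alpha><..<\<beta>} (fst z) * indicator {- real N<..<real N} (snd z))) = 0"
    unfolding AE_all_countable by blast
  then have "AE z in lborel. z \<in> {\<alpha>..\<beta>} \<times> UNIV \<longrightarrow> fst z \<noteq> \<alpha> \<longrightarrow> fst z \<noteq> \<beta> \<longrightarrow> k z = 0"
  proof eventually_elim
    case (elim z)
    show ?case
    proof (intro impI)
      assume zz: "z \<in> {\<alpha>..\<beta>} \<times> UNIV" "fst z \<noteq> \<alpha>" "fst z \<noteq> \<beta>"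
      obtain N :: nat where N: "\<bar>snd z\<bar> < real N" using reals_Archimedean2 by blast
      then have "snd z \<in> {- real N<..<real N}" by auto
      moreover have "fst z \<in> {\<alpha><..<\<beta>}" using zz by (auto simp: mem_Times_iff)
      ultimately show "k z = 0" using elim[rule_format, of N] zz(1) by simp
    qed
  qed
  then have "AE z in ?M. fst z \<noteq> \<alpha> \<longrightarrow> fst z \<noteq> \<beta> \<longrightarrow> k z = 0"
    unfolding strip_measure_eq by (subst AE_restrict_space_iff) (use S in auto)
  moreover have "AE z in ?M. fst z \<noteq> c" for c
  proof -
    interpret pair_sigma_finite "restrict_space lborel {\<alpha>..\<beta>}" "lborel :: real measure" by (rule strip_sigma_finite)
    have "AE x in restrict_space lborel {\<alpha>..\<beta>}. x \<noteq> c"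
      by (subst AE_restrict_space_iff) (use AE_lborel_singleton[of c] in \<open>auto elim: AE_mp\<close>)
    then have "AE x in restrict_space lborel {\<alpha>..\<beta>}. AE y in (lborel :: real measure). fst (x, y) \<noteq> c"
      by eventually_elim simp
    moreover have "{z \<in> space (restrict_space lborel {\<alpha>..\<beta>} \<Otimes>\<^sub>M (lborel :: real measure)). fst z \<noteq> c} \<in> sets (restrict_space lborel {\<alpha>..\<beta>} \<Otimes>\<^sub>M lborel)"
    proof -
      have "fst \<in> borel_measurable (strip_measure \<alpha> \<beta>)"
        by (rule sets_strip_borel) (intro borel_measurable_continuous_onI continuous_intros)
      then have [measurable]: "fst \<in> borel_measurable (restrict_space lborel {\<alpha>..\<beta>} \<Otimes>\<^sub>M (lborel :: real measure))"
        by (simp add: strip_measure_def)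
      show ?thesis by measurable
    qed
    ultimately show ?thesis unfolding strip_measure_def by (intro AE_pair_measure)
  qed
  from this[of \<alpha>] this[of \<beta>] calculation show ?thesis by eventually_elim simp
qed

subsection \<open>Weak derivatives on the strip\<close>

locale strip =
  fixes \<alpha> \<beta> :: real
  assumes ab: "\<alpha> < \<beta>"
begin

abbreviation X :: "real measure" where "X \<equiv> restrict_space lborel {\<alpha>..\<beta>}"
abbreviation M :: "(real \<times> real) measure" where "M \<equiv> strip_measure \<alpha> \<beta>"

lemma M_eq: "M = X \<Otimes>\<^sub>M lborel"
  by (simp add: strip_measure_def)

sublocale X: finite_measure X
  by (rule finite_measure_restrict_interval)

sublocale P: pair_sigma_finite X "lborel :: real measure"
  by (rule strip_sigma_finite)

lemma sigma_finite_X: "sigma_finite_measure X"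
  by unfold_locales

lemma space_X: "space X = {\<alpha>..\<beta>}"
  by (simp add: space_restrict_space)

lemma measurable_ident_X [measurable]: "(\<lambda>x. x) \<in> X \<rightarrow>\<^sub>M borel"
  by simp

lemma measurable_fst_M [measurable]: "fst \<in> M \<rightarrow>\<^sub>M X" "snd \<in> M \<rightarrow>\<^sub>M borel"
proof -
  show "fst \<in> M \<rightarrow>\<^sub>M X" by (simp add: M_eq)
  have "snd \<in> M \<rightarrow>\<^sub>M lborel" by (simp add: M_eq)
  then show "snd \<in> M \<rightarrow>\<^sub>M borel" by simp
qed

lemma AE_exists_in_interval:
  assumes "AE x in X. P x" "\<alpha> \<le> l" "l < r" "r \<le> \<beta>"
  shows "\<exists>x\<in>{l<..<r}. P x"
proof (rule ccontr)
  assume n: "\<not> ?thesis"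
  have "AE x in lborel. x \<in> {\<alpha>..\<beta>} \<longrightarrow> P x"
    using assms(1) by (subst (asm) AE_restrict_space_iff) auto
  then have "AE x in lborel. x \<notin> {l<..<r}"
    by eventually_elim (use n assms in auto)
  then have "emeasure lborel {l<..<r} = 0"
    by (subst (asm) AE_iff_measurable[where N = "{l<..<r}"]) auto
  then show False using assms by simp
qed

lemma AE_exists: "AE x in X. P x \<Longrightarrow> \<exists>x\<in>{\<alpha>..\<beta>}. P x"
  using AE_exists_in_interval[of P \<alpha> \<beta>] ab by fastforce

lemma const_L2_D:
  assumes "(\<lambda>z. K (snd z)) \<in> L2 M" shows "K \<in> L2 lborel"
  using AE_exists[OF P.AE_L2_fibre[OF assms[unfolded M_eq]]] by simp

lemma const_L2_I: "K \<in> L2 lborel \<Longrightarrow> (\<lambda>z. K (snd z)) \<in> L2 M"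
  unfolding M_eq by (rule P.L2_snd[OF finite_measure_restrict_interval])

section \<open>Integral operators acting in \<open>x\<close> alone\<close>

definition kop :: "(real \<Rightarrow> real \<Rightarrow> complex) \<Rightarrow> (real \<times> real \<Rightarrow> complex) \<Rightarrow> real \<times> real \<Rightarrow> complex" where
  "kop k g z = (LINT s|X. k (fst z) s * g (s, snd z))"

definition kernel :: "(real \<Rightarrow> real \<Rightarrow> complex) \<Rightarrow> bool" where
  "kernel k \<longleftrightarrow> (\<lambda>(x, s). k x s) \<in> borel_measurable (borel \<Otimes>\<^sub>M borel) \<and> (\<forall>x s. cmod (k x s) \<le> 1)"

lemma kernel_measurable:
  assumes "kernel k" "a \<in> N \<rightarrow>\<^sub>M borel" "b \<in> N \<rightarrow>\<^sub>M borel"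
  shows "(\<lambda>p. k (a p) (b p)) \<in> borel_measurable N"
proof -
  have "(\<lambda>p. (a p, b p)) \<in> N \<rightarrow>\<^sub>M borel \<Otimes>\<^sub>M borel" using assms(2,3) by measurable
  moreover have "(\<lambda>(x, s). k x s) \<in> borel_measurable (borel \<Otimes>\<^sub>M borel)" using assms(1) by (simp add: kernel_def)
  ultimately show ?thesis using measurable_compose by fastforce
qed

lemma borel_measurable_kop:
  assumes k: "kernel k" and g: "g \<in> borel_measurable M"
  shows "kop k g \<in> borel_measurable M"
proof -
  have [measurable]: "g \<in> borel_measurable (X \<Otimes>\<^sub>M lborel)" using g by (simp add: M_eq)
  have id: "(\<lambda>x. x) \<in> X \<rightarrow>\<^sub>M borel" by simp
  have 1: "(\<lambda>q. fst (fst q)) \<in> (X \<Otimes>\<^sub>M lborel) \<Otimes>\<^sub>M X \<rightarrow>\<^sub>M (borel :: real measure)"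
    using measurable_compose[OF _ id, of "\<lambda>q. fst (fst q)" "(X \<Otimes>\<^sub>M (lborel :: real measure)) \<Otimes>\<^sub>M X"] by simp
  have 2: "(\<lambda>q. snd q) \<in> (X \<Otimes>\<^sub>M (lborel :: real measure)) \<Otimes>\<^sub>M X \<rightarrow>\<^sub>M borel"
    using measurable_compose[OF _ id, of "snd" "(X \<Otimes>\<^sub>M (lborel :: real measure)) \<Otimes>\<^sub>M X"] by simp
  note [measurable] = kernel_measurable[OF k 1 2]
  show ?thesis
    unfolding kop_def[abs_def] M_eq
    by (rule X.borel_measurable_lebesgue_integral) (simp add: case_prod_unfold)
qed

lemma kop_bound:
  assumes k: "kernel k" and g: "(\<lambda>s. g (s, y)) \<in> L2 X"
  shows "(cmod (kop k g (x, y)))\<^sup>2 \<le> l2sq X (k x) * l2sq X (\<lambda>s. g (s, y))"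
    "integrable X (\<lambda>s. k x s * g (s, y))"
proof -
  have km: "k x \<in> borel_measurable X" by (rule kernel_measurable[OF k]) auto
  have kL: "k x \<in> L2 X" by (rule X.L2_bounded[OF km]) (use k in \<open>auto simp: kernel_def\<close>)
  show "integrable X (\<lambda>s. k x s * g (s, y))" by (rule L2_prod_integrable[OF kL g])
  have "kop k g (x, y) = l2_inner X (\<lambda>s. cnj (k x s)) (\<lambda>s. g (s, y))"
    by (simp add: kop_def l2_inner_def)
  then have "cmod (kop k g (x, y)) \<le> sqrt (l2sq X (\<lambda>s. cnj (k x s))) * sqrt (l2sq X (\<lambda>s. g (s, y)))"
    using l2_cauchy_schwarz[OF L2_cnj[OF kL] g] by simp
  then have "(cmod (kop k g (x, y)))\<^sup>2 \<le> (sqrt (l2sq X (\<lambda>s. cnj (k x s))) * sqrt (l2sq X (\<lambda>s. g (s, y))))\<^sup>2"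
    by (intro power_mono) auto
  then show "(cmod (kop k g (x, y)))\<^sup>2 \<le> l2sq X (k x) * l2sq X (\<lambda>s. g (s, y))"
    by (simp add: power_mult_distrib) (simp add: l2sq_def)
qed

lemma AE_fibre_snd: "g \<in> L2 M \<Longrightarrow> AE y in lborel. (\<lambda>s. g (s, y)) \<in> L2 X"
  unfolding M_eq by (rule P.AE_L2_fibre_snd)

lemma l2sq_fibre_snd:
  assumes "g \<in> L2 M"
  shows "(\<integral>\<^sup>+y. ennreal (l2sq X (\<lambda>s. g (s, y))) \<partial>lborel) = ennreal (l2sq M g)"
proof -
  have [measurable]: "g \<in> borel_measurable (X \<Otimes>\<^sub>M lborel)" using assms by (auto simp: M_eq)
  have "(\<integral>\<^sup>+y. ennreal (l2sq X (\<lambda>s. g (s, y))) \<partial>lborel) = (\<integral>\<^sup>+y. \<integral>\<^sup>+s. ennreal ((cmod (g (s, y)))\<^sup>2) \<partial>X \<partial>lborel)"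
  proof (rule nn_integral_cong_AE, use AE_fibre_snd[OF assms] in eventually_elim)
    case (elim y)
    show ?case unfolding l2sq_def by (rule nn_integral_eq_integral[symmetric, OF L2_integrable[OF elim]]) auto
  qed
  also have "\<dots> = (\<integral>\<^sup>+z. ennreal ((cmod (g z))\<^sup>2) \<partial>(X \<Otimes>\<^sub>M lborel))"
    using P.nn_integral_snd[of "\<lambda>z. ennreal ((cmod (g z))\<^sup>2)"] by (simp add: case_prod_unfold)
  also have "\<dots> = ennreal (l2sq M g)"
    unfolding M_eq[symmetric] l2sq_def by (rule nn_integral_eq_integral[OF L2_integrable[OF assms]]) auto
  finally show ?thesis .
qed

text \<open>Cauchy-Schwarz in \<open>s\<close> bounds the operator on each fibre over
  \<open>y\<close> by the width of the strip; the integration over \<open>x\<close> contributes the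
  width once more.\<close>

lemma kop_L2:
  assumes k: "kernel k" and g: "g \<in> L2 M"
  shows "kop k g \<in> L2 M" "l2sq M (kop k g) \<le> (\<beta> - \<alpha>)\<^sup>2 * l2sq M g"
proof -
  let ?L = "\<beta> - \<alpha>"
  have [measurable]: "kop k g \<in> borel_measurable (X \<Otimes>\<^sub>M lborel)"
    using borel_measurable_kop[OF k L2_measurable[OF g]] by (simp add: M_eq)
  have em: "emeasure X {\<alpha>..\<beta>} = ennreal ?L"
    using ab by (simp add: emeasure_restrict_space)
  have kl: "l2sq X (k x) \<le> ?L" for x
  proof -
    have kL: "k x \<in> L2 X"
      by (rule X.L2_bounded[of _ 1]) (use k kernel_measurable[OF k] in \<open>auto simp: kernel_def\<close>)
    have "l2sq X (k x) \<le> (LINT s|X. 1)"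
      unfolding l2sq_def
    proof (rule integral_mono[OF L2_integrable[OF kL]])
      show "(cmod (k x s))\<^sup>2 \<le> 1" for s
        using k power_mono[of "cmod (k x s)" 1 2] by (simp add: kernel_def)
    qed auto
    also have "\<dots> = ?L" using em ab by (simp add: measure_def space_X)
    finally show ?thesis .
  qed
  have "(\<integral>\<^sup>+z. ennreal ((cmod (kop k g z))\<^sup>2) \<partial>(X \<Otimes>\<^sub>M lborel)) = (\<integral>\<^sup>+y. \<integral>\<^sup>+x. ennreal ((cmod (kop k g (x, y)))\<^sup>2) \<partial>X \<partial>lborel)"
    using P.nn_integral_snd[of "\<lambda>z. ennreal ((cmod (kop k g z))\<^sup>2)"] by (simp add: case_prod_unfold)
  also have "\<dots> \<le> (\<integral>\<^sup>+y. ennreal (?L\<^sup>2) * ennreal (l2sq X (\<lambda>s. g (s, y))) \<partial>lborel)"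
  proof (rule nn_integral_mono_AE, use AE_fibre_snd[OF g] in eventually_elim)
    case (elim y)
    have "(\<integral>\<^sup>+x. ennreal ((cmod (kop k g (x, y)))\<^sup>2) \<partial>X) \<le> (\<integral>\<^sup>+x. ennreal (?L * l2sq X (\<lambda>s. g (s, y))) \<partial>X)"
      by (intro nn_integral_mono ennreal_leI order_trans[OF kop_bound(1)[OF k elim]] mult_right_mono kl) auto
    also have "\<dots> = ennreal (?L\<^sup>2) * ennreal (l2sq X (\<lambda>s. g (s, y)))"
      using ab by (simp add: em space_X ennreal_mult[symmetric] power2_eq_square mult_ac)
    finally show ?case .
  qed
  also have "\<dots> = ennreal (?L\<^sup>2 * l2sq M g)"
  proof -
    have [measurable]: "g \<in> borel_measurable (X \<Otimes>\<^sub>M lborel)" using g by (auto simp: M_eq)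
    have "(\<lambda>y. LINT s|X. (cmod (g (s, y)))\<^sup>2) \<in> borel_measurable lborel"
      by (rule X.borel_measurable_lebesgue_integral) measurable
    then show ?thesis
      by (subst nn_integral_cmult) (simp_all add: l2sq_fibre_snd[OF g] ennreal_mult, simp add: l2sq_def)
  qed
  finally have nn: "(\<integral>\<^sup>+z. ennreal ((cmod (kop k g z))\<^sup>2) \<partial>M) \<le> ennreal (?L\<^sup>2 * l2sq M g)"
    by (simp add: M_eq)
  show L: "kop k g \<in> L2 M"
  proof (rule L2_I)
    show m: "kop k g \<in> borel_measurable M" by (simp add: M_eq)
    show "integrable M (\<lambda>z. (cmod (kop k g z))\<^sup>2)"
    proof (rule integrableI_bounded)
      show "(\<integral>\<^sup>+z. ennreal (norm ((cmod (kop k g z))\<^sup>2)) \<partial>M) < \<infinity>"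
        using nn by (simp add: le_less_trans[OF _ ennreal_less_top])
    qed (use m in measurable)
  qed
  show "l2sq M (kop k g) \<le> ?L\<^sup>2 * l2sq M g"
  proof -
    have "ennreal (l2sq M (kop k g)) \<le> ennreal (?L\<^sup>2 * l2sq M g)"
      using nn nn_integral_eq_integral[OF L2_integrable[OF L]] by (simp add: l2sq_def)
    then show ?thesis by (subst (asm) ennreal_le_iff) auto
  qed
qed

lemma AE_M_snd:
  assumes "{z \<in> space M. Q z} \<in> sets M" "AE y in lborel. \<forall>x. Q (x, y)"
  shows "AE z in M. Q z"
proof -
  have "AE x in X. AE y in lborel. Q (x, y)"
  proof (rule AE_I2)
    fix x show "AE y in lborel. Q (x, y)" using assms(2) by eventually_elim blast
  qed
  then show ?thesis using assms(1) unfolding M_eq by (intro P.AE_pair_measure)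
qed

lemma kop_diff:
  assumes k: "kernel k" and f: "f \<in> L2 M" and g: "g \<in> L2 M"
  shows "AE z in M. kop k (\<lambda>z. f z - g z) z = kop k f z - kop k g z"
proof (rule AE_M_snd)
  note [measurable] = kop_L2(1)[OF k f, THEN L2_measurable] kop_L2(1)[OF k g, THEN L2_measurable]
    kop_L2(1)[OF k L2_diff[OF f g], THEN L2_measurable]
  show "{z \<in> space M. kop k (\<lambda>z. f z - g z) z = kop k f z - kop k g z} \<in> sets M" by measurable
  show "AE y in lborel. \<forall>x. kop k (\<lambda>z. f z - g z) (x, y) = kop k f (x, y) - kop k g (x, y)"
    using AE_fibre_snd[OF f] AE_fibre_snd[OF g]
  proof eventually_elim
    case (elim y)
    then show ?case using kop_bound(2)[OF k] by (simp add: kop_def right_diff_distrib)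
  qed
qed

lemma kop_dist:
  assumes k: "kernel k" and f: "f \<in> L2 M" and g: "g \<in> L2 M"
  shows "l2_dist M (kop k f) (kop k g) \<le> (\<beta> - \<alpha>) * l2_dist M f g"
proof -
  have "l2sq M (\<lambda>z. kop k f z - kop k g z) = l2sq M (kop k (\<lambda>z. f z - g z))"
  proof (rule l2sq_cong_AE)
    show "(\<lambda>z. kop k f z - kop k g z) \<in> borel_measurable M"
      by (rule L2_measurable[OF L2_diff[OF kop_L2(1)[OF k f] kop_L2(1)[OF k g]]])
    show "kop k (\<lambda>z. f z - g z) \<in> borel_measurable M"
      by (rule L2_measurable[OF kop_L2(1)[OF k L2_diff[OF f g]]])
    show "AE z in M. kop k f z - kop k g z = kop k (\<lambda>z. f z - g z) z"
      using kop_diff[OF k f g] by eventually_elim simp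
  qed
  also have "\<dots> \<le> (\<beta> - \<alpha>)\<^sup>2 * l2sq M (\<lambda>z. f z - g z)"
    by (rule kop_L2(2)[OF k L2_diff[OF f g]])
  finally have "sqrt (l2sq M (\<lambda>z. kop k f z - kop k g z)) \<le> sqrt ((\<beta> - \<alpha>)\<^sup>2 * l2sq M (\<lambda>z. f z - g z))"
    by (rule real_sqrt_le_mono)
  then show ?thesis using ab by (simp add: l2_dist_eq real_sqrt_mult)
qed

lemma kop_lim: "kernel k \<Longrightarrow> l2_lim M u f \<Longrightarrow> l2_lim M (\<lambda>n. kop k (u n)) (kop k f)"
  by (rule l2_lim_map[where C = "\<beta> - \<alpha>"]) (auto simp: l2_lim_def intro: kop_L2(1) kop_dist)

lemma kop_cong:
  assumes k: "kernel k" and f: "f \<in> L2 M" and g: "g \<in> L2 M" and e: "AE z in M. f z = g z"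
  shows "AE z in M. kop k f z = kop k g z"
proof (rule l2_dist_0_imp_AE[OF kop_L2(1)[OF k f] kop_L2(1)[OF k g]])
  have "AE z in M. f z - g z = 0" using e by eventually_elim simp
  then have "l2_dist M f g = 0"
    using l2sq_eq_0_iff[OF L2_diff[OF f g]] by (simp add: l2_dist_eq)
  then show "l2_dist M (kop k f) (kop k g) = 0"
    using kop_dist[OF k f g] l2_dist_nonneg[of M "kop k f" "kop k g"] by simp
qed

text \<open>A truncated transform and \<open>kop\<close> integrate over different variables, so
  Fubini exchanges them at every point; continuity of \<open>kop\<close> in \<open>L2\<close>
  carries this to the limit.\<close>

lemma pft_kop:
  assumes k: "kernel k" and g: "g \<in> L2 M"
  shows "AE z in M. pft X (kop k g) z = kop k (pft X g) z"
proof (rule l2_lim_unique)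
  have lim: "l2_lim M (\<lambda>n. trunc_pft n f) (pft X f)" if "f \<in> L2 M" for f
    using pft_lim[OF sigma_finite_X] that by (simp add: M_eq)
  show "l2_lim M (\<lambda>n. kop k (trunc_pft n g)) (kop k (pft X g))"
    by (rule kop_lim[OF k lim[OF g]])
  have eq: "trunc_pft n (kop k g) z = kop k (trunc_pft n g) z" for n z
  proof -
    obtain x t where z: "z = (x, t)" by (cases z)
    define h where "h s y = indicator {- real n..real n} y *\<^sub>R (k x s * expi2pi (- t * y) * g (s, y))" for s y
    define m where "m p = indicator {- real n..real n} (snd p) *\<^sub>R (k x (fst p) * expi2pi (- t * snd p))" for p :: "real \<times> real"
    have "m \<in> L2 M"
    proof (rule L2_strip_bounded[where K = 1 and R = "real n"])
      have "(\<lambda>p. fst p) \<in> M \<rightarrow>\<^sub>M borel" using measurable_compose[OF measurable_fst_M(1) measurable_ident_X] by simp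
      note [measurable] = kernel_measurable[OF k _ this, of "\<lambda>_. x"]
      show "m \<in> borel_measurable M" unfolding m_def by measurable
      show "cmod (m p) \<le> 1" for p using k by (auto simp: m_def norm_mult kernel_def indicator_def)
    qed (auto simp: m_def indicator_def)
    from L2_prod_integrable[OF this g] have int: "integrable (X \<Otimes>\<^sub>M lborel) (\<lambda>(s, y). h s y)"
      by (simp add: M_eq m_def h_def case_prod_unfold)
    have "trunc_pft n (kop k g) z = (LINT y|lborel. LINT s|X. h s y)"
      unfolding z trunc_pft_def trunc_fourier_def set_lebesgue_integral_def kop_def h_def
      by (simp add: scaleR_conv_of_real mult_ac flip: integral_mult_right_zero)
    also have "\<dots> = (LINT s|X. LINT y|lborel. h s y)"
      by (rule P.Fubini_integral[OF int])
    also have "\<dots> = kop k (trunc_pft n g) z"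
      unfolding z trunc_pft_def trunc_fourier_def set_lebesgue_integral_def kop_def h_def
      by (simp add: scaleR_conv_of_real mult_ac flip: integral_mult_right_zero)
    finally show ?thesis .
  qed
  show "l2_lim M (\<lambda>n. kop k (trunc_pft n g)) (pft X (kop k g))"
    using lim[OF kop_L2(1)[OF k g]] by (simp add: eq[abs_def])
qed

text \<open>Integration in \<open>x\<close> from \<open>\<alpha>\<close> to \<open>x\<close>, and over all of \<open>[\<alpha>,\<beta>]\<close>.\<close>

abbreviation J where "J \<equiv> kop (\<lambda>x s. of_bool (s \<le> x))"
abbreviation Av where "Av \<equiv> kop (\<lambda>x s. 1)"

lemma kernel_J: "kernel (\<lambda>x s. of_bool (s \<le> x))"
proof -
  have "(\<lambda>p :: real \<times> real. if snd p \<le> fst p then 1 else 0 :: complex) \<in> borel_measurable (borel \<Otimes>\<^sub>M borel)"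
    by measurable
  then show ?thesis by (simp add: kernel_def of_bool_def case_prod_unfold)
qed

lemma kernel_Av: "kernel (\<lambda>x s. 1)"
  by (simp add: kernel_def)

text \<open>The two terms are the integrals of \<open>p s * q x\<close> over the two triangles of
  the square, and the diagonal they share is null.\<close>

lemma integration_by_parts:
  fixes p q :: "real \<Rightarrow> complex"
  assumes p: "integrable X p" and q: "integrable X q"
  shows "(LINT x|X. (LINT s|X. of_bool (s \<le> x) * p s) * q x) + (LINT x|X. p x * (LINT s|X. of_bool (s \<le> x) * q s))
    = (LINT x|X. p x) * (LINT x|X. q x)"
proof -
  interpret XX: pair_sigma_finite X X ..
  have [measurable]: "p \<in> borel_measurable X" "q \<in> borel_measurable X" using p q by auto
  have id: "(\<lambda>x. x) \<in> X \<rightarrow>\<^sub>M borel" by simp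
  have [measurable]: "(\<lambda>z. fst z) \<in> X \<Otimes>\<^sub>M X \<rightarrow>\<^sub>M (borel :: real measure)" "(\<lambda>z. snd z) \<in> X \<Otimes>\<^sub>M X \<rightarrow>\<^sub>M (borel :: real measure)"
    using measurable_compose[OF measurable_fst id] measurable_compose[OF measurable_snd id] by auto
  have int: "integrable (X \<Otimes>\<^sub>M X) (\<lambda>(x, s). c x s * (p s * q x))"
    if "(\<lambda>(x, s). c x s) \<in> borel_measurable (X \<Otimes>\<^sub>M X)" "\<And>x s. cmod (c x s) \<le> 1" for c
  proof (rule Bochner_Integration.integrable_bound)
    show "integrable (X \<Otimes>\<^sub>M X) (\<lambda>(x, s). p s * q x)"
      by (rule XX.Fubini_integrable) (use p q in \<open>auto simp: norm_mult\<close>)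
    have [measurable]: "(\<lambda>z. c (fst z) (snd z)) \<in> borel_measurable (X \<Otimes>\<^sub>M X)"
      using that(1) by (simp add: case_prod_unfold)
    show "(\<lambda>(x, s). c x s * (p s * q x)) \<in> borel_measurable (X \<Otimes>\<^sub>M X)"
      unfolding case_prod_unfold by measurable
    show "AE z in X \<Otimes>\<^sub>M X. norm (case z of (x, s) \<Rightarrow> c x s * (p s * q x)) \<le> norm (case z of (x, s) \<Rightarrow> p s * q x)"
      using that(2) by (auto simp: norm_mult intro!: AE_I2 mult_left_le_one_le)
  qed
  have m1: "(\<lambda>(x, s). of_bool (s \<le> x) :: complex) \<in> borel_measurable (X \<Otimes>\<^sub>M X)"
    "(\<lambda>(x, s). of_bool (x \<le> s) :: complex) \<in> borel_measurable (X \<Otimes>\<^sub>M X)"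
  proof -
    have "(\<lambda>z. if snd z \<le> fst z then 1 else 0 :: complex) \<in> borel_measurable (X \<Otimes>\<^sub>M X)"
      "(\<lambda>z. if fst z \<le> snd z then 1 else 0 :: complex) \<in> borel_measurable (X \<Otimes>\<^sub>M X)" by measurable
    then show "(\<lambda>(x, s). of_bool (s \<le> x) :: complex) \<in> borel_measurable (X \<Otimes>\<^sub>M X)"
      "(\<lambda>(x, s). of_bool (x \<le> s) :: complex) \<in> borel_measurable (X \<Otimes>\<^sub>M X)"
      by (simp_all add: case_prod_unfold of_bool_def)
  qed
  have i1: "integrable (X \<Otimes>\<^sub>M X) (\<lambda>(x, s). of_bool (s \<le> x) * (p s * q x))"
    by (rule int[OF m1(1)]) auto
  have i2: "integrable (X \<Otimes>\<^sub>M X) (\<lambda>(x, s). of_bool (x \<le> s) * (p s * q x))"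
    by (rule int[OF m1(2)]) auto
  have "(LINT x|X. (LINT s|X. of_bool (s \<le> x) * p s) * q x) = (LINT x|X. LINT s|X. of_bool (s \<le> x) * (p s * q x))"
    by (simp add: mult.assoc flip: integral_mult_left_zero)
  also have "\<dots> = (LINT z|(X \<Otimes>\<^sub>M X). (case z of (x, s) \<Rightarrow> of_bool (s \<le> x) * (p s * q x)))"
    by (rule XX.integral_fst[OF i1])
  finally have e1: "(LINT x|X. (LINT s|X. of_bool (s \<le> x) * p s) * q x) = \<dots>" .
  have "(LINT x|X. p x * (LINT s|X. of_bool (s \<le> x) * q s)) = (LINT s|X. LINT x|X. of_bool (x \<le> s) * (p s * q x))"
    by (simp add: mult.left_commute flip: integral_mult_right_zero)
  also have "\<dots> = (LINT z|(X \<Otimes>\<^sub>M X). (case z of (x, s) \<Rightarrow> of_bool (x \<le> s) * (p s * q x)))"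
    by (rule XX.integral_snd[OF i2])
  finally have e2: "(LINT x|X. p x * (LINT s|X. of_bool (s \<le> x) * q s)) = \<dots>" .
  have pq: "integrable (X \<Otimes>\<^sub>M X) (\<lambda>(x, s). p s * q x)"
    using int[of "\<lambda>_ _. 1"] by simp
  have "(LINT z|(X \<Otimes>\<^sub>M X). (case z of (x, s) \<Rightarrow> of_bool (s \<le> x) * (p s * q x))) + (LINT z|(X \<Otimes>\<^sub>M X). (case z of (x, s) \<Rightarrow> of_bool (x \<le> s) * (p s * q x)))
    = (LINT z|(X \<Otimes>\<^sub>M X). (case z of (x, s) \<Rightarrow> of_bool (s \<le> x) * (p s * q x)) + (case z of (x, s) \<Rightarrow> of_bool (x \<le> s) * (p s * q x)))"
    by (rule Bochner_Integration.integral_add[symmetric, OF i1 i2])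
  also have "\<dots> = (LINT z|(X \<Otimes>\<^sub>M X). (case z of (x, s) \<Rightarrow> p s * q x))"
  proof (rule integral_cong_AE)
    have "AE x in X. AE s in X. fst (x, s) \<noteq> snd (x, s)"
    proof (rule AE_I2)
      fix x
      have "AE s in X. s \<noteq> x"
        by (subst AE_restrict_space_iff) (use AE_lborel_singleton[of x] in \<open>auto elim: AE_mp\<close>)
      then show "AE s in X. fst (x, s) \<noteq> snd (x, s)" by eventually_elim auto
    qed
    then have "AE z in X \<Otimes>\<^sub>M X. fst z \<noteq> snd z"
      by (intro XX.AE_pair_measure) measurable
    then show "AE z in X \<Otimes>\<^sub>M X. (case z of (x, s) \<Rightarrow> of_bool (s \<le> x) * (p s * q x)) + (case z of (x, s) \<Rightarrow> of_bool (x \<le> s) * (p s * q x))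
      = (case z of (x, s) \<Rightarrow> p s * q x)"
      by eventually_elim (auto simp: of_bool_def split: prod.splits)
  qed (use i1 i2 pq in auto)
  also have "\<dots> = (LINT x|X. LINT s|X. p s * q x)"
    by (rule XX.integral_fst[OF pq, symmetric])
  also have "\<dots> = (LINT x|X. p x) * (LINT x|X. q x)" by simp
  finally show ?thesis using e1 e2 by simp
qed

text \<open>\<open>rep f f' K\<close>: the weak derivative of \<open>f\<close> in \<open>x\<close> is \<open>f'\<close>, and the trace of \<open>f\<close> at \<open>x = \<alpha>\<close> is \<open>K\<close>.\<close>

definition rep :: "(real \<times> real \<Rightarrow> complex) \<Rightarrow> (real \<times> real \<Rightarrow> complex) \<Rightarrow> (real \<Rightarrow> complex) \<Rightarrow> bool" where
  "rep f f' K \<longleftrightarrow> f \<in> L2 M \<and> f' \<in> L2 M \<and> K \<in> L2 lborel \<and> (AE z in M. f z = K (snd z) + J f' z)"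

lemma AE_fibre_M: "AE z in M. Q z \<Longrightarrow> {z \<in> space M. Q z} \<in> sets M \<Longrightarrow> AE y in lborel. AE x in X. Q (x, y)"
proof -
  assume Q: "AE z in M. Q z" and s: "{z \<in> space M. Q z} \<in> sets M"
  have "AE x in X. AE y in lborel. Q (x, y)"
    by (rule P.AE_pair[OF Q[unfolded M_eq]])
  moreover have "{z \<in> space (X \<Otimes>\<^sub>M lborel). Q (fst z, snd z)} \<in> sets (X \<Otimes>\<^sub>M lborel)"
    using s[unfolded M_eq] by (simp only: prod.collapse)
  ultimately show ?thesis
    using P.AE_commute[of "\<lambda>x y. Q (x, y)"] by blast
qed

lemma rep_fibre:
  assumes "rep f f' K"
  shows "AE y in lborel. AE x in X. f (x, y) = K y + J f' (x, y)"
proof -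
  have L: "f \<in> L2 M" "f' \<in> L2 M" "K \<in> L2 lborel" and e: "AE z in M. f z = K (snd z) + J f' z"
    using assms by (auto simp: rep_def)
  note [measurable] = L2_measurable[OF L(1)] L2_measurable[OF const_L2_I[OF L(3)]] L2_measurable[OF kop_L2(1)[OF kernel_J L(2)]]
  have "{z \<in> space M. f z = K (snd z) + J f' z} \<in> sets M" by measurable
  from AE_fibre_M[OF e this] show ?thesis by simp
qed

lemma integral_fst_M:
  fixes h :: "real \<times> real \<Rightarrow> complex"
  assumes "integrable M h"
  shows "(LINT z|M. h z) = (LINT y|lborel. LINT x|X. h (x, y))" "AE y in lborel. integrable X (\<lambda>x. h (x, y))"
    "integrable lborel (\<lambda>y. LINT x|X. h (x, y))"
  using P.integral_snd[of "\<lambda>x y. h (x, y)"] P.AE_integrable_snd[of "\<lambda>x y. h (x, y)"] P.integrable_snd[of "\<lambda>x y. h (x, y)"] assms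
  by (simp_all add: M_eq case_prod_unfold)

text \<open>On almost every fibre this is \<open>integration_by_parts\<close> for \<open>v'\<close>
  and \<open>f'\<close> together with the constants \<open>K'\<close> and \<open>K\<close>. The
  right-hand side is the product of the traces at \<beta> minus that at \<alpha>.\<close>

lemma green:
  assumes f: "rep f f' K" and v: "rep v v' K'"
  shows "(LINT z|M. v z * f' z) + (LINT z|M. v' z * f z)
    = (LINT y|lborel. (K' y + (LINT s|X. v' (s, y))) * (K y + (LINT s|X. f' (s, y))) - K' y * K y)"
proof -
  have L: "f \<in> L2 M" "f' \<in> L2 M" "v \<in> L2 M" "v' \<in> L2 M" using f v by (auto simp: rep_def)
  have i: "integrable M (\<lambda>z. v z * f' z)" "integrable M (\<lambda>z. v' z * f z)"
    using L by (auto intro: L2_prod_integrable)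
  have "(LINT z|M. v z * f' z) + (LINT z|M. v' z * f z) = (LINT z|M. v z * f' z + v' z * f z)"
    using i by simp
  also have "\<dots> = (LINT y|lborel. LINT x|X. v (x, y) * f' (x, y) + v' (x, y) * f (x, y))"
    by (rule integral_fst_M(1)) (use i in simp)
  also have "\<dots> = (LINT y|lborel. (K' y + (LINT s|X. v' (s, y))) * (K y + (LINT s|X. f' (s, y))) - K' y * K y)"
  proof (rule integral_cong_AE)
    show "(\<lambda>y. LINT x|X. v (x, y) * f' (x, y) + v' (x, y) * f (x, y)) \<in> borel_measurable lborel"
      using integral_fst_M(3)[of "\<lambda>z. v z * f' z + v' z * f z"] i by auto
    have av: "(\<lambda>y. LINT s|X. h (s, y)) \<in> borel_measurable lborel" if "h \<in> L2 M" for h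
      using const_L2_D[of "\<lambda>y. LINT s|X. h (s, y)"] kop_L2(1)[OF kernel_Av that] by (auto simp: kop_def[abs_def])
    note [measurable] = av[OF L(2)] av[OF L(4)]
    have [measurable]: "K \<in> borel_measurable lborel" "K' \<in> borel_measurable lborel" using f v by (auto simp: rep_def)
    show "(\<lambda>y. (K' y + (LINT s|X. v' (s, y))) * (K y + (LINT s|X. f' (s, y))) - K' y * K y) \<in> borel_measurable lborel"
      by measurable
    show "AE y in lborel. (LINT x|X. v (x, y) * f' (x, y) + v' (x, y) * f (x, y))
      = (K' y + (LINT s|X. v' (s, y))) * (K y + (LINT s|X. f' (s, y))) - K' y * K y"
      using rep_fibre[OF f] rep_fibre[OF v] AE_fibre_snd[OF L(1)] AE_fibre_snd[OF L(2)] AE_fibre_snd[OF L(3)] AE_fibre_snd[OF L(4)]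
    proof eventually_elim
      case (elim y)
      define p where "p x = v' (x, y)" for x
      define q where "q x = f' (x, y)" for x
      define jp where "jp x = (LINT s|X. of_bool (s \<le> x) * p s)" for x
      define jq where "jq x = (LINT s|X. of_bool (s \<le> x) * q s)" for x
      have pq: "integrable X p" "integrable X q" using elim(4,6) by (simp_all add: p_def[abs_def] q_def[abs_def] X.L2_imp_integrable)
      have fe: "AE x in X. f (x, y) = K y + jq x" and ve: "AE x in X. v (x, y) = K' y + jp x"
        using elim(1,2) by (simp_all add: kop_def jp_def jq_def p_def q_def)
      have L': "p \<in> L2 X" "q \<in> L2 X" using elim(4,6) by (auto simp: p_def[abs_def] q_def[abs_def])
      have one: "(\<lambda>x. c) \<in> L2 X" for c by (rule X.L2_bounded[where C = "cmod c"]) auto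
      have jm: "jp \<in> borel_measurable X" "jq \<in> borel_measurable X"
        unfolding jp_def[abs_def] jq_def[abs_def]
      proof -
        have id: "(\<lambda>x. x) \<in> X \<rightarrow>\<^sub>M borel" by simp
        have a: "(\<lambda>z. fst z) \<in> X \<Otimes>\<^sub>M X \<rightarrow>\<^sub>M (borel :: real measure)" "(\<lambda>z. snd z) \<in> X \<Otimes>\<^sub>M X \<rightarrow>\<^sub>M (borel :: real measure)"
          using measurable_compose[OF measurable_fst id] measurable_compose[OF measurable_snd id] by auto
        note [measurable] = kernel_measurable[OF kernel_J a]
        have [measurable]: "p \<in> borel_measurable X" "q \<in> borel_measurable X" using pq by auto
        show "(\<lambda>x. LINT s|X. of_bool (s \<le> x) * p s) \<in> borel_measurable X" "(\<lambda>x. LINT s|X. of_bool (s \<le> x) * q s) \<in> borel_measurable X"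
          by (rule X.borel_measurable_lebesgue_integral; simp add: case_prod_unfold)+
      qed
      have vL: "(\<lambda>x. K' y + jp x) \<in> L2 X" "(\<lambda>x. K y + jq x) \<in> L2 X"
        by (rule L2_cong_AE[OF elim(5)], use jm ve in auto) (rule L2_cong_AE[OF elim(3)], use jm fe in auto)
      have jL: "jp \<in> L2 X" "jq \<in> L2 X"
        using L2_diff[OF vL(1) one[of "K' y"]] L2_diff[OF vL(2) one[of "K y"]] by simp_all
      note ij = L2_prod_integrable[OF jL(1) L'(2)] L2_prod_integrable[OF L'(1) jL(2)]
      have "(LINT x|X. v (x, y) * f' (x, y) + v' (x, y) * f (x, y)) = (LINT x|X. (K' y * q x + K y * p x) + (jp x * q x + p x * jq x))"
      proof (rule integral_cong_AE)
        show "AE x in X. v (x, y) * f' (x, y) + v' (x, y) * f (x, y) = (K' y * q x + K y * p x) + (jp x * q x + p x * jq x)"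
          using fe ve by eventually_elim (simp add: p_def q_def algebra_simps)
      qed (use elim(3-6) jm pq in auto)
      also have "\<dots> = K' y * (LINT x|X. q x) + K y * (LINT x|X. p x) + ((LINT x|X. jp x * q x) + (LINT x|X. p x * jq x))"
        using pq ij by simp
      also have "(LINT x|X. jp x * q x) + (LINT x|X. p x * jq x) = (LINT x|X. p x) * (LINT x|X. q x)"
        unfolding jp_def jq_def by (rule integration_by_parts[OF pq])
      finally show ?case by (simp add: p_def q_def algebra_simps)
    qed
  qed
  finally show ?thesis .
qed

end

lemma smooth_continuous_on: "smooth \<phi> \<Longrightarrow> continuous_on S \<phi>"
  by (rule continuous_at_imp_continuous_on) (auto intro: differentiable_imp_continuous_within smooth_differentiable)

lemma line_derivative:
  assumes "smooth \<phi>"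
  shows "((\<lambda>t. \<phi> (p + t *\<^sub>R v)) has_vector_derivative dir_deriv v \<phi> (p + t *\<^sub>R v)) (at t within T)"
proof -
  have f: "(\<phi> has_derivative frechet_derivative \<phi> (at (p + t *\<^sub>R v))) (at (p + t *\<^sub>R v))"
    using smooth_differentiable[OF assms] by (simp add: frechet_derivative_works)
  have g: "((\<lambda>t. p + t *\<^sub>R v) has_derivative (\<lambda>h. h *\<^sub>R v)) (at t within T)"
    by (auto intro!: derivative_eq_intros)
  have "((\<lambda>t. \<phi> (p + t *\<^sub>R v)) has_derivative (\<lambda>h. frechet_derivative \<phi> (at (p + t *\<^sub>R v)) (h *\<^sub>R v))) (at t within T)"
    by (rule has_derivative_compose[OF g f])
  then show ?thesis
    using linear_scale[OF has_derivative_linear[OF f]] by (simp add: has_vector_derivative_def dir_deriv_def)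
qed

lemma test_function_outside:
  assumes "test_function (S \<times> UNIV) \<phi>" "x \<notin> S" shows "\<phi> (x, y) = 0"
  using assms closure_subset[of "{p. \<phi> p \<noteq> 0}"] by (fastforce simp: test_function_def)

lemma test_functionD:
  assumes "test_function (S \<times> UNIV) (\<phi> :: real \<times> real \<Rightarrow> complex)"
  obtains C R where "\<And>p. cmod (\<phi> p) \<le> C" "\<And>p. cmod (dir_deriv v \<phi> p) \<le> C"
    "\<And>p. \<bar>snd p\<bar> > R \<Longrightarrow> \<phi> p = 0" "\<And>p. \<bar>snd p\<bar> > R \<Longrightarrow> dir_deriv v \<phi> p = 0"
proof -
  define K where "K = closure {p. \<phi> p \<noteq> 0}"
  have sm: "smooth \<phi>" and K: "compact K" "K \<subseteq> S \<times> UNIV"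
    using assms by (auto simp: test_function_def K_def)
  have \<phi>0: "\<phi> p = 0" if "p \<notin> K" for p
    using that closure_subset[of "{p. \<phi> p \<noteq> 0}"] by (auto simp: K_def)
  have D0: "dir_deriv v \<phi> p = 0" if "p \<notin> K" for p
  proof -
    have "open (- K)" using K(1) by (simp add: compact_imp_closed open_Compl)
    then have "(\<phi> has_derivative (\<lambda>h. 0)) (at p)"
      using that \<phi>0 by (intro has_derivative_transform_within_open[OF has_derivative_const[of 0]]) auto
    then show ?thesis by (rule dir_deriv_eq)
  qed
  have "bounded (\<phi> ` K)" "bounded (dir_deriv v \<phi> ` K)"
    using K(1) smooth_continuous_on[OF sm] smooth_continuous_on[OF smooth_dir_deriv[OF sm, of v]]
    by (auto intro!: compact_imp_bounded compact_continuous_image)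
  then obtain C1 C2 where C: "\<And>p. p \<in> K \<Longrightarrow> cmod (\<phi> p) \<le> C1" "\<And>p. p \<in> K \<Longrightarrow> cmod (dir_deriv v \<phi> p) \<le> C2"
    by (auto simp: bounded_iff)
  obtain R where R: "\<And>p. p \<in> K \<Longrightarrow> norm p \<le> R"
    using compact_imp_bounded[OF K(1)] by (auto simp: bounded_iff)
  show ?thesis
  proof
    show "cmod (\<phi> p) \<le> \<bar>C1\<bar> + \<bar>C2\<bar>" for p using C(1)[of p] \<phi>0[of p] by (cases "p \<in> K") auto
    show "cmod (dir_deriv v \<phi> p) \<le> \<bar>C1\<bar> + \<bar>C2\<bar>" for p using C(2)[of p] D0[of p] by (cases "p \<in> K") auto
    have "p \<notin> K" if "\<bar>snd p\<bar> > R" for p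
      using R[of p] that norm_snd_le[of "snd p" "fst p"] by auto
    then show "\<And>p. \<bar>snd p\<bar> > R \<Longrightarrow> \<phi> p = 0" "\<And>p. \<bar>snd p\<bar> > R \<Longrightarrow> dir_deriv v \<phi> p = 0"
      using \<phi>0 D0 by auto
  qed
qed

context strip
begin

lemma test_function_L2:
  assumes "test_function ({\<alpha><..<\<beta>} \<times> UNIV) \<phi>"
  shows "\<phi> \<in> L2 M" "dir_deriv v \<phi> \<in> L2 M"
proof -
  obtain C R where C: "\<And>p. cmod (\<phi> p) \<le> C" "\<And>p. cmod (dir_deriv v \<phi> p) \<le> C"
    "\<And>p. \<bar>snd p\<bar> > R \<Longrightarrow> \<phi> p = 0" "\<And>p. \<bar>snd p\<bar> > R \<Longrightarrow> dir_deriv v \<phi> p = 0"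
    using test_functionD[OF assms, where v = v] by blast
  have sm: "smooth \<phi>" using assms by (simp add: test_function_def)
  have m: "\<phi> \<in> borel_measurable M" "dir_deriv v \<phi> \<in> borel_measurable M"
    using smooth_continuous_on[OF sm] smooth_continuous_on[OF smooth_dir_deriv[OF sm, of v]]
    by (auto intro!: sets_strip_borel borel_measurable_continuous_onI)
  show "\<phi> \<in> L2 M" by (rule L2_strip_bounded[OF m(1) C(1,3)])
  show "dir_deriv v \<phi> \<in> L2 M" by (rule L2_strip_bounded[OF m(2) C(2,4)])
qed

lemma LINT_J:
  fixes h :: "real \<Rightarrow> complex"
  assumes "x \<in> {\<alpha>..\<beta>}"
  shows "(LINT s|X. of_bool (s \<le> x) * h s) = (LINT s|restrict_space lborel {\<alpha>..x}. h s)"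
  unfolding LINT_restrict_interval set_lebesgue_integral_def
  by (rule Bochner_Integration.integral_cong) (use assms in \<open>auto simp: indicator_def\<close>)

lemma rep_of_eq:
  assumes "f \<in> L2 M" "f' \<in> L2 M" "\<And>x y. x \<in> {\<alpha>..\<beta>} \<Longrightarrow> f (x, y) = J f' (x, y)"
  shows "rep f f' (\<lambda>y. 0)"
  unfolding rep_def using assms L2_zero
  by (auto intro!: AE_I2 simp: space_strip)

lemma rep_test_function:
  assumes "test_function ({\<alpha><..<\<beta>} \<times> UNIV) \<phi>"
  shows "rep \<phi> (dir_deriv (1, 0) \<phi>) (\<lambda>y. 0)" "(LINT s|X. dir_deriv (1, 0) \<phi> (s, y)) = 0"
proof -
  let ?D = "dir_deriv (1, 0) \<phi>"
  have sm: "smooth \<phi>" using assms by (simp add: test_function_def)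
  have int: "(LINT s|restrict_space lborel {\<alpha>..x}. ?D (s, y)) = \<phi> (x, y)" if x: "x \<in> {\<alpha>..\<beta>}" for x y
  proof -
    have "(LINT s|restrict_space lborel {\<alpha>..x}. ?D (s, y)) = \<phi> (x, y) - \<phi> (\<alpha>, y)"
    proof (rule LBINT_has_vector_derivative)
      show "((\<lambda>x. \<phi> (x, y)) has_vector_derivative ?D (s, y)) (at s within {\<alpha>..x})" for s
        using line_derivative[OF sm, of "(0, y)" "(1, 0)" s] by simp
      show "continuous_on {\<alpha>..x} (\<lambda>s. ?D (s, y))"
        by (rule continuous_on_compose2[OF smooth_continuous_on[OF smooth_dir_deriv[OF sm], of UNIV]])
           (auto intro!: continuous_intros)
    qed (use x in auto)
    then show ?thesis using test_function_outside[OF assms, of \<alpha> y] by simp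
  qed
  show "rep \<phi> ?D (\<lambda>y. 0)"
    by (rule rep_of_eq) (use test_function_L2[OF assms] int LINT_J in \<open>auto simp: kop_def\<close>)
  have "\<phi> (\<beta>, y) = 0"
    using test_function_outside[OF assms, of \<beta> y] by simp
  then show "(LINT s|X. ?D (s, y)) = 0"
    using int[of \<beta> y] ab by simp
qed

text \<open>Test functions have zero traces at both ends, so \<open>green\<close> leaves no boundary
  term.\<close>

lemma rep_imp_weak_deriv:
  assumes "rep f f' K" shows "weak_deriv \<alpha> \<beta> (1, 0) f f'"
  unfolding weak_deriv_def
proof (intro allI impI)
  fix \<phi> :: "real \<times> real \<Rightarrow> complex" assume t: "test_function ({\<alpha><..<\<beta>} \<times> UNIV) \<phi>"
  have "(LINT z|M. \<phi> z * f' z) + (LINT z|M. dir_deriv (1, 0) \<phi> z * f z) = 0"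
    using green[OF assms rep_test_function(1)[OF t]] by (simp add: rep_test_function(2)[OF t])
  then show "(LINT p|M. f p * dir_deriv (1, 0) \<phi> p) = - (LINT p|M. f' p * \<phi> p)"
    by (simp add: mult.commute add_eq_0_iff)
qed

lemma LINT_step:
  assumes "\<alpha> \<le> p" "x \<in> {\<alpha>..\<beta>}"
  shows "(LINT s|restrict_space lborel {\<alpha>..x}. step (s - p)) = ramp (x - p)"
    "integrable (restrict_space lborel {\<alpha>..x}) (\<lambda>s. step (s - p))"
proof -
  have e: "indicator {\<alpha>..x} s *\<^sub>R step (s - p) = indicator {p<..x} s" for s
    using assms by (auto simp: indicator_def step_def)
  have i: "integrable lborel (indicat_real {p<..x})"
  proof (rule integrable_real_indicator)
    show "emeasure lborel {p<..x} < \<infinity>" by (cases "p \<le> x") (auto simp: not_le less_imp_le)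
  qed simp
  have "(LINT s|lborel. indicat_real {p<..x} s) = ramp (x - p)"
    by (cases "p \<le> x") (auto simp: ramp_def)
  then show "(LINT s|restrict_space lborel {\<alpha>..x}. step (s - p)) = ramp (x - p)"
    unfolding LINT_restrict_interval set_lebesgue_integral_def e by simp
  show "integrable (restrict_space lborel {\<alpha>..x}) (\<lambda>s. step (s - p))"
    unfolding integrable_restrict_interval set_integrable_def e using i by simp
qed

lemma LINT_comb_step:
  assumes "\<alpha> \<le> p1" "\<alpha> \<le> q1" "\<alpha> \<le> p2" "\<alpha> \<le> q2" "x \<in> {\<alpha>..\<beta>}"
  shows "(LINT s|restrict_space lborel {\<alpha>..x}. complex_of_real (comb w1 p1 q1 w2 p2 q2 step s)) = of_real (comb w1 p1 q1 w2 p2 q2 ramp x)"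
proof -
  note i = LINT_step(2)[OF assms(1,5)] LINT_step(2)[OF assms(2,5)] LINT_step(2)[OF assms(3,5)] LINT_step(2)[OF assms(4,5)]
  have "(LINT s|restrict_space lborel {\<alpha>..x}. comb w1 p1 q1 w2 p2 q2 step s) = comb w1 p1 q1 w2 p2 q2 ramp x"
    using i by (simp add: comb_def LINT_step(1)[OF assms(1,5)] LINT_step(1)[OF assms(2,5)]
        LINT_step(1)[OF assms(3,5)] LINT_step(1)[OF assms(4,5)])
  then show ?thesis by simp
qed

lemma borel_measurable_product_M:
  assumes [measurable]: "F \<in> borel_measurable borel" "G \<in> borel_measurable borel"
  shows "(\<lambda>z. complex_of_real (F (fst z) * G (snd z))) \<in> borel_measurable M"
proof -
  have "(\<lambda>z :: real \<times> real. complex_of_real (F (fst z) * G (snd z))) \<in> borel_measurable (borel \<Otimes>\<^sub>M borel)" by measurable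
  then show ?thesis unfolding borel_prod by (rule sets_strip_borel)
qed

lemma comb_step_bounds:
  "\<bar>comb w1 p1 q1 w2 p2 q2 step s\<bar> \<le> \<bar>w1\<bar> + \<bar>w2\<bar>"
  "\<bar>comb w1 p1 q1 w2 p2 q2 ramp s\<bar> \<le> \<bar>w1\<bar> * \<bar>q1 - p1\<bar> + \<bar>w2\<bar> * \<bar>q2 - p2\<bar>"
  using comb_abs_le[of step 1] comb_abs_le_lipschitz[of ramp] by (auto simp: step_def ramp_def)

lemma product_L2:
  assumes "F \<in> borel_measurable borel" "\<And>s. \<bar>F s\<bar> \<le> A" and cd: "c < d"
  shows "(\<lambda>z. complex_of_real (F (fst z) * comb 1 c d 0 c d step (snd z))) \<in> L2 M"
proof (rule L2_strip_bounded[where K = A and R = "\<bar>c\<bar> + \<bar>d\<bar>"])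
  show "(\<lambda>z. complex_of_real (F (fst z) * comb 1 c d 0 c d step (snd z))) \<in> borel_measurable M"
    by (rule borel_measurable_product_M) (use assms in auto)
  have "0 \<le> A" using assms(2)[of 0] by simp
  then show "cmod (complex_of_real (F (fst z) * comb 1 c d 0 c d step (snd z))) \<le> A" for z
    using assms(2)[of "fst z"] cd by (auto simp: comb_step_single)
  show "\<bar>snd z\<bar> > \<bar>c\<bar> + \<bar>d\<bar> \<Longrightarrow> complex_of_real (F (fst z) * comb 1 c d 0 c d step (snd z)) = 0" for z :: "real \<times> real"
    using cd by (auto simp: comb_step_single)
qed

text \<open>Du Bois-Reymond's argument: \<open>h = f - J f'\<close> has vanishing weak
  \<open>x\<close>-derivative. Testing it with a piecewise linear function compares its mean over
  \<open>{p<..q}\<close> with its mean \<open>K\<close> over a fixed reference interval. All means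
  agree, so \<open>strip_zero\<close> gives \<open>h = K\<close>.\<close>

lemma weak_deriv_imp_rep:
  assumes f: "f \<in> L2 M" and f': "f' \<in> L2 M" and wd: "weak_deriv \<alpha> \<beta> (1, 0) f f'"
  shows "\<exists>K. rep f f' K"
proof -
  \<comment> \<open>The middle third; any reference interval strictly inside would do.\<close>
  define p0 q0 where "p0 = \<alpha> + (\<beta> - \<alpha>) / 3" and "q0 = \<beta> - (\<beta> - \<alpha>) / 3"
  have pq0: "\<alpha> < p0" "p0 < q0" "q0 < \<beta>" using ab by (auto simp: p0_def q0_def field_simps)
  define h where "h z = f z - J f' z" for z
  have Jf: "J f' \<in> L2 M" by (rule kop_L2(1)[OF kernel_J f'])
  have h: "h \<in> L2 M" unfolding h_def[abs_def] by (rule L2_diff[OF f Jf])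
  define k0 where "k0 x s = complex_of_real (comb 1 p0 q0 0 p0 q0 step s)" for x s :: real
  have k0: "kernel k0"
    unfolding kernel_def k0_def using comb_step_bounds(1)[of 1 p0 q0 0 p0 q0] by (auto simp: case_prod_unfold)
  define K where "K y = (LINT s|X. of_real (comb 1 p0 q0 0 p0 q0 step s) * h (s, y)) / of_real (q0 - p0)" for y
  have "(\<lambda>z. (1 / of_real (q0 - p0)) * kop k0 h z) \<in> L2 M"
    by (rule L2_cmult[OF kop_L2(1)[OF k0 h]])
  then have KM: "(\<lambda>z. K (snd z)) \<in> L2 M"
    by (simp add: K_def kop_def k0_def)
  have K: "K \<in> L2 lborel" by (rule const_L2_D[OF KM])
  have "AE z in M. h z - K (snd z) = 0"
  proof (rule strip_zero[OF L2_diff[OF h KM]])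
    fix p q c d :: real assume pq: "\<alpha> < p" "p < q" "q < \<beta>" and cd: "c < d"
    \<comment> \<open>Opposite total masses, so that the primitive has compact support in the open
      interval and may be tested against.\<close>
    let ?w1 = "1 / (q - p)" and ?w2 = "- (1 / (q0 - p0))"
    let ?a = "comb ?w1 p q ?w2 p0 q0" and ?\<psi> = "comb 1 c d 0 c d step"
    have w: "?w1 * (q - p) + ?w2 * (q0 - p0) = 0" using pq pq0 by simp
    define v where "v z = complex_of_real (?a ramp (fst z) * ?\<psi> (snd z))" for z :: "real \<times> real"
    define v' where "v' z = complex_of_real (?a step (fst z) * ?\<psi> (snd z))" for z :: "real \<times> real"
    have vL: "v \<in> L2 M" "v' \<in> L2 M"
      unfolding v_def[abs_def] v'_def[abs_def] by (rule product_L2[OF _ comb_step_bounds(2) cd], simp) (rule product_L2[OF _ comb_step_bounds(1) cd], simp)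
    have Jv: "J v' (x, y) = v (x, y)" if "x \<in> {\<alpha>..\<beta>}" for x y
      using LINT_comb_step[of p q p0 q0 x ?w1 ?w2] that pq pq0
      by (simp add: kop_def LINT_J v_def v'_def)
    have rv: "rep v v' (\<lambda>y. 0)" by (rule rep_of_eq[OF vL]) (simp add: Jv)
    have intv: "(LINT s|X. v' (s, y)) = 0" for y
    proof -
      have "(LINT s|X. v' (s, y)) = of_real (?a ramp \<beta>) * of_real (?\<psi> y)"
        using LINT_comb_step[of p q p0 q0 \<beta> ?w1 ?w2] pq pq0 ab by (simp add: v'_def)
      also have "?a ramp \<beta> = 0" using pq pq0 by (simp add: comb_def ramp_def)
      finally show ?thesis by simp
    qed
    have rJ: "rep (J f') f' (\<lambda>y. 0)" by (rule rep_of_eq[OF Jf f']) simp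
    have 1: "(LINT z|M. v z * f' z) + (LINT z|M. v' z * J f' z) = 0"
      using green[OF rJ rv] by (simp add: intv)
    have 2: "(LINT z|M. f z * v' z) = - (LINT z|M. f' z * v z)"
      unfolding v_def v'_def by (rule weak_deriv_comb(1)[OF f f' pq(2) pq0(2) w cd wd pq(1) pq0(1) pq(3) pq0(3)])
    have 3: "(LINT z|M. h z * v' z) = 0"
    proof -
      have "(LINT z|M. h z * v' z) = (LINT z|M. f z * v' z - v' z * J f' z)"
        by (rule Bochner_Integration.integral_cong) (auto simp: h_def algebra_simps)
      also have "\<dots> = (LINT z|M. f z * v' z) - (LINT z|M. v' z * J f' z)"
        by (rule Bochner_Integration.integral_diff) (intro L2_prod_integrable f vL Jf)+
      also have "\<dots> = 0" using 1 2 by (simp add: mult.commute add_eq_0_iff2)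
      finally show ?thesis .
    qed
    define I where "I p q z = complex_of_real (comb 1 p q 0 p q step (fst z) * ?\<psi> (snd z))" for p q and z :: "real \<times> real"
    have IL: "I p q \<in> L2 M" for p q
      unfolding I_def[abs_def] by (rule product_L2[OF _ comb_step_bounds(1) cd]) simp
    have v'I: "v' z = of_real ?w1 * I p q z + of_real ?w2 * I p0 q0 z" for z
      by (simp add: v'_def I_def comb_def algebra_simps)
    have ih: "integrable M (\<lambda>z. h z * I p q z)" for p q by (rule L2_prod_integrable[OF h IL])
    have 4: "of_real ?w1 * (LINT z|M. h z * I p q z) + of_real ?w2 * (LINT z|M. h z * I p0 q0 z) = 0"
    proof -
      have "h z * v' z = of_real ?w1 * (h z * I p q z) + of_real ?w2 * (h z * I p0 q0 z)" for z
        unfolding v'I by (simp add: algebra_simps)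
      then show ?thesis using 3 ih[of p q] ih[of p0 q0] by simp
    qed
    have 5: "(LINT z|M. h z * I p0 q0 z) = of_real (q0 - p0) * (LINT y|lborel. K y * of_real (?\<psi> y))"
    proof -
      have "(LINT z|M. h z * I p0 q0 z) = (LINT y|lborel. LINT x|X. h (x, y) * I p0 q0 (x, y))"
        by (rule integral_fst_M(1)[OF ih])
      also have "\<dots> = (LINT y|lborel. of_real (q0 - p0) * (K y * of_real (?\<psi> y)))"
      proof (rule Bochner_Integration.integral_cong[OF refl])
        fix y
        have "(LINT x|X. h (x, y) * I p0 q0 (x, y)) = (LINT x|X. (of_real (comb 1 p0 q0 0 p0 q0 step x) * h (x, y)) * of_real (?\<psi> y))"
          by (rule Bochner_Integration.integral_cong) (auto simp: I_def)
        also have "\<dots> = (LINT x|X. of_real (comb 1 p0 q0 0 p0 q0 step x) * h (x, y)) * of_real (?\<psi> y)"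
          by simp
        also have "\<dots> = of_real (q0 - p0) * (K y * of_real (?\<psi> y))"
          using pq0 by (simp add: K_def)
        finally show "(LINT x|X. h (x, y) * I p0 q0 (x, y)) = of_real (q0 - p0) * (K y * of_real (?\<psi> y))" .
      qed
      finally show ?thesis by simp
    qed
    have 6: "(LINT z|M. K (snd z) * I p q z) = of_real (q - p) * (LINT y|lborel. K y * of_real (?\<psi> y))"
    proof -
      have "(LINT z|M. K (snd z) * I p q z) = (LINT y|lborel. LINT x|X. K (snd (x, y)) * I p q (x, y))"
        by (rule integral_fst_M(1)[OF L2_prod_integrable[OF KM IL]])
      also have "\<dots> = (LINT y|lborel. of_real (q - p) * (K y * of_real (?\<psi> y)))"
      proof (rule Bochner_Integration.integral_cong[OF refl])
        fix y
        have "(LINT x|X. K (snd (x, y)) * I p q (x, y)) = (LINT x|X. of_real (comb 1 p q 0 p q step x) * (K y * of_real (?\<psi> y)))"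
          by (rule Bochner_Integration.integral_cong) (auto simp: I_def)
        also have "\<dots> = (LINT x|X. of_real (comb 1 p q 0 p q step x)) * (K y * of_real (?\<psi> y))"
          by (rule integral_mult_left_zero)
        also have "(LINT x|X. complex_of_real (comb 1 p q 0 p q step x)) = of_real (q - p)"
          using LINT_comb_step[of p q p q \<beta> 1 0] pq by (simp add: comb_def[of _ _ _ _ _ _ ramp] ramp_def)
        finally show "(LINT x|X. K (snd (x, y)) * I p q (x, y)) = of_real (q - p) * (K y * of_real (?\<psi> y))" .
      qed
      finally show ?thesis by simp
    qed
    have "(LINT z|M. h z * I p q z) = of_real (q - p) * (LINT y|lborel. K y * of_real (?\<psi> y))"
    proof -
      have w2: "of_real ?w2 * complex_of_real (q0 - p0) = -1" and w1: "complex_of_real (q - p) * of_real ?w1 = 1"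
        using pq pq0 by (simp_all flip: of_real_mult)
      have "of_real ?w1 * (LINT z|M. h z * I p q z) = (LINT y|lborel. K y * of_real (?\<psi> y))"
        using 4 unfolding 5 mult.assoc[symmetric] w2 by simp
      then have "complex_of_real (q - p) * (of_real ?w1 * (LINT z|M. h z * I p q z)) = of_real (q - p) * (LINT y|lborel. K y * of_real (?\<psi> y))"
        by (rule arg_cong)
      then show ?thesis unfolding mult.assoc[symmetric] w1 by simp
    qed
    then have "(LINT z|M. h z * I p q z) - (LINT z|M. K (snd z) * I p q z) = 0" using 6 by simp
    moreover have "(LINT z|M. h z * I p q z - K (snd z) * I p q z) = (LINT z|M. h z * I p q z) - (LINT z|M. K (snd z) * I p q z)"
      by (rule Bochner_Integration.integral_diff[OF ih L2_prod_integrable[OF KM IL]])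
    ultimately show "(LINT z|M. (h z - K (snd z)) * of_real (comb 1 p q 0 p q step (fst z) * comb 1 c d 0 c d step (snd z))) = 0"
      unfolding left_diff_distrib I_def by simp
  qed
  then have "AE z in M. f z = K (snd z) + J f' z"
    by eventually_elim (simp add: h_def algebra_simps)
  then show ?thesis using f f' K by (auto simp: rep_def)
qed

section \<open>Traces at fixed \<open>x\<close> and the domain of \<open>P\<close>\<close>

definition tr :: "(real \<Rightarrow> complex) \<Rightarrow> (real \<times> real \<Rightarrow> complex) \<Rightarrow> real \<Rightarrow> real \<Rightarrow> complex" where
  "tr K f' x y = K y + J f' (x, y)"

lemma kernel_const: "F \<in> borel_measurable borel \<Longrightarrow> (\<And>s. cmod (F s) \<le> 1) \<Longrightarrow> kernel (\<lambda>x s. F s)"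
  by (auto simp: kernel_def case_prod_unfold)

lemma J_fibre_L2:
  assumes "f' \<in> L2 M" shows "(\<lambda>y. J f' (x, y)) \<in> L2 lborel"
proof (rule const_L2_D)
  have "kernel (\<lambda>_ s. of_bool (s \<le> x))" by (rule kernel_const) auto
  from kop_L2(1)[OF this assms] show "(\<lambda>z. J f' (x, snd z)) \<in> L2 M" by (simp add: kop_def[abs_def])
qed

lemma tr_L2: "K \<in> L2 lborel \<Longrightarrow> f' \<in> L2 M \<Longrightarrow> tr K f' x \<in> L2 lborel"
  unfolding tr_def[abs_def] by (intro L2_add J_fibre_L2)

text \<open>Cauchy-Schwarz in \<open>s\<close> against the indicator of the interval between
  \<open>x\<close> and \<open>t\<close>, whose squared norm is at most
  \<open>|t - x|\<close>.\<close>

lemma tr_dist: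
  assumes K: "K \<in> L2 lborel" and f': "f' \<in> L2 M" and xt: "x \<in> {\<alpha>..\<beta>}" "t \<in> {\<alpha>..\<beta>}"
  shows "l2_dist lborel (tr K f' t) (tr K f' x) \<le> sqrt (\<bar>t - x\<bar> * l2sq M f')"
proof -
  define F where "F s = (of_bool (s \<le> t) - of_bool (s \<le> x) :: complex)" for s
  have Fm [measurable]: "F \<in> borel_measurable borel" unfolding F_def[abs_def] by measurable
  have kF: "kernel (\<lambda>_ s. F s)" by (rule kernel_const) (auto simp: F_def)
  have l2F: "l2sq X F \<le> \<bar>t - x\<bar>"
  proof -
    have "l2sq X F = (LINT s|lborel. indicat_real {min t x<..max t x} s)"
      unfolding l2sq_def LINT_restrict_interval set_lebesgue_integral_def
      by (rule Bochner_Integration.integral_cong) (use xt in \<open>auto simp: F_def indicator_def\<close>)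
    also have "\<dots> = \<bar>t - x\<bar>" by (simp add: max_def min_def)
    finally show ?thesis by simp
  qed
  have L: "(\<lambda>y. tr K f' t y - tr K f' x y) \<in> L2 lborel" by (intro L2_diff[OF tr_L2 tr_L2] K f')
  have "ennreal (l2sq lborel (\<lambda>y. tr K f' t y - tr K f' x y)) = (\<integral>\<^sup>+y. ennreal ((cmod (tr K f' t y - tr K f' x y))\<^sup>2) \<partial>lborel)"
    unfolding l2sq_def by (rule nn_integral_eq_integral[symmetric, OF L2_integrable[OF L]]) auto
  also have "\<dots> \<le> (\<integral>\<^sup>+y. ennreal \<bar>t - x\<bar> * ennreal (l2sq X (\<lambda>s. f' (s, y))) \<partial>lborel)"
  proof (rule nn_integral_mono_AE, use AE_fibre_snd[OF f'] in eventually_elim)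
    case (elim y)
    have i: "integrable X (\<lambda>s. of_bool (s \<le> x) * f' (s, y))" for x
      by (rule kop_bound(2)[OF _ elim, where x = 0]) (rule kernel_const, auto)
    have "tr K f' t y - tr K f' x y = kop (\<lambda>_ s. F s) f' (0, y)"
      using i[of t] i[of x] by (simp add: tr_def kop_def F_def left_diff_distrib)
    then have "(cmod (tr K f' t y - tr K f' x y))\<^sup>2 \<le> l2sq X F * l2sq X (\<lambda>s. f' (s, y))"
      using kop_bound(1)[OF kF elim, of 0] by simp
    also have "\<dots> \<le> \<bar>t - x\<bar> * l2sq X (\<lambda>s. f' (s, y))" by (rule mult_right_mono[OF l2F]) simp
    finally show ?case by (simp add: ennreal_mult[symmetric] ennreal_leI)
  qed
  also have "\<dots> = ennreal (\<bar>t - x\<bar> * l2sq M f')"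
  proof -
    have [measurable]: "f' \<in> borel_measurable (X \<Otimes>\<^sub>M lborel)" using f' by (auto simp: M_eq)
    have "(\<lambda>y. LINT s|X. (cmod (f' (s, y)))\<^sup>2) \<in> borel_measurable lborel"
      by (rule X.borel_measurable_lebesgue_integral) measurable
    then show ?thesis
      by (subst nn_integral_cmult) (simp_all add: l2sq_fibre_snd[OF f'] ennreal_mult, simp add: l2sq_def)
  qed
  finally have "l2sq lborel (\<lambda>y. tr K f' t y - tr K f' x y) \<le> \<bar>t - x\<bar> * l2sq M f'"
    by (subst (asm) ennreal_le_iff) auto
  then show ?thesis unfolding l2_dist_eq by (rule real_sqrt_le_mono)
qed

lemma rep_continuous_representative:
  assumes r: "rep f f' K" shows "continuous_representative \<alpha> \<beta> f (tr K f')"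
proof -
  have L: "f' \<in> L2 M" "K \<in> L2 lborel" and e: "AE z in M. f z = K (snd z) + J f' z"
    using r by (auto simp: rep_def)
  have "((\<lambda>t. l2_dist lborel (tr K f' t) (tr K f' x)) \<longlongrightarrow> 0) (at x within {\<alpha>..\<beta>})" if x: "x \<in> {\<alpha>..\<beta>}" for x
  proof (rule Lim_null_comparison)
    show "\<forall>\<^sub>F t in at x within {\<alpha>..\<beta>}. norm (l2_dist lborel (tr K f' t) (tr K f' x)) \<le> sqrt (\<bar>t - x\<bar> * l2sq M f')"
      using tr_dist[OF L(2,1) x] by (auto simp: eventually_at_filter)
    have "((\<lambda>t. sqrt (\<bar>t - x\<bar> * l2sq M f')) \<longlongrightarrow> sqrt (\<bar>x - x\<bar> * l2sq M f')) (at x within {\<alpha>..\<beta>})"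
      by (intro tendsto_intros)
    then show "((\<lambda>t. sqrt (\<bar>t - x\<bar> * l2sq M f')) \<longlongrightarrow> 0) (at x within {\<alpha>..\<beta>})" by simp
  qed
  moreover have "AE x in X. ae_eq lborel (\<lambda>y. f (x, y)) (tr K f' x)"
    using P.AE_pair[OF e[unfolded M_eq]] by (simp add: ae_eq_def tr_def)
  ultimately show ?thesis
    using tr_L2[OF L(2,1)] by (simp add: continuous_representative_def)
qed

text \<open>The two representatives agree at almost every \<open>x\<close>, hence at points
  arbitrarily close to \<open>x0\<close>, and both are continuous into \<open>L2\<close>.\<close>

lemma continuous_representative_unique:
  assumes F: "continuous_representative \<alpha> \<beta> f F" and G: "continuous_representative \<alpha> \<beta> g G"
    and eq: "AE x in X. ae_eq lborel (\<lambda>y. f (x, y)) (\<lambda>y. g (x, y))"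
    and x0: "x0 \<in> {\<alpha>..\<beta>}"
  shows "ae_eq lborel (F x0) (G x0)"
proof -
  have FL: "F x \<in> L2 lborel" and GL: "G x \<in> L2 lborel" if "x \<in> {\<alpha>..\<beta>}" for x
    using F G that by (auto simp: continuous_representative_def)
  have AEeq: "AE x in X. ae_eq lborel (F x) (G x)"
  proof -
    have "AE x in X. ae_eq lborel (\<lambda>y. f (x, y)) (F x)" "AE x in X. ae_eq lborel (\<lambda>y. g (x, y)) (G x)"
      using F G by (auto simp: continuous_representative_def)
    then show ?thesis using eq
    proof eventually_elim
      case (elim x)
      show ?case using elim unfolding ae_eq_def by eventually_elim simp
    qed
  qed
  have "((\<lambda>t. l2_dist lborel (F t) (F x0) + l2_dist lborel (G t) (G x0)) \<longlongrightarrow> 0 + 0) (at x0 within {\<alpha>..\<beta>})"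
    using F G x0 by (intro tendsto_add) (auto simp: continuous_representative_def)
  then have lim: "((\<lambda>t. l2_dist lborel (F t) (F x0) + l2_dist lborel (G t) (G x0)) \<longlongrightarrow> 0) (at x0 within {\<alpha>..\<beta>})" by simp
  have "l2_dist lborel (F x0) (G x0) \<le> e" if e: "e > 0" for e
  proof -
    from order_tendstoD(2)[OF lim e] obtain d where d: "d > 0"
      and near: "\<And>t. t \<in> {\<alpha>..\<beta>} \<Longrightarrow> t \<noteq> x0 \<Longrightarrow> dist t x0 < d \<Longrightarrow> l2_dist lborel (F t) (F x0) + l2_dist lborel (G t) (G x0) < e"
      unfolding eventually_at by blast
    \<comment> \<open>A nondegenerate interval next to \<open>x0\<close> inside
      \<open>[\<alpha>,\<beta>]\<close>, on the left only when \<open>x0\<close> is the right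
      endpoint; agreement almost everywhere supplies a point in it.\<close>
    obtain l r where lr: "\<alpha> \<le> l" "l < r" "r \<le> \<beta>" "\<And>t. t \<in> {l<..<r} \<Longrightarrow> t \<noteq> x0 \<and> \<bar>t - x0\<bar> < d"
    proof (cases "x0 < \<beta>")
      case True
      show ?thesis by (rule that[of x0 "min \<beta> (x0 + d)"]) (use True x0 d in auto)
    next
      case False
      show ?thesis by (rule that[of "max \<alpha> (x0 - d)" x0]) (use False x0 d ab in auto)
    qed
    obtain t where t: "t \<in> {l<..<r}" "ae_eq lborel (F t) (G t)"
      using AE_exists_in_interval[OF AEeq lr(1-3)] by blast
    have tin: "t \<in> {\<alpha>..\<beta>}" using t lr by auto
    have "l2_dist lborel (F x0) (G x0) \<le> l2_dist lborel (F x0) (F t) + l2_dist lborel (F t) (G x0)"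
      by (rule l2_dist_triangle) (use FL GL tin x0 in auto)
    also have "l2_dist lborel (F t) (G x0) = l2_dist lborel (G t) (G x0)"
      by (rule l2_dist_cong_AE)
         (use FL[OF tin] GL[OF tin] GL[OF x0] t(2) in \<open>auto simp: ae_eq_def dest!: L2_measurable\<close>)
    finally show ?thesis
      using near[OF tin] lr(4)[OF t(1)] by (simp add: dist_real_def l2_dist_sym[of _ "F x0" "F t"])
  qed
  then have "l2_dist lborel (F x0) (G x0) \<le> 0"
    by (rule field_le_epsilon[of _ 0, simplified])
  then have "l2_dist lborel (F x0) (G x0) = 0"
    using l2_dist_nonneg[of lborel "F x0" "G x0"] by linarith
  then show ?thesis
    using l2_dist_0_imp_AE[OF FL[OF x0] GL[OF x0]] by (simp add: ae_eq_def)
qed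

lemma tr_ends:
  "tr K f' \<alpha> y = K y" "tr K f' \<beta> y = K y + (LINT s|X. f' (s, y))"
proof -
  have "(LINT s|X. of_bool (s \<le> \<alpha>) * f' (s, y)) = 0"
  proof (rule integral_eq_zero_AE)
    have "AE s in X. s \<noteq> \<alpha>"
      by (subst AE_restrict_space_iff) (use AE_lborel_singleton[of \<alpha>] in \<open>auto elim: AE_mp\<close>)
    with AE_space show "AE s in X. of_bool (s \<le> \<alpha>) * f' (s, y) = 0"
      by eventually_elim (auto simp: space_X)
  qed
  then show "tr K f' \<alpha> y = K y" by (simp add: tr_def kop_def)
  have "(LINT s|X. of_bool (s \<le> \<beta>) * f' (s, y)) = (LINT s|X. f' (s, y))"
    by (rule Bochner_Integration.integral_cong) (auto simp: space_X)
  then show "tr K f' \<beta> y = K y + (LINT s|X. f' (s, y))" by (simp add: tr_def kop_def)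
qed

lemma rep_cong:
  assumes "rep f f' K" "f'' \<in> L2 M" "AE z in M. f' z = f'' z"
  shows "rep f f'' K"
proof -
  have L: "f' \<in> L2 M" using assms(1) by (simp add: rep_def)
  have "AE z in M. f z = K (snd z) + J f' z" using assms(1) by (simp add: rep_def)
  then have "AE z in M. f z = K (snd z) + J f'' z"
    using kop_cong[OF kernel_J L assms(2,3)] by eventually_elim simp
  then show ?thesis using assms by (simp add: rep_def)
qed

abbreviation (input) tpi :: complex where "tpi \<equiv> \<i> * 2 * of_real pi"

text \<open>The weak derivative and the continuous representative are existential in
  \<open>P_op\<close>. \<open>weak_deriv_imp_rep\<close> and uniqueness of traces make both
  explicit: the trace is \<open>K\<close> at \<alpha> and \<open>K\<close> plus the total integral
  of the derivative at \<beta>.\<close>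

lemma P_op_iff:
  assumes U: "l2_linear lborel U"
  shows "P_op \<alpha> \<beta> U f g \<longleftrightarrow> g \<in> L2 M \<and> (\<exists>K. rep f (\<lambda>z. tpi * g z) K \<and>
    ae_eq lborel (\<lambda>y. K y + (LINT s|X. tpi * g (s, y))) (U K))"
proof
  assume P: "P_op \<alpha> \<beta> U f g"
  then obtain f' F where f: "f \<in> L2 M" "g \<in> L2 M" "f' \<in> L2 M" "weak_deriv \<alpha> \<beta> (1, 0) f f'"
    "AE z in M. g z = f' z / tpi" and F: "continuous_representative \<alpha> \<beta> f F" "ae_eq lborel (F \<beta>) (U (F \<alpha>))"
    unfolding P_op_def ae_eq_def by blast
  obtain K where "rep f f' K" using weak_deriv_imp_rep[OF f(1,3,4)] by blast
  moreover have "AE z in M. f' z = tpi * g z" using f(5) by eventually_elim simp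
  ultimately have r: "rep f (\<lambda>z. tpi * g z) K" by (rule rep_cong[OF _ L2_cmult[OF f(2)]])
  have e: "ae_eq lborel (F x) (tr K (\<lambda>z. tpi * g z) x)" if "x \<in> {\<alpha>..\<beta>}" for x
    by (rule continuous_representative_unique[OF F(1) rep_continuous_representative[OF r] _ that])
       (simp add: ae_eq_def)
  have KL: "K \<in> L2 lborel" using r by (simp add: rep_def)
  have FL: "F \<alpha> \<in> L2 lborel" using F(1) ab by (simp add: continuous_representative_def)
  have "ae_eq lborel (F \<alpha>) K" using e[of \<alpha>] ab by (simp add: tr_ends ae_eq_def)
  then have "ae_eq lborel (U (F \<alpha>)) (U K)" using U FL KL unfolding l2_linear_def by blast
  moreover have "ae_eq lborel (F \<beta>) (\<lambda>y. K y + (LINT s|X. tpi * g (s, y)))"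
    using e[of \<beta>] ab by (simp add: tr_ends ae_eq_def)
  ultimately have "ae_eq lborel (\<lambda>y. K y + (LINT s|X. tpi * g (s, y))) (U K)"
    using F(2) unfolding ae_eq_def by eventually_elim simp
  then show "g \<in> L2 M \<and> (\<exists>K. rep f (\<lambda>z. tpi * g z) K \<and> ae_eq lborel (\<lambda>y. K y + (LINT s|X. tpi * g (s, y))) (U K))"
    using r f(2) by blast
next
  assume "g \<in> L2 M \<and> (\<exists>K. rep f (\<lambda>z. tpi * g z) K \<and> ae_eq lborel (\<lambda>y. K y + (LINT s|X. tpi * g (s, y))) (U K))"
  then obtain K where g: "g \<in> L2 M" and r: "rep f (\<lambda>z. tpi * g z) K"
    and b: "ae_eq lborel (\<lambda>y. K y + (LINT s|X. tpi * g (s, y))) (U K)" by blast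
  have "tr K (\<lambda>z. tpi * g z) \<alpha> = K" "tr K (\<lambda>z. tpi * g z) \<beta> = (\<lambda>y. K y + (LINT s|X. tpi * g (s, y)))"
    by (simp_all add: tr_ends fun_eq_iff)
  then have "\<exists>F. continuous_representative \<alpha> \<beta> f F \<and> ae_eq lborel (F \<beta>) (U (F \<alpha>))"
    using rep_continuous_representative[OF r] b by metis
  moreover have "ae_eq M g (\<lambda>p. tpi * g p / tpi)" by (simp add: ae_eq_def)
  ultimately show "P_op \<alpha> \<beta> U f g"
    unfolding P_op_def using rep_imp_weak_deriv[OF r] L2_cmult[OF g, of tpi] r g by (auto simp: rep_def)
qed

end

subsection \<open>The operators on the Fourier side\<close>

text \<open>Integration by parts against the exponential; all boundary terms vanish because
  \<open>p\<close> has integral zero.\<close>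

lemma fourier_antiderivative:
  fixes p :: "real \<Rightarrow> complex"
  assumes ab: "a < b" and p: "integrable (restrict_space lborel {a..b}) p" and 0: "(LINT y|restrict_space lborel {a..b}. p y) = 0"
  shows "(LINT y|restrict_space lborel {a..b}. p y * expi2pi (- t * y))
    = \<i> * 2 * of_real pi * of_real t * (LINT y|restrict_space lborel {a..b}. (LINT s|restrict_space lborel {a..b}. of_bool (s \<le> y) * p s) * expi2pi (- t * y))"
proof -
  interpret strip a b by standard (rule ab)
  define c where "c = - (\<i> * 2 * of_real pi * of_real t)"
  define q where "q y = expi2pi (- t * y)" for y
  have der: "(q has_vector_derivative c * q y) (at y within S)" for y S
    using has_vector_derivative_expi2pi[of "- t" 0 y S] by (simp add: q_def[abs_def] c_def)
  have qc: "continuous_on S q" for S unfolding q_def by (intro continuous_intros)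
  have qi: "integrable X q"
    using X.L2_imp_integrable[OF X.L2_bounded[of q 1]] unfolding q_def by auto
  have "c * (LINT s|X. of_bool (s \<le> y) * q s) = q y - q a" if y: "y \<in> {a..b}" for y
  proof -
    have "(LINT s|restrict_space lborel {a..y}. c * q s) = q y - q a"
      by (rule LBINT_has_vector_derivative) (use y der qc in \<open>auto intro!: continuous_intros\<close>)
    then show ?thesis by (simp add: LINT_J[OF y])
  qed
  note Q = this
  have pq: "integrable X (\<lambda>y. p y * q y)"
  proof (rule Bochner_Integration.integrable_bound[OF p])
    have [measurable]: "p \<in> borel_measurable X" "q \<in> borel_measurable X" using p qi by auto
    show "(\<lambda>y. p y * q y) \<in> borel_measurable X" by measurable
  qed (simp add: norm_mult q_def)
  have "c * (LINT y|X. p y * (LINT s|X. of_bool (s \<le> y) * q s)) = (LINT y|X. p y * q y - p y * q a)"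
  proof -
    have "c * (LINT y|X. p y * (LINT s|X. of_bool (s \<le> y) * q s)) = (LINT y|X. p y * (c * (LINT s|X. of_bool (s \<le> y) * q s)))"
      by (simp only: mult.left_commute[of c] integral_mult_right_zero[symmetric])
    also have "\<dots> = (LINT y|X. p y * (q y - q a))"
      by (rule Bochner_Integration.integral_cong) (use Q in \<open>auto simp: space_X\<close>)
    finally show ?thesis by (simp add: right_diff_distrib)
  qed
  also have "\<dots> = (LINT y|X. p y * q y)"
    using pq p 0 by simp
  finally have 1: "c * (LINT y|X. p y * (LINT s|X. of_bool (s \<le> y) * q s)) = (LINT y|X. p y * q y)" .
  have "(LINT y|X. (LINT s|X. of_bool (s \<le> y) * p s) * q y) + (LINT y|X. p y * (LINT s|X. of_bool (s \<le> y) * q s)) = 0"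
    using integration_by_parts[OF p qi] 0 by simp
  then have "(LINT y|X. p y * (LINT s|X. of_bool (s \<le> y) * q s)) = - (LINT y|X. (LINT s|X. of_bool (s \<le> y) * p s) * q y)"
    by (simp add: add_eq_0_iff)
  with 1 show ?thesis by (simp add: q_def c_def)
qed

text \<open>A chord is no longer than its arc. Hence \<open>(1 - e(t)) / t\<close> is a bounded
  multiplier, as needed in \<open>weak_deriv_imp_snd_pft\<close>.\<close>

lemma cmod_one_minus_expi2pi_le: "cmod (1 - expi2pi t) \<le> 2 * pi * \<bar>t\<bar>"
proof -
  have "(cmod (1 - cis x))\<^sup>2 \<le> x\<^sup>2" for x
  proof -
    have "(cmod (1 - cis x))\<^sup>2 = (1 - cos x)\<^sup>2 + (sin x)\<^sup>2" by (simp add: cmod_power2)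
    also have "\<dots> = 2 - 2 * cos x" by (simp add: power2_diff sin_squared_eq)
    also have "cos x = 1 - 2 * (sin (x / 2))\<^sup>2" using cos_double_sin[of "x / 2"] by simp
    also have "2 - 2 * (1 - 2 * (sin (x / 2))\<^sup>2) = (2 * \<bar>sin (x / 2)\<bar>)\<^sup>2" by (simp add: power_mult_distrib)
    also have "\<dots> \<le> (2 * \<bar>x / 2\<bar>)\<^sup>2"
      by (intro power_mono mult_left_mono abs_sin_x_le_abs_x) auto
    finally show ?thesis by (simp add: power2_abs)
  qed
  from this[of "2 * pi * t"] have "(cmod (1 - expi2pi t))\<^sup>2 \<le> (2 * pi * \<bar>t\<bar>)\<^sup>2"
    by (simp add: expi2pi_cis power_mult_distrib)
  then show ?thesis by (rule power2_le_imp_le) auto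
qed

lemma l2_unitary_pair_compose:
  assumes "l2_unitary_pair A B V V'" "l2_unitary_pair B C W W'"
  shows "l2_unitary_pair A C (\<lambda>f. W (V f)) (\<lambda>h. V' (W' h))"
proof -
  interpret V: l2_unitary_pair A B V V' by fact
  interpret W: l2_unitary_pair B C W W' by fact
  show ?thesis
  proof
    fix f g assume f: "f \<in> L2 A"
    show "W (V f) \<in> L2 C" by (intro W.L2 V.L2 f)
    show "l2sq C (W (V f)) = l2sq A f" by (simp add: W.l2sq V.l2sq V.L2 f)
    show "AE x in C. W (V (\<lambda>x. c * f x)) x = c * W (V f) x" for c
      using W.cong[OF V.L2[OF L2_cmult[OF f]] L2_cmult[OF V.L2[OF f]] V.cmult[OF f, of c]] W.cmult[OF V.L2[OF f], of c]
      by eventually_elim simp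
    assume g: "g \<in> L2 A"
    show "AE x in C. W (V (\<lambda>x. f x + g x)) x = W (V f) x + W (V g) x"
      using W.cong[OF V.L2[OF L2_add[OF f g]] L2_add[OF V.L2[OF f] V.L2[OF g]] V.add[OF f g]] W.add[OF V.L2[OF f] V.L2[OF g]]
      by eventually_elim simp
  next
    fix h assume h: "h \<in> L2 C"
    show "V' (W' h) \<in> L2 A" by (intro V.W_L2 W.W_L2 h)
    show "AE x in C. W (V (V' (W' h))) x = h x"
      using W.cong[OF V.L2[OF V.W_L2[OF W.W_L2[OF h]]] W.W_L2[OF h] V.V_W[OF W.W_L2[OF h]]] W.V_W[OF h]
      by eventually_elim simp
  qed
qed

context strip
begin

sublocale pft: l2_unitary_pair M M "pft X" "ipft X"
  using pft_unitary[OF sigma_finite_X] by (simp add: M_eq)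

lemma trunc_pft_lim: "f \<in> L2 M \<Longrightarrow> l2_lim M (\<lambda>n. trunc_pft n f) (pft X f)"
  using pft_lim[OF sigma_finite_X] by (simp add: M_eq)

text \<open>For support in \<open>|y| \<le> n\<close> the truncated transforms no longer change from
  index \<open>n\<close> on, so the limit is one of them.\<close>

lemma pft_of_support:
  assumes h: "h \<in> L2 M" and 0: "\<And>z. \<bar>snd z\<bar> > real n \<Longrightarrow> h z = 0"
  shows "AE z in M. pft X h z = trunc_pft n h z"
proof -
  have eq: "trunc_pft m h z = trunc_pft n h z" if "n \<le> m" for m z
  proof -
    have "cutoff n (\<lambda>y. h (fst z, y)) = (\<lambda>y. h (fst z, y))"
      using 0 by (auto simp: cutoff_def fun_eq_iff)
    then show ?thesis
      using trunc_fourier_cutoff[OF that, of "\<lambda>y. h (fst z, y)" "snd z"] by (simp add: trunc_pft_def)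
  qed
  have "trunc_pft (m + n) h = trunc_pft n h" for m by (intro ext eq) simp
  moreover have "l2_lim M (\<lambda>m. trunc_pft (m + n) h) (pft X h)"
    by (rule l2_lim_subseq[OF trunc_pft_lim[OF h], where r = "\<lambda>m. m + n"]) (simp add: strict_mono_def)
  ultimately have "l2_lim M (\<lambda>m. trunc_pft n h) (pft X h)" by simp
  moreover have "l2_lim M (\<lambda>m. trunc_pft n h) (trunc_pft n h)"
    by (rule l2_lim_const) (use trunc_pft_lim[OF h] in \<open>simp add: l2_lim_def\<close>)
  ultimately show ?thesis by (rule l2_lim_unique)
qed

lemma pft_derivative:
  assumes h: "h \<in> L2 M" "h' \<in> L2 M" and n: "n > 0"
    and 0: "\<And>z. \<bar>snd z\<bar> > real n \<Longrightarrow> h z = 0" "\<And>z. \<bar>snd z\<bar> > real n \<Longrightarrow> h' z = 0"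
    and i: "\<And>x. x \<in> {\<alpha>..\<beta>} \<Longrightarrow> integrable (restrict_space lborel {- real n..real n}) (\<lambda>y. h' (x, y))"
    and z: "\<And>x. x \<in> {\<alpha>..\<beta>} \<Longrightarrow> (LINT y|restrict_space lborel {- real n..real n}. h' (x, y)) = 0"
    and e: "\<And>x y. x \<in> {\<alpha>..\<beta>} \<Longrightarrow> y \<in> {- real n..real n} \<Longrightarrow> (LINT s|restrict_space lborel {- real n..real n}. of_bool (s \<le> y) * h' (x, s)) = h (x, y)"
  shows "AE z in M. pft X h' z = \<i> * 2 * of_real pi * of_real (snd z) * pft X h z"
proof -
  have "AE z in M. pft X h z = trunc_pft n h z" by (rule pft_of_support[OF h(1)]) (rule 0(1))
  moreover have "AE z in M. pft X h' z = trunc_pft n h' z" by (rule pft_of_support[OF h(2)]) (rule 0(2))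
  ultimately show ?thesis using AE_space[of M]
proof eventually_elim
  case (elim z)
  then have x: "fst z \<in> {\<alpha>..\<beta>}" by (auto simp: space_strip)
  have "trunc_pft n h' z = \<i> * 2 * of_real pi * of_real (snd z) * (LINT y|restrict_space lborel {- real n..real n}.
      (LINT s|restrict_space lborel {- real n..real n}. of_bool (s \<le> y) * h' (fst z, s)) * expi2pi (- snd z * y))"
    unfolding trunc_pft_def trunc_fourier_eq by (rule fourier_antiderivative) (use n i[OF x] z[OF x] in auto)
  also have "(LINT y|restrict_space lborel {- real n..real n}. (LINT s|restrict_space lborel {- real n..real n}. of_bool (s \<le> y) * h' (fst z, s)) * expi2pi (- snd z * y))
      = trunc_pft n h z"
    unfolding trunc_pft_def trunc_fourier_eq
    by (rule Bochner_Integration.integral_cong) (use e[OF x] in \<open>auto simp: space_restrict_space\<close>)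
  finally show ?case using elim by simp
qed
qed

lemma l2_inner_M_cnj: "l2_inner M (\<lambda>z. cnj (v z)) f = (LINT z|M. f z * v z)"
  by (simp add: l2_inner_def mult.commute)

text \<open>Parseval turns the pairing with the \<open>y\<close>-derivative of \<phi> into an inner
  product of transforms, where the derivative is the factor \<open>2 pi i \<lambda>\<close>. Being
  real up to \<open>i\<close>, it moves to the other side and produces the transform of
  \<open>g\<close>. Conjugates \<open>h\<close>, \<open>h'\<close> are used because the pairing is
  bilinear.\<close>

lemma snd_pft_imp_weak_deriv:
  assumes f: "f \<in> L2 M" and g: "g \<in> L2 M" and e: "AE z in M. pft X g z = of_real (snd z) * pft X f z"
  shows "weak_deriv \<alpha> \<beta> (0, 1) f (\<lambda>z. \<i> * 2 * of_real pi * g z)"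
  unfolding weak_deriv_def
proof (intro allI impI)
  fix \<phi> :: "real \<times> real \<Rightarrow> complex" assume t: "test_function ({\<alpha><..<\<beta>} \<times> UNIV) \<phi>"
  let ?D = "dir_deriv (0, 1) \<phi>" and ?c = "\<i> * 2 * complex_of_real pi"
  define h where "h z = cnj (\<phi> z)" for z
  define h' where "h' z = cnj (?D z)" for z
  have sm: "smooth \<phi>" using t by (simp add: test_function_def)
  obtain C R where C: "\<And>p. cmod (\<phi> p) \<le> C" "\<And>p. cmod (?D p) \<le> C"
    "\<And>p. \<bar>snd p\<bar> > R \<Longrightarrow> \<phi> p = 0" "\<And>p. \<bar>snd p\<bar> > R \<Longrightarrow> ?D p = 0"
    using test_functionD[OF t, where v = "(0, 1)"] by blast
  obtain n :: nat where n0: "\<bar>R\<bar> + 1 < real n" using reals_Archimedean2 by blast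
  then have n: "n > 0" "real n > R" by auto
  have hL: "h \<in> L2 M" "h' \<in> L2 M"
    unfolding h_def[abs_def] h'_def[abs_def] by (intro L2_cnj test_function_L2[OF t])+
  have Dc: "continuous_on S (\<lambda>y. ?D (x, y))" for x S
    by (rule continuous_on_compose2[OF smooth_continuous_on[OF smooth_dir_deriv[OF sm], of UNIV]]) (auto intro!: continuous_intros)
  have ftc: "(LINT s|restrict_space lborel {- real n..y}. ?D (x, s)) = \<phi> (x, y) - \<phi> (x, - real n)"
      "integrable (restrict_space lborel {- real n..y}) (\<lambda>s. ?D (x, s))" if "- real n \<le> y" for x y
  proof -
    have d: "((\<lambda>y. \<phi> (x, y)) has_vector_derivative ?D (x, s)) (at s within {- real n..y})" for s
      using line_derivative[OF sm, of "(x, 0)" "(0, 1)" s] by simp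
    show "(LINT s|restrict_space lborel {- real n..y}. ?D (x, s)) = \<phi> (x, y) - \<phi> (x, - real n)"
      "integrable (restrict_space lborel {- real n..y}) (\<lambda>s. ?D (x, s))"
      using LBINT_has_vector_derivative[OF that d Dc] by auto
  qed
  have \<phi>0: "\<phi> (x, - real n) = 0" "\<phi> (x, real n) = 0" for x
    using C(3)[of "(x, - real n)"] C(3)[of "(x, real n)"] n by auto
  interpret Y: strip "- real n" "real n" by standard (use n in simp)
  have pd: "AE z in M. pft X h' z = ?c * of_real (snd z) * pft X h z"
  proof (rule pft_derivative[OF hL n(1)])
    show "h z = 0" "h' z = 0" if "\<bar>snd z\<bar> > real n" for z
      using C(3,4)[of z] that n by (auto simp: h_def h'_def)
    fix x
    show "integrable (restrict_space lborel {- real n..real n}) (\<lambda>y. h' (x, y))"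
      using ftc(2)[of "real n" x] by (simp add: h'_def)
    show "(LINT y|restrict_space lborel {- real n..real n}. h' (x, y)) = 0"
      using ftc(1)[of "real n" x] \<phi>0[of x] by (simp add: h'_def)
    show "(LINT s|restrict_space lborel {- real n..real n}. of_bool (s \<le> y) * h' (x, s)) = h (x, y)" if "y \<in> {- real n..real n}" for y
      using ftc(1)[of y x] \<phi>0[of x] that by (simp add: Y.LINT_J h'_def h_def)
  qed
  have fL: "pft X f \<in> L2 M" and gL: "pft X g \<in> L2 M" using f g by (auto intro: pft.L2)
  have "(LINT z|M. f z * ?D z) = l2_inner M h' f"
    by (simp add: h'_def[abs_def] l2_inner_M_cnj)
  also have "\<dots> = l2_inner M (pft X h') (pft X f)"
    by (rule pft.inner[OF hL(2) f, symmetric])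
  also have "\<dots> = (LINT z|M. (- ?c) * (cnj (pft X h z) * pft X g z))"
    unfolding l2_inner_def
  proof (rule integral_cong_AE)
    note [measurable] = L2_measurable[OF pft.L2[OF hL(1)]] L2_measurable[OF pft.L2[OF hL(2)]] L2_measurable[OF fL] L2_measurable[OF gL]
    show "(\<lambda>z. cnj (pft X h' z) * pft X f z) \<in> borel_measurable M" "(\<lambda>z. (- ?c) * (cnj (pft X h z) * pft X g z)) \<in> borel_measurable M"
      by measurable
    show "AE z in M. cnj (pft X h' z) * pft X f z = (- ?c) * (cnj (pft X h z) * pft X g z)"
      using pd e by eventually_elim simp
  qed
  also have "\<dots> = (- ?c) * l2_inner M (pft X h) (pft X g)"
    by (simp only: l2_inner_def integral_mult_right_zero)
  also have "l2_inner M (pft X h) (pft X g) = l2_inner M h g"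
    by (rule pft.inner[OF hL(1) g])
  also have "\<dots> = (LINT z|M. g z * \<phi> z)" by (simp add: h_def[abs_def] l2_inner_M_cnj)
  also have "(- ?c) * \<dots> = - (LINT z|M. ?c * g z * \<phi> z)"
    by (simp add: mult.assoc)
  finally show "(LINT p|M. f p * ?D p) = - (LINT p|M. ?c * g p * \<phi> p)" .
qed

lemma AE_M_snd_neq: "AE z in M. snd z \<noteq> c"
proof (rule AE_M_snd)
  show "{z \<in> space M. snd z \<noteq> c} \<in> sets M" by measurable
  show "AE y in lborel. \<forall>x::real. snd (x, y) \<noteq> c"
    using AE_lborel_singleton[of c] by eventually_elim simp
qed

text \<open>The transform of \<open>f\<close> times \<lambda> is not known to be in
  \<open>L2\<close>, so the claim is first proved after multiplication by
  \<open>(1 - e(\<lambda>)) / \<lambda>\<close>, as \<open>H = 0\<close>. The difference of a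
  rectangle indicator and its unit translate in \<open>y\<close> has a compactly supported
  primitive; testing with that primitive shows that \<open>ipft X H\<close> is orthogonal to the
  rectangle. Finally \<open>1 - e(\<lambda>)\<close> is cancelled off the integers, which are
  null.\<close>

lemma weak_deriv_imp_snd_pft:
  assumes f: "f \<in> L2 M" and g: "g \<in> L2 M" and wd: "weak_deriv \<alpha> \<beta> (0, 1) f f'" and f': "f' \<in> L2 M"
    and fg: "AE z in M. f' z = \<i> * 2 * of_real pi * g z"
  shows "AE z in M. pft X g z = of_real (snd z) * pft X f z"
proof -
  let ?c = "\<i> * 2 * complex_of_real pi"
  let ?F = "pft X f" and ?G = "pft X g"
  have FL: "?F \<in> L2 M" and GL: "?G \<in> L2 M" using f g by (auto intro: pft.L2)
  define H where "H z = (1 - expi2pi (snd z)) * ?F z - ((1 - expi2pi (snd z)) / of_real (snd z)) * ?G z" for z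
  have H: "H \<in> L2 M"
    unfolding H_def[abs_def]
  proof (rule L2_diff)
    show "(\<lambda>z. (1 - expi2pi (snd z)) * ?F z) \<in> L2 M"
    proof (rule L2_mult_bounded[OF FL, where C = 2])
      show "cmod (1 - expi2pi (snd z)) \<le> 2" for z :: "real \<times> real"
        using norm_triangle_ineq4[of 1 "expi2pi (snd z)"] by simp
    qed measurable
    show "(\<lambda>z. ((1 - expi2pi (snd z)) / of_real (snd z)) * ?G z) \<in> L2 M"
    proof (rule L2_mult_bounded[OF GL, where C = "2 * pi"])
      show "cmod ((1 - expi2pi (snd z)) / of_real (snd z)) \<le> 2 * pi" for z :: "real \<times> real"
        using cmod_one_minus_expi2pi_le[of "snd z"]
        by (cases "snd z = 0") (simp_all add: norm_divide divide_le_eq)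
    qed measurable
  qed
  have "AE z in M. ipft X H z = 0"
  proof (rule strip_zero[OF pft.W_L2[OF H]])
    fix p q c d :: real assume pq: "\<alpha> < p" "p < q" "q < \<beta>" and cd: "c < d"
    let ?I = "comb 1 p q 0 p q step"
    \<comment> \<open>An indicator minus its translate by 1. The total mass is zero, so its
      primitive has compact support, and the transform acquires the factor
      \<open>1 - e(-\<lambda>)\<close>.\<close>
    let ?u = "comb 1 c d (- 1) (c + 1) (d + 1)"
    define \<psi> where "\<psi> z = complex_of_real (?I (fst z) * comb 1 c d 0 c d step (snd z))" for z
    define \<tau> where "\<tau> z = \<psi> (fst z, snd z - 1)" for z
    define v where "v z = complex_of_real (?I (fst z) * ?u ramp (snd z))" for z
    define v' where "v' z = complex_of_real (?I (fst z) * ?u step (snd z))" for z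
    obtain n :: nat where n0: "\<bar>c\<bar> + \<bar>d\<bar> + 2 < real n" using reals_Archimedean2 by blast
    then have n: "n > 0" by (auto intro: Nat.gr0I)
    have cdn: "- real n < c" "- real n < d" "d + 1 < real n" "c + 1 < real n" using n0 by auto
    have m: "(\<lambda>z. complex_of_real (?I (fst z) * G (snd z))) \<in> borel_measurable M" if "G \<in> borel_measurable borel" for G
      by (rule borel_measurable_product_M) (use that in auto)
    have Ib: "\<bar>?I s\<bar> \<le> 1" for s using comb_step_bounds(1)[of 1 p q 0 p q s] by simp
    have psi_out: "comb 1 c d 0 c d step y = 0" if "\<bar>y\<bar> > real n - 1" for y
      using that n0 cd by (auto simp: comb_step_single)
    have step_eq: "?u step y = comb 1 c d 0 c d step y - comb 1 c d 0 c d step (y - 1)" for y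
      by (simp add: comb_def algebra_simps)
    have u0: "?u step y = 0" "?u ramp y = 0" if "\<bar>y\<bar> > real n" for y
      using that n0 cd by (auto simp: comb_def step_def ramp_def)
    have ub: "\<bar>?u step y\<bar> \<le> 2" "\<bar>?u ramp y\<bar> \<le> 2 * (d - c)" for y
      using comb_step_bounds[of 1 c d "-1" "c + 1" "d + 1" y] cd by auto
    have \<psi>L: "\<psi> \<in> L2 M" unfolding \<psi>_def[abs_def] by (rule product_L2[OF _ Ib cd]) simp
    have bd: "\<bar>?I s * y\<bar> \<le> K" if "\<bar>y\<bar> \<le> K" for s y K
    proof -
      have "\<bar>?I s\<bar> * \<bar>y\<bar> \<le> 1 * K" by (intro mult_mono Ib that) auto
      then show ?thesis by (simp add: abs_mult)
    qed
    have vL: "v \<in> L2 M" unfolding v_def[abs_def]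
      by (rule L2_strip_bounded[where K = "2 * (d - c)" and R = "real n"])
         (use u0 bd[OF ub(2)] in \<open>auto intro!: m simp del: of_real_mult\<close>)
    have v'L: "v' \<in> L2 M" unfolding v'_def[abs_def]
      by (rule L2_strip_bounded[where K = 2 and R = "real n"])
         (use u0 bd[OF ub(1)] in \<open>auto intro!: m simp del: of_real_mult\<close>)
    have v'_eq: "v' z = \<psi> z - \<tau> z" for z
      unfolding v'_def \<psi>_def \<tau>_def step_eq fst_conv snd_conv by (simp add: right_diff_distrib)
    have \<tau>L: "\<tau> \<in> L2 M"
    proof -
      have "\<tau> = (\<lambda>z. \<psi> z - v' z)" by (rule ext) (simp add: v'_eq)
      then show ?thesis using L2_diff[OF \<psi>L v'L] by simp
    qed
    have \<tau>F: "AE z in M. pft X \<tau> z = expi2pi (- snd z) * pft X \<psi> z"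
    proof -
      have 1: "AE z in M. pft X \<tau> z = trunc_pft n \<tau> z"
        by (rule pft_of_support[OF \<tau>L]) (auto simp: \<tau>_def \<psi>_def psi_out)
      have 2: "AE z in M. pft X \<psi> z = trunc_pft n \<psi> z"
        by (rule pft_of_support[OF \<psi>L]) (auto simp: \<psi>_def psi_out)
      have "trunc_pft n \<tau> (x, t) = expi2pi (- t) * trunc_pft n \<psi> (x, t)" for x t
      proof -
        have full: "trunc_fourier n h t = (LINT y|lborel. h y * expi2pi (- t * y))" if "\<And>y. \<bar>y\<bar> > real n \<Longrightarrow> h y = 0" for h
          unfolding trunc_fourier_def set_lebesgue_integral_def
        proof (rule Bochner_Integration.integral_cong[OF refl])
          fix y show "indicator {- real n..real n} y *\<^sub>R (h y * expi2pi (- t * y)) = h y * expi2pi (- t * y)"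
            using that[of y] by (cases "\<bar>y\<bar> \<le> real n") (auto simp: indicator_def abs_le_iff)
        qed
        have "trunc_pft n \<tau> (x, t) = (LINT y|lborel. \<psi> (x, y - 1) * expi2pi (- t * y))"
          unfolding trunc_pft_def \<tau>_def fst_conv snd_conv by (rule full) (auto simp: \<psi>_def psi_out)
        also have "\<dots> = (LINT y|lborel. \<psi> (x, y) * expi2pi (- t * (1 + y)))"
          by (subst lborel_integral_real_affine[where c = 1 and t = 1]) auto
        also have "\<dots> = (LINT y|lborel. expi2pi (- t) * (\<psi> (x, y) * expi2pi (- t * y)))"
          by (rule Bochner_Integration.integral_cong) (auto simp: expi2pi_add[symmetric] algebra_simps)
        also have "\<dots> = expi2pi (- t) * trunc_pft n \<psi> (x, t)"
          using full[of "\<lambda>y. \<psi> (x, y)"] by (simp add: trunc_pft_def \<psi>_def psi_out)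
        finally show ?thesis .
      qed
      then have 3: "trunc_pft n \<tau> z = expi2pi (- snd z) * trunc_pft n \<psi> z" for z by (cases z) simp
      show ?thesis using 1 2 by eventually_elim (simp add: 3)
    qed
    have v'F: "AE z in M. pft X v' z = (1 - expi2pi (- snd z)) * pft X \<psi> z"
    proof -
      have "v' = (\<lambda>z. \<psi> z - \<tau> z)" by (rule ext) (rule v'_eq)
      then have "AE z in M. pft X v' z = pft X \<psi> z - pft X \<tau> z" using pft.diff[OF \<psi>L \<tau>L] by simp
      then show ?thesis using \<tau>F by eventually_elim (simp add: algebra_simps)
    qed
    interpret Y: strip "- real n" "real n" by standard (use n in simp)
    have lc: "(LINT s|restrict_space lborel {- real n..y}. complex_of_real (?u step s)) = of_real (?u ramp y)" if "y \<in> {- real n..real n}" for y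
      by (rule Y.LINT_comb_step) (use cdn that in auto)
    have vF: "AE z in M. pft X v' z = ?c * of_real (snd z) * pft X v z"
    proof (rule pft_derivative[OF vL v'L n])
      show "v z = 0" "v' z = 0" if "\<bar>snd z\<bar> > real n" for z using u0 that by (auto simp: v_def v'_def)
      fix x
      have ui: "integrable (restrict_space lborel {- real n..real n}) (\<lambda>y. complex_of_real (?u step y))"
        by (rule Y.X.L2_imp_integrable, rule Y.X.L2_bounded[where C = 2]) (use ub in \<open>auto\<close>)
      then show "integrable (restrict_space lborel {- real n..real n}) (\<lambda>y. v' (x, y))"
        by (simp add: v'_def)
      show "(LINT y|restrict_space lborel {- real n..real n}. v' (x, y)) = 0"
      proof -
        have "(LINT y|restrict_space lborel {- real n..real n}. v' (x, y)) = of_real (?I x) * of_real (?u ramp (real n))"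
          using lc[of "real n"] by (simp add: v'_def)
        also have "?u ramp (real n) = 0" using cdn cd by (simp add: comb_def ramp_def)
        finally show ?thesis by simp
      qed
      show "(LINT s|restrict_space lborel {- real n..real n}. of_bool (s \<le> y) * v' (x, s)) = v (x, y)" if "y \<in> {- real n..real n}" for y
      proof -
        have "(LINT s|restrict_space lborel {- real n..y}. v' (x, s)) = v (x, y)"
          using lc[OF that] by (simp add: v'_def v_def)
        then show ?thesis by (simp only: Y.LINT_J[OF that])
      qed
    qed
    have test: "(LINT z|M. f z * v' z) = - (LINT z|M. f' z * v z)"
      unfolding v_def v'_def using weak_deriv_comb(2)[OF f f' cd _ _ pq(2) wd pq(1,3), of "c + 1" "d + 1" 1 "-1"] cd by simp
    have cnj_real: "cnj (v z) = v z" "cnj (v' z) = v' z" for z by (simp_all add: v_def v'_def)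
    have i1: "l2_inner M v' f = (LINT z|M. f z * v' z)" using l2_inner_M_cnj[of v' f] by (simp add: cnj_real)
    have i2: "(LINT z|M. f' z * v z) = ?c * l2_inner M v g"
    proof -
      have "(LINT z|M. f' z * v z) = (LINT z|M. ?c * (cnj (v z) * g z))"
      proof (rule integral_cong_AE)
        show "AE z in M. f' z * v z = ?c * (cnj (v z) * g z)"
          using fg by eventually_elim (simp add: cnj_real)
      qed (use L2_measurable[OF vL] L2_measurable[OF g] L2_measurable[OF f'] in auto)
      then show ?thesis by (simp only: l2_inner_def integral_mult_right_zero)
    qed
    have key: "l2_inner M (pft X v') ?F = - (?c * l2_inner M (pft X v) ?G)"
      using test i1 i2 by (simp add: pft.inner vL v'L f g)
    note [measurable] = L2_measurable[OF pft.L2[OF vL]] L2_measurable[OF pft.L2[OF v'L]] L2_measurable[OF pft.L2[OF \<psi>L]]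
      L2_measurable[OF FL] L2_measurable[OF GL] L2_measurable[OF H]
    have "l2_inner M (pft X \<psi>) H = (LINT z|M. cnj (pft X v' z) * ?F z + ?c * (cnj (pft X v z) * ?G z))"
      unfolding l2_inner_def
    proof (rule integral_cong_AE)
      show "AE z in M. cnj (pft X \<psi> z) * H z = cnj (pft X v' z) * ?F z + ?c * (cnj (pft X v z) * ?G z)"
        using v'F vF AE_M_snd_neq[of 0]
      proof eventually_elim
        case (elim z)
        have a: "cnj (pft X v' z) = cnj (pft X \<psi> z) * (1 - expi2pi (snd z))"
          unfolding elim(1) by (simp add: cnj_expi2pi mult.commute)
        have b: "cnj (pft X v' z) = - ?c * of_real (snd z) * cnj (pft X v z)"
          unfolding elim(2) by simp
        have "cnj (pft X \<psi> z) * H z = cnj (pft X v' z) * ?F z - cnj (pft X v' z) / of_real (snd z) * ?G z"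
          unfolding H_def a by (simp add: algebra_simps)
        also have "cnj (pft X v' z) / of_real (snd z) = - ?c * cnj (pft X v z)"
          unfolding b using elim(3) by simp
        finally show ?case by simp
      qed
    qed measurable
    also have "\<dots> = l2_inner M (pft X v') ?F + ?c * l2_inner M (pft X v) ?G"
      using L2_inner_integrable[OF pft.L2[OF v'L] FL] L2_inner_integrable[OF pft.L2[OF vL] GL] by (simp add: l2_inner_def)
    also have "\<dots> = 0" using key by simp
    finally have "l2_inner M \<psi> (ipft X H) = 0"
      using pft_adjoint[OF sigma_finite_X, of \<psi> H] \<psi>L H by (simp add: M_eq)
    moreover have "cnj (\<psi> z) = \<psi> z" for z by (simp add: \<psi>_def)
    ultimately show "(LINT z|M. ipft X H z * of_real (?I (fst z) * comb 1 c d 0 c d step (snd z))) = 0"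
      by (simp add: l2_inner_def \<psi>_def mult.commute)
  qed
  then have "AE z in M. pft X (ipft X H) z = pft X (\<lambda>z. 0) z"
    by (rule pft.cong[OF pft.W_L2[OF H] L2_zero])
  moreover have "AE z in M. pft X (\<lambda>z. 0 * 0) z = 0 * pft X (\<lambda>z. 0) z" by (rule pft.cmult[OF L2_zero])
  ultimately have H0: "AE z in M. H z = 0"
    using pft.V_W[OF H] by eventually_elim simp
  have "AE z in M. snd z \<notin> \<int>"
  proof -
    have "AE z in M. \<forall>k::int. snd z \<noteq> of_int k"
      unfolding AE_all_countable using AE_M_snd_neq by blast
    then show ?thesis by eventually_elim (auto elim!: Ints_cases)
  qed
  with H0 show ?thesis
  proof eventually_elim
    case (elim z)
    then have "snd z \<noteq> 0" "1 - expi2pi (snd z) \<noteq> 0" using expi2pi_eq_1_iff[of "snd z"] by auto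
    moreover have "(1 - expi2pi (snd z)) * (?F z - ?G z / of_real (snd z)) = 0"
      using elim(1) by (simp add: H_def right_diff_distrib)
    ultimately have "?F z = ?G z / of_real (snd z)" by simp
    then show ?case using \<open>snd z \<noteq> 0\<close> by (simp add: field_simps)
  qed
qed

lemma Q_op_iff:
  "Q_op \<alpha> \<beta> f g \<longleftrightarrow> f \<in> L2 M \<and> g \<in> L2 M \<and> (AE z in M. pft X g z = of_real (snd z) * pft X f z)"
proof
  assume "Q_op \<alpha> \<beta> f g"
  then obtain f' where f: "f \<in> L2 M" "g \<in> L2 M" "f' \<in> L2 M" "weak_deriv \<alpha> \<beta> (0, 1) f f'"
    "AE z in M. g z = f' z / (\<i> * 2 * of_real pi)"
    unfolding Q_op_def ae_eq_def by blast
  have "AE z in M. f' z = \<i> * 2 * of_real pi * g z" using f(5) by eventually_elim simp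
  from weak_deriv_imp_snd_pft[OF f(1,2,4,3) this] f
  show "f \<in> L2 M \<and> g \<in> L2 M \<and> (AE z in M. pft X g z = of_real (snd z) * pft X f z)" by blast
next
  assume a: "f \<in> L2 M \<and> g \<in> L2 M \<and> (AE z in M. pft X g z = of_real (snd z) * pft X f z)"
  then have "weak_deriv \<alpha> \<beta> (0, 1) f (\<lambda>z. \<i> * 2 * of_real pi * g z)"
    by (intro snd_pft_imp_weak_deriv) auto
  moreover have "ae_eq M g (\<lambda>z. \<i> * 2 * of_real pi * g z / (\<i> * 2 * of_real pi))" by (simp add: ae_eq_def)
  ultimately show "Q_op \<alpha> \<beta> f g" unfolding Q_op_def using a L2_cmult[of g M "\<i> * 2 * of_real pi"] by blast
qed

end

section \<open>Fourier coefficients under the twisted boundary condition on one fibre\<close>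

context strip
begin

sublocale basis: l2_orthonormal_basis X "fourier_basis \<alpha> \<beta> \<theta>" for \<theta>
  by (rule fourier_basis_orthonormal_basis[OF ab])

text \<open>Integration by parts against the conjugate exponential. For \<open>f = c + J p\<close>
  the right-hand side is \<open>e(-\<theta>) f(\<beta>) - f(\<alpha>)\<close> up to normalization,
  so it vanishes exactly when \<open>f\<close> satisfies the twisted boundary condition.\<close>

lemma fourier_basis_by_parts:
  assumes p: "integrable X p"
  shows "l2_inner X (fourier_basis \<alpha> \<beta> \<theta> k) p
      - tpi * of_real ((of_int k + \<theta>) / (\<beta> - \<alpha>)) * l2_inner X (fourier_basis \<alpha> \<beta> \<theta> k) (\<lambda>x. c + (LINT s|X. of_bool (s \<le> x) * p s))
    = (expi2pi (- \<theta>) * (c + (LINT x|X. p x)) - c) / of_real (sqrt (\<beta> - \<alpha>))"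
proof -
  define m where "m = (of_int k + \<theta>) / (\<beta> - \<alpha>)"
  define a where "a = - (tpi * of_real m)"
  define q where "q x = cnj (fourier_basis \<alpha> \<beta> \<theta> k x)" for x
  let ?F = "\<lambda>x. LINT s|X. of_bool (s \<le> x) * p s"
  have q_eq: "q x = expi2pi (- m * x + m * \<alpha>) / of_real (sqrt (\<beta> - \<alpha>))" for x
  proof -
    have "- (m * (x - \<alpha>)) = - m * x + m * \<alpha>" by (simp add: algebra_simps)
    then show ?thesis by (simp add: q_def fourier_basis_def cnj_expi2pi m_def[symmetric])
  qed
  have der: "(q has_vector_derivative a * q x) (at x within S)" for x S
    using has_vector_derivative_mult_right[OF has_vector_derivative_expi2pi[of "- m" "m * \<alpha>" x S], of "1 / of_real (sqrt (\<beta> - \<alpha>))"]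
    unfolding q_eq[abs_def] a_def by simp
  have qc: "continuous_on S q" for S unfolding q_eq[abs_def] using ab by (intro continuous_intros) simp
  have [measurable]: "p \<in> borel_measurable X" using p by auto
  have qm [measurable]: "q \<in> borel_measurable borel" using qc by (rule borel_measurable_continuous_onI)
  have qb: "cmod (q x) \<le> 1 / sqrt (\<beta> - \<alpha>)" for x using ab by (simp add: q_eq norm_divide)
  have qi: "integrable X (\<lambda>x. a * q x)"
    by (rule X.L2_imp_integrable[OF L2_cmult[OF X.L2_bounded]]) (use qb in auto)
  have ftc: "(LINT s|X. of_bool (s \<le> x) * (a * q s)) = q x - q \<alpha>" if x: "x \<in> {\<alpha>..\<beta>}" for x
    unfolding LINT_J[OF x]
    by (rule LBINT_has_vector_derivative) (use x der qc in \<open>auto intro!: continuous_intros\<close>)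
  have tot: "(LINT s|X. a * q s) = q \<beta> - q \<alpha>"
    by (rule LBINT_has_vector_derivative) (use ab der qc in \<open>auto intro!: continuous_intros\<close>)
  have pq: "integrable X (\<lambda>x. p x * q x)"
  proof (rule Bochner_Integration.integrable_bound[OF integrable_mult_right[OF p, of "1 / of_real (sqrt (\<beta> - \<alpha>))"]])
    show "AE x in X. norm (p x * q x) \<le> norm (1 / of_real (sqrt (\<beta> - \<alpha>)) * p x)"
      using mult_left_mono[OF qb, of "cmod (p _)"] ab by (auto simp: norm_mult norm_divide mult.commute)
  qed measurable
  have kF: "integrable X (\<lambda>x. ?F x * (a * q x))"
  proof (rule Bochner_Integration.integrable_bound[OF integrable_mult_right[OF qi, of "of_real (LINT s|X. cmod (p s))"]])
    have "cmod (?F x) \<le> (LINT s|X. cmod (p s))" for x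
    proof -
      have "cmod (?F x) \<le> (LINT s|X. cmod (of_bool (s \<le> x) * p s))" by (rule integral_norm_bound)
      also have "\<dots> \<le> (LINT s|X. cmod (p s))"
        by (rule integral_mono_AE') (use p in \<open>auto simp: norm_mult\<close>)
      finally show ?thesis .
    qed
    then show "AE x in X. norm (?F x * (a * q x)) \<le> norm (of_real (LINT s|X. cmod (p s)) * (a * q x))"
      by (auto simp: norm_mult intro!: mult_right_mono)
    have id: "(\<lambda>x. x) \<in> X \<rightarrow>\<^sub>M borel" by simp
    have [measurable]: "(\<lambda>z. fst z) \<in> X \<Otimes>\<^sub>M X \<rightarrow>\<^sub>M (borel :: real measure)" "(\<lambda>z. snd z) \<in> X \<Otimes>\<^sub>M X \<rightarrow>\<^sub>M (borel :: real measure)"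
      using measurable_compose[OF measurable_fst id] measurable_compose[OF measurable_snd id] by auto
    have "(\<lambda>z. of_bool (snd z \<le> fst z) * p (snd z)) \<in> borel_measurable (X \<Otimes>\<^sub>M X)"
      unfolding of_bool_def by measurable
    then have [measurable]: "?F \<in> borel_measurable X"
      by (intro X.borel_measurable_lebesgue_integral) (simp add: case_prod_unfold)
    show "(\<lambda>x. ?F x * (a * q x)) \<in> borel_measurable X" by measurable
  qed
  have "(LINT x|X. p x * (LINT s|X. of_bool (s \<le> x) * (a * q s))) = (LINT x|X. p x * q x - p x * q \<alpha>)"
    by (rule Bochner_Integration.integral_cong) (auto simp: ftc space_X right_diff_distrib)
  also have "\<dots> = (LINT x|X. p x * q x) - (LINT x|X. p x) * q \<alpha>"
    using pq p by simp
  finally have e: "(LINT x|X. p x * (LINT s|X. of_bool (s \<le> x) * (a * q s))) = (LINT x|X. p x * q x) - (LINT x|X. p x) * q \<alpha>" .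
  have ibp: "(LINT x|X. ?F x * (a * q x)) + (LINT x|X. p x * q x) = (LINT x|X. p x) * q \<beta>"
  proof -
    have "x + (y - t * z) = t * (w - z) \<Longrightarrow> x + y = t * w" for x y z w t :: complex by (simp add: algebra_simps)
    from this[OF integration_by_parts[OF p qi, unfolded e tot]] show ?thesis by (simp only: mult.commute)
  qed
  have "a * l2_inner X (fourier_basis \<alpha> \<beta> \<theta> k) (\<lambda>x. c + ?F x) = (LINT x|X. a * (q x * (c + ?F x)))"
    by (simp only: l2_inner_def q_def integral_mult_right_zero)
  also have "\<dots> = (LINT x|X. c * (a * q x) + ?F x * (a * q x))"
    by (rule Bochner_Integration.integral_cong) (auto simp: algebra_simps)
  also have "\<dots> = c * (q \<beta> - q \<alpha>) + (LINT x|X. ?F x * (a * q x))"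
    using qi kF tot by simp
  finally have i: "a * l2_inner X (fourier_basis \<alpha> \<beta> \<theta> k) (\<lambda>x. c + ?F x) = c * (q \<beta> - q \<alpha>) + (LINT x|X. ?F x * (a * q x))" .
  have pi: "l2_inner X (fourier_basis \<alpha> \<beta> \<theta> k) p = (LINT x|X. p x * q x)"
    by (simp add: l2_inner_def q_def mult.commute)
  have "x + y = w * t \<Longrightarrow> y + (c * (t - z) + x) = t * (c + w) - z * c" for x y z w t :: complex
    by (simp add: algebra_simps)
  from this[OF ibp] have "l2_inner X (fourier_basis \<alpha> \<beta> \<theta> k) p + a * l2_inner X (fourier_basis \<alpha> \<beta> \<theta> k) (\<lambda>x. c + ?F x)
      = q \<beta> * (c + (LINT x|X. p x)) - q \<alpha> * c"
    unfolding i pi .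
  moreover have "q \<alpha> = 1 / of_real (sqrt (\<beta> - \<alpha>))" by (simp add: q_eq)
  moreover have "q \<beta> = expi2pi (- \<theta>) / of_real (sqrt (\<beta> - \<alpha>))"
  proof -
    have "- m * \<beta> + m * \<alpha> = - \<theta> + of_int (- k)"
    proof -
      have "- m * \<beta> + m * \<alpha> = - (m * (\<beta> - \<alpha>))" by (simp add: algebra_simps)
      also have "m * (\<beta> - \<alpha>) = of_int k + \<theta>" using ab by (simp add: m_def)
      finally show ?thesis by simp
    qed
    then show ?thesis unfolding q_eq by (simp only: expi2pi_add expi2pi_of_int) simp
  qed
  ultimately show ?thesis by (simp add: a_def m_def[symmetric] diff_divide_distrib)
qed

lemma LINT_X_const:
  "(LINT x|X. c) = c * of_real (\<beta> - \<alpha>)" for c :: complex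
proof -
  have "measure X {\<alpha>..\<beta>} = \<beta> - \<alpha>" using ab by (simp add: measure_restrict_space)
  then show ?thesis by (simp add: space_X scaleR_conv_of_real mult.commute)
qed

text \<open>If the frequency \<open>k + \<theta>\<close> is nonzero, the coefficient relation determines the coefficient of
  \<open>f - \<integral> f'\<close>; it is that of a constant, which for \<open>\<theta> \<noteq> 0\<close> the boundary condition determines.\<close>

lemma twisted_derivative:
  assumes f: "f \<in> L2 X" and g: "g \<in> L2 X" and F: "(\<lambda>x. LINT s|X. of_bool (s \<le> x) * (tpi * g s)) \<in> L2 X"
    and \<theta>: "\<theta> \<in> {0..<1}"
    and e: "\<And>k. l2_inner X (fourier_basis \<alpha> \<beta> \<theta> k) g = of_real ((of_int k + \<theta>) / (\<beta> - \<alpha>)) * l2_inner X (fourier_basis \<alpha> \<beta> \<theta> k) f"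
    and c: "c = (LINT x|X. f x - (LINT s|X. of_bool (s \<le> x) * (tpi * g s))) / of_real (\<beta> - \<alpha>)"
  shows "AE x in X. f x = c + (LINT s|X. of_bool (s \<le> x) * (tpi * g s))"
    and "c + (LINT s|X. tpi * g s) = expi2pi \<theta> * c"
proof -
  let ?u = "fourier_basis \<alpha> \<beta> \<theta>" and ?s = "complex_of_real (sqrt (\<beta> - \<alpha>))"
  define m where "m k = (of_int k + \<theta>) / (\<beta> - \<alpha>)" for k :: int
  define p where "p x = tpi * g x" for x
  define F where "F x = (LINT s|X. of_bool (s \<le> x) * p s)" for x
  define A where "A = (LINT s|X. p s)"
  have FL: "F \<in> L2 X" using F by (simp add: F_def[abs_def] p_def)
  have s0: "?s \<noteq> 0" using ab by simp
  have pi: "integrable X p" unfolding p_def using X.L2_imp_integrable[OF g] by simp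
  have cL: "(\<lambda>x. d) \<in> L2 X" for d :: complex by (rule X.L2_bounded[of _ "cmod d"]) auto
  define r where "r x = f x - F x" for x
  have rL: "r \<in> L2 X" unfolding r_def[abs_def] by (rule L2_diff[OF f FL])
  have r_inner: "tpi * of_real (m k) * l2_inner X (?u k) r = expi2pi (- \<theta>) * A / ?s" for k
  proof -
    have "l2_inner X (?u k) p = tpi * of_real (m k) * l2_inner X (?u k) f"
      by (simp add: p_def[abs_def] l2_inner_cmult_right e m_def)
    moreover have "l2_inner X (?u k) p - tpi * of_real (m k) * l2_inner X (?u k) F = expi2pi (- \<theta>) * A / ?s"
      using fourier_basis_by_parts[OF pi, of \<theta> k 0]
      by (simp only: m_def[symmetric] F_def[symmetric] A_def[symmetric] add_0 diff_zero)
    ultimately show ?thesis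
      unfolding r_def[abs_def] l2_inner_diff_right[OF basis.u_L2 f FL] right_diff_distrib by simp
  qed
  have c_inner: "tpi * of_real (m k) * l2_inner X (?u k) (\<lambda>x. d) = (1 - expi2pi (- \<theta>)) * d / ?s" for k d
    using fourier_basis_by_parts[of "\<lambda>x. 0" \<theta> k d] by (simp add: m_def l2_inner_def diff_divide_distrib algebra_simps)
  have "\<exists>d. (\<forall>k. l2_inner X (?u k) (\<lambda>x. r x - d) = 0) \<and> d + A = expi2pi \<theta> * d"
  proof (cases "\<theta> = 0")
    case True
    \<comment> \<open>At \<open>k = 0\<close> the frequency vanishes: the relation yields
      \<open>A = 0\<close> but no information on the mean of \<open>r\<close>, which is therefore
      taken as \<open>d\<close>.\<close>
    have A: "A = 0" using r_inner[of 0] True s0 by (simp add: m_def)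
    define d where "d = (LINT x|X. r x) / of_real (\<beta> - \<alpha>)"
    have "l2_inner X (?u k) (\<lambda>x. r x - d) = 0" for k
    proof (cases "k = 0")
      case True
      have "l2_inner X (?u k) (\<lambda>x. r x - d) = (LINT x|X. r x - d) / ?s"
        using True \<open>\<theta> = 0\<close> by (simp add: l2_inner_def fourier_basis_def)
      also have "(LINT x|X. r x - d) = (LINT x|X. r x) - (LINT x|X. d)"
        by (rule Bochner_Integration.integral_diff[OF X.L2_imp_integrable[OF rL] X.L2_imp_integrable[OF cL]])
      also have "\<dots> = 0"
        unfolding LINT_X_const d_def using ab by simp
      finally show ?thesis by simp
    next
      case False
      then have "m k \<noteq> 0" using True ab by (simp add: m_def)
      then have "l2_inner X (?u k) r = 0" "l2_inner X (?u k) (\<lambda>x. d) = 0"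
        using r_inner[of k] c_inner[of k d] A True by auto
      then show ?thesis by (simp add: l2_inner_diff_right[OF basis.u_L2 rL cL])
    qed
    then show ?thesis using A True by auto
  next
    case False
    have e1: "expi2pi \<theta> - 1 \<noteq> 0"
      using \<theta> False expi2pi_eq_1_iff[of \<theta>] by (auto elim!: Ints_cases)
    \<comment> \<open>The solution of the boundary condition
      \<open>d + A = e(\<theta>) d\<close>.\<close>
    define d where "d = A / (expi2pi \<theta> - 1)"
    have "(1 - expi2pi (- \<theta>)) * d = expi2pi (- \<theta>) * ((expi2pi \<theta> - 1) * d)"
      by (simp only: mult.assoc[symmetric] right_diff_distrib expi2pi_minus_mult) simp
    also have "(expi2pi \<theta> - 1) * d = A" using e1 by (simp add: d_def)
    finally have d1: "(1 - expi2pi (- \<theta>)) * d = expi2pi (- \<theta>) * A" .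
    have "l2_inner X (?u k) (\<lambda>x. r x - d) = 0" for k
    proof -
      have "of_int k + \<theta> \<noteq> 0"
      proof
        assume "of_int k + \<theta> = 0"
        then have "\<theta> = of_int (- k)" by simp
        then show False using \<theta> False by auto
      qed
      then have m0: "m k \<noteq> 0" using ab by (simp add: m_def)
      have "tpi * of_real (m k) * (l2_inner X (?u k) r - l2_inner X (?u k) (\<lambda>x. d)) = 0"
        unfolding right_diff_distrib r_inner c_inner d1 by simp
      then have "l2_inner X (?u k) r - l2_inner X (?u k) (\<lambda>x. d) = 0" using m0 by simp
      then show ?thesis by (simp add: l2_inner_diff_right[OF basis.u_L2 rL cL])
    qed
    moreover have "d + A = expi2pi \<theta> * d"
      using e1 by (simp add: d_def field_simps)
    ultimately show ?thesis by blast
  qed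
  then obtain d where d: "\<And>k. l2_inner X (?u k) (\<lambda>x. r x - d) = 0" and dA: "d + A = expi2pi \<theta> * d" by blast
  have rd: "AE x in X. r x - d = 0" by (rule basis.complete[OF L2_diff[OF rL cL] d])
  \<comment> \<open>In both cases \<open>d\<close> is the mean of \<open>r\<close>. With this
    uniform formula, \<open>P_op_W\<close> can obtain the constants of all fibres from a single
    function of \<open>y\<close>.\<close>
  have "(LINT x|X. r x) = (LINT x|X. d)"
    by (rule integral_cong_AE) (use rd rL in auto)
  then have "d = (LINT x|X. r x) / of_real (\<beta> - \<alpha>)" unfolding LINT_X_const using ab by simp
  then have "d = c" by (simp add: c r_def F_def p_def)
  with rd dA show "AE x in X. f x = c + (LINT s|X. of_bool (s \<le> x) * (tpi * g s))" "c + (LINT s|X. tpi * g s) = expi2pi \<theta> * c"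
    by (auto simp: r_def F_def p_def A_def algebra_simps)
qed

end

context strip
begin

lemma AE_M_iff:
  assumes [measurable]: "f \<in> borel_measurable M" "g \<in> borel_measurable M"
  shows "(AE z in M. f z = g z) \<longleftrightarrow> (AE y in lborel. AE x in X. f (x, y) = (g (x, y) :: complex))"
proof -
  have s: "{z \<in> space M. f z = g z} \<in> sets M" by measurable
  then have s': "{z \<in> space (X \<Otimes>\<^sub>M lborel). f (fst z, snd z) = g (fst z, snd z)} \<in> sets (X \<Otimes>\<^sub>M lborel)"
    unfolding M_eq by (simp only: prod.collapse)
  have "(AE z in M. f z = g z) \<longleftrightarrow> (AE x in X. AE y in lborel. f (x, y) = g (x, y))"
    unfolding M_eq using P.AE_pair_iff[of "\<lambda>x y. f (x, y) = g (x, y)"] s' by simp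
  also have "\<dots> \<longleftrightarrow> (AE y in lborel. AE x in X. f (x, y) = g (x, y))"
    by (rule P.AE_commute) (use s' in simp)
  finally show ?thesis .
qed

lemma AE_X_const: "(AE x in X. Q) \<longleftrightarrow> Q"
  using AE_exists[of "\<lambda>x. Q"] by auto

lemma AE_M_const_iff:
  assumes "K \<in> L2 lborel" "K' \<in> L2 lborel"
  shows "(AE z in M. K (snd z) = K' (snd z)) \<longleftrightarrow> (AE y in lborel. K y = K' y)"
  using AE_M_iff[OF L2_measurable L2_measurable, OF const_L2_I const_L2_I, OF assms]
  by (simp add: AE_X_const)

lemma pft_const:
  assumes h: "h \<in> L2 lborel" shows "AE z in M. pft X (\<lambda>z. h (snd z)) z = fourier h (snd z)"
proof -
  let ?f = "\<lambda>z :: real \<times> real. h (snd z)"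
  have f: "?f \<in> L2 M" using h by (rule const_L2_I)
  note [measurable] = L2_measurable[OF pft.L2[OF f]] L2_measurable[OF const_L2_I[OF fourier.L2[OF h]]]
  have s: "{z \<in> space M. pft X ?f z = fourier h (snd z)} \<in> sets M" by measurable
  then have s': "{z \<in> space (X \<Otimes>\<^sub>M lborel). pft X ?f (fst z, snd z) = fourier h (snd z)} \<in> sets (X \<Otimes>\<^sub>M lborel)"
    unfolding M_eq by (simp only: prod.collapse)
  have "AE x in X. AE t in lborel. pft X ?f (x, t) = fourier h t"
    using pft_fibre[OF sigma_finite_X f[unfolded M_eq]]
  proof eventually_elim
    case (elim x)
    then have "AE t in lborel. fourier h t = pft X ?f (x, t)" using fourier_eqI[OF h] by simp
    then show ?case by eventually_elim simp
  qed
  then show ?thesis unfolding M_eq using P.AE_pair_iff[of "\<lambda>x t. pft X ?f (x, t) = fourier h t"] s' by simp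
qed

lemma pft_const_kop:
  assumes k: "kernel k" and K: "K \<in> L2 lborel" and g: "g \<in> L2 M"
  shows "AE z in M. pft X (\<lambda>z. K (snd z) + kop k (\<lambda>z. c * g z) z) z = fourier K (snd z) + kop k (\<lambda>z. c * pft X g z) z"
  using pft.add[OF const_L2_I[OF K] kop_L2(1)[OF k L2_cmult[OF g]], of c] pft_const[OF K]
    pft_kop[OF k L2_cmult[OF g], of c]
    kop_cong[OF k pft.L2[OF L2_cmult[OF g]] L2_cmult[OF pft.L2[OF g]] pft.cmult[OF g], of c]
  by eventually_elim simp

end

section \<open>Simultaneous diagonalization of \<open>P\<close> and \<open>Q\<close>\<close>

locale twisted_strip = strip +
  fixes \<gamma> :: "real \<Rightarrow> real"
  assumes \<gamma>_measurable [measurable]: "\<gamma> \<in> borel_measurable borel"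
    and \<gamma>_range: "\<gamma> t \<in> {0..<1}"
begin

abbreviation "N \<equiv> count_space (UNIV :: int set) \<Otimes>\<^sub>M (lborel :: real measure)"

sublocale N: pair_sigma_finite "count_space (UNIV :: int set)" "lborel :: real measure"
  by (rule pair_sigma_finite_lborel) (rule sigma_finite_measure_count_space_countable, simp)

text \<open>Fourier coefficients in \<open>x\<close> for the boundary condition \<open>f(\<beta>) = e(\<gamma>(\<lambda>)) f(\<alpha>)\<close> on the fibre over \<open>\<lambda>\<close>.\<close>

definition fs :: "(real \<times> real \<Rightarrow> complex) \<Rightarrow> int \<times> real \<Rightarrow> complex" where
  "fs f p = l2_inner X (fourier_basis \<alpha> \<beta> (\<gamma> (snd p)) (fst p)) (\<lambda>x. f (x, snd p))"

lemma borel_measurable_N: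
  "(\<And>k. (\<lambda>t. h (k, t)) \<in> borel_measurable borel) \<Longrightarrow> h \<in> borel_measurable N"
  by (rule measurable_pair_measure_countable1) auto

lemma AE_N_iff:
  assumes [measurable]: "h \<in> borel_measurable N" "h' \<in> borel_measurable N"
  shows "(AE p in N. h p = h' p) \<longleftrightarrow> (AE y in lborel. \<forall>k. h (k, y) = (h' (k, y) :: complex))"
proof -
  have "{z \<in> space N. h z = h' z} \<in> sets N" by measurable
  then have "{z \<in> space N. h (fst z, snd z) = h' (fst z, snd z)} \<in> sets N"
    by (simp only: prod.collapse)
  then have "(AE p in N. h p = h' p) \<longleftrightarrow> (AE k in count_space UNIV. AE y in lborel. h (k, y) = h' (k, y))"
    using N.AE_pair_iff[of "\<lambda>x y. h (x, y) = h' (x, y)"] by simp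
  also have "\<dots> \<longleftrightarrow> (AE y in lborel. \<forall>k. h (k, y) = h' (k, y))"
    by (simp add: AE_count_space AE_all_countable)
  finally show ?thesis .
qed

lemma borel_measurable_twisted_basis:
  "(\<lambda>z. fourier_basis \<alpha> \<beta> (\<gamma> (snd z)) k (fst z)) \<in> borel_measurable M"
  unfolding fourier_basis_def
  using measurable_compose[OF measurable_fst_M(1) measurable_ident_X]
  by measurable

lemma fs_measurable:
  assumes "f \<in> L2 M" shows "fs f \<in> borel_measurable N"
proof (rule borel_measurable_N)
  fix k
  have "(\<lambda>z. cnj (fourier_basis \<alpha> \<beta> (\<gamma> (snd z)) k (fst z)) * f z) \<in> borel_measurable (X \<Otimes>\<^sub>M lborel)"
    using borel_measurable_twisted_basis[of k] L2_measurable[OF assms] unfolding M_eq by measurable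
  from measurable_compose[OF measurable_pair_swap' this]
  have m: "(\<lambda>z. cnj (fourier_basis \<alpha> \<beta> (\<gamma> (fst z)) k (snd z)) * f (snd z, fst z)) \<in> borel_measurable (lborel \<Otimes>\<^sub>M X)"
    by (simp add: case_prod_unfold)
  have "(\<lambda>y. LINT x|X. cnj (fourier_basis \<alpha> \<beta> (\<gamma> y) k x) * f (x, y)) \<in> borel_measurable lborel"
    by (rule X.borel_measurable_lebesgue_integral) (use m in \<open>simp add: case_prod_unfold\<close>)
  then show "(\<lambda>t. fs f (k, t)) \<in> borel_measurable borel" by (simp add: fs_def l2_inner_def)
qed

lemma fs_norm:
  assumes f: "f \<in> L2 M"
  shows "(\<integral>\<^sup>+p. ennreal ((cmod (fs f p))\<^sup>2) \<partial>N) = ennreal (l2sq M f)"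
proof -
  note [measurable] = fs_measurable[OF f]
  have "(\<integral>\<^sup>+p. ennreal ((cmod (fs f p))\<^sup>2) \<partial>N)
      = (\<integral>\<^sup>+y. (\<integral>\<^sup>+k. ennreal ((cmod (fs f (k, y)))\<^sup>2) \<partial>count_space UNIV) \<partial>lborel)"
    by (subst N.nn_integral_snd[symmetric]) auto
  also have "\<dots> = (\<integral>\<^sup>+y. ennreal (l2sq X (\<lambda>x. f (x, y))) \<partial>lborel)"
  proof (rule nn_integral_cong_AE)
    show "AE y in lborel. (\<integral>\<^sup>+k. ennreal ((cmod (fs f (k, y)))\<^sup>2) \<partial>count_space UNIV) = ennreal (l2sq X (\<lambda>x. f (x, y)))"
      using AE_fibre_snd[OF f] by eventually_elim (simp add: fs_def basis.parseval_nn)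
  qed
  also have "\<dots> = ennreal (l2sq M f)" by (rule l2sq_fibre_snd[OF f])
  finally show ?thesis .
qed

lemma fs_L2: assumes f: "f \<in> L2 M" shows "fs f \<in> L2 N"
proof (rule L2_I[OF fs_measurable[OF f]])
  note [measurable] = fs_measurable[OF f]
  show "integrable N (\<lambda>p. (cmod (fs f p))\<^sup>2)"
    by (rule integrableI_bounded) (simp_all add: fs_norm[OF f])
qed

sublocale fs: l2_isometry M N fs
proof
  fix f g assume f: "f \<in> L2 M"
  show "fs f \<in> L2 N" by (rule fs_L2[OF f])
  show "AE p in N. fs (\<lambda>z. c * f z) p = c * fs f p" for c by (simp add: fs_def l2_inner_cmult_right)
  have "ennreal (l2sq N (fs f)) = ennreal (l2sq M f)"
    using nn_integral_eq_integral[OF L2_integrable[OF fs_L2[OF f]]] fs_norm[OF f] by (simp add: l2sq_def)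
  then show "l2sq N (fs f) = l2sq M f" by simp
  assume g: "g \<in> L2 M"
  note [measurable] = L2_measurable[OF fs_L2[OF f]] L2_measurable[OF fs_L2[OF g]] L2_measurable[OF fs_L2[OF L2_add[OF f g]]]
  show "AE p in N. fs (\<lambda>z. f z + g z) p = fs f p + fs g p"
  proof (subst AE_N_iff)
    show "AE y in lborel. \<forall>k. fs (\<lambda>z. f z + g z) (k, y) = fs f (k, y) + fs g (k, y)"
      using AE_fibre_snd[OF f] AE_fibre_snd[OF g]
      by eventually_elim (simp add: fs_def l2_inner_add_right basis.u_L2)
  qed measurable
qed

text \<open>The partial sums with coefficients \<open>h\<close> lie in \<open>L2 M\<close> and have
  the truncations of \<open>h\<close> as images. These converge to \<open>h\<close>, and the range
  of an isometry is closed.\<close>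

lemma fs_surj:
  assumes h: "h \<in> L2 N" shows "\<exists>f\<in>L2 M. AE p in N. fs f p = h p"
proof -
  define c where "c n p = of_bool (\<bar>fst p\<bar> \<le> int n) * h p" for n and p :: "int \<times> real"
  define s where "s n z = basis.partial_sum (\<gamma> (snd z)) (\<lambda>k. h (k, snd z)) n (fst z)" for n :: nat and z :: "real \<times> real"
  have lim: "l2_lim N c h"
    unfolding c_def[abs_def]
  proof (rule l2_lim_cutoff[OF h])
    show "{p \<in> space N. \<bar>fst p\<bar> \<le> int n} \<in> sets N" for n
      using measurable_sets[OF measurable_fst[of "count_space (UNIV :: int set)" "lborel :: real measure"], of "{k. \<bar>k\<bar> \<le> int n}"]
      by (simp add: vimage_def Int_def conj_commute)
    show "\<forall>\<^sub>F n in sequentially. \<bar>fst p\<bar> \<le> int n" for p :: "int \<times> real"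
      using eventually_ge_at_top[of "nat \<bar>fst p\<bar>"] by eventually_elim auto
  qed
  have hk: "(\<lambda>y. h (k, y)) \<in> L2 lborel" for k
    using N.AE_L2_fibre[OF h] by (simp add: AE_count_space)
  have sL: "s n \<in> L2 M" for n
    unfolding s_def[abs_def] basis.partial_sum_def
  proof (rule L2_sum)
    fix k
    have "(\<lambda>z. fourier_basis \<alpha> \<beta> (\<gamma> (snd z)) k (fst z) * h (k, snd z)) \<in> L2 M"
    proof (rule L2_mult_bounded[OF const_L2_I[OF hk] borel_measurable_twisted_basis])
      show "cmod (fourier_basis \<alpha> \<beta> (\<gamma> (snd z)) k (fst z)) \<le> 1 / sqrt (\<beta> - \<alpha>)" for z
        using ab by (simp add: fourier_basis_def norm_divide)
    qed
    then show "(\<lambda>z. h (k, snd z) * fourier_basis \<alpha> \<beta> (\<gamma> (snd z)) k (fst z)) \<in> L2 M" by (simp add: mult.commute)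
  qed
  have "fs (s n) p = c n p" for n p
    by (cases p) (simp add: fs_def s_def c_def basis.inner_partial_sum)
  then have "\<exists>f. l2_lim M s f \<and> (AE p in N. fs f p = h p)"
    by (intro l2_isometry_range_closed[OF fs.L2 fs.dist lim sL]) auto
  then show ?thesis using l2_lim_L2 by blast
qed

definition ifs :: "(int \<times> real \<Rightarrow> complex) \<Rightarrow> real \<times> real \<Rightarrow> complex" where
  "ifs h = (SOME f. f \<in> L2 M \<and> (AE p in N. fs f p = h p))"

sublocale fs: l2_unitary_pair M N fs ifs
proof
  fix h assume "h \<in> L2 N"
  then have "\<exists>f. f \<in> L2 M \<and> (AE p in N. fs f p = h p)" using fs_surj by blast
  from someI_ex[OF this] show "ifs h \<in> L2 M" "AE p in N. fs (ifs h) p = h p" by (simp_all add: ifs_def)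
qed

abbreviation W where "W f \<equiv> fs (pft X f)"
abbreviation W' where "W' h \<equiv> ipft X (ifs h)"

sublocale W: l2_unitary_pair M N W W'
  by (rule l2_unitary_pair_compose[OF pft.l2_unitary_pair_axioms fs.l2_unitary_pair_axioms])

text \<open>The eigenvalue of the basis function with index \<open>k\<close> on the fibre over
  \<lambda>.\<close>

definition mP :: "int \<times> real \<Rightarrow> real" where
  "mP p = (of_int (fst p) + \<gamma> (snd p)) / (\<beta> - \<alpha>)"

lemma mP_measurable [measurable]: "mP \<in> borel_measurable N"
  unfolding mP_def[abs_def] by (rule borel_measurable_N) simp

text \<open>On the fibre over \<open>y\<close> the multiplier is the scalar \<open>y\<close>, which
  passes through every coefficient; completeness of the basis gives the way back.\<close>

lemma Q_op_W:
  "Q_op \<alpha> \<beta> f g \<longleftrightarrow> f \<in> L2 M \<and> g \<in> L2 M \<and> (AE p in N. W g p = of_real (snd p) * W f p)"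
proof -
  have "(AE z in M. pft X g z = of_real (snd z) * pft X f z) \<longleftrightarrow> (AE p in N. W g p = of_real (snd p) * W f p)"
    if f: "f \<in> L2 M" and g: "g \<in> L2 M"
  proof -
    let ?f = "pft X f" and ?g = "pft X g"
    have fL: "?f \<in> L2 M" "?g \<in> L2 M" using f g by (auto intro: pft.L2)
    note [measurable] = L2_measurable[OF fL(1)] L2_measurable[OF fL(2)] L2_measurable[OF fs_L2[OF fL(1)]] L2_measurable[OF fs_L2[OF fL(2)]]
    have "AE y in lborel. (AE x in X. ?g (x, y) = of_real y * ?f (x, y)) \<longleftrightarrow> (\<forall>k. W g (k, y) = of_real y * W f (k, y))"
      using AE_fibre_snd[OF fL(1)] AE_fibre_snd[OF fL(2)]
    proof eventually_elim
      case (elim y)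
      have L: "(\<lambda>x. of_real y * ?f (x, y)) \<in> L2 X" by (rule L2_cmult[OF elim(1)])
      show ?case
      proof
        assume a: "AE x in X. ?g (x, y) = of_real y * ?f (x, y)"
        show "\<forall>k. W g (k, y) = of_real y * W f (k, y)"
        proof
          fix k
          show "W g (k, y) = of_real y * W f (k, y)"
            using l2_inner_cong_AE[OF basis.u_L2[of "\<gamma> y" k] basis.u_L2[of "\<gamma> y" k] elim(2) L] a
            by (simp add: fs_def ae_eq_def l2_inner_cmult_right)
        qed
      next
        assume a: "\<forall>k. W g (k, y) = of_real y * W f (k, y)"
        have "AE x in X. ?g (x, y) - of_real y * ?f (x, y) = 0"
        proof (rule basis.complete[OF L2_diff[OF elim(2) L]])
          show "l2_inner X (fourier_basis \<alpha> \<beta> (\<gamma> y) k) (\<lambda>x. ?g (x, y) - of_real y * ?f (x, y)) = 0" for k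
            using a[rule_format, of k] unfolding l2_inner_diff_right[OF basis.u_L2 elim(2) L]
            by (simp add: fs_def l2_inner_cmult_right)
        qed
        then show "AE x in X. ?g (x, y) = of_real y * ?f (x, y)" by eventually_elim simp
      qed
    qed
    then have "(AE y in lborel. AE x in X. ?g (x, y) = of_real y * ?f (x, y)) \<longleftrightarrow> (AE y in lborel. \<forall>k. W g (k, y) = of_real y * W f (k, y))"
      by (rule eventually_subst)
    moreover have "(AE z in M. ?g z = of_real (snd z) * ?f z) \<longleftrightarrow> (AE y in lborel. AE x in X. ?g (x, y) = of_real y * ?f (x, y))"
      by (subst AE_M_iff) auto
    moreover have "(AE p in N. W g p = of_real (snd p) * W f p) \<longleftrightarrow> (AE y in lborel. \<forall>k. W g (k, y) = of_real y * W f (k, y))"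
      by (subst AE_N_iff) auto
    ultimately show ?thesis by simp
  qed
  then show ?thesis unfolding Q_op_iff by blast
qed

text \<open>Transforming \<open>rep\<close> in \<open>y\<close> turns the boundary condition into
  one with the scalar \<open>e(\<gamma>(\<lambda>))\<close> on each fibre. Then
  \<open>fourier_basis_by_parts\<close> has right-hand side zero, which is the multiplier relation.
  Conversely \<open>twisted_derivative\<close> rebuilds almost every fibre from its coefficients,
  and injectivity of the transform returns the representation and the boundary condition to the
  variable \<open>y\<close>.\<close>

lemma P_op_W:
  assumes U: "l2_linear lborel U" and diag: "fourier_diagonalized U \<gamma>"
  shows "P_op \<alpha> \<beta> U f g \<longleftrightarrow> f \<in> L2 M \<and> g \<in> L2 M \<and> (AE p in N. W g p = of_real (mP p) * W f p)"
proof
  assume "P_op \<alpha> \<beta> U f g"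
  then obtain K where g: "g \<in> L2 M" and r: "rep f (\<lambda>z. tpi * g z) K"
    and b: "AE y in lborel. K y + (LINT s|X. tpi * g (s, y)) = U K y"
    unfolding P_op_iff[OF U] ae_eq_def by blast
  have f: "f \<in> L2 M" and K: "K \<in> L2 lborel" and fe: "AE z in M. f z = K (snd z) + J (\<lambda>z. tpi * g z) z"
    using r by (auto simp: rep_def)
  have UK: "U K \<in> L2 lborel" using U K by (auto simp: l2_linear_def)
  let ?f = "pft X f" and ?g = "pft X g"
  have fL: "?f \<in> L2 M" "?g \<in> L2 M" using f g by (auto intro: pft.L2)
  have KJ: "(\<lambda>z. K (snd z) + kop k (\<lambda>z. tpi * g z) z) \<in> L2 M" if "kernel k" for k
    by (rule L2_add[OF const_L2_I[OF K] kop_L2(1)[OF that L2_cmult[OF g]]])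
  have KJ': "(\<lambda>z. fourier K (snd z) + kop k (\<lambda>z. tpi * ?g z) z) \<in> L2 M" if "kernel k" for k
    by (rule L2_add[OF const_L2_I[OF fourier.L2[OF K]] kop_L2(1)[OF that L2_cmult[OF fL(2)]]])
  have "AE z in M. ?f z = fourier K (snd z) + J (\<lambda>z. tpi * ?g z) z"
    using pft.cong[OF f KJ[OF kernel_J] fe] pft_const_kop[OF kernel_J K g, of tpi]
    by eventually_elim simp
  then have 1: "AE y in lborel. AE x in X. ?f (x, y) = fourier K y + J (\<lambda>z. tpi * ?g z) (x, y)"
    using AE_M_iff[OF L2_measurable L2_measurable, OF fL(1) KJ'[OF kernel_J]] by simp
  have "AE z in M. K (snd z) + Av (\<lambda>z. tpi * g z) z = U K (snd z)"
    using AE_M_iff[OF L2_measurable L2_measurable, OF KJ[OF kernel_Av] const_L2_I[OF UK]] b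
    by (simp add: kop_def AE_X_const)
  from pft.cong[OF KJ[OF kernel_Av] const_L2_I[OF UK] this]
  have "AE z in M. fourier K (snd z) + Av (\<lambda>z. tpi * ?g z) z = fourier (U K) (snd z)"
    using pft_const_kop[OF kernel_Av K g, of tpi] pft_const[OF UK] by eventually_elim simp
  then have 2: "AE y in lborel. fourier K y + (LINT s|X. tpi * ?g (s, y)) = fourier (U K) y"
    using AE_M_iff[OF L2_measurable L2_measurable, OF KJ'[OF kernel_Av] const_L2_I[OF fourier.L2[OF UK]]]
    by (simp add: kop_def AE_X_const)
  have 3: "AE y in lborel. fourier (U K) y = expi2pi (\<gamma> y) * fourier K y"
    using diag K by (auto simp: fourier_diagonalized_def)
  note [measurable] = L2_measurable[OF fs_L2[OF fL(1)]] L2_measurable[OF fs_L2[OF fL(2)]]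
  have "AE p in N. W g p = of_real (mP p) * W f p"
  proof (subst AE_N_iff)
    show "AE y in lborel. \<forall>k. W g (k, y) = of_real (mP (k, y)) * W f (k, y)"
      using 1 2 3 AE_fibre_snd[OF fL(1)] AE_fibre_snd[OF fL(2)] AE_fibre_snd[OF KJ'[OF kernel_J]]
    proof eventually_elim
      case (elim y)
      have "integrable X (\<lambda>s. tpi * ?g (s, y))" using X.L2_imp_integrable[OF elim(5)] by simp
      note parts = fourier_basis_by_parts[OF this, of "\<gamma> y" _ "fourier K y"]
      have z: "expi2pi (- \<gamma> y) * (fourier K y + (LINT s|X. tpi * ?g (s, y))) - fourier K y = 0"
        unfolding elim(2) elim(3) by (simp flip: mult.assoc)
      show ?case
      proof
        fix k
        have "W f (k, y) = l2_inner X (fourier_basis \<alpha> \<beta> (\<gamma> y) k) (\<lambda>x. fourier K y + (LINT s|X. of_bool (s \<le> x) * (tpi * ?g (s, y))))"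
          using l2_inner_cong_AE[OF basis.u_L2[of "\<gamma> y" k] basis.u_L2[of "\<gamma> y" k] elim(4,6)] elim(1)
          by (simp add: fs_def ae_eq_def kop_def)
        moreover have "tpi * W g (k, y) = l2_inner X (fourier_basis \<alpha> \<beta> (\<gamma> y) k) (\<lambda>s. tpi * ?g (s, y))"
          by (simp only: fs_def l2_inner_cmult_right fst_conv snd_conv)
        ultimately have "tpi * W g (k, y) - tpi * of_real (mP (k, y)) * W f (k, y) = 0"
          using parts[of k] unfolding z by (simp only: mP_def fst_conv snd_conv div_0)
        then show "W g (k, y) = of_real (mP (k, y)) * W f (k, y)" by simp
      qed
    qed
  qed measurable
  then show "f \<in> L2 M \<and> g \<in> L2 M \<and> (AE p in N. W g p = of_real (mP p) * W f p)" using f g by blast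
next
  assume "f \<in> L2 M \<and> g \<in> L2 M \<and> (AE p in N. W g p = of_real (mP p) * W f p)"
  then have f: "f \<in> L2 M" and g: "g \<in> L2 M" and e: "AE p in N. W g p = of_real (mP p) * W f p" by auto
  let ?f = "pft X f" and ?g = "pft X g"
  have fL: "?f \<in> L2 M" "?g \<in> L2 M" using f g by (auto intro: pft.L2)
  note [measurable] = L2_measurable[OF fs_L2[OF fL(1)]] L2_measurable[OF fs_L2[OF fL(2)]]
  have e': "AE y in lborel. \<forall>k. W g (k, y) = of_real (mP (k, y)) * W f (k, y)"
    using e by (subst (asm) AE_N_iff) auto
  define r where "r z = f z - J (\<lambda>z. tpi * g z) z" for z
  define r' where "r' z = ?f z - J (\<lambda>z. tpi * ?g z) z" for z
  define L where "L = complex_of_real (\<beta> - \<alpha>)"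
  have JL: "J (\<lambda>z. tpi * g z) \<in> L2 M" "J (\<lambda>z. tpi * ?g z) \<in> L2 M"
    using kop_L2(1)[OF kernel_J L2_cmult] g fL(2) by auto
  have rL: "r \<in> L2 M" "r' \<in> L2 M"
    unfolding r_def[abs_def] r'_def[abs_def] using L2_diff[OF f JL(1)] L2_diff[OF fL(1) JL(2)] by auto
  \<comment> \<open>The candidate trace at \<alpha> is the mean over \<open>x\<close> of
    \<open>f\<close> minus the integral of its derivative; the argument \<alpha> is a dummy because
    \<open>Av\<close> ignores it. Its Fourier transform is the constant required by
    \<open>twisted_derivative\<close>.\<close>
  define K where "K y = Av r (\<alpha>, y) / L" for y
  have KAv: "K (snd z) = Av r z / L" for z by (simp add: K_def kop_def)
  have K: "K \<in> L2 lborel"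
    by (rule const_L2_D) (use L2_cmult[OF kop_L2(1)[OF kernel_Av rL(1)], of "1 / L"] in \<open>simp add: KAv\<close>)
  have UK: "U K \<in> L2 lborel" using U K by (auto simp: l2_linear_def)
  have pr: "AE z in M. pft X r z = r' z"
    using pft.diff[OF f JL(1)] pft_kop[OF kernel_J L2_cmult[OF g], of tpi]
      kop_cong[OF kernel_J pft.L2[OF L2_cmult[OF g]] L2_cmult[OF pft.L2[OF g]] pft.cmult[OF g], of tpi]
    unfolding r_def[abs_def] r'_def by eventually_elim simp
  have FK: "AE z in M. fourier K (snd z) = Av r' z / L"
  proof -
    have "AE z in M. pft X (\<lambda>z. K (snd z)) z = (1 / L) * pft X (Av r) z"
      using pft.cmult[OF kop_L2(1)[OF kernel_Av rL(1)], of "1 / L"] by (simp add: KAv)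
    then show ?thesis
      using pft_const[OF K] pft_kop[OF kernel_Av rL(1)] kop_cong[OF kernel_Av pft.L2[OF rL(1)] rL(2) pr]
      by eventually_elim simp
  qed
  have FK': "AE y in lborel. fourier K y = (LINT x|X. r' (x, y)) / L"
  proof -
    have "(\<lambda>z. Av r' z / L) \<in> borel_measurable M"
      using L2_measurable[OF kop_L2(1)[OF kernel_Av rL(2)]] by measurable
    from AE_M_iff[OF L2_measurable[OF const_L2_I[OF fourier.L2[OF K]]] this] FK show ?thesis
      by (simp add: kop_def AE_X_const)
  qed
  have fib: "AE y in lborel. (AE x in X. ?f (x, y) = fourier K y + J (\<lambda>z. tpi * ?g z) (x, y)) \<and>
      fourier K y + (LINT s|X. tpi * ?g (s, y)) = expi2pi (\<gamma> y) * fourier K y"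
    using e' FK' AE_fibre_snd[OF fL(1)] AE_fibre_snd[OF fL(2)] AE_fibre_snd[OF JL(2)]
  proof eventually_elim
    case (elim y)
    have F: "(\<lambda>x. LINT s|X. of_bool (s \<le> x) * (tpi * ?g (s, y))) \<in> L2 X" using elim(5) by (simp add: kop_def)
    have c: "fourier K y = (LINT x|X. ?f (x, y) - (LINT s|X. of_bool (s \<le> x) * (tpi * ?g (s, y)))) / of_real (\<beta> - \<alpha>)"
      unfolding elim(2) L_def r'_def kop_def by simp
    have "l2_inner X (fourier_basis \<alpha> \<beta> (\<gamma> y) k) (\<lambda>x. ?g (x, y)) = of_real ((of_int k + \<gamma> y) / (\<beta> - \<alpha>)) * l2_inner X (fourier_basis \<alpha> \<beta> (\<gamma> y) k) (\<lambda>x. ?f (x, y))" for k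
      using elim(1)[rule_format, of k] by (simp add: fs_def mP_def)
    from twisted_derivative[OF elim(3,4) F \<gamma>_range this c] show ?case by (simp add: kop_def)
  qed
  have KJ: "(\<lambda>z. K (snd z) + kop k (\<lambda>z. tpi * g z) z) \<in> L2 M" if "kernel k" for k
    by (rule L2_add[OF const_L2_I[OF K] kop_L2(1)[OF that L2_cmult[OF g]]])
  have KJ': "(\<lambda>z. fourier K (snd z) + kop k (\<lambda>z. tpi * ?g z) z) \<in> L2 M" if "kernel k" for k
    by (rule L2_add[OF const_L2_I[OF fourier.L2[OF K]] kop_L2(1)[OF that L2_cmult[OF fL(2)]]])
  have "AE z in M. ?f z = fourier K (snd z) + J (\<lambda>z. tpi * ?g z) z"
    unfolding AE_M_iff[OF L2_measurable L2_measurable, OF fL(1) KJ'[OF kernel_J]] using fib by simp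
  then have "AE z in M. ?f z = pft X (\<lambda>z. K (snd z) + J (\<lambda>z. tpi * g z) z) z"
    using pft_const_kop[OF kernel_J K g, of tpi] by eventually_elim simp
  then have rep: "rep f (\<lambda>z. tpi * g z) K"
    using pft.eq_iff[OF f KJ[OF kernel_J]] f K L2_cmult[OF g] by (simp add: rep_def)
  have 3: "AE y in lborel. fourier (U K) y = expi2pi (\<gamma> y) * fourier K y"
    using diag K by (auto simp: fourier_diagonalized_def)
  have "AE y in lborel. fourier K y + (LINT s|X. tpi * ?g (s, y)) = fourier (U K) y"
    using 3 fib by eventually_elim simp
  then have "AE z in M. fourier K (snd z) + Av (\<lambda>z. tpi * ?g z) z = fourier (U K) (snd z)"
    unfolding AE_M_iff[OF L2_measurable L2_measurable, OF KJ'[OF kernel_Av] const_L2_I[OF fourier.L2[OF UK]]]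
    by (simp add: kop_def AE_X_const)
  then have "AE z in M. pft X (\<lambda>z. K (snd z) + Av (\<lambda>z. tpi * g z) z) z = pft X (\<lambda>z. U K (snd z)) z"
    using pft_const_kop[OF kernel_Av K g, of tpi] pft_const[OF UK] by eventually_elim simp
  then have "AE z in M. K (snd z) + Av (\<lambda>z. tpi * g z) z = U K (snd z)"
    using pft.eq_iff[OF KJ[OF kernel_Av] const_L2_I[OF UK]] by simp
  then have "AE y in lborel. K y + (LINT s|X. tpi * g (s, y)) = U K y"
    using AE_M_iff[OF L2_measurable L2_measurable, OF KJ[OF kernel_Av] const_L2_I[OF UK]]
    by (simp add: kop_def AE_X_const)
  then show "P_op \<alpha> \<beta> U f g" unfolding P_op_iff[OF U] ae_eq_def using g rep by blast
qed

lemma diagonalized_imp_commute: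
  assumes U: "l2_linear lborel U" and diag: "fourier_diagonalized U \<gamma>"
  shows "spectrally_commute M (P_op \<alpha> \<beta> U) (Q_op \<alpha> \<beta>)"
proof -
  interpret mp: mult_representation M N W W' mP "P_op \<alpha> \<beta> U"
    by standard (simp_all add: P_op_W[OF U diag])
  have snd: "snd \<in> borel_measurable N" by measurable
  interpret mq: mult_representation M N W W' snd "Q_op \<alpha> \<beta>"
    by standard (use snd in \<open>simp_all add: Q_op_W\<close>)
  have "AE z in M. mp.mult_spectral S (mq.mult_spectral T f) z = mq.mult_spectral T (mp.mult_spectral S f) z"
    if "S \<in> sets borel" "T \<in> sets borel" "f \<in> L2 M" for S T f
  proof (rule iffD2[OF W.eq_iff])
    show "AE p in N. W (mp.mult_spectral S (mq.mult_spectral T f)) p = W (mq.mult_spectral T (mp.mult_spectral S f)) p"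
      using mp.V_mult_spectral[OF that(1) mq.mult_spectral_L2[OF that(2,3)]] mq.V_mult_spectral[OF that(2,3)]
        mq.V_mult_spectral[OF that(2) mp.mult_spectral_L2[OF that(1,3)]] mp.V_mult_spectral[OF that(1,3)]
      by eventually_elim (simp add: mult.left_commute)
  qed (use that in \<open>auto intro: mp.mult_spectral_L2 mq.mult_spectral_L2\<close>)
  then show ?thesis
    unfolding spectrally_commute_def ae_eq_def
    using mp.is_spectral_measure_mult_spectral mq.is_spectral_measure_mult_spectral by blast
qed

end

subsection \<open>Commutation of \<open>U\<close> with the spectral projections of \<open>Q\<close>\<close>

text \<open>\<open>T\<close> preserves the inner product of \<open>e j\<close> with \<open>h\<close>
  even after restriction to an arbitrary interval, so the integrands agree pointwise:
  \<open>cnj (T (e j)) * T h = cnj (e j) * h\<close>. With \<open>h = e j\<close> this gives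
  \<open>T (e j)\<close> modulus 1 on the \<open>j\<close>-th unit interval, and \<open>m\<close> is
  glued from these pieces.\<close>

lemma l2_isometry_multiplier:
  assumes "l2_isometry lborel lborel T"
    and loc: "\<And>a b h. a < b \<Longrightarrow> h \<in> L2 lborel \<Longrightarrow>
      AE t in lborel. T (\<lambda>t. of_bool (t \<in> {a<..b}) * h t) t = of_bool (t \<in> {a<..b}) * T h t"
  obtains m :: "real \<Rightarrow> complex" where "m \<in> borel_measurable borel" "\<And>t. cmod (m t) = 1"
    "\<And>h. h \<in> L2 lborel \<Longrightarrow> AE t in lborel. T h t = m t * h t"
proof -
  interpret T: l2_isometry lborel lborel T by fact
  define e where "e j t = (of_bool (t \<in> {real_of_int j<..real_of_int j + 1}) :: complex)" for j t
  have ind: "(\<lambda>t. of_bool (t \<in> {a<..b}) * h t) \<in> L2 lborel" if "h \<in> L2 lborel" for a b :: real and h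
    by (rule L2_indicator_mult[OF that]) simp
  have eL: "e j \<in> L2 lborel" for j
  proof (rule L2_I)
    show "e j \<in> borel_measurable lborel" unfolding e_def[abs_def] by simp
    have "(\<lambda>t. (cmod (e j t))\<^sup>2) = (\<lambda>t. indicator {real_of_int j<..real_of_int j + 1} t :: real)"
      by (auto simp: e_def indicator_def fun_eq_iff)
    then show "integrable lborel (\<lambda>t. (cmod (e j t))\<^sup>2)" by (simp add: integrable_real_indicator)
  qed
  have key: "AE t in lborel. cnj (T (e j) t) * T h t = cnj (e j t) * h t" if h: "h \<in> L2 lborel" for h j
  proof -
    let ?k = "\<lambda>t. cnj (T (e j) t) * T h t - cnj (e j t) * h t"
    have "AE t in lborel. ?k t = 0"
    proof (rule AE_zero_of_box_integrals)
      show "integrable lborel ?k"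
        by (rule Bochner_Integration.integrable_diff[OF L2_inner_integrable[OF T.L2[OF eL] T.L2[OF h]] L2_inner_integrable[OF eL h]])
      fix a b :: real
      show "(LINT x:box a b|lborel. ?k x) = 0"
      proof (cases "a < b")
        case True
        let ?h = "\<lambda>t. of_bool (t \<in> {a<..b}) * h t"
        have "(LINT x:box a b|lborel. ?k x) = (LINT t|lborel. cnj (T (e j) t) * (of_bool (t \<in> {a<..b}) * T h t) - cnj (e j t) * ?h t)"
          unfolding set_lebesgue_integral_def
        proof (rule integral_cong_AE)
          note [measurable] = L2_measurable[OF eL] L2_measurable[OF T.L2[OF eL]] L2_measurable[OF h] L2_measurable[OF T.L2[OF h]]
          show "(\<lambda>x. indicat_real (box a b) x *\<^sub>R ?k x) \<in> borel_measurable lborel"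
            "(\<lambda>t. cnj (T (e j) t) * (of_bool (t \<in> {a<..b}) * T h t) - cnj (e j t) * ?h t) \<in> borel_measurable lborel"
            by measurable
          show "AE x in lborel. indicat_real (box a b) x *\<^sub>R ?k x = cnj (T (e j) x) * (of_bool (x \<in> {a<..b}) * T h x) - cnj (e j x) * ?h x"
            using AE_lborel_singleton[of b] by eventually_elim (auto simp: indicator_def)
        qed
        also have "\<dots> = l2_inner lborel (T (e j)) (\<lambda>t. of_bool (t \<in> {a<..b}) * T h t) - l2_inner lborel (e j) ?h"
          unfolding l2_inner_def
          by (rule Bochner_Integration.integral_diff[OF L2_inner_integrable[OF T.L2[OF eL] ind[OF T.L2[OF h]]] L2_inner_integrable[OF eL ind[OF h]]])
        also have "l2_inner lborel (T (e j)) (\<lambda>t. of_bool (t \<in> {a<..b}) * T h t) = l2_inner lborel (T (e j)) (T ?h)"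
        proof (rule l2_inner_cong_AE[OF T.L2[OF eL] T.L2[OF eL] ind[OF T.L2[OF h]] T.L2[OF ind[OF h]]])
          show "ae_eq lborel (\<lambda>t. of_bool (t \<in> {a<..b}) * T h t) (T ?h)"
            unfolding ae_eq_def using loc[OF True h] by eventually_elim simp
        qed (simp add: ae_eq_def)
        also have "\<dots> = l2_inner lborel (e j) ?h" by (rule T.inner[OF eL ind[OF h]])
        finally show ?thesis by simp
      qed (simp add: set_lebesgue_integral_def)
    qed
    then show ?thesis by eventually_elim simp
  qed
  define m0 where "m0 t = T (e (\<lceil>t\<rceil> - 1)) t" for t
  \<comment> \<open>Alters \<open>m0\<close> only on a null set, so that the modulus is 1
    everywhere.\<close>
  define m where "m t = (if cmod (m0 t) = 1 then m0 t else 1)" for t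
  have e1: "e (\<lceil>t\<rceil> - 1) t = 1" for t :: real
    unfolding e_def using ceiling_correct[of t] by simp
  have [measurable]: "m0 \<in> borel_measurable borel"
    unfolding m0_def
  proof (rule measurable_compose_countable[where f = "\<lambda>j t. T (e j) t" and g = "\<lambda>t. \<lceil>t\<rceil> - 1"])
    show "T (e j) \<in> borel_measurable borel" for j using L2_measurable[OF T.L2[OF eL]] by simp
  qed measurable
  show thesis
  proof (rule that)
    show "m \<in> borel_measurable borel" unfolding m_def[abs_def] by measurable
    show "cmod (m t) = 1" for t by (simp add: m_def)
    fix h :: "real \<Rightarrow> complex" assume h: "h \<in> L2 lborel"
    have "AE t in lborel. \<forall>j. cnj (T (e j) t) * T (e j) t = cnj (e j t) * e j t"
      unfolding AE_all_countable using key[OF eL] by blast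
    moreover have "AE t in lborel. \<forall>j. cnj (T (e j) t) * T h t = cnj (e j t) * h t"
      unfolding AE_all_countable using key[OF h] by blast
    ultimately show "AE t in lborel. T h t = m t * h t"
    proof eventually_elim
      case (elim t)
      have 1: "cnj (m0 t) * m0 t = 1" and 2: "cnj (m0 t) * T h t = h t"
        using elim[rule_format, of "\<lceil>t\<rceil> - 1"] by (simp_all add: m0_def e1)
      have "(cmod (m0 t))\<^sup>2 = 1"
        using 1 complex_norm_square[of "m0 t"] by (simp add: mult.commute flip: of_real_eq_iff[where 'a = complex])
      then have "m t = m0 t" using norm_ge_zero[of "m0 t"] by (auto simp: m_def power2_eq_1_iff)
      then have "m t * h t = (cnj (m0 t) * m0 t) * T h t" by (simp add: 2[symmetric])
      then show ?case using 1 by simp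
    qed
  qed
qed

text \<open>\<open>arccos (Re m)\<close> is the angle on the closed upper half circle and is
  reflected to \<open>2 pi - a\<close> below it. There \<open>a\<close> is positive, so \<gamma>
  stays strictly below 1.\<close>

lemma borel_unit_circle_log:
  fixes m :: "real \<Rightarrow> complex"
  assumes [measurable]: "m \<in> borel_measurable borel" and m: "\<And>t. cmod (m t) = 1"
  obtains \<gamma> where "\<gamma> \<in> borel_measurable borel" "\<And>t. \<gamma> t \<in> {0..<1}" "\<And>t. expi2pi (\<gamma> t) = m t"
proof -
  \<comment> \<open>The clamp does nothing on the circle; it makes \<open>a\<close> the composite of
    \<open>Re m\<close> with a function continuous on the whole line, hence measurable.\<close>
  define a where "a t = arccos (max (- 1) (min 1 (Re (m t))))" for t
  define \<gamma> where "\<gamma> t = (if Im (m t) \<ge> 0 then a t else 2 * pi - a t) / (2 * pi)" for t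
  have "continuous_on UNIV (\<lambda>x::real. arccos (max (- 1) (min 1 x)))"
    by (rule continuous_on_compose2[OF continuous_on_arccos']) (auto intro!: continuous_intros)
  from borel_measurable_continuous_onI[OF this] have "(\<lambda>t. arccos (max (- 1) (min 1 (Re (m t))))) \<in> borel_measurable borel"
    by (rule measurable_compose[rotated]) measurable
  then have [measurable]: "a \<in> borel_measurable borel" by (simp add: a_def[abs_def])
  have sq: "(Re (m t))\<^sup>2 + (Im (m t))\<^sup>2 = 1" for t using m[of t] by (simp add: cmod_def)
  have Re: "\<bar>Re (m t)\<bar> \<le> 1" for t using abs_Re_le_cmod[of "m t"] m by simp
  have a: "a t = arccos (Re (m t))" for t using Re[of t] by (simp add: a_def abs_le_iff max_absorb2 min_absorb2)
  have ab: "0 \<le> a t" "a t \<le> pi" "cos (a t) = Re (m t)" for t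
    using arccos[of "Re (m t)"] Re[of t] by (auto simp: a abs_le_iff)
  have sin: "sin (a t) = \<bar>Im (m t)\<bar>" for t
  proof -
    have "sin (a t) = sqrt (1 - (Re (m t))\<^sup>2)"
      using Re[of t] by (simp add: a sin_arccos_abs)
    also have "1 - (Re (m t))\<^sup>2 = (Im (m t))\<^sup>2" using sq[of t] by simp
    finally show ?thesis by simp
  qed
  show thesis
  proof (rule that)
    show "\<gamma> \<in> borel_measurable borel" unfolding \<gamma>_def[abs_def] by measurable
    show "\<gamma> t \<in> {0..<1}" for t
    proof (cases "Im (m t) \<ge> 0")
      case True
      have "a t < 2 * pi" using ab(2)[of t] pi_gt_zero by linarith
      then show ?thesis using True ab[of t] by (simp add: \<gamma>_def)
    next
      case False
      then have "sin (a t) > 0" using sin by simp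
      then have "a t \<noteq> 0" by auto
      then show ?thesis using False ab[of t] pi_gt_zero by (simp add: \<gamma>_def field_simps)
    qed
    show "expi2pi (\<gamma> t) = m t" for t
      unfolding expi2pi_cis \<gamma>_def
      using sin[of t] ab(3)[of t] by (auto simp: complex_eq_iff cos_diff sin_diff)
  qed
qed

lemma l2_unitary_isometry:
  assumes U: "l2_unitary M U" shows "l2_isometry M M U"
proof
  fix f g assume f: "f \<in> L2 M"
  show Uf: "U f \<in> L2 M" using U f by (auto simp: l2_unitary_def l2_linear_def)
  have "l2_inner M (U f) (U f) = l2_inner M f f" using U f by (auto simp: l2_unitary_def)
  then show "l2sq M (U f) = l2sq M f" by (simp add: l2_inner_self)
  show "AE x in M. U (\<lambda>x. c * f x) x = c * U f x" for c
    using U f by (auto simp: l2_unitary_def l2_linear_def ae_eq_def)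
  assume "g \<in> L2 M"
  then show "AE x in M. U (\<lambda>x. f x + g x) x = U f x + U g x"
    using U f by (auto simp: l2_unitary_def l2_linear_def ae_eq_def)
qed

text \<open>Restriction to the frequency band \<open>I\<close>: the counterpart in one variable of
  the spectral projection of \<open>Q\<close>.\<close>

definition fourier_restrict :: "real set \<Rightarrow> (real \<Rightarrow> complex) \<Rightarrow> real \<Rightarrow> complex" where
  "fourier_restrict I \<phi> = inv_fourier (\<lambda>t. of_bool (t \<in> I) * fourier \<phi> t)"

lemma
  assumes \<phi>: "\<phi> \<in> L2 lborel" and I: "I \<in> sets borel"
  shows fourier_restrict_L2: "fourier_restrict I \<phi> \<in> L2 lborel"
    and fourier_fourier_restrict: "AE t in lborel. fourier (fourier_restrict I \<phi>) t = of_bool (t \<in> I) * fourier \<phi> t"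
proof -
  have "(\<lambda>t. of_bool (t \<in> I) * fourier \<phi> t) \<in> L2 lborel"
    by (rule L2_indicator_mult[OF fourier.L2[OF \<phi>]]) (use I in simp)
  from fourier.W_L2[OF this] fourier.V_W[OF this] show "fourier_restrict I \<phi> \<in> L2 lborel"
    "AE t in lborel. fourier (fourier_restrict I \<phi>) t = of_bool (t \<in> I) * fourier \<phi> t"
    unfolding fourier_restrict_def by this
qed

section \<open>From commutation to a multiplier on the Fourier side\<close>

context strip
begin

text \<open>The function \<open>\<phi> + (x - \<alpha>) / (\<beta> - \<alpha>) * \<delta>\<close>
  with boundary values \<phi> and \<open>\<phi> + \<delta>\<close>, written through \<open>J\<close>
  so that \<open>rep\<close>, the trace lemmas and \<open>pft_const_kop\<close> apply
  directly.\<close>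

abbreviation ramp_fun :: "(real \<Rightarrow> complex) \<Rightarrow> (real \<Rightarrow> complex) \<Rightarrow> real \<times> real \<Rightarrow> complex" where
  "ramp_fun \<phi> \<delta> \<equiv> (\<lambda>z. \<phi> (snd z) + J (\<lambda>z. 1 / of_real (\<beta> - \<alpha>) * \<delta> (snd z)) z)"

lemma rep_ramp_fun:
  assumes \<phi>: "\<phi> \<in> L2 lborel" and \<delta>: "\<delta> \<in> L2 lborel"
  shows "rep (ramp_fun \<phi> \<delta>) (\<lambda>z. 1 / of_real (\<beta> - \<alpha>) * \<delta> (snd z)) \<phi>"
  unfolding rep_def
  by (intro conjI L2_add[OF const_L2_I[OF \<phi>] kop_L2(1)[OF kernel_J L2_cmult[OF const_L2_I[OF \<delta>]]]] L2_cmult[OF const_L2_I[OF \<delta>]] \<phi> AE_I2 refl)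

lemma LINT_X_ramp: "(LINT s|X. 1 / of_real (\<beta> - \<alpha>) * d) = (d :: complex)"
  unfolding LINT_X_const using ab by simp

lemma pft_ramp_fun:
  assumes \<phi>: "\<phi> \<in> L2 lborel" and \<delta>: "\<delta> \<in> L2 lborel"
  shows "AE z in M. pft X (ramp_fun \<phi> \<delta>) z = ramp_fun (fourier \<phi>) (fourier \<delta>) z"
proof -
  let ?c = "1 / complex_of_real (\<beta> - \<alpha>)"
  have 1: "AE z in M. ?c * pft X (\<lambda>z. \<delta> (snd z)) z = ?c * fourier \<delta> (snd z)"
    using pft_const[OF \<delta>] by eventually_elim simp
  show ?thesis
    using pft_const_kop[OF kernel_J \<phi> const_L2_I[OF \<delta>], of ?c]
      kop_cong[OF kernel_J L2_cmult[OF pft.L2[OF const_L2_I[OF \<delta>]]] L2_cmult[OF const_L2_I[OF fourier.L2[OF \<delta>]]] 1]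
    by eventually_elim simp
qed

lemma ramp_fun_indicator:
  "ramp_fun (\<lambda>t. of_bool (t \<in> I) * \<phi> t) (\<lambda>t. of_bool (t \<in> I) * \<delta> t) z = of_bool (snd z \<in> I) * ramp_fun \<phi> \<delta> z"
  by (cases "snd z \<in> I") (simp_all add: kop_def)

lemma ramp_fun_cong:
  assumes "\<phi> \<in> L2 lborel" "\<phi>' \<in> L2 lborel" "\<delta> \<in> L2 lborel" "\<delta>' \<in> L2 lborel"
    and "AE y in lborel. \<phi> y = \<phi>' y" "AE y in lborel. \<delta> y = \<delta>' y"
  shows "AE z in M. ramp_fun \<phi> \<delta> z = ramp_fun \<phi>' \<delta>' z"
proof -
  let ?c = "1 / complex_of_real (\<beta> - \<alpha>)"
  have 1: "AE z in M. \<phi> (snd z) = \<phi>' (snd z)" using assms AE_M_const_iff by blast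
  have "AE z in M. \<delta> (snd z) = \<delta>' (snd z)" using assms AE_M_const_iff by blast
  then have 2: "AE z in M. ?c * \<delta> (snd z) = ?c * \<delta>' (snd z)" by eventually_elim simp
  show ?thesis
    using 1 kop_cong[OF kernel_J L2_cmult[OF const_L2_I[OF assms(3)]] L2_cmult[OF const_L2_I[OF assms(4)]] 2]
    by eventually_elim simp
qed

text \<open>Let \<open>f\<close> interpolate between \<phi> and \<open>U \<phi>\<close>. Both
  \<open>F I f\<close> and the interpolation \<open>f2\<close> of the restricted boundary values
  have transform \<open>1_I(\<lambda>)\<close> times that of \<open>f\<close>, so they coincide.
  Since \<open>F I f\<close> is in the domain of \<open>P\<close>, its traces are related by
  \<open>U\<close>, and uniqueness of traces transfers this relation to \<open>f2\<close>.\<close>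

lemma commute_imp_fourier_restrict:
  assumes U: "l2_unitary lborel U"
    and comm: "spectrally_commute M (P_op \<alpha> \<beta> U) (Q_op \<alpha> \<beta>)"
    and ab': "a < b" and \<phi>: "\<phi> \<in> L2 lborel"
  shows "AE y in lborel. U (fourier_restrict {a<..b} \<phi>) y = fourier_restrict {a<..b} (U \<phi>) y"
proof -
  obtain E F where E: "is_spectral_measure M E (P_op \<alpha> \<beta> U)" and F: "is_spectral_measure M F (Q_op \<alpha> \<beta>)"
    and EF: "\<And>S T f. S \<in> sets borel \<Longrightarrow> T \<in> sets borel \<Longrightarrow> f \<in> L2 M \<Longrightarrow> AE z in M. E S (F T f) z = F T (E S f) z"
    using comm unfolding spectrally_commute_def ae_eq_def by blast
  interpret E: l2_projection_measure M E
    by standard (use E in \<open>simp add: is_spectral_measure_def\<close>)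
  interpret mq: mult_representation M M "pft X" "ipft X" snd "Q_op \<alpha> \<beta>"
    by standard (simp_all add: Q_op_iff)
  interpret F: mult_spectral_measure M M "pft X" "ipft X" snd "Q_op \<alpha> \<beta>" F
    by standard (use F in \<open>simp_all add: is_spectral_measure_def\<close>)
  interpret U: l2_isometry lborel lborel U by (rule l2_unitary_isometry[OF U])
  have Ul: "l2_linear lborel U" using U by (simp add: l2_unitary_def)
  let ?I = "{a<..b}" and ?D = "fourier_restrict {a<..b}"
  define \<delta> where "\<delta> y = U \<phi> y - \<phi> y" for y
  have \<delta>: "\<delta> \<in> L2 lborel" unfolding \<delta>_def[abs_def] by (rule L2_diff[OF U.L2[OF \<phi>] \<phi>])
  define f where "f = ramp_fun \<phi> \<delta>"
  define f2 where "f2 = ramp_fun (?D \<phi>) (?D \<delta>)"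
  have borel_I: "?I \<in> sets borel" by simp
  note D = fourier_restrict_L2[where I = ?I, OF _ borel_I] and FD = fourier_fourier_restrict[where I = ?I, OF _ borel_I]
  have r: "rep f (\<lambda>z. 1 / of_real (\<beta> - \<alpha>) * \<delta> (snd z)) \<phi>" unfolding f_def by (rule rep_ramp_fun[OF \<phi> \<delta>])
  have r2: "rep f2 (\<lambda>z. 1 / of_real (\<beta> - \<alpha>) * ?D \<delta> (snd z)) (?D \<phi>)"
    unfolding f2_def by (rule rep_ramp_fun) (use D \<phi> \<delta> in auto)
  have fL: "f \<in> L2 M" "f2 \<in> L2 M" using r r2 by (auto simp: rep_def)
  define g where "g z = 1 / of_real (\<beta> - \<alpha>) / tpi * \<delta> (snd z)" for z :: "real \<times> real"
  have tg: "tpi * g z = 1 / of_real (\<beta> - \<alpha>) * \<delta> (snd z)" for z by (simp add: g_def)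
  have "P_op \<alpha> \<beta> U f g"
    unfolding P_op_iff[OF Ul]
  proof (intro conjI exI[of _ \<phi>])
    show "g \<in> L2 M" unfolding g_def[abs_def] by (rule L2_cmult[OF const_L2_I[OF \<delta>]])
    show "rep f (\<lambda>z. tpi * g z) \<phi>" unfolding tg by (rule r)
    show "ae_eq lborel (\<lambda>y. \<phi> y + (LINT s|X. tpi * g (s, y))) (U \<phi>)"
      unfolding tg snd_conv LINT_X_ramp by (simp add: \<delta>_def ae_eq_def)
  qed
  then have i: "integrable (spectral_distr M E f) (\<lambda>t. t\<^sup>2)"
    using E fL(1) unfolding is_spectral_measure_def by blast
  have FfL: "F ?I f \<in> L2 M" by (rule F.E_L2) (use fL in auto)
  \<comment> \<open>The distribution of \<open>F I f\<close> under \<open>E\<close> is dominated by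
    that of \<open>f\<close>, since \<open>E S (F I f) = F I (E S f)\<close> and \<open>F I\<close>
    is a contraction. Finite second moments, and with them the domain of \<open>P\<close>, are thus
    preserved.\<close>
  have "integrable (spectral_distr M E (F ?I f)) (\<lambda>t. t\<^sup>2)"
  proof (rule integrableI_bounded)
    have "(\<integral>\<^sup>+t. ennreal (norm (t\<^sup>2)) \<partial>spectral_distr M E (F ?I f)) \<le> (\<integral>\<^sup>+t. ennreal (norm (t\<^sup>2)) \<partial>spectral_distr M E f)"
    proof (rule nn_integral_mono_measure)
      show "sets (spectral_distr M E (F ?I f)) = sets (spectral_distr M E f)" by simp
      show "spectral_distr M E (F ?I f) \<le> spectral_distr M E f"
      proof (rule le_measure[THEN iffD2, rule_format])
        fix S assume "S \<in> sets (spectral_distr M E (F ?I f))"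
        then have S: "S \<in> sets borel" by simp
        have "l2sq M (E S (F ?I f)) = l2sq M (F ?I (E S f))"
          by (rule l2sq_cong_AE) (use EF[OF S _ fL(1)] E.E_L2[OF S FfL] F.E_L2[OF _ E.E_L2[OF S fL(1)]] in auto)
        also have "\<dots> \<le> l2sq M (E S f)" by (rule F.E_contract) (use E.E_L2[OF S fL(1)] in auto)
        finally show "emeasure (spectral_distr M E (F ?I f)) S \<le> emeasure (spectral_distr M E f) S"
          unfolding E.emeasure_spectral_distr[OF FfL S] E.emeasure_spectral_distr[OF fL(1) S] by (rule ennreal_leI)
      qed simp
    qed
    also have "\<dots> < \<infinity>" using i by (simp add: integrable_iff_bounded)
    finally show "(\<integral>\<^sup>+t. ennreal (norm (t\<^sup>2)) \<partial>spectral_distr M E (F ?I f)) < \<infinity>" .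
  qed (subst measurable_cong_sets[OF E.sets_spectral_distr refl], measurable)
  then have "\<exists>g'. P_op \<alpha> \<beta> U (F ?I f) g'"
    using E FfL unfolding is_spectral_measure_def by blast
  then obtain g' K where r': "rep (F ?I f) (\<lambda>z. tpi * g' z) K"
    and b: "AE y in lborel. K y + (LINT s|X. tpi * g' (s, y)) = U K y"
    unfolding P_op_iff[OF Ul] ae_eq_def by blast
  have K: "K \<in> L2 lborel" using r' by (simp add: rep_def)
  have "AE z in M. pft X (F ?I f) z = of_bool (snd z \<in> ?I) * pft X f z"
    by (rule F.V_E_interval[OF ab' fL(1) AE_M_snd_neq])
  moreover have "AE z in M. pft X f2 z = of_bool (snd z \<in> ?I) * ramp_fun (fourier \<phi>) (fourier \<delta>) z"
  proof -
    have ind: "(\<lambda>t. of_bool (t \<in> ?I) * fourier h t) \<in> L2 lborel" if "h \<in> L2 lborel" for h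
      by (rule L2_indicator_mult[OF fourier.L2[OF that]]) simp
    have "AE z in M. ramp_fun (fourier (?D \<phi>)) (fourier (?D \<delta>)) z
        = ramp_fun (\<lambda>t. of_bool (t \<in> ?I) * fourier \<phi> t) (\<lambda>t. of_bool (t \<in> ?I) * fourier \<delta> t) z"
      by (rule ramp_fun_cong[OF fourier.L2[OF D[OF \<phi>]] ind[OF \<phi>] fourier.L2[OF D[OF \<delta>]] ind[OF \<delta>] FD[OF \<phi>] FD[OF \<delta>]])
    moreover have "AE z in M. pft X f2 z = ramp_fun (fourier (?D \<phi>)) (fourier (?D \<delta>)) z"
      unfolding f2_def by (rule pft_ramp_fun) (use D \<phi> \<delta> in auto)
    ultimately show ?thesis unfolding ramp_fun_indicator by eventually_elim simp
  qed
  moreover have "AE z in M. pft X f z = ramp_fun (fourier \<phi>) (fourier \<delta>) z"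
    unfolding f_def by (rule pft_ramp_fun[OF \<phi> \<delta>])
  ultimately have "AE z in M. pft X (F ?I f) z = pft X f2 z"
    by eventually_elim simp
  then have "AE z in M. F ?I f z = f2 z" using pft.eq_iff[OF FfL fL(2)] by simp
  then have "AE x in X. ae_eq lborel (\<lambda>y. F ?I f (x, y)) (\<lambda>y. f2 (x, y))"
    unfolding M_eq ae_eq_def by (rule P.AE_pair)
  note ends = continuous_representative_unique[OF rep_continuous_representative[OF r'] rep_continuous_representative[OF r2] this]
  have e1: "AE y in lborel. K y = ?D \<phi> y" using ends[of \<alpha>] ab by (simp add: tr_ends ae_eq_def)
  have e2: "AE y in lborel. K y + (LINT s|X. tpi * g' (s, y)) = ?D \<phi> y + ?D \<delta> y"
    using ends[of \<beta>] ab unfolding ae_eq_def tr_ends snd_conv LINT_X_ramp by simp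
  have D\<phi>: "?D \<phi> \<in> L2 lborel" and D\<delta>: "?D \<delta> \<in> L2 lborel" and DU: "?D (U \<phi>) \<in> L2 lborel"
    using D \<phi> \<delta> U.L2[OF \<phi>] by auto
  have "AE t in lborel. fourier (\<lambda>y. ?D \<phi> y + ?D \<delta> y) t = fourier (?D (U \<phi>)) t"
    using fourier.add[OF D\<phi> D\<delta>] FD[OF \<phi>] FD[OF \<delta>] FD[OF U.L2[OF \<phi>]] fourier.diff[OF U.L2[OF \<phi>] \<phi>]
    unfolding \<delta>_def[symmetric, abs_def] by eventually_elim (simp add: algebra_simps)
  then have "AE y in lborel. ?D \<phi> y + ?D \<delta> y = ?D (U \<phi>) y"
    using fourier.eq_iff[OF L2_add[OF D\<phi> D\<delta>] DU] by simp
  with e2 b U.cong[OF K D\<phi> e1] show ?thesis by eventually_elim simp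
qed

lemma commute_imp_diagonalized:
  assumes U: "l2_unitary lborel U"
    and comm: "spectrally_commute M (P_op \<alpha> \<beta> U) (Q_op \<alpha> \<beta>)"
  shows "\<exists>\<gamma>\<in>borel_measurable borel. (\<forall>t. \<gamma> t \<in> {0..<1}) \<and> fourier_diagonalized U \<gamma>"
proof -
  interpret U: l2_isometry lborel lborel U by (rule l2_unitary_isometry[OF U])
  define T where "T h = fourier (U (inv_fourier h))" for h
  have T_fourier: "AE t in lborel. T (fourier \<phi>) t = fourier (U \<phi>) t" if "\<phi> \<in> L2 lborel" for \<phi>
    unfolding T_def
    using that by (intro fourier.cong U.cong fourier.W_V U.L2 fourier.W_L2 fourier.L2)
  have T: "l2_isometry lborel lborel T"
  proof
    fix h k :: "real \<Rightarrow> complex" assume h: "h \<in> L2 lborel"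
    note hi = fourier.W_L2[OF h]
    show "T h \<in> L2 lborel" unfolding T_def by (intro fourier.L2 U.L2 hi)
    show "l2sq lborel (T h) = l2sq lborel h"
      unfolding T_def by (simp add: fourier.l2sq U.l2sq U.L2 hi fourier.inverse.l2sq h)
    show "AE t in lborel. T (\<lambda>t. c * h t) t = c * T h t" for c
      unfolding T_def
      using fourier.cong[OF U.L2 U.L2, OF fourier.W_L2[OF L2_cmult[OF h]] L2_cmult[OF hi] U.cong[OF fourier.W_L2[OF L2_cmult[OF h]] L2_cmult[OF hi] fourier.inverse.cmult[OF h]], of c]
        fourier.cong[OF U.L2[OF L2_cmult[OF hi]] L2_cmult[OF U.L2[OF hi]] U.cmult[OF hi], of c] fourier.cmult[OF U.L2[OF hi], of c]
      by eventually_elim simp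
    assume k: "k \<in> L2 lborel"
    note ki = fourier.W_L2[OF k]
    show "AE t in lborel. T (\<lambda>t. h t + k t) t = T h t + T k t"
      unfolding T_def
      using fourier.cong[OF U.L2 U.L2, OF fourier.W_L2[OF L2_add[OF h k]] L2_add[OF hi ki] U.cong[OF fourier.W_L2[OF L2_add[OF h k]] L2_add[OF hi ki] fourier.inverse.add[OF h k]]]
        fourier.cong[OF U.L2[OF L2_add[OF hi ki]] L2_add[OF U.L2[OF hi] U.L2[OF ki]] U.add[OF hi ki]] fourier.add[OF U.L2[OF hi] U.L2[OF ki]]
      by eventually_elim simp
  qed
  interpret T: l2_isometry lborel lborel T by (rule T)
  have loc: "AE t in lborel. T (\<lambda>t. of_bool (t \<in> {a<..b}) * h t) t = of_bool (t \<in> {a<..b}) * T h t"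
    if ab': "a < b" and h: "h \<in> L2 lborel" for a b :: real and h :: "real \<Rightarrow> complex"
  proof -
    let ?I = "{a<..b}"
    define \<phi> where "\<phi> = inv_fourier h"
    have \<phi>: "\<phi> \<in> L2 lborel" unfolding \<phi>_def by (rule fourier.W_L2[OF h])
    have F\<phi>: "AE t in lborel. fourier \<phi> t = h t" unfolding \<phi>_def by (rule fourier.V_W[OF h])
    have I: "?I \<in> sets borel" by simp
    note D = fourier_restrict_L2[OF _ I] and FD = fourier_fourier_restrict[OF _ I]
    have ind: "(\<lambda>t. of_bool (t \<in> ?I) * h t) \<in> L2 lborel" by (rule L2_indicator_mult[OF h]) simp
    have "AE t in lborel. of_bool (t \<in> ?I) * h t = fourier (fourier_restrict ?I \<phi>) t"
      using F\<phi> FD[OF \<phi>] by eventually_elim simp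
    from T.cong[OF ind fourier.L2[OF D[OF \<phi>]] this] T_fourier[OF D[OF \<phi>]]
      fourier.cong[OF U.L2[OF D[OF \<phi>]] D[OF U.L2[OF \<phi>]] commute_imp_fourier_restrict[OF U comm ab' \<phi>]]
      FD[OF U.L2[OF \<phi>]]
    show ?thesis unfolding T_def \<phi>_def by eventually_elim simp
  qed
  obtain m where m: "m \<in> borel_measurable borel" "\<And>t. cmod (m t) = 1"
    and Tm: "\<And>h. h \<in> L2 lborel \<Longrightarrow> AE t in lborel. T h t = m t * h t"
    by (rule l2_isometry_multiplier[OF T], rule loc, assumption+, rule that)
  obtain \<gamma> where \<gamma>: "\<gamma> \<in> borel_measurable borel" "\<And>t. \<gamma> t \<in> {0..<1}" "\<And>t. expi2pi (\<gamma> t) = m t"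
    by (rule borel_unit_circle_log[OF m], rule that)
  have "AE t in lborel. fourier (U \<phi>) t = expi2pi (\<gamma> t) * fourier \<phi> t" if "\<phi> \<in> L2 lborel" for \<phi>
    using T_fourier[OF that] Tm[OF fourier.L2[OF that]] by eventually_elim (simp add: \<gamma>(3))
  then show ?thesis using \<gamma>(1,2) unfolding fourier_diagonalized_def by blast
qed

end

theorem theorem5p1:
  fixes \<alpha> \<beta> :: real
    and U :: "(real \<Rightarrow> complex) \<Rightarrow> (real \<Rightarrow> complex)"
  assumes "\<alpha> < \<beta>"
    and "l2_unitary lborel U"
  shows "spectrally_commute (strip_measure \<alpha> \<beta>) (P_op \<alpha> \<beta> U) (Q_op \<alpha> \<beta>) \<longleftrightarrow>
    (\<exists>\<gamma>\<in>borel_measurable borel. (\<forall>t. \<gamma> t \<in> {0..<1}) \<and> fourier_diagonalized U \<gamma>)"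
proof
  interpret strip \<alpha> \<beta> by standard (rule assms(1))
  assume "spectrally_commute (strip_measure \<alpha> \<beta>) (P_op \<alpha> \<beta> U) (Q_op \<alpha> \<beta>)"
  with assms(2) show "\<exists>\<gamma>\<in>borel_measurable borel. (\<forall>t. \<gamma> t \<in> {0..<1}) \<and> fourier_diagonalized U \<gamma>"
    by (rule commute_imp_diagonalized)
next
  assume "\<exists>\<gamma>\<in>borel_measurable borel. (\<forall>t. \<gamma> t \<in> {0..<1}) \<and> fourier_diagonalized U \<gamma>"
  then obtain \<gamma> where \<gamma>: "\<gamma> \<in> borel_measurable borel" "\<And>t. \<gamma> t \<in> {0..<1}" "fourier_diagonalized U \<gamma>" by blast
  interpret twisted_strip \<alpha> \<beta> \<gamma> by standard (use assms(1) \<gamma> in auto)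
  show "spectrally_commute (strip_measure \<alpha> \<beta>) (P_op \<alpha> \<beta> U) (Q_op \<alpha> \<beta>)"
    using assms(2) \<gamma>(3) by (intro diagonalized_imp_commute) (simp_all add: l2_unitary_def)
qed

end
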